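(* If $K\subseteq\mathbb R^d$ is a compact convex set such that the spectral function system $\mathcal E_K^{[d]}$ determined by $K$ has the lifting property, then $K^{\rm min}$ has Smith-Ward geometry.
   Context: For compact $K\subset\mathbb R^d$, the spectral function system determined by $K$ is the operator subsystem $\mathcal E_K^{[d]}=\mathrm{Span}\{1,\varepsilon_1,\dots,\varepsilon_d\}$ of $C(K)$, where $\varepsilon_j(\zeta_1,\dots,\zeta_d)=\zeta_j$. Lifting property: an operator system $\mathcal R$ has the lifting property if, for every unital C$^*$-algebra $\mathcal A$ and closed ideal $\mathcal J\subseteq\mathcal A$ with quotient map $\pi_{\mathcal J}$, every unital completely positive (ucp) map $\phi:\mathcal R\to\mathcal A/\mathcal J$ admits a ucp map $\psi:\mathcal R\to\mathcal A$ with $\phi=\pi_{\mathcal J}\circ\psi$. $\mathbb B$ is the C$^*$-algebra of bounded linear operators on $\ell^2(\mathbb N)$ and $\mathbb K$ is the ideal of compact operators. For a $d$-tuple $\mathfrak x$ of elements of a unital C$^*$-algebra, $\mathcal O_{\mathfrak x}=\mathrm{Span}\{1,x_1,x_1^*,\dots,x_d,x_d^*\}$. The matrix range is $W(\mathfrak x)=\bigsqcup_n W_n(\mathfrak x)$, $W_n(\mathfrak x)=\{(\phi(x_1),\dots,\phi(x_d)) : \phi:\mathrm C^*(\mathcal O_{\mathfrak x})\to M_n(\mathbb C)\text{ ucp}\}$. For $\mathfrak x\in\mathbb B^d$, the essential matrix range $W_{\rm e}(\mathfrak x)=\bigsqcup_n W_{n,{\rm e}}(\mathfrak x)$ is defined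 in the same way but using only those $\phi$ that vanish on every compact operator in $\mathrm C^*(\mathcal O_{\mathfrak x})$; it equals the matrix range of the image of $\mathfrak x$ in $\mathbb B/\mathbb K$. For a compact convex set $K\subseteq\mathbb R^d$, $K^{\rm min}=\bigsqcup_nK_n^{\rm min}$, where $K_n^{\rm min}$ is the set of $d$-tuples $(a_1,\dots,a_d)$ of $n\times n$ matrices for which there are positive $h_1,\dots,h_m\in M_n(\mathbb C)$ and $\lambda_j=(\lambda_{j1},\dots,\lambda_{jd})\in K$ with $\sum_jh_j=1_n$ and $a_\ell=\sum_j\lambda_{j\ell}h_j$ for all $\ell$. A tuple $\mathfrak x\in\mathbb B^d$ has the Smith-Ward property if $W_{\rm e}(\mathfrak x)=W(\mathfrak x+\mathfrak k)$ for some $\mathfrak k\in\mathbb K^d$. A compact matrix convex set is a graded set $K_{\rm nc}=\bigsqcup_n K_n$, $K_n\subseteq M_n(\mathbb C)^d$ compact, such that $\sum_{j=1}^m\gamma_j^*\mathfrak a_j\gamma_j\in K_n$ whenever $\mathfrak a_j\in K_{n_j}$ and $\gamma_j:\mathbb C^n\to\mathbb C^{n_j}$ are linear with $\sum_j\gamma_j^*\gamma_j=1_n$. It has Smith-Ward geometry if every tuple $\mathfrak x\in\mathbb B^d$ with $W_{\rm e}(\mathfrak x)=K_{\rm nc}$ has the Smith-Ward property. *)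

theory Defs
  imports
    "HOL-Analysis.Analysis"
    "HOL-Algebra.QuotRing"
    "HOL-Algebra.Subrings"
    "Jordan_Normal_Form.Schur_Decomposition"
    "Jordan_Normal_Form.VS_Connect"
begin

section \<open>Unital C*-algebras\<close>

text \<open>Algebras are records with an explicit carrier, extending the ring and module records of
  HOL-Algebra.  The norm is a separate extension because positivity, and hence complete
  positivity, only depends on the *-algebra.\<close>

record 'a star_alg = "(complex, 'a) module" +
  star :: "'a \<Rightarrow> 'a"

record 'a cstar_alg = "'a star_alg" +
  cnorm :: "'a \<Rightarrow> real"

text \<open>Off the carrier the distance is set to \<open>0\<close>, since \<^locale>\<open>Metric_space\<close> demands a symmetric
  nonnegative function on the whole type.\<close>

definition cdist :: "('a, 'm) cstar_alg_scheme \<Rightarrow> 'a \<Rightarrow> 'a \<Rightarrow> real" where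
  "cdist A x y = (if x \<in> carrier A \<and> y \<in> carrier A then cnorm A (x \<ominus>\<^bsub>A\<^esub> y) else 0)"

abbreviation cstar_topology :: "('a, 'm) cstar_alg_scheme \<Rightarrow> 'a topology" where
  "cstar_topology A \<equiv> Metric_space.mtopology (carrier A) (cdist A)"

locale cstar_algebra = ring A + module "class_ring :: complex ring" A
  for A :: "('a, 'm) cstar_alg_scheme" (structure) +
  assumes smult_mult_left:
      "\<lbrakk>x \<in> carrier A; y \<in> carrier A\<rbrakk> \<Longrightarrow> (c \<odot> x) \<otimes> y = c \<odot> (x \<otimes> y)"
    and smult_mult_right:
      "\<lbrakk>x \<in> carrier A; y \<in> carrier A\<rbrakk> \<Longrightarrow> x \<otimes> (c \<odot> y) = c \<odot> (x \<otimes> y)"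
    and star_closed: "x \<in> carrier A \<Longrightarrow> star A x \<in> carrier A"
    and star_star: "x \<in> carrier A \<Longrightarrow> star A (star A x) = x"
    and star_add:
      "\<lbrakk>x \<in> carrier A; y \<in> carrier A\<rbrakk> \<Longrightarrow> star A (x \<oplus> y) = star A x \<oplus> star A y"
    and star_smult: "x \<in> carrier A \<Longrightarrow> star A (c \<odot> x) = cnj c \<odot> star A x"
    and star_mult:
      "\<lbrakk>x \<in> carrier A; y \<in> carrier A\<rbrakk> \<Longrightarrow> star A (x \<otimes> y) = star A y \<otimes> star A x"
    and cnorm_nonneg: "x \<in> carrier A \<Longrightarrow> 0 \<le> cnorm A x"
    and cnorm_eq_0_iff: "x \<in> carrier A \<Longrightarrow> cnorm A x = 0 \<longleftrightarrow> x = \<zero>"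
    and cnorm_triangle:
      "\<lbrakk>x \<in> carrier A; y \<in> carrier A\<rbrakk> \<Longrightarrow> cnorm A (x \<oplus> y) \<le> cnorm A x + cnorm A y"
    and cnorm_smult: "x \<in> carrier A \<Longrightarrow> cnorm A (c \<odot> x) = cmod c * cnorm A x"
    and cnorm_mult:
      "\<lbrakk>x \<in> carrier A; y \<in> carrier A\<rbrakk> \<Longrightarrow> cnorm A (x \<otimes> y) \<le> cnorm A x * cnorm A y"
    and cstar_identity: "x \<in> carrier A \<Longrightarrow> cnorm A (star A x \<otimes> x) = (cnorm A x)\<^sup>2"
    and complete: "Metric_space.mcomplete (carrier A) (cdist A)"

definition cspan :: "('a, 'm) star_alg_scheme \<Rightarrow> 'a set \<Rightarrow> 'a set" where
  "cspan A S = {\<Oplus>\<^bsub>A\<^esub>s\<in>F. c s \<odot>\<^bsub>A\<^esub> s | F c. finite F \<and> F \<subseteq> S}"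

definition cstar_subalgebra :: "('a, 'm) cstar_alg_scheme \<Rightarrow> 'a set \<Rightarrow> bool" where
  "cstar_subalgebra A D \<longleftrightarrow> subring D A \<and> (\<forall>c. \<forall>x\<in>D. c \<odot>\<^bsub>A\<^esub> x \<in> D) \<and>
     (\<forall>x\<in>D. star A x \<in> D) \<and> closedin (cstar_topology A) D"

definition cstar_generated :: "('a, 'm) cstar_alg_scheme \<Rightarrow> 'a set \<Rightarrow> 'a set" where
  "cstar_generated A S = \<Inter>{D. cstar_subalgebra A D \<and> S \<subseteq> D}"

definition closed_ideal :: "('a, 'm) cstar_alg_scheme \<Rightarrow> 'a set \<Rightarrow> bool" where
  "closed_ideal A J \<longleftrightarrow> ideal J A \<and> closedin (cstar_topology A) J"

text \<open>The quotient is the ring of cosets \<open>A Quot J\<close> with the induced scalar multiplication and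
  involution; the quotient map is \<open>x \<mapsto> J +> x\<close>.\<close>

definition quotient_alg :: "('a, 'm) cstar_alg_scheme \<Rightarrow> 'a set \<Rightarrow> 'a set star_alg" where
  "quotient_alg A J =
    \<lparr>carrier = carrier (A Quot J), mult = mult (A Quot J), one = one (A Quot J),
     zero = zero (A Quot J), add = add (A Quot J),
     smult = (\<lambda>c X. \<Union>x\<in>X. J +>\<^bsub>A\<^esub> (c \<odot>\<^bsub>A\<^esub> x)),
     star = (\<lambda>X. \<Union>x\<in>X. J +>\<^bsub>A\<^esub> star A x)\<rparr>"


section \<open>Unital completely positive maps and the lifting property\<close>

definition positive_elem :: "('a, 'm) star_alg_scheme \<Rightarrow> 'a \<Rightarrow> bool" where
  "positive_elem A a \<longleftrightarrow> (\<exists>y\<in>carrier A. a = star A y \<otimes>\<^bsub>A\<^esub> y)"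

text \<open>\<open>X = Y\<^sup>* Y\<close> in \<open>M\<^sub>n(A)\<close>; only the entries with indices below \<open>n\<close> are meaningful.\<close>

definition positive_matrix ::
  "('a, 'm) star_alg_scheme \<Rightarrow> nat \<Rightarrow> (nat \<Rightarrow> nat \<Rightarrow> 'a) \<Rightarrow> bool" where
  "positive_matrix A n X \<longleftrightarrow>
     (\<exists>Y. (\<forall>i<n. \<forall>j<n. Y i j \<in> carrier A) \<and>
          (\<forall>i<n. \<forall>j<n. X i j = (\<Oplus>\<^bsub>A\<^esub>k\<in>{..<n}. star A (Y k i) \<otimes>\<^bsub>A\<^esub> Y k j)))"

text \<open>\<open>ucp A R B \<phi>\<close>: \<open>\<phi>\<close> is a ucp map into \<open>B\<close> from the operator subsystem \<open>R\<close> of \<open>A\<close>.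
  The positive cone of \<open>M\<^sub>n(R)\<close> is the one inherited from \<open>M\<^sub>n(A)\<close>.\<close>

definition ucp ::
  "('a, 'm) star_alg_scheme \<Rightarrow> 'a set \<Rightarrow> ('b, 'k) star_alg_scheme \<Rightarrow> ('a \<Rightarrow> 'b) \<Rightarrow> bool" where
  "ucp A R B \<phi> \<longleftrightarrow>
     (\<forall>x\<in>R. \<phi> x \<in> carrier B) \<and>
     (\<forall>x\<in>R. \<forall>y\<in>R. \<phi> (x \<oplus>\<^bsub>A\<^esub> y) = \<phi> x \<oplus>\<^bsub>B\<^esub> \<phi> y) \<and>
     (\<forall>c. \<forall>x\<in>R. \<phi> (c \<odot>\<^bsub>A\<^esub> x) = c \<odot>\<^bsub>B\<^esub> \<phi> x) \<and>
     \<phi> \<one>\<^bsub>A\<^esub> = \<one>\<^bsub>B\<^esub> \<and>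
     (\<forall>n X. (\<forall>i<n. \<forall>j<n. X i j \<in> R) \<and> positive_matrix A n X \<longrightarrow>
            positive_matrix B n (\<lambda>i j. \<phi> (X i j)))"

text \<open>HOL cannot quantify over types inside a formula, so the algebras range over all unital
  C*-algebras whose carrier is a subset of a type \<open>'u\<close>, which plays the role of a universe.\<close>

definition lifting_property ::
  "'u itself \<Rightarrow> ('a, 'm) star_alg_scheme \<Rightarrow> 'a set \<Rightarrow> bool" where
  "lifting_property _ C R \<longleftrightarrow>
     (\<forall>(A :: 'u cstar_alg) J \<phi>.
        cstar_algebra A \<and> closed_ideal A J \<and> ucp C R (quotient_alg A J) \<phi> \<longrightarrow>
        (\<exists>\<psi>. ucp C R A \<psi> \<and> (\<forall>r\<in>R. \<phi> r = J +>\<^bsub>A\<^esub> \<psi> r)))"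


section \<open>Spectral function systems\<close>

text \<open>Functions on \<open>K\<close> are extended by \<open>0\<close> outside \<open>K\<close>, so that equality in \<open>C(K)\<close> is equality
  in HOL.\<close>

definition C_alg :: "'x::topological_space set \<Rightarrow> ('x \<Rightarrow> complex) star_alg" where
  "C_alg K =
    \<lparr>carrier = {f. continuous_on K f \<and> (\<forall>\<zeta>. \<zeta> \<notin> K \<longrightarrow> f \<zeta> = 0)},
     mult = (\<lambda>f g \<zeta>. f \<zeta> * g \<zeta>), one = (\<lambda>\<zeta>. if \<zeta> \<in> K then 1 else 0),
     zero = (\<lambda>_. 0), add = (\<lambda>f g \<zeta>. f \<zeta> + g \<zeta>),
     smult = (\<lambda>c f \<zeta>. c * f \<zeta>), star = (\<lambda>f \<zeta>. cnj (f \<zeta>))\<rparr>"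

definition coord_fun :: "(real^'d) set \<Rightarrow> 'd \<Rightarrow> real^'d \<Rightarrow> complex" where
  "coord_fun K j = (\<lambda>\<zeta>. if \<zeta> \<in> K then complex_of_real (vec_nth \<zeta> j) else 0)"

definition spectral_system :: "(real^'d) set \<Rightarrow> (real^'d \<Rightarrow> complex) set" where
  "spectral_system K = cspan (C_alg K) (insert \<one>\<^bsub>C_alg K\<^esub> (range (coord_fun K)))"


section \<open>The Hilbert space of square-summable sequences\<close>

typedef ell2 = "{f :: nat \<Rightarrow> complex. summable (\<lambda>n. (cmod (f n))\<^sup>2)}"
  morphisms ell2_nth Abs_ell2
  by (rule exI[of _ "\<lambda>_. 0"]) simp

setup_lifting type_definition_ell2

lemma ell2_summable_add:
  assumes "summable (\<lambda>n. (cmod (f n))\<^sup>2)" "summable (\<lambda>n. (cmod (g n))\<^sup>2)"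
  shows "summable (\<lambda>n. (cmod (f n + g n))\<^sup>2)"
proof (rule summable_comparison_test')
  show "summable (\<lambda>n. 2 * (cmod (f n))\<^sup>2 + 2 * (cmod (g n))\<^sup>2)"
    using assms by (intro summable_add summable_mult)
  fix n :: nat
  have "(cmod (f n + g n))\<^sup>2 \<le> (cmod (f n) + cmod (g n))\<^sup>2"
    by (intro power_mono norm_triangle_ineq) simp
  also have "\<dots> \<le> 2 * (cmod (f n))\<^sup>2 + 2 * (cmod (g n))\<^sup>2"
    using zero_le_power2[of "cmod (f n) - cmod (g n)"]
    by (simp add: power2_eq_square algebra_simps)
  finally show "norm ((cmod (f n + g n))\<^sup>2) \<le> 2 * (cmod (f n))\<^sup>2 + 2 * (cmod (g n))\<^sup>2"
    by simp
qed

lemma ell2_summable_mult: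
  assumes "summable (\<lambda>n. (cmod (f n))\<^sup>2)"
  shows "summable (\<lambda>n. (cmod (c * f n))\<^sup>2)"
  using assms by (simp add: norm_mult power_mult_distrib summable_mult)

lemma ell2_summable_inner:
  assumes "summable (\<lambda>n. (cmod (f n))\<^sup>2)" "summable (\<lambda>n. (cmod (g n))\<^sup>2)"
  shows "summable (\<lambda>n. cnj (f n) * g n)"
proof (rule summable_comparison_test')
  show "summable (\<lambda>n. (cmod (f n))\<^sup>2 + (cmod (g n))\<^sup>2)"
    using assms by (intro summable_add)
  fix n :: nat
  have "2 * (cmod (f n) * cmod (g n)) \<le> (cmod (f n))\<^sup>2 + (cmod (g n))\<^sup>2"
    using zero_le_power2[of "cmod (f n) - cmod (g n)"]
    by (simp add: power2_eq_square algebra_simps)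
  moreover have "0 \<le> cmod (f n) * cmod (g n)" by simp
  ultimately show "norm (cnj (f n) * g n) \<le> (cmod (f n))\<^sup>2 + (cmod (g n))\<^sup>2"
    unfolding norm_mult complex_mod_cnj by linarith
qed

lift_definition scaleC :: "complex \<Rightarrow> ell2 \<Rightarrow> ell2" is "\<lambda>c f n. c * f n"
  by (rule ell2_summable_mult)

lift_definition cinner :: "ell2 \<Rightarrow> ell2 \<Rightarrow> complex" is "\<lambda>f g. \<Sum>n. cnj (f n) * g n" .

instantiation ell2 :: real_inner
begin

lift_definition zero_ell2 :: ell2 is "\<lambda>_. 0" by simp
lift_definition plus_ell2 :: "ell2 \<Rightarrow> ell2 \<Rightarrow> ell2" is "\<lambda>f g n. f n + g n"
  by (rule ell2_summable_add)
lift_definition uminus_ell2 :: "ell2 \<Rightarrow> ell2" is "\<lambda>f n. - f n" by simp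
definition minus_ell2 :: "ell2 \<Rightarrow> ell2 \<Rightarrow> ell2" where "minus_ell2 x y = x + - y"
definition scaleR_ell2 :: "real \<Rightarrow> ell2 \<Rightarrow> ell2" where
  "scaleR_ell2 r x = scaleC (complex_of_real r) x"
definition inner_ell2 :: "ell2 \<Rightarrow> ell2 \<Rightarrow> real" where
  "inner_ell2 x y = Re (cinner x y)"
definition norm_ell2 :: "ell2 \<Rightarrow> real" where
  "norm_ell2 x = sqrt (\<Sum>n. (cmod (ell2_nth x n))\<^sup>2)"
definition dist_ell2 :: "ell2 \<Rightarrow> ell2 \<Rightarrow> real" where
  "dist_ell2 x y = norm (x - y)"
definition sgn_ell2 :: "ell2 \<Rightarrow> ell2" where
  "sgn_ell2 x = inverse (norm x) *\<^sub>R x"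
definition uniformity_ell2 :: "(ell2 \<times> ell2) filter" where
  "uniformity_ell2 = (INF e\<in>{0 <..}. principal {(x, y). dist x y < e})"
definition open_ell2 :: "ell2 set \<Rightarrow> bool" where
  "open_ell2 U \<longleftrightarrow> (\<forall>x\<in>U. eventually (\<lambda>(x', y). x' = x \<longrightarrow> y \<in> U) uniformity)"

instance
proof
  have sm: "summable (\<lambda>n. (cmod (ell2_nth z n))\<^sup>2)" for z
    using ell2_nth[of z] by simp
  have si: "summable (\<lambda>n. cnj (ell2_nth z n) * ell2_nth w n)" for z w
    by (intro ell2_summable_inner sm)
  have Re_sum: "inner z w = (\<Sum>n. Re (cnj (ell2_nth z n) * ell2_nth w n))" for z w
    unfolding inner_ell2_def cinner.rep_eq using Re_suminf[OF si] by simp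
  have sRe: "summable (\<lambda>n. Re (cnj (ell2_nth z n) * ell2_nth w n))" for z w
    by (rule summable_Re[OF si])
  have self: "inner z z = (\<Sum>n. (cmod (ell2_nth z n))\<^sup>2)" for z
    unfolding Re_sum by (intro suminf_cong) (simp add: cmod_power2 flip: power2_eq_square)
  fix x y z :: ell2 and r s :: real
  show "x + y + z = x + (y + z)" by transfer (simp add: add.assoc)
  show "x + y = y + x" by transfer (simp add: add.commute)
  show "0 + x = x" by transfer simp
  show "- x + x = 0" by transfer simp
  show "x - y = x + - y" by (rule minus_ell2_def)
  show "r *\<^sub>R (x + y) = r *\<^sub>R x + r *\<^sub>R y"
    unfolding scaleR_ell2_def by transfer (simp add: algebra_simps)
  show "(r + s) *\<^sub>R x = r *\<^sub>R x + s *\<^sub>R x"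
    unfolding scaleR_ell2_def by transfer (simp add: algebra_simps)
  show "r *\<^sub>R s *\<^sub>R x = (r * s) *\<^sub>R x"
    unfolding scaleR_ell2_def by transfer (simp add: algebra_simps)
  show "1 *\<^sub>R x = x"
    unfolding scaleR_ell2_def by transfer simp
  show "dist x y = norm (x - y)" by (rule dist_ell2_def)
  show "sgn x = inverse (norm x) *\<^sub>R x" by (rule sgn_ell2_def)
  show "uniformity = (INF e\<in>{0 <..}. principal {(x :: ell2, y). dist x y < e})"
    by (rule uniformity_ell2_def)
  show "open U \<longleftrightarrow> (\<forall>x\<in>U. eventually (\<lambda>(x', y). x' = x \<longrightarrow> y \<in> U) uniformity)"
    for U :: "ell2 set" by (rule open_ell2_def)
  show "inner x y = inner y x"
    unfolding Re_sum by (intro suminf_cong) (simp add: mult.commute)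
  show "inner (x + y) z = inner x z + inner y z"
    unfolding Re_sum plus_ell2.rep_eq
    by (subst suminf_add[OF sRe sRe]) (simp add: algebra_simps)
  show "inner (r *\<^sub>R x) y = r * inner x y"
    unfolding Re_sum scaleR_ell2_def scaleC.rep_eq
    by (subst suminf_mult[OF sRe, symmetric]) (simp add: algebra_simps)
  show "0 \<le> inner x x"
    unfolding self by (intro suminf_nonneg sm) simp
  show "inner x x = 0 \<longleftrightarrow> x = 0"
  proof -
    have "inner x x = 0 \<longleftrightarrow> (\<forall>n. (cmod (ell2_nth x n))\<^sup>2 = 0)"
      unfolding self by (intro suminf_eq_zero_iff sm) simp
    also have "\<dots> \<longleftrightarrow> x = 0"
      by (auto simp: ell2_nth_inject[symmetric] zero_ell2.rep_eq fun_eq_iff)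
    finally show ?thesis .
  qed
  show "norm x = sqrt (inner x x)"
    unfolding self norm_ell2_def ..
qed

end

definition bounded_ops :: "(ell2 \<Rightarrow> ell2) set" where
  "bounded_ops = {T. bounded_linear T \<and> (\<forall>c x. T (scaleC c x) = scaleC c (T x))}"

definition op_adjoint :: "(ell2 \<Rightarrow> ell2) \<Rightarrow> ell2 \<Rightarrow> ell2" where
  "op_adjoint T = (THE S. S \<in> bounded_ops \<and> (\<forall>x y. cinner (S x) y = cinner x (T y)))"

definition B_alg :: "(ell2 \<Rightarrow> ell2) cstar_alg" where
  "B_alg =
    \<lparr>carrier = bounded_ops, mult = (\<circ>), one = id, zero = (\<lambda>_. 0),
     add = (\<lambda>S T x. S x + T x), smult = (\<lambda>c T x. scaleC c (T x)),
     star = op_adjoint, cnorm = onorm\<rparr>"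

definition compact_ops :: "(ell2 \<Rightarrow> ell2) set" where
  "compact_ops = {T \<in> bounded_ops. compact (closure (T ` cball 0 1))}"


section \<open>Matrix ranges and matrix convex sets\<close>

definition M_alg :: "nat \<Rightarrow> complex mat star_alg" where
  "M_alg n =
    \<lparr>carrier = carrier_mat n n, mult = (*), one = 1\<^sub>m n, zero = 0\<^sub>m n n, add = (+),
     smult = (\<cdot>\<^sub>m), star = mat_adjoint\<rparr>"

definition operator_system :: "('a, 'm) star_alg_scheme \<Rightarrow> ('d \<Rightarrow> 'a) \<Rightarrow> 'a set" where
  "operator_system A x = cspan A (insert \<one>\<^bsub>A\<^esub> (range x \<union> range (\<lambda>l. star A (x l))))"

definition cstar_of_tuple :: "('a, 'm) cstar_alg_scheme \<Rightarrow> ('d \<Rightarrow> 'a) \<Rightarrow> 'a set" where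
  "cstar_of_tuple A x = cstar_generated A (operator_system A x)"

text \<open>Graded sets \<open>\<Squnion>\<^sub>n K\<^sub>n\<close> over \<open>n \<ge> 1\<close> are sets of pairs \<open>(n, a)\<close> with \<open>a \<in> K\<^sub>n\<close>.
  For the ucp maps the algebra \<open>C*(O\<^sub>x)\<close> is a C*-algebra in its own right: positive matrices over
  it are of the form \<open>Y\<^sup>* Y\<close> with the entries of \<open>Y\<close> in \<open>C*(O\<^sub>x)\<close>.\<close>

definition matrix_range ::
  "('a, 'm) cstar_alg_scheme \<Rightarrow> ('d \<Rightarrow> 'a) \<Rightarrow> (nat \<times> ('d \<Rightarrow> complex mat)) set" where
  "matrix_range A x =
     (SIGMA n:{1..}. {(\<lambda>l. \<phi> (x l)) | \<phi>.
        ucp (A\<lparr>carrier := cstar_of_tuple A x\<rparr>) (cstar_of_tuple A x) (M_alg n) \<phi>})"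

definition ess_matrix_range ::
  "('d \<Rightarrow> ell2 \<Rightarrow> ell2) \<Rightarrow> (nat \<times> ('d \<Rightarrow> complex mat)) set" where
  "ess_matrix_range x =
     (SIGMA n:{1..}. {(\<lambda>l. \<phi> (x l)) | \<phi>.
        ucp (B_alg\<lparr>carrier := cstar_of_tuple B_alg x\<rparr>) (cstar_of_tuple B_alg x) (M_alg n) \<phi> \<and>
        (\<forall>T\<in>cstar_of_tuple B_alg x \<inter> compact_ops. \<phi> T = 0\<^sub>m n n)})"

definition Kmin :: "(real^'d) set \<Rightarrow> (nat \<times> ('d \<Rightarrow> complex mat)) set" where
  "Kmin K =
     (SIGMA n:{1..}. {a. \<exists>(m :: nat) h \<Lambda>.
        (\<forall>j<m. positive_elem (M_alg n) (h j) \<and> \<Lambda> j \<in> K) \<and>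
        (\<Oplus>\<^bsub>M_alg n\<^esub>j\<in>{..<m}. h j) = 1\<^sub>m n \<and>
        (\<forall>l. a l = (\<Oplus>\<^bsub>M_alg n\<^esub>j\<in>{..<m}. complex_of_real (vec_nth (\<Lambda> j) l) \<cdot>\<^sub>m h j))})"

text \<open>\<open>M\<^sub>n(\<complex>)\<^sup>d\<close> carries the topology of entrywise convergence.  The type of matrices has no
  topology, so a level is compact if its image under the map to the entries is compact in the
  product topology.\<close>

definition mat_entries :: "nat \<Rightarrow> ('d \<Rightarrow> complex mat) \<Rightarrow> 'd \<Rightarrow> nat \<Rightarrow> nat \<Rightarrow> complex" where
  "mat_entries n a = (\<lambda>l i j. if i < n \<and> j < n then a l $$ (i, j) else 0)"

definition compact_matrix_convex :: "(nat \<times> ('d \<Rightarrow> complex mat)) set \<Rightarrow> bool" where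
  "compact_matrix_convex Knc \<longleftrightarrow>
     Knc \<subseteq> (SIGMA n:{1..}. {a. \<forall>l. a l \<in> carrier_mat n n}) \<and>
     (\<forall>n\<ge>1. compact (mat_entries n ` (Knc `` {n}))) \<and>
     (\<forall>n\<ge>1. \<forall>(m :: nat) N a \<gamma>.
        (\<forall>j<m. (N j, a j) \<in> Knc \<and> \<gamma> j \<in> carrier_mat (N j) n) \<and>
        (\<Oplus>\<^bsub>M_alg n\<^esub>j\<in>{..<m}. mat_adjoint (\<gamma> j) * \<gamma> j) = 1\<^sub>m n \<longrightarrow>
        (n, \<lambda>l. \<Oplus>\<^bsub>M_alg n\<^esub>j\<in>{..<m}. mat_adjoint (\<gamma> j) * a j l * \<gamma> j) \<in> Knc)"


section \<open>The Smith-Ward property\<close>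

definition smith_ward_property :: "('d \<Rightarrow> ell2 \<Rightarrow> ell2) \<Rightarrow> bool" where
  "smith_ward_property x \<longleftrightarrow>
     (\<exists>k. (\<forall>l. k l \<in> compact_ops) \<and>
          ess_matrix_range x = matrix_range B_alg (\<lambda>l. x l \<oplus>\<^bsub>B_alg\<^esub> k l))"

definition smith_ward_geometry :: "(nat \<times> ('d \<Rightarrow> complex mat)) set \<Rightarrow> bool" where
  "smith_ward_geometry Knc \<longleftrightarrow> compact_matrix_convex Knc \<and>
     (\<forall>x. (\<forall>l. x l \<in> bounded_ops) \<and> ess_matrix_range x = Knc \<longrightarrow> smith_ward_property x)"

end

theory Submission
  imports Defs
begin

text \<open>Let \<open>W\<^sub>e(x) = K\<^sup>m\<^sup>i\<^sup>n\<close>.  If an affine function with matrix coefficients is positive on \<open>K\<close>, its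
  value at \<open>x\<close> is positive modulo compact operators: otherwise compressions to vectors escaping to
  infinity converge to an element of \<open>W\<^sub>e(x)\<close> violating positivity, while the elements of \<open>K\<^sup>m\<^sup>i\<^sup>n\<close> are
  compressions of commuting normal tuples with joint spectrum in \<open>K\<close>.  Hence \<open>\<epsilon>\<^sub>l \<mapsto> x\<^sub>l + \<K>\<close> is a ucp map
  into the Calkin algebra; a lift \<open>\<Psi>\<close> gives \<open>y\<^sub>l = \<Psi>(\<epsilon>\<^sub>l) = x\<^sub>l + k\<^sub>l\<close> with \<open>k\<^sub>l\<close> compact.  Positivity of \<open>\<Psi>\<close>
  on affine functions and a Hahn-Banach separation give \<open>W(y) \<subseteq> K\<^sup>m\<^sup>i\<^sup>n\<close>.  Conversely every point of \<open>K\<close> is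
  the value at \<open>x\<close>, hence at \<open>y\<close>, of a state vanishing on the compact operators, and these states combine
  with a positive operator-valued measure to a ucp map producing any given element of \<open>K\<^sup>m\<^sup>i\<^sup>n\<close>.  As the
  lifting property only quantifies over algebras inside the universe, the algebra of bounded operators
  is first copied into it.\<close>

section \<open>The Hilbert space\<close>

text \<open>Three obstacles shape the development. Positivity is defined by factorizations
  \<open>Y\<^sup>* Y\<close>, so each positivity claim needs explicit factors: square roots by an
  iteration that stays inside every C*-subalgebra, Cholesky factors that vary continuously, and
  square roots modulo compact operators. Compactness is handled through the tail projections
  \<open>tailp N\<close>: a bounded operator is compact iff its norm on far tails is small
  (\<open>compact_ops_iff\<close>), and positivity modulo compact operators becomes a statement
  about quadratic forms on far tails. Matrices of operators are folded into single operators by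
  Cuntz isometries, so both facts are proved for one operator only. The \<open>x l\<close> are not
  assumed self-adjoint, hence positivity modulo compact operators also controls imaginary parts.
  Strict positivity on \<open>K\<close> is what the separation delivers and what keeps the Cholesky
  pivots nonzero, so the two ends meet without a limiting argument. Limits of compressions and of
  states are taken along one fixed filter along which all bounded sequences converge.\<close>

lemma summable_ell2_nth: "summable (\<lambda>n. (cmod (ell2_nth x n))\<^sup>2)"
  using ell2_nth[of x] by simp

lemma summable_cinner: "summable (\<lambda>n. cnj (ell2_nth x n) * ell2_nth y n)"
  by (intro ell2_summable_inner summable_ell2_nth)

lemma ell2_eqI: "(\<And>n. ell2_nth x n = ell2_nth y n) \<Longrightarrow> x = y"
  by (simp add: ell2_nth_inject[symmetric] fun_eq_iff)

lemma ell2_nth_simps [simp]: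
  "ell2_nth 0 n = 0" "ell2_nth (x + y) n = ell2_nth x n + ell2_nth y n"
  "ell2_nth (- x) n = - ell2_nth x n" "ell2_nth (x - y) n = ell2_nth x n - ell2_nth y n"
  "ell2_nth (scaleC c x) n = c * ell2_nth x n" "ell2_nth (r *\<^sub>R x) n = of_real r * ell2_nth x n"
  unfolding zero_ell2.rep_eq plus_ell2.rep_eq uminus_ell2.rep_eq minus_ell2_def
      scaleC.rep_eq scaleR_ell2_def by simp_all

lemma ell2_nth_sum [simp]: "ell2_nth (\<Sum>i\<in>F. f i) n = (\<Sum>i\<in>F. ell2_nth (f i) n)"
  by (induction F rule: infinite_finite_induct) auto

lemma scaleC_simps [simp]:
  "scaleC 1 x = x" "scaleC 0 x = 0" "scaleC c 0 = 0" "scaleC c (scaleC d x) = scaleC (c * d) x"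
  by (auto intro: ell2_eqI)

lemma scaleC_distribs:
  "scaleC c (x + y) = scaleC c x + scaleC c y" "scaleC c (x - y) = scaleC c x - scaleC c y"
  "scaleC (c + d) x = scaleC c x + scaleC d x" "scaleC (c - d) x = scaleC c x - scaleC d x"
  "scaleC c (- x) = - scaleC c x" "scaleC (- c) x = - scaleC c x"
  by (auto intro!: ell2_eqI simp: algebra_simps)

lemma scaleC_sum: "scaleC c (\<Sum>i\<in>F. f i) = (\<Sum>i\<in>F. scaleC c (f i))"
  by (induction F rule: infinite_finite_induct) (auto simp: scaleC_distribs)

lemma scaleR_scaleC: "r *\<^sub>R x = scaleC (of_real r) x"
  by (simp add: scaleR_ell2_def)

lemma cinner_simps [simp]:
  "cinner (x + y) z = cinner x z + cinner y z" "cinner z (x + y) = cinner z x + cinner z y"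
  "cinner (scaleC c x) z = cnj c * cinner x z" "cinner z (scaleC c x) = c * cinner z x"
proof -
  show "cinner (x + y) z = cinner x z + cinner y z"
    unfolding cinner.rep_eq by (subst suminf_add[OF summable_cinner summable_cinner]) (simp add: algebra_simps)
  show "cinner z (x + y) = cinner z x + cinner z y"
    unfolding cinner.rep_eq by (subst suminf_add[OF summable_cinner summable_cinner]) (simp add: algebra_simps)
  show "cinner (scaleC c x) z = cnj c * cinner x z"
    unfolding cinner.rep_eq by (subst suminf_mult[OF summable_cinner, symmetric]) (simp add: algebra_simps)
  show "cinner z (scaleC c x) = c * cinner z x"
    unfolding cinner.rep_eq by (subst suminf_mult[OF summable_cinner, symmetric]) (simp add: algebra_simps)
qed

lemma cinner_minus [simp]: "cinner (- x) z = - cinner x z" "cinner z (- x) = - cinner z x"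
  using cinner_simps(3)[of "-1" x z] cinner_simps(4)[of z "-1" x] by (simp_all add: scaleC_distribs)

lemma cinner_diff [simp]:
  "cinner (x - y) z = cinner x z - cinner y z" "cinner z (x - y) = cinner z x - cinner z y"
  unfolding minus_ell2_def cinner_simps cinner_minus by simp_all

lemma cinner_zero [simp]: "cinner 0 x = 0" "cinner x 0 = 0"
  using cinner_simps(3)[of 0 0 x] cinner_simps(4)[of x 0 0] by simp_all

lemma cinner_scaleR [simp]:
  "cinner (r *\<^sub>R x) z = of_real r * cinner x z" "cinner z (r *\<^sub>R x) = of_real r * cinner z x"
  by (simp_all add: scaleR_scaleC)

lemma cinner_sum_left: "cinner (\<Sum>i\<in>F. f i) z = (\<Sum>i\<in>F. cinner (f i) z)"
  by (induction F rule: infinite_finite_induct) auto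

lemma cinner_sum_right: "cinner z (\<Sum>i\<in>F. f i) = (\<Sum>i\<in>F. cinner z (f i))"
  by (induction F rule: infinite_finite_induct) auto

lemma cnj_cinner: "cnj (cinner x y) = cinner y x"
proof -
  have "(\<lambda>n. cnj (cnj (ell2_nth x n) * ell2_nth y n)) sums cnj (cinner x y)"
    using summable_sums[OF summable_cinner[of x y]]
    unfolding cinner.rep_eq by (subst sums_cnj)
  thus ?thesis unfolding cinner.rep_eq by (simp add: sums_iff mult.commute)
qed

lemma cinner_self: "cinner x x = of_real ((norm x)\<^sup>2)"
proof -
  have "Im (cinner x x) = 0" using cnj_cinner[of x x] by (simp add: complex_eq_iff)
  moreover have "Re (cinner x x) = (norm x)\<^sup>2"
    by (simp add: inner_ell2_def[symmetric] dot_square_norm)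
  ultimately show ?thesis by (simp add: complex_eq_iff)
qed

lemma norm_scaleC [simp]: "norm (scaleC c x) = cmod c * norm (x::ell2)"
proof -
  have "complex_of_real ((norm (scaleC c x))\<^sup>2) = of_real ((cmod c * norm x)\<^sup>2)"
  proof -
    have "complex_of_real ((norm (scaleC c x))\<^sup>2) = (c * cnj c) * cinner x x"
      using cinner_self[of "scaleC c x"] by (simp add: mult_ac)
    thus ?thesis unfolding cinner_self complex_norm_square[symmetric] by (simp add: power_mult_distrib)
  qed
  hence "(norm (scaleC c x))\<^sup>2 = (cmod c * norm x)\<^sup>2" by (simp only: of_real_eq_iff)
  thus ?thesis by (simp add: power2_eq_iff_nonneg)
qed

text \<open>Rotating \<open>y\<close> by a unimodular scalar makes the inner product real and
  nonnegative, which reduces the claim to the real Cauchy-Schwarz inequality.\<close>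

lemma cmod_cinner_le: "cmod (cinner x y) \<le> norm x * norm y"
proof (cases "cinner x y = 0")
  case False
  define c where "c = cnj (cinner x y) / cmod (cinner x y)"
  have c: "cmod c = 1" using False by (simp add: c_def norm_divide)
  have "cinner x (scaleC c y) = cmod (cinner x y)"
    using False by (simp add: c_def complex_norm_square[symmetric] field_simps power2_eq_square)
  hence "cmod (cinner x y) = inner x (scaleC c y)" by (simp add: inner_ell2_def)
  also have "\<dots> \<le> norm x * norm (scaleC c y)" by (rule norm_cauchy_schwarz)
  finally show ?thesis using c by simp
qed simp

lemma cinner_eqI: "(\<And>z. cinner z x = cinner z y) \<Longrightarrow> x = y"
proof -
  assume "\<And>z. cinner z x = cinner z y"
  hence "cinner (x - y) (x - y) = 0" by (simp only: cinner_diff(2)) simp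
  thus ?thesis by (simp add: cinner_self del: cinner_diff)
qed

lemma bounded_bilinear_cinner: "bounded_bilinear cinner"
proof
  show "\<exists>K. \<forall>a b. norm (cinner a b) \<le> norm a * norm b * K"
    by (intro exI[of _ 1]) (simp add: cmod_cinner_le)
qed (auto simp: scaleR_conv_of_real)

lemmas tendsto_cinner = bounded_bilinear.tendsto[OF bounded_bilinear_cinner]

section \<open>Coordinate vectors and tail projections\<close>

lift_definition ebasis :: "nat \<Rightarrow> ell2" is "\<lambda>n k. if k = n then 1 else 0"
proof -
  fix n
  have "summable (\<lambda>k. (cmod (if k = n then 1 else 0))\<^sup>2) = summable (\<lambda>k. if k = n then (1::real) else 0)"
    by (intro summable_cong) auto
  thus "summable (\<lambda>k. (cmod (if k = n then 1 else 0))\<^sup>2)" by simp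
qed

lemma ell2_nth_ebasis [simp]: "ell2_nth (ebasis n) k = (if k = n then 1 else 0)"
  by (simp add: ebasis.rep_eq)

lemma cinner_ebasis_left [simp]: "cinner (ebasis n) x = ell2_nth x n"
proof -
  have "(\<lambda>k. cnj (ell2_nth (ebasis n) k) * ell2_nth x k) = (\<lambda>k. if k = n then ell2_nth x k else 0)"
    by auto
  hence "(\<lambda>k. cnj (ell2_nth (ebasis n) k) * ell2_nth x k) sums ell2_nth x n"
    using sums_single[of n "ell2_nth x"] by metis
  thus ?thesis unfolding cinner.rep_eq by (simp add: sums_iff)
qed

lemma cinner_ebasis_right [simp]: "cinner x (ebasis n) = cnj (ell2_nth x n)"
  using cnj_cinner[of "ebasis n" x] by simp

lemma norm_ebasis [simp]: "norm (ebasis n) = 1"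
proof -
  have "cinner (ebasis n) (ebasis n) = 1" by simp
  hence "(norm (ebasis n))\<^sup>2 = 1" by (simp only: cinner_self of_real_eq_1_iff)
  thus ?thesis using power2_eq_iff_nonneg[of "norm (ebasis n)" 1] by simp
qed

lemma cmod_ell2_nth_le: "cmod (ell2_nth x n) \<le> norm x"
  using cmod_cinner_le[of "ebasis n" x] by simp

lemma norm_ell2_sq: "(norm x)\<^sup>2 = (\<Sum>n. (cmod (ell2_nth x n))\<^sup>2)"
  unfolding norm_ell2_def by (intro real_sqrt_pow2 suminf_nonneg summable_ell2_nth) simp

text \<open>Vectors fixed by \<open>tailp N\<close> with \<open>N\<close> growing are the ones that
  escape to infinity; compactness and positivity modulo compact operators are later expressed
  through these projections.\<close>

lift_definition tailp :: "nat \<Rightarrow> ell2 \<Rightarrow> ell2" is "\<lambda>N f n. if n < N then 0 else f n"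
proof -
  fix N and f :: "nat \<Rightarrow> complex" assume f: "summable (\<lambda>n. (cmod (f n))\<^sup>2)"
  show "summable (\<lambda>n. (cmod (if n < N then 0 else f n))\<^sup>2)"
    by (rule summable_comparison_test'[OF f]) auto
qed

lemma ell2_nth_tailp [simp]: "ell2_nth (tailp N x) n = (if n < N then 0 else ell2_nth x n)"
  by (simp add: tailp.rep_eq)

lemma head_tail: "x = (\<Sum>i<N. scaleC (ell2_nth x i) (ebasis i)) + tailp N x"
  by (rule ell2_eqI) (auto simp: if_distrib cong: if_cong)

lemma tailp_linear [simp]:
  "tailp N (x + y) = tailp N x + tailp N y" "tailp N (scaleC c x) = scaleC c (tailp N x)"
  "tailp N (tailp N x) = tailp N x"
  by (auto intro!: ell2_eqI)

lemma cinner_tailp: "cinner (tailp N x) y = cinner x (tailp N y)"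
  unfolding cinner.rep_eq by (intro suminf_cong) auto

lemma norm_tailp_le: "norm (tailp N x) \<le> norm x"
proof -
  have "(norm (tailp N x))\<^sup>2 \<le> (norm x)\<^sup>2"
    unfolding norm_ell2_sq by (intro suminf_le summable_ell2_nth) auto
  thus ?thesis by (simp add: power2_le_iff_abs_le)
qed

lemma norm_tailp_tendsto: "(\<lambda>N. norm (tailp N x)) \<longlonglongrightarrow> 0"
proof -
  have eq: "(norm (tailp N x))\<^sup>2 = (\<Sum>n. (cmod (ell2_nth x (n + N)))\<^sup>2)" for N
    unfolding norm_ell2_sq
    by (subst suminf_split_initial_segment[OF summable_ell2_nth, of _ N]) simp
  have "(\<lambda>N. (norm (tailp N x))\<^sup>2) \<longlonglongrightarrow> 0"
    unfolding eq by (rule suminf_exist_split2[OF summable_ell2_nth])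
  hence "(\<lambda>N. sqrt ((norm (tailp N x))\<^sup>2)) \<longlonglongrightarrow> sqrt 0" by (rule tendsto_real_sqrt)
  thus ?thesis by simp
qed

text \<open>Serves to build vectors from their coordinates: limits of Cauchy sequences and values of
  adjoints are both known only coordinatewise, together with a bound on finite partial sums.\<close>

lemma ell2I_bounded_partial:
  assumes "\<And>M. (\<Sum>n<M. (cmod (f n))\<^sup>2) \<le> B\<^sup>2" "0 \<le> B"
  obtains x where "ell2_nth x = f" "norm x \<le> B"
proof -
  have s: "summable (\<lambda>n. (cmod (f n))\<^sup>2)"
    by (rule summableI_nonneg_bounded[OF _ assms(1)]) simp
  define x where "x = Abs_ell2 f"
  have x: "ell2_nth x = f" unfolding x_def using s by (intro Abs_ell2_inverse) simp
  have "(norm x)\<^sup>2 \<le> B\<^sup>2"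
    unfolding norm_ell2_sq x by (rule suminf_le_const[OF s assms(1)])
  hence "norm x \<le> B" using assms(2) by (simp add: power2_le_iff_abs_le)
  thus ?thesis using x that by blast
qed

lemma sum_cmod_ell2_nth_le: "(\<Sum>n<M. (cmod (ell2_nth x n))\<^sup>2) \<le> (norm x)\<^sup>2"
  unfolding norm_ell2_sq by (intro sum_le_suminf summable_ell2_nth) auto

instance ell2 :: complete_space
proof
  fix X :: "nat \<Rightarrow> ell2" assume "Cauchy X"
  have "Cauchy (\<lambda>k. ell2_nth (X k) n)" for n
  proof (rule CauchyI)
    fix e :: real assume "0 < e"
    then obtain M where M: "\<forall>m\<ge>M. \<forall>k\<ge>M. norm (X m - X k) < e"
      using CauchyD[OF \<open>Cauchy X\<close> \<open>0 < e\<close>] by blast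
    have "norm (ell2_nth (X m) n - ell2_nth (X k) n) < e" if "m \<ge> M" "k \<ge> M" for m k
      using M that cmod_ell2_nth_le[of "X m - X k" n] by fastforce
    thus "\<exists>M. \<forall>m\<ge>M. \<forall>k\<ge>M. norm (ell2_nth (X m) n - ell2_nth (X k) n) < e" by blast
  qed
  hence "\<forall>n. \<exists>l. (\<lambda>k. ell2_nth (X k) n) \<longlonglongrightarrow> l"
    using Cauchy_convergent unfolding convergent_def by blast
  then obtain l where l: "\<And>n. (\<lambda>k. ell2_nth (X k) n) \<longlonglongrightarrow> l n" by metis
  \<comment> \<open>Finite partial sums let the coordinatewise limit pass through the Cauchy
    estimate, which is uniform in \<open>M\<close>.\<close>
  have key: "\<exists>N. \<forall>k\<ge>N. \<forall>M. (\<Sum>n<M. (cmod (ell2_nth (X k) n - l n))\<^sup>2) \<le> e\<^sup>2" if e: "0 < e" for e :: real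
  proof -
    obtain N where N: "\<forall>m\<ge>N. \<forall>k\<ge>N. norm (X m - X k) < e"
      using CauchyD[OF \<open>Cauchy X\<close> e] by blast
    have "(\<Sum>n<M. (cmod (ell2_nth (X k) n - l n))\<^sup>2) \<le> e\<^sup>2" if "k \<ge> N" for k M
    proof (rule Lim_bounded)
      show "(\<lambda>m. \<Sum>n<M. (cmod (ell2_nth (X k) n - ell2_nth (X m) n))\<^sup>2)
          \<longlonglongrightarrow> (\<Sum>n<M. (cmod (ell2_nth (X k) n - l n))\<^sup>2)"
        by (intro tendsto_intros l)
      show "\<forall>m\<ge>N. (\<Sum>n<M. (cmod (ell2_nth (X k) n - ell2_nth (X m) n))\<^sup>2) \<le> e\<^sup>2"
      proof (intro allI impI)
        fix m assume "N \<le> m"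
        have "(\<Sum>n<M. (cmod (ell2_nth (X k) n - ell2_nth (X m) n))\<^sup>2) \<le> (norm (X k - X m))\<^sup>2"
          using sum_cmod_ell2_nth_le[of "X k - X m" M] by simp
        also have "\<dots> \<le> e\<^sup>2" using N \<open>N \<le> m\<close> that by (intro power_mono) (auto intro: less_imp_le)
        finally show "(\<Sum>n<M. (cmod (ell2_nth (X k) n - ell2_nth (X m) n))\<^sup>2) \<le> e\<^sup>2" .
      qed
    qed
    thus ?thesis by blast
  qed
  obtain N1 where N1: "\<forall>M. (\<Sum>n<M. (cmod (ell2_nth (X N1) n - l n))\<^sup>2) \<le> 1\<^sup>2"
    using key[of 1] by auto
  obtain z where z: "ell2_nth z = (\<lambda>n. ell2_nth (X N1) n - l n)"
    using N1 by (auto intro: ell2I_bounded_partial[of "\<lambda>n. ell2_nth (X N1) n - l n" 1])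
  \<comment> \<open>Only \<open>X N1 - l\<close> is known to be square summable, so the limit is
    recovered as a difference.\<close>
  define L where "L = X N1 - z"
  have L: "ell2_nth L n = l n" for n by (simp add: L_def z)
  have "X \<longlonglongrightarrow> L"
  proof (rule LIMSEQ_I)
    fix r :: real assume "0 < r"
    then obtain N where N: "\<forall>k\<ge>N. \<forall>M. (\<Sum>n<M. (cmod (ell2_nth (X k) n - l n))\<^sup>2) \<le> (r/2)\<^sup>2"
      using key[of "r/2"] by auto
    have "norm (X k - L) < r" if k: "k \<ge> N" for k
    proof -
      have "(\<Sum>n<M. (cmod (ell2_nth (X k) n - l n))\<^sup>2) \<le> (r/2)\<^sup>2" for M
        using N k by blast
      then obtain x where x: "ell2_nth x = (\<lambda>n. ell2_nth (X k) n - l n)" "norm x \<le> r/2"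
        using \<open>0 < r\<close> by (auto intro: ell2I_bounded_partial[of "\<lambda>n. ell2_nth (X k) n - l n" "r/2"])
      have "x = X k - L" by (rule ell2_eqI) (simp add: x L)
      thus ?thesis using x \<open>0 < r\<close> by simp
    qed
    thus "\<exists>no. \<forall>n\<ge>no. norm (X n - L) < r" by blast
  qed
  thus "convergent X" by (rule convergentI)
qed

instance ell2 :: banach ..

section \<open>Bounded operators\<close>

lemma bounded_opsI:
  assumes "\<And>x y. T (x + y) = T x + T y" "\<And>c x. T (scaleC c x) = scaleC c (T x)"
    and "\<And>x. norm (T x) \<le> B * norm x"
  shows "T \<in> bounded_ops"
proof -
  have "bounded_linear T"
    by (rule bounded_linear_intro[of _ B]) (use assms in \<open>auto simp: scaleR_scaleC mult.commute\<close>)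
  thus ?thesis using assms by (simp add: bounded_ops_def)
qed

lemma bounded_ops_bl: "T \<in> bounded_ops \<Longrightarrow> bounded_linear T"
  by (simp add: bounded_ops_def)

lemma bounded_ops_lin:
  assumes "T \<in> bounded_ops"
  shows "T (x + y) = T x + T y" "T (scaleC c x) = scaleC c (T x)" "T 0 = 0" "T (x - y) = T x - T y"
    "T (- x) = - T x" "T (r *\<^sub>R x) = r *\<^sub>R T x"
  using assms bounded_linear.linear[OF bounded_ops_bl[OF assms]]
  by (auto simp: bounded_ops_def linear_add linear_diff linear_0 linear_neg linear_scale)

lemma bounded_ops_sum: "T \<in> bounded_ops \<Longrightarrow> T (\<Sum>i\<in>F. f i) = (\<Sum>i\<in>F. T (f i))"
  by (rule linear_sum[OF bounded_linear.linear[OF bounded_ops_bl]])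

lemma norm_op_le: "T \<in> bounded_ops \<Longrightarrow> norm (T x) \<le> onorm T * norm x"
  by (rule onorm[OF bounded_ops_bl])

lemma onorm_op_nonneg: "T \<in> bounded_ops \<Longrightarrow> 0 \<le> onorm T"
  by (rule onorm_pos_le[OF bounded_ops_bl])

lemma bounded_ops_tendsto: "T \<in> bounded_ops \<Longrightarrow> (f \<longlongrightarrow> x) F \<Longrightarrow> ((\<lambda>i. T (f i)) \<longlongrightarrow> T x) F"
  by (rule bounded_linear.tendsto[OF bounded_ops_bl])

lemma bounded_ops_0 [simp]: "(\<lambda>_. 0) \<in> bounded_ops"
  by (rule bounded_opsI[of _ 0]) auto

lemma bounded_ops_id [simp]: "id \<in> bounded_ops"
  by (rule bounded_opsI[of _ 1]) auto

lemma bounded_ops_id' [simp]: "(\<lambda>x. x) \<in> bounded_ops"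
  by (rule bounded_opsI[of _ 1]) auto

lemma bounded_ops_add [intro]: 
  assumes "S \<in> bounded_ops" "T \<in> bounded_ops" shows "(\<lambda>x. S x + T x) \<in> bounded_ops"
  using assms bounded_linear_add unfolding bounded_ops_def by (auto simp: scaleC_distribs)

lemma bounded_ops_diff [intro]: 
  assumes "S \<in> bounded_ops" "T \<in> bounded_ops" shows "(\<lambda>x. S x - T x) \<in> bounded_ops"
  using assms bounded_linear_sub unfolding bounded_ops_def by (auto simp: scaleC_distribs)

lemma bounded_ops_scaleC [intro]: 
  assumes "T \<in> bounded_ops" shows "(\<lambda>x. scaleC c (T x)) \<in> bounded_ops"
proof (rule bounded_opsI)
  fix x show "norm (scaleC c (T x)) \<le> (cmod c * onorm T) * norm x"
    using norm_op_le[OF assms, of x] by (simp add: mult.assoc mult_left_mono)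
qed (auto simp: bounded_ops_lin[OF assms] scaleC_distribs mult.commute)

lemma bounded_ops_uminus [intro]: "T \<in> bounded_ops \<Longrightarrow> (\<lambda>x. - T x) \<in> bounded_ops"
  using bounded_ops_scaleC[of T "-1"] by (simp add: scaleC_distribs)

lemma bounded_ops_comp [intro]: "S \<in> bounded_ops \<Longrightarrow> T \<in> bounded_ops \<Longrightarrow> S \<circ> T \<in> bounded_ops"
  using bounded_linear_compose[of S T] by (simp add: bounded_ops_def comp_def)

lemma bounded_ops_comp' [intro]: "S \<in> bounded_ops \<Longrightarrow> T \<in> bounded_ops \<Longrightarrow> (\<lambda>x. S (T x)) \<in> bounded_ops"
  using bounded_ops_comp[of S T] by (simp add: comp_def)

lemma bounded_ops_sum_fun [intro]:
  "(\<And>i. i \<in> F \<Longrightarrow> f i \<in> bounded_ops) \<Longrightarrow> (\<lambda>x. \<Sum>i\<in>F. f i x) \<in> bounded_ops"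
  by (induction F rule: infinite_finite_induct) auto

lemma tailp_bounded [simp]: "tailp N \<in> bounded_ops"
  by (rule bounded_opsI[of _ 1]) (auto simp: norm_tailp_le)

lemma ell2_partial_tendsto: "(\<lambda>N. \<Sum>i<N. scaleC (ell2_nth x i) (ebasis i)) \<longlonglongrightarrow> x"
proof -
  have "(\<lambda>N. tailp N x) \<longlonglongrightarrow> 0" using norm_tailp_tendsto by (rule tendsto_norm_zero_cancel)
  hence "(\<lambda>N. x - tailp N x) \<longlonglongrightarrow> x - 0" by (intro tendsto_intros)
  moreover have "x - tailp N x = (\<Sum>i<N. scaleC (ell2_nth x i) (ebasis i))" for N
    unfolding diff_eq_eq by (rule head_tail)
  ultimately show ?thesis by simp
qed

lemma bounded_ops_eqI:
  assumes "S \<in> bounded_ops" "T \<in> bounded_ops" "\<And>n. S (ebasis n) = T (ebasis n)"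
  shows "S = T"
proof
  fix x
  let ?p = "\<lambda>N. \<Sum>i<N. scaleC (ell2_nth x i) (ebasis i)"
  have "(\<lambda>N. S (?p N)) \<longlonglongrightarrow> S x" by (rule bounded_ops_tendsto[OF assms(1) ell2_partial_tendsto])
  moreover have "S (?p N) = T (?p N)" for N
    using assms(3) by (simp add: bounded_ops_sum[OF assms(1)] bounded_ops_lin[OF assms(1)]
        bounded_ops_sum[OF assms(2)] bounded_ops_lin[OF assms(2)])
  ultimately have "(\<lambda>N. T (?p N)) \<longlonglongrightarrow> S x" by simp
  thus "S x = T x" by (rule LIMSEQ_unique[OF _ bounded_ops_tendsto[OF assms(2) ell2_partial_tendsto]])
qed

text \<open>The coordinates of the adjoint at \<open>x\<close> have to be
  \<open>cinner (T (ebasis n)) x\<close>; the work is to bound their square sum, which is done by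
  applying \<open>T\<close> to the truncated vector that has these very coordinates.\<close>

lemma op_adjoint_ex:
  assumes T: "T \<in> bounded_ops"
  shows "\<exists>S\<in>bounded_ops. \<forall>x y. cinner (S x) y = cinner x (T y)"
proof -
  have "\<exists>z. ell2_nth z = (\<lambda>n. cinner (T (ebasis n)) x) \<and> norm z \<le> onorm T * norm x" for x
  proof -
    define f where "f = (\<lambda>n. cinner (T (ebasis n)) x)"
    have fn: "cinner (T (ebasis n)) x = f n" for n by (simp add: f_def)
    have "(\<Sum>n<M. (cmod (f n))\<^sup>2) \<le> (onorm T * norm x)\<^sup>2" for M
    proof -
      define v where "v = (\<Sum>n<M. scaleC (f n) (ebasis n))"
      define s where "s = (\<Sum>n<M. (cmod (f n))\<^sup>2)"
      have s0: "0 \<le> s" by (simp add: s_def sum_nonneg)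
      have Tv: "cinner (T v) x = of_real s"
        unfolding v_def s_def bounded_ops_sum[OF T] bounded_ops_lin[OF T] cinner_sum_left
        by (simp add: fn complex_norm_square[symmetric] mult.commute)
      have "cinner v v = of_real s"
        unfolding v_def s_def cinner_sum_left
        by (simp add: cinner_sum_right complex_norm_square[symmetric] mult.commute[of "cnj _"] if_distrib cong: if_cong)
      hence nv: "(norm v)\<^sup>2 = s" by (simp only: cinner_self of_real_eq_iff)
      have "s = cmod (cinner (T v) x)" using Tv s0 by simp
      also have "\<dots> \<le> norm (T v) * norm x" by (rule cmod_cinner_le)
      also have "\<dots> \<le> (onorm T * norm v) * norm x" by (intro mult_right_mono norm_op_le T) simp
      finally have "norm v * norm v \<le> (onorm T * norm x) * norm v"
        by (simp add: nv[symmetric] power2_eq_square algebra_simps)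
      hence "norm v \<le> onorm T * norm x \<or> norm v = 0" by (metis mult_right_le_imp_le norm_ge_zero not_less_iff_gr_or_eq order_le_less)
      hence "norm v \<le> onorm T * norm x" using onorm_op_nonneg[OF T] by auto
      thus ?thesis using nv unfolding s_def[symmetric] by (metis norm_ge_zero power_mono)
    qed
    thus ?thesis using ell2I_bounded_partial[of f "onorm T * norm x"] onorm_op_nonneg[OF T]
      unfolding f_def by (metis mult_nonneg_nonneg norm_ge_zero)
  qed
  then obtain S where S: "\<And>x n. ell2_nth (S x) n = cinner (T (ebasis n)) x"
    "\<And>x. norm (S x) \<le> onorm T * norm x" by metis
  have Sb: "S \<in> bounded_ops"
    by (rule bounded_opsI[OF _ _ S(2)]) (auto intro!: ell2_eqI simp: S)
  have "cinner (S x) y = cinner x (T y)" for x y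
  proof -
    let ?p = "\<lambda>N. \<Sum>i<N. scaleC (ell2_nth y i) (ebasis i)"
    have 1: "(\<lambda>N. cinner (S x) (?p N)) \<longlonglongrightarrow> cinner (S x) y"
      by (intro tendsto_cinner tendsto_const ell2_partial_tendsto)
    have 2: "(\<lambda>N. cinner x (T (?p N))) \<longlonglongrightarrow> cinner x (T y)"
      by (intro tendsto_cinner tendsto_const bounded_ops_tendsto[OF T] ell2_partial_tendsto)
    have "cinner (S x) (?p N) = cinner x (T (?p N))" for N
      unfolding bounded_ops_sum[OF T] bounded_ops_lin[OF T] cinner_sum_right
      by (simp add: S cnj_cinner)
    hence "(\<lambda>N. cinner (S x) (?p N)) \<longlonglongrightarrow> cinner x (T y)" using 2 by simp
    thus ?thesis by (rule LIMSEQ_unique[OF 1])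
  qed
  thus ?thesis using Sb by blast
qed

lemma op_adjointI:
  assumes "S \<in> bounded_ops" "\<And>x y. cinner (S x) y = cinner x (T y)"
  shows "op_adjoint T = S"
  unfolding op_adjoint_def
proof (rule the_equality)
  fix R assume R: "R \<in> bounded_ops \<and> (\<forall>x y. cinner (R x) y = cinner x (T y))"
  show "R = S"
  proof
    fix x show "R x = S x"
      by (rule cinner_eqI) (metis R assms(2) cnj_cinner)
  qed
qed (use assms in auto)

lemma op_adjoint:
  assumes "T \<in> bounded_ops"
  shows op_adjoint_bounded [simp]: "op_adjoint T \<in> bounded_ops"
    and cinner_op_adjoint: "cinner (op_adjoint T x) y = cinner x (T y)"
    and cinner_op_adjoint': "cinner x (op_adjoint T y) = cinner (T x) y"
proof -
  obtain S where S: "S \<in> bounded_ops" "\<And>x y. cinner (S x) y = cinner x (T y)"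
    using op_adjoint_ex[OF assms] by blast
  show "op_adjoint T \<in> bounded_ops" "cinner (op_adjoint T x) y = cinner x (T y)"
    using S op_adjointI by metis+
  show "cinner x (op_adjoint T y) = cinner (T x) y"
    using S op_adjointI by (metis cnj_cinner)
qed

lemma op_adjoint_op_adjoint [simp]: "T \<in> bounded_ops \<Longrightarrow> op_adjoint (op_adjoint T) = T"
  by (rule op_adjointI) (auto simp: cinner_op_adjoint')

lemma op_adjoint_add:
  "S \<in> bounded_ops \<Longrightarrow> T \<in> bounded_ops \<Longrightarrow> op_adjoint (\<lambda>x. S x + T x) = (\<lambda>x. op_adjoint S x + op_adjoint T x)"
  by (rule op_adjointI) (auto simp: cinner_op_adjoint)

lemma op_adjoint_scaleC:
  "T \<in> bounded_ops \<Longrightarrow> op_adjoint (\<lambda>x. scaleC c (T x)) = (\<lambda>x. scaleC (cnj c) (op_adjoint T x))"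
  by (rule op_adjointI) (auto simp: cinner_op_adjoint)

lemma op_adjoint_comp:
  "S \<in> bounded_ops \<Longrightarrow> T \<in> bounded_ops \<Longrightarrow> op_adjoint (S \<circ> T) = op_adjoint T \<circ> op_adjoint S"
  by (rule op_adjointI) (auto simp: cinner_op_adjoint)

lemma op_adjoint_sum:
  "(\<And>i. i \<in> F \<Longrightarrow> f i \<in> bounded_ops) \<Longrightarrow> op_adjoint (\<lambda>x. \<Sum>i\<in>F. f i x) = (\<lambda>x. \<Sum>i\<in>F. op_adjoint (f i) x)"
  by (rule op_adjointI) (auto simp: cinner_op_adjoint cinner_sum_left cinner_sum_right)

lemma op_adjoint_id [simp]: "op_adjoint id = id" "op_adjoint (\<lambda>x. x) = (\<lambda>x. x)"
  by (rule op_adjointI; simp)+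

lemma onorm_op_adjoint_le:
  assumes T: "T \<in> bounded_ops" shows "onorm (op_adjoint T) \<le> onorm T"
proof (rule onorm_bound[OF onorm_op_nonneg[OF T]])
  fix x
  let ?y = "op_adjoint T x"
  have "(norm ?y)\<^sup>2 = cmod (cinner ?y ?y)" by (simp only: cinner_self norm_of_real abs_of_nonneg zero_le_power2)
  also have "\<dots> = cmod (cinner x (T ?y))" by (simp add: cinner_op_adjoint T)
  also have "\<dots> \<le> norm x * (onorm T * norm ?y)"
    using cmod_cinner_le[of x "T ?y"] norm_op_le[OF T, of ?y] by (meson mult_left_mono norm_ge_zero order_trans)
  finally have "norm ?y * norm ?y \<le> (onorm T * norm x) * norm ?y" by (simp add: power2_eq_square algebra_simps)
  thus "norm ?y \<le> onorm T * norm x"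
    using onorm_op_nonneg[OF T] by (cases "norm ?y = 0") (auto simp del: norm_eq_zero simp: mult_le_cancel_right)
qed

lemma onorm_adjoint_comp_self:
  assumes T: "T \<in> bounded_ops" shows "onorm (op_adjoint T \<circ> T) = (onorm T)\<^sup>2"
proof (rule antisym)
  have bl: "bounded_linear (op_adjoint T)" "bounded_linear T" using T op_adjoint_bounded bounded_ops_bl by auto
  have "onorm (op_adjoint T \<circ> T) \<le> onorm (op_adjoint T) * onorm T" by (rule onorm_compose[OF bl])
  also have "\<dots> \<le> onorm T * onorm T" by (intro mult_right_mono onorm_op_adjoint_le T onorm_op_nonneg)
  finally show "onorm (op_adjoint T \<circ> T) \<le> (onorm T)\<^sup>2" by (simp add: power2_eq_square)
  let ?m = "onorm (op_adjoint T \<circ> T)"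
  have b: "op_adjoint T \<circ> T \<in> bounded_ops" using T by auto
  have m: "0 \<le> ?m" by (rule onorm_op_nonneg[OF b])
  have "onorm T \<le> sqrt ?m"
  proof (rule onorm_bound)
    show "0 \<le> sqrt ?m" using m by simp
  next
    fix x
    have "(norm (T x))\<^sup>2 = cmod (cinner (T x) (T x))" by (simp only: cinner_self norm_of_real abs_of_nonneg zero_le_power2)
    also have "\<dots> = cmod (cinner x ((op_adjoint T \<circ> T) x))" by (simp add: cinner_op_adjoint' T)
    also have "\<dots> \<le> norm x * (?m * norm x)"
      using cmod_cinner_le[of x "(op_adjoint T \<circ> T) x"] norm_op_le[OF b, of x] by (meson mult_left_mono norm_ge_zero order_trans)
    also have "\<dots> = (sqrt ?m * norm x)\<^sup>2" using m by (simp add: power_mult_distrib power2_eq_square)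
    finally show "norm (T x) \<le> sqrt ?m * norm x" using m by (simp add: power2_le_iff_abs_le)
  qed
  hence "(onorm T)\<^sup>2 \<le> (sqrt ?m)\<^sup>2" by (intro power_mono onorm_op_nonneg T)
  thus "(onorm T)\<^sup>2 \<le> ?m" using m by simp
qed

lemma onorm_scaleC: 
  assumes T: "T \<in> bounded_ops" shows "onorm (\<lambda>x. scaleC c (T x)) = cmod c * onorm T"
proof -
  have le: "onorm (\<lambda>x. scaleC c (T x)) \<le> cmod c * onorm T" if "T \<in> bounded_ops" for c T
  proof (rule onorm_bound)
    show "0 \<le> cmod c * onorm T" using onorm_op_nonneg[OF that] by simp
  next
    fix x show "norm (scaleC c (T x)) \<le> cmod c * onorm T * norm x"
      using norm_op_le[OF that, of x] by (simp add: mult.assoc mult_left_mono)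
  qed
  show ?thesis
  proof (cases "c = 0")
    case False
    have "onorm T \<le> cmod (inverse c) * onorm (\<lambda>x. scaleC c (T x))"
      using le[OF bounded_ops_scaleC[OF T], of "inverse c" c] False by simp
    hence "cmod c * onorm T \<le> onorm (\<lambda>x. scaleC c (T x))"
      using False by (simp add: norm_inverse norm_divide field_simps)
    thus ?thesis using le[OF T, of c] by simp
  qed (simp add: onorm_zero)
qed

section \<open>The algebra of bounded operators\<close>

lemma B_alg_sel [simp]:
  "carrier B_alg = bounded_ops" "mult B_alg = (\<circ>)" "one B_alg = id" "zero B_alg = (\<lambda>_. 0)"
  "add B_alg = (\<lambda>S T x. S x + T x)" "smult B_alg = (\<lambda>c T x. scaleC c (T x))"
  "star B_alg = op_adjoint" "cnorm B_alg = onorm"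
  by (simp_all add: B_alg_def)

lemma ring_B_alg: "ring B_alg"
proof (rule ringI)
  show "abelian_group B_alg"
  proof (rule abelian_groupI)
    fix S assume "S \<in> carrier B_alg"
    thus "\<exists>T\<in>carrier B_alg. T \<oplus>\<^bsub>B_alg\<^esub> S = \<zero>\<^bsub>B_alg\<^esub>"
      by (intro bexI[of _ "\<lambda>x. - S x"]) auto
  qed (auto simp: algebra_simps)
  show "monoid B_alg" by (rule monoidI) (auto simp: comp_assoc)
next
  fix S T R assume "R \<in> carrier B_alg"
  thus "R \<otimes>\<^bsub>B_alg\<^esub> (S \<oplus>\<^bsub>B_alg\<^esub> T) = R \<otimes>\<^bsub>B_alg\<^esub> S \<oplus>\<^bsub>B_alg\<^esub> R \<otimes>\<^bsub>B_alg\<^esub> T"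
    by (simp add: fun_eq_iff bounded_ops_lin(1)[of R])
qed (auto simp: fun_eq_iff)

lemma a_inv_B_alg:
  assumes "T \<in> bounded_ops" shows "\<ominus>\<^bsub>B_alg\<^esub> T = (\<lambda>x. - T x)"
proof -
  interpret ring B_alg by (rule ring_B_alg)
  show ?thesis by (rule minus_equality) (use assms in auto)
qed

lemma a_minus_B_alg:
  "S \<in> bounded_ops \<Longrightarrow> T \<in> bounded_ops \<Longrightarrow> S \<ominus>\<^bsub>B_alg\<^esub> T = (\<lambda>x. S x - T x)"
  by (simp add: a_minus_def a_inv_B_alg)

lemma cdist_B_alg:
  "S \<in> bounded_ops \<Longrightarrow> T \<in> bounded_ops \<Longrightarrow> cdist B_alg S T = onorm (\<lambda>x. S x - T x)"
  by (simp add: cdist_def a_minus_B_alg)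

text \<open>\<open>Blinfun\<close> embeds the algebra isometrically into a Banach space of
  real-linear maps; metric axioms and completeness are inherited from there.\<close>

lemma onorm_diff_eq_dist:
  assumes "S \<in> bounded_ops" "T \<in> bounded_ops"
  shows "onorm (\<lambda>x. S x - T x) = dist (Blinfun S) (Blinfun T)"
  unfolding dist_norm norm_blinfun.rep_eq minus_blinfun.rep_eq
  using assms by (simp add: bounded_linear_Blinfun_apply bounded_ops_bl)

lemma Metric_space_B_alg: "Metric_space bounded_ops (cdist B_alg)"
proof
  fix x y show "0 \<le> cdist B_alg x y" "cdist B_alg x y = cdist B_alg y x"
    by (auto simp: cdist_def a_minus_B_alg onorm_diff_eq_dist dist_commute)
next
  fix x y assume xy: "x \<in> bounded_ops" "y \<in> bounded_ops"
  hence "cdist B_alg x y = 0 \<longleftrightarrow> Blinfun x = Blinfun y"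
    by (simp add: cdist_def a_minus_B_alg onorm_diff_eq_dist)
  thus "cdist B_alg x y = 0 \<longleftrightarrow> x = y"
    using xy by (metis bounded_linear_Blinfun_apply bounded_ops_bl)
  fix z assume "z \<in> bounded_ops"
  thus "cdist B_alg x z \<le> cdist B_alg x y + cdist B_alg y z"
    using xy by (simp add: cdist_B_alg onorm_diff_eq_dist dist_triangle)
qed

lemma cdist_B_alg_dist:
  "S \<in> bounded_ops \<Longrightarrow> T \<in> bounded_ops \<Longrightarrow> cdist B_alg S T = dist (Blinfun S) (Blinfun T)"
  by (simp add: cdist_B_alg onorm_diff_eq_dist)

text \<open>Norm convergence of real-linear maps gives pointwise convergence, and complex
  homogeneity survives pointwise limits.\<close>

lemma bounded_ops_limit:
  assumes "\<And>n. \<sigma> n \<in> bounded_ops" "(\<lambda>n. Blinfun (\<sigma> n)) \<longlonglongrightarrow> L"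
  shows "blinfun_apply L \<in> bounded_ops"
proof -
  have lim: "(\<lambda>n. \<sigma> n x) \<longlonglongrightarrow> blinfun_apply L x" for x
  proof -
    have "(\<lambda>n. blinfun_apply (Blinfun (\<sigma> n)) x) \<longlonglongrightarrow> blinfun_apply L x"
      by (intro tendsto_intros assms)
    thus ?thesis using assms(1) by (simp add: bounded_linear_Blinfun_apply bounded_ops_bl)
  qed
  have "blinfun_apply L (scaleC c x) = scaleC c (blinfun_apply L x)" for c x
  proof (rule LIMSEQ_unique[OF lim])
    have "(\<lambda>n. scaleC c (\<sigma> n x)) \<longlonglongrightarrow> scaleC c (blinfun_apply L x)"
      using bounded_ops_tendsto[OF bounded_ops_scaleC[OF bounded_ops_id', of c] lim] .
    thus "(\<lambda>n. \<sigma> n (scaleC c x)) \<longlonglongrightarrow> scaleC c (blinfun_apply L x)"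
      by (simp add: bounded_ops_lin(2)[OF assms(1)])
  qed
  thus ?thesis by (simp add: bounded_ops_def blinfun.bounded_linear_right)
qed

lemma mcomplete_B_alg: "Metric_space.mcomplete bounded_ops (cdist B_alg)"
proof -
  interpret M: Metric_space bounded_ops "cdist B_alg" by (rule Metric_space_B_alg)
  show ?thesis
    unfolding M.mcomplete_def
  proof (intro allI impI)
    fix \<sigma> assume C: "M.MCauchy \<sigma>"
    hence r: "\<And>n. \<sigma> n \<in> bounded_ops" unfolding M.MCauchy_def by blast
    have "Cauchy (\<lambda>n. Blinfun (\<sigma> n))"
    proof (rule metric_CauchyI)
      fix e :: real assume "0 < e"
      then obtain N where "\<And>n n'. N \<le> n \<Longrightarrow> N \<le> n' \<Longrightarrow> cdist B_alg (\<sigma> n) (\<sigma> n') < e"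
        using C unfolding M.MCauchy_def by blast
      thus "\<exists>M. \<forall>m\<ge>M. \<forall>n\<ge>M. dist (Blinfun (\<sigma> m)) (Blinfun (\<sigma> n)) < e"
        unfolding cdist_B_alg_dist[OF r r] by blast
    qed
    then obtain L where L: "(\<lambda>n. Blinfun (\<sigma> n)) \<longlonglongrightarrow> L"
      unfolding Cauchy_convergent_iff convergent_def by blast
    have Lb: "blinfun_apply L \<in> bounded_ops" by (rule bounded_ops_limit[OF r L])
    have "(\<lambda>n. dist (Blinfun (\<sigma> n)) L) \<longlonglongrightarrow> 0" by (rule tendsto_dist_iff[THEN iffD1, OF L])
    hence "limitin M.mtopology \<sigma> (blinfun_apply L) sequentially"
      unfolding M.limitin_metric_dist_null cdist_B_alg_dist[OF r Lb] blinfun_apply_inverse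
      using r Lb by simp
    thus "\<exists>x. limitin M.mtopology \<sigma> x sequentially" by blast
  qed
qed

lemma cring_complex: "cring (class_ring :: complex ring)"
  by (rule class_cring.cring_axioms)

lemma cstar_algebra_B_alg: "cstar_algebra B_alg"
proof -
  interpret R: ring B_alg by (rule ring_B_alg)
  have m: "module (class_ring :: complex ring) B_alg"
    by (rule moduleI[OF cring_complex R.abelian_group_axioms])
      (auto simp: scaleC_distribs fun_eq_iff)
  show ?thesis
  proof (intro cstar_algebra.intro ring_B_alg m cstar_algebra_axioms.intro)
    show "Metric_space.mcomplete (carrier B_alg) (cdist B_alg)" using mcomplete_B_alg by simp
  next
    fix S T assume "S \<in> carrier B_alg" "T \<in> carrier B_alg"
    thus "cnorm B_alg (S \<oplus>\<^bsub>B_alg\<^esub> T) \<le> cnorm B_alg S + cnorm B_alg T"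
      by (simp add: onorm_triangle bounded_ops_bl)
  next
    fix S T assume "S \<in> carrier B_alg" "T \<in> carrier B_alg"
    thus "cnorm B_alg (S \<otimes>\<^bsub>B_alg\<^esub> T) \<le> cnorm B_alg S * cnorm B_alg T"
      by (simp add: onorm_compose bounded_ops_bl)
  next
    fix T assume "T \<in> carrier B_alg"
    thus "(cnorm B_alg T = 0) = (T = \<zero>\<^bsub>B_alg\<^esub>)"
      by (auto simp: onorm_eq_0 bounded_ops_bl fun_eq_iff)
  next
    fix S T c assume "S \<in> carrier B_alg"
    thus "S \<otimes>\<^bsub>B_alg\<^esub> (c \<odot>\<^bsub>B_alg\<^esub> T) = c \<odot>\<^bsub>B_alg\<^esub> (S \<otimes>\<^bsub>B_alg\<^esub> T)"
      by (simp add: fun_eq_iff bounded_ops_lin(2)[of S])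
  qed (auto simp: fun_eq_iff op_adjoint_add op_adjoint_scaleC op_adjoint_comp
      onorm_op_nonneg onorm_scaleC onorm_adjoint_comp_self)
qed

text \<open>The topology is metric, so closedness is tested on sequences; in this form it is checked
  for commutants, matrix algebras and the compact operators.\<close>

lemma closedin_B_alg:
  "closedin (cstar_topology B_alg) D \<longleftrightarrow> D \<subseteq> bounded_ops \<and>
     (\<forall>\<sigma> L. (\<forall>n. \<sigma> n \<in> D) \<and> L \<in> bounded_ops \<and> (\<lambda>n. onorm (\<lambda>x. \<sigma> n x - L x)) \<longlonglongrightarrow> 0 \<longrightarrow> L \<in> D)"
proof -
  interpret M: Metric_space bounded_ops "cdist B_alg" by (rule Metric_space_B_alg)
  show ?thesis
  proof (cases "D \<subseteq> bounded_ops")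
    case True
    have lim: "limitin M.mtopology \<sigma> L sequentially \<longleftrightarrow>
        L \<in> bounded_ops \<and> (\<lambda>n. onorm (\<lambda>x. \<sigma> n x - L x)) \<longlonglongrightarrow> 0" if "\<forall>n. \<sigma> n \<in> D" for \<sigma> L
    proof (cases "L \<in> bounded_ops")
      case L: True
      have \<sigma>: "\<And>n. \<sigma> n \<in> bounded_ops" using that True by blast
      show ?thesis unfolding M.limitin_metric_dist_null cdist_B_alg[OF \<sigma> L] using L \<sigma> by simp
    qed (simp add: M.limitin_metric_dist_null)
    have "range \<sigma> \<subseteq> D \<and> limitin M.mtopology \<sigma> L sequentially \<longleftrightarrow>
        (\<forall>n. \<sigma> n \<in> D) \<and> L \<in> bounded_ops \<and> (\<lambda>n. onorm (\<lambda>x. \<sigma> n x - L x)) \<longlonglongrightarrow> 0" for \<sigma> L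
      using lim[of \<sigma> L] by blast
    thus ?thesis
      unfolding B_alg_sel M.metric_closedin_iff_sequentially_closed by (simp only:)
  qed (simp add: M.metric_closedin_iff_sequentially_closed)
qed

section \<open>Positive operators and square roots\<close>

lemma cstar_subalgebra_B_algD:
  assumes "cstar_subalgebra B_alg D"
  shows "D \<subseteq> bounded_ops" "id \<in> D" "\<And>S T. S \<in> D \<Longrightarrow> T \<in> D \<Longrightarrow> (\<lambda>x. S x + T x) \<in> D"
    "\<And>S T. S \<in> D \<Longrightarrow> T \<in> D \<Longrightarrow> (\<lambda>x. S x - T x) \<in> D" "\<And>S T. S \<in> D \<Longrightarrow> T \<in> D \<Longrightarrow> S \<circ> T \<in> D"
    "\<And>c T. T \<in> D \<Longrightarrow> (\<lambda>x. scaleC c (T x)) \<in> D" "\<And>T. T \<in> D \<Longrightarrow> op_adjoint T \<in> D" "(\<lambda>x. 0) \<in> D"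
    "\<And>\<sigma> L. (\<And>n. \<sigma> n \<in> D) \<Longrightarrow> L \<in> bounded_ops \<Longrightarrow> (\<lambda>n. onorm (\<lambda>x. \<sigma> n x - L x)) \<longlonglongrightarrow> 0 \<Longrightarrow> L \<in> D"
proof -
  have sr: "subring D B_alg" and sm: "\<And>c x. x \<in> D \<Longrightarrow> c \<odot>\<^bsub>B_alg\<^esub> x \<in> D"
    and st: "\<And>x. x \<in> D \<Longrightarrow> star B_alg x \<in> D" and cl: "closedin (cstar_topology B_alg) D"
    using assms unfolding cstar_subalgebra_def by blast+
  note r = subringE[OF sr, unfolded B_alg_sel]
  show sub: "D \<subseteq> bounded_ops" and "id \<in> D" and "(\<lambda>x. 0) \<in> D" using r by blast+
  show add: "(\<lambda>x. S x + T x) \<in> D" if "S \<in> D" "T \<in> D" for S T using r(7)[OF that] .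
  show "S \<circ> T \<in> D" if "S \<in> D" "T \<in> D" for S T using r(6)[OF that] .
  show sc: "(\<lambda>x. scaleC c (T x)) \<in> D" if "T \<in> D" for c T using sm[OF that] by simp
  show "(\<lambda>x. S x - T x) \<in> D" if "S \<in> D" "T \<in> D" for S T
    using add[OF that(1) sc[OF that(2), of "-1"]] by (simp add: scaleC_distribs)
  show "op_adjoint T \<in> D" if "T \<in> D" for T using st[OF that] by simp
  show "L \<in> D" if "\<And>n. \<sigma> n \<in> D" "L \<in> bounded_ops" "(\<lambda>n. onorm (\<lambda>x. \<sigma> n x - L x)) \<longlonglongrightarrow> 0" for \<sigma> L
    using cl that unfolding closedin_B_alg by blast
qed

lemma cstar_subalgebra_B_algI:
  assumes sub: "D \<subseteq> bounded_ops" and id: "id \<in> D"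
    and add: "\<And>S T. S \<in> D \<Longrightarrow> T \<in> D \<Longrightarrow> (\<lambda>x. S x + T x) \<in> D"
    and mult: "\<And>S T. S \<in> D \<Longrightarrow> T \<in> D \<Longrightarrow> S \<circ> T \<in> D"
    and sc: "\<And>c T. T \<in> D \<Longrightarrow> (\<lambda>x. scaleC c (T x)) \<in> D" 
    and st: "\<And>T. T \<in> D \<Longrightarrow> op_adjoint T \<in> D"
    and cl: "\<And>\<sigma> L. (\<And>n. \<sigma> n \<in> D) \<Longrightarrow> L \<in> bounded_ops \<Longrightarrow> (\<lambda>n. onorm (\<lambda>x. \<sigma> n x - L x)) \<longlonglongrightarrow> 0 \<Longrightarrow> L \<in> D"
  shows "cstar_subalgebra B_alg D"
proof -
  interpret ring B_alg by (rule ring_B_alg)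
  have "subring D B_alg"
  proof (rule subringI)
    fix T assume T: "T \<in> D"
    have "(\<lambda>x. - T x) \<in> D" using sc[OF T, of "-1"] by (simp add: scaleC_distribs)
    thus "\<ominus>\<^bsub>B_alg\<^esub> T \<in> D" using a_inv_B_alg[of T] T sub by auto
  qed (use sub id add mult in auto)
  moreover have "closedin (cstar_topology B_alg) D"
    unfolding closedin_B_alg using sub cl by blast
  ultimately show ?thesis unfolding cstar_subalgebra_def using sc st by simp
qed

text \<open>Positivity by the quadratic form, as opposed to the factorization used in
  \<open>positive_elem\<close>; \<open>pos_op_sqrt\<close> passes from the former to the
  latter.\<close>

definition pos_op :: "(ell2 \<Rightarrow> ell2) \<Rightarrow> bool" where
  "pos_op T \<longleftrightarrow> T \<in> bounded_ops \<and> op_adjoint T = T \<and> (\<forall>v. 0 \<le> Re (cinner v (T v)))"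

lemma pos_opD:
  assumes "pos_op T"
  shows "T \<in> bounded_ops" "op_adjoint T = T" "0 \<le> Re (cinner v (T v))"
  using assms by (auto simp: pos_op_def)

lemma selfadjoint_cinner: "T \<in> bounded_ops \<Longrightarrow> op_adjoint T = T \<Longrightarrow> cinner (T x) y = cinner x (T y)"
  using cinner_op_adjoint by metis

text \<open>Inserting \<open>v - t T v\<close> into the nonnegative form, with
  \<open>t = 1 / onorm T\<close>, lets the quadratic term cancel half of the linear one. A small
  form thus forces a small vector \<open>T v\<close>, which is how forms are turned into norms
  below.\<close>

lemma pos_op_norm_le:
  assumes T: "pos_op T"
  shows "(norm (T v))\<^sup>2 \<le> onorm T * Re (cinner v (T v))"
proof (cases "onorm T = 0")
  case True
  hence "T v = 0" using norm_op_le[OF pos_opD(1)[OF T], of v] by simp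
  thus ?thesis using True by simp
next
  case False
  let ?M = "onorm T"
  note b = pos_opD(1)[OF T]
  have M: "0 < ?M" using onorm_op_nonneg[OF b] False by simp
  define t where "t = 1 / ?M"
  have sa: "cinner (T v) (T v) = cinner v (T (T v))" by (rule selfadjoint_cinner[OF b pos_opD(2)[OF T]])
  have "Re (cinner (T v) (T (T v))) \<le> norm (T v) * norm (T (T v))"
    using cmod_cinner_le[of "T v" "T (T v)"] complex_Re_le_cmod order_trans by blast
  also have "\<dots> \<le> norm (T v) * (?M * norm (T v))" by (intro mult_left_mono norm_op_le b) simp
  finally have q: "Re (cinner (T v) (T (T v))) \<le> ?M * (norm (T v))\<^sup>2" by (simp add: power2_eq_square mult_ac)
  have "0 \<le> Re (cinner (v - t *\<^sub>R T v) (T (v - t *\<^sub>R T v)))" by (rule pos_opD(3)[OF T])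
  also have "\<dots> = Re (cinner v (T v)) - 2 * t * (norm (T v))\<^sup>2 + t\<^sup>2 * Re (cinner (T v) (T (T v)))"
    by (simp add: bounded_ops_lin[OF b] sa[symmetric] cinner_self power2_eq_square algebra_simps del: of_real_mult)
  also have "\<dots> \<le> Re (cinner v (T v)) - 2 * t * (norm (T v))\<^sup>2 + t\<^sup>2 * (?M * (norm (T v))\<^sup>2)"
    by (intro add_left_mono mult_left_mono q) simp
  also have "t\<^sup>2 * (?M * (norm (T v))\<^sup>2) = t * (norm (T v))\<^sup>2" using M by (simp add: t_def power2_eq_square)
  finally have "t * (norm (T v))\<^sup>2 \<le> Re (cinner v (T v))" by simp
  thus ?thesis using M by (simp add: t_def field_simps)
qed

text \<open>The previous inequality gives \<open>onorm T \<le> sqrt (onorm T)\<close>, hence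
  \<open>onorm T \<le> 1\<close>.\<close>

lemma pos_op_contraction:
  assumes T: "pos_op T" and le: "\<And>v. Re (cinner v (T v)) \<le> (norm v)\<^sup>2"
  shows "norm (T v) \<le> norm v"
proof -
  note b = pos_opD(1)[OF T]
  have M: "0 \<le> onorm T" by (rule onorm_op_nonneg[OF b])
  have *: "norm (T v) \<le> sqrt (onorm T) * norm v" for v
  proof -
    have "(norm (T v))\<^sup>2 \<le> onorm T * (norm v)\<^sup>2"
      using pos_op_norm_le[OF T, of v] mult_left_mono[OF le M, of v] by linarith
    also have "\<dots> = (sqrt (onorm T) * norm v)\<^sup>2" using M by (simp add: power_mult_distrib)
    finally show ?thesis using M by (simp add: power2_le_iff_abs_le)
  qed
  have "onorm T \<le> sqrt (onorm T)" by (rule onorm_bound[OF _ *]) (use M in simp)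
  moreover have "onorm T = sqrt (onorm T) * sqrt (onorm T)" using M by simp
  ultimately have "sqrt (onorm T) * sqrt (onorm T) \<le> sqrt (onorm T) * 1" by simp
  hence "sqrt (onorm T) \<le> 1" using M by (cases "onorm T = 0") (simp_all add: mult_le_cancel_left_pos del: real_sqrt_mult_self)
  hence "onorm T \<le> 1" by simp
  thus ?thesis using norm_op_le[OF b, of v] mult_right_mono[of "onorm T" 1 "norm v"] by simp
qed

text \<open>A fixed point \<open>Z = (S + Z\<^sup>2)/2\<close> satisfies
  \<open>(1 - Z)\<^sup>2 = 1 - S\<close>, so the iteration leads to \<open>1 - Z\<close> as a square
  root of \<open>1 - S\<close>.\<close>

primrec sqrt_iter :: "(ell2 \<Rightarrow> ell2) \<Rightarrow> nat \<Rightarrow> ell2 \<Rightarrow> ell2" where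
  "sqrt_iter S 0 = (\<lambda>x. 0)"
| "sqrt_iter S (Suc n) = (\<lambda>x. scaleC (1/2) (S x + sqrt_iter S n (sqrt_iter S n x)))"

primrec sqrt_bound :: "nat \<Rightarrow> real" where
  "sqrt_bound 0 = 0"
| "sqrt_bound (Suc n) = (1 + (sqrt_bound n)\<^sup>2) / 2"

lemma sqrt_bound: "0 \<le> sqrt_bound n" "sqrt_bound n \<le> 1" "sqrt_bound n \<le> sqrt_bound (Suc n)"
proof -
  show 0: "0 \<le> sqrt_bound n" by (induction n) auto
  show 1: "sqrt_bound n \<le> 1" 
  proof (induction n)
    case (Suc n)
    have "0 \<le> sqrt_bound n" by (induction n) auto
    hence "(sqrt_bound n)\<^sup>2 \<le> 1" using Suc by (simp add: power_le_one)
    thus ?case by simp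
  qed simp
  have "0 \<le> (1 - sqrt_bound n)\<^sup>2" by simp
  thus "sqrt_bound n \<le> sqrt_bound (Suc n)" by (simp add: power2_eq_square algebra_simps)
qed

text \<open>The iterates are dominated termwise by the scalar iteration started from \<open>S = 1\<close>, which
  increases to its limit \<open>1\<close>; this gives norm convergence.\<close>

lemma sqrt_one_minus:
  assumes S: "S \<in> bounded_ops" "op_adjoint S = S" and contr: "\<And>v. norm (S v) \<le> norm v"
  obtains R where "pos_op R" "\<And>x. R (R x) = x - S x"
    "\<And>D. cstar_subalgebra B_alg D \<Longrightarrow> S \<in> D \<Longrightarrow> R \<in> D"
proof -
  let ?Y = "sqrt_iter S" and ?r = sqrt_bound
  have Yb: "?Y n \<in> bounded_ops" for n
  proof (induction n)
    case (Suc n)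
    from bounded_ops_scaleC[OF bounded_ops_add[OF S(1) bounded_ops_comp'[OF Suc Suc]]] show ?case by simp
  qed simp
  have Yle: "norm (?Y n x) \<le> ?r n * norm x" for n x
  proof (induction n arbitrary: x)
    case (Suc n)
    have "norm (?Y n (?Y n x)) \<le> ?r n * (?r n * norm x)"
      using Suc[of "?Y n x"] mult_left_mono[OF Suc[of x] sqrt_bound(1)[of n]] by linarith
    moreover have "norm (S x + ?Y n (?Y n x)) \<le> norm x + norm (?Y n (?Y n x))"
      using norm_triangle_ineq[of "S x" "?Y n (?Y n x)"] contr[of x] by linarith
    ultimately show ?case by (simp add: power2_eq_square algebra_simps)
  qed simp
  have Ydiff: "norm (?Y (Suc n) x - ?Y n x) \<le> (?r (Suc n) - ?r n) * norm x" for n x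
  proof (induction n arbitrary: x)
    case 0 thus ?case using contr[of x] by simp
  next
    case (Suc n)
    let ?d = "?r (Suc n) - ?r n"
    \<comment> \<open>The difference of the squares is split as
      \<open>Y (Y - Y') + (Y - Y') Y'\<close>, which is valid for operators and matches the scalar
      identity for \<open>sqrt_bound\<close> term by term.\<close>
    have "?Y (Suc (Suc n)) x - ?Y (Suc n) x =
        scaleC (1/2) (?Y (Suc n) (?Y (Suc n) x - ?Y n x) + (?Y (Suc n) (?Y n x) - ?Y n (?Y n x)))"
      by (simp only: sqrt_iter.simps(2)[of S "Suc n"] sqrt_iter.simps(2)[of S n, THEN fun_cong] bounded_ops_lin[OF Yb])
        (simp add: scaleC_distribs)
    moreover have "norm (?Y (Suc n) (?Y (Suc n) x - ?Y n x)) \<le> ?r (Suc n) * (?d * norm x)"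
      using Yle[of "Suc n" "?Y (Suc n) x - ?Y n x"] mult_left_mono[OF Suc[of x] sqrt_bound(1)[of "Suc n"]] by linarith
    moreover have "norm (?Y (Suc n) (?Y n x) - ?Y n (?Y n x)) \<le> ?d * (?r n * norm x)"
    proof -
      have "0 \<le> ?d" using sqrt_bound(3)[of n] by linarith
      from mult_left_mono[OF Yle[of n x] this] show ?thesis using Suc[of "?Y n x"] by linarith
    qed
    ultimately have "norm (?Y (Suc (Suc n)) x - ?Y (Suc n) x) \<le>
        (?r (Suc n) * (?d * norm x) + ?d * (?r n * norm x)) / 2"
      using norm_triangle_ineq[of "?Y (Suc n) (?Y (Suc n) x - ?Y n x)" "?Y (Suc n) (?Y n x) - ?Y n (?Y n x)"]
      by (simp only: norm_scaleC) simp
    also have "\<dots> = (?r (Suc (Suc n)) - ?r (Suc n)) * norm x"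
      by (simp only: sqrt_bound.simps(2)[of "Suc n"] sqrt_bound.simps(2)[of n, symmetric])
        (simp add: power2_eq_square field_simps)
    finally show ?case .
  qed
  have Ydiff': "norm (?Y (n + k) x - ?Y n x) \<le> (?r (n + k) - ?r n) * norm x" for n k x
  proof (induction k)
    case (Suc k)
    have "norm (?Y (n + Suc k) x - ?Y n x) \<le> norm (?Y (Suc (n + k)) x - ?Y (n + k) x) + norm (?Y (n + k) x - ?Y n x)"
      using norm_triangle_ineq[of "?Y (Suc (n + k)) x - ?Y (n + k) x" "?Y (n + k) x - ?Y n x"] by (simp del: sqrt_iter.simps)
    thus ?case using Suc Ydiff[of "n + k" x] by (simp add: algebra_simps del: sqrt_iter.simps sqrt_bound.simps)
  qed simp
  have "\<exists>l. ?r \<longlonglongrightarrow> l"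
  proof -
    have "incseq ?r" by (rule incseq_SucI) (rule sqrt_bound(3))
    thus ?thesis using incseq_convergent[of ?r 1] sqrt_bound(2) by metis
  qed
  hence rC: "Cauchy ?r" using LIMSEQ_imp_Cauchy by blast
  have dY: "dist (Blinfun (?Y n)) (Blinfun (?Y m)) \<le> \<bar>?r n - ?r m\<bar>" for n m
  proof -
    have *: "dist (Blinfun (?Y n)) (Blinfun (?Y m)) \<le> \<bar>?r n - ?r m\<bar>" if nm: "m \<le> n" for n m
      unfolding onorm_diff_eq_dist[OF Yb Yb, symmetric]
    proof (rule onorm_bound)
      fix x show "norm (?Y n x - ?Y m x) \<le> \<bar>?r n - ?r m\<bar> * norm x"
        using order_trans[OF Ydiff'[of m "n - m" x] mult_right_mono[OF abs_ge_self norm_ge_zero]] nm by simp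
    qed simp
    show ?thesis using *[of m n] *[of n m] by (cases "m \<le> n") (auto simp: dist_commute abs_minus_commute)
  qed
  have "Cauchy (\<lambda>n. Blinfun (?Y n))"
  proof (rule metric_CauchyI)
    fix e :: real assume "0 < e"
    then obtain M where M: "\<forall>m\<ge>M. \<forall>n\<ge>M. dist (?r m) (?r n) < e" using metric_CauchyD[OF rC] by blast
    show "\<exists>M. \<forall>m\<ge>M. \<forall>n\<ge>M. dist (Blinfun (?Y m)) (Blinfun (?Y n)) < e"
      using M dY le_less_trans unfolding dist_real_def by blast
  qed
  then obtain L where L: "(\<lambda>n. Blinfun (?Y n)) \<longlonglongrightarrow> L"
    unfolding Cauchy_convergent_iff convergent_def by blast
  define Z where "Z = blinfun_apply L"
  have Zb: "Z \<in> bounded_ops" unfolding Z_def by (rule bounded_ops_limit[OF Yb L])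
  have BY: "blinfun_apply (Blinfun (?Y n)) = ?Y n" for n
    by (simp add: bounded_linear_Blinfun_apply bounded_ops_bl Yb)
  have lim: "(\<lambda>n. ?Y n x) \<longlonglongrightarrow> Z x" for x
  proof -
    have "(\<lambda>n. blinfun_apply (Blinfun (?Y n)) x) \<longlonglongrightarrow> Z x"
      unfolding Z_def by (intro tendsto_intros L)
    thus ?thesis by (simp only: BY)
  qed
  have lim2: "(\<lambda>n. ?Y n (?Y n x)) \<longlonglongrightarrow> Z (Z x)" for x
  proof -
    have "(\<lambda>n. blinfun_apply (Blinfun (?Y n)) (?Y n x)) \<longlonglongrightarrow> Z (Z x)"
      unfolding Z_def[of, THEN fun_cong, of "Z x"] by (intro tendsto_intros L lim)
    thus ?thesis by (simp only: BY)
  qed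
  have Zeq: "Z x = scaleC (1/2) (S x + Z (Z x))" for x
  proof (rule LIMSEQ_unique[OF LIMSEQ_Suc[OF lim]])
    have "(\<lambda>n. S x + ?Y n (?Y n x)) \<longlonglongrightarrow> S x + Z (Z x)" by (intro tendsto_intros lim2)
    from bounded_ops_tendsto[OF bounded_ops_scaleC[OF bounded_ops_id', of "1/2"] this]
    show "(\<lambda>n. ?Y (Suc n) x) \<longlonglongrightarrow> scaleC (1/2) (S x + Z (Z x))" by simp
  qed
  have Ysa: "cinner (?Y n x) y = cinner x (?Y n y)" for n x y
  proof (induction n arbitrary: x y)
    case (Suc n) thus ?case by (simp add: selfadjoint_cinner[OF S])
  qed simp
  have Zsa: "cinner (Z x) y = cinner x (Z y)" for x y
  proof (rule LIMSEQ_unique)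
    show "(\<lambda>n. cinner (?Y n x) y) \<longlonglongrightarrow> cinner (Z x) y" by (intro tendsto_cinner lim tendsto_const)
    show "(\<lambda>n. cinner (?Y n x) y) \<longlonglongrightarrow> cinner x (Z y)"
      unfolding Ysa by (intro tendsto_cinner lim tendsto_const)
  qed
  have Zle: "norm (Z x) \<le> norm x" for x
  proof (rule LIMSEQ_le_const2[OF tendsto_norm[OF lim]])
    have "norm (?Y n x) \<le> norm x" for n
      using Yle[of n x] mult_right_mono[OF sqrt_bound(2)[of n], of "norm x"] by simp
    thus "\<exists>N. \<forall>n\<ge>N. norm (?Y n x) \<le> norm x" by blast
  qed
  define R where "R = (\<lambda>x. x - Z x)"
  have Rb: "R \<in> bounded_ops" unfolding R_def by (intro bounded_ops_diff bounded_ops_id' Zb)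
  show ?thesis
  proof (rule that[of R])
    have "0 \<le> Re (cinner v (R v))" for v
    proof -
      have "Re (cinner v (Z v)) \<le> norm v * norm (Z v)"
        using cmod_cinner_le[of v "Z v"] complex_Re_le_cmod order_trans by blast
      also have "\<dots> \<le> norm v * norm v" by (intro mult_left_mono Zle) simp
      finally show ?thesis by (simp add: R_def cinner_self power2_eq_square del: of_real_mult)
    qed
    moreover have "op_adjoint R = R" by (rule op_adjointI[OF Rb]) (simp add: R_def Zsa)
    ultimately show "pos_op R" using Rb by (simp add: pos_op_def)
    show "R (R x) = x - S x" for x
    proof -
      have "scaleC 2 (Z x) = scaleC 2 (scaleC (1/2) (S x + Z (Z x)))" by (subst Zeq) (rule refl)
      hence "Z x + Z x = S x + Z (Z x)" using scaleC_distribs(3)[of 1 1 "Z x"] by simp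
      thus ?thesis by (simp add: R_def bounded_ops_lin[OF Zb] algebra_simps)
    qed
    \<comment> \<open>The iterates are polynomials in \<open>S\<close>, so their norm limit
      \<open>Z\<close> lies in every C*-subalgebra that contains \<open>S\<close>.\<close>
    fix D assume D: "cstar_subalgebra B_alg D" "S \<in> D"
    note d = cstar_subalgebra_B_algD[OF D(1)]
    have YD: "?Y n \<in> D" for n
    proof (induction n)
      case (Suc n)
      from d(6)[OF d(3)[OF D(2) d(5)[OF Suc Suc]]] show ?case by (simp add: comp_def)
    qed (simp add: d(8))
    have "(\<lambda>n. dist (Blinfun (?Y n)) L) \<longlonglongrightarrow> 0" by (rule tendsto_dist_iff[THEN iffD1, OF L])
    moreover have "Blinfun Z = L" by (simp add: Z_def blinfun_apply_inverse)
    ultimately have "(\<lambda>n. onorm (\<lambda>x. ?Y n x - Z x)) \<longlonglongrightarrow> 0"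
      by (simp add: onorm_diff_eq_dist[OF Yb Zb])
    hence "Z \<in> D" by (rule d(9)[OF YD Zb])
    from d(4)[OF d(2) this] show "R \<in> D" by (simp add: R_def)
  qed
qed

lemma pos_op_scaleR:
  assumes "pos_op T" "0 \<le> r" shows "pos_op (\<lambda>x. r *\<^sub>R T x)"
  unfolding pos_op_def
proof (intro conjI allI)
  note b = pos_opD[OF assms(1)]
  show B: "(\<lambda>x. r *\<^sub>R T x) \<in> bounded_ops" unfolding scaleR_scaleC by (rule bounded_ops_scaleC[OF b(1)])
  show "op_adjoint (\<lambda>x. r *\<^sub>R T x) = (\<lambda>x. r *\<^sub>R T x)"
    by (rule op_adjointI[OF B]) (simp add: selfadjoint_cinner[OF b(1,2)])
  fix v show "0 \<le> Re (cinner v (r *\<^sub>R T v))" using assms(2) b(3)[of v] by simp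
qed

text \<open>Rescaling makes \<open>S = 1 - T/M\<close> a positive contraction, and
  \<open>sqrt M\<close> times the square root of \<open>1 - S = T/M\<close> is the desired root.
  Membership in every C*-subalgebra containing \<open>T\<close> is part of the claim because it
  later yields commutation, via a commutant, and factors inside a subalgebra, via matrix
  algebras.\<close>

lemma pos_op_sqrt:
  assumes T: "pos_op T"
  obtains R where "pos_op R" "\<And>x. R (R x) = T x"
    "\<And>D. cstar_subalgebra B_alg D \<Longrightarrow> T \<in> D \<Longrightarrow> R \<in> D"
proof -
  note b = pos_opD[OF T]
  \<comment> \<open>The summand \<open>1\<close> keeps \<open>M\<close> positive when
    \<open>T\<close> is zero.\<close>
  define M where "M = onorm T + 1"
  have M: "0 < M" using onorm_op_nonneg[OF b(1)] by (simp add: M_def)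
  define S where "S = (\<lambda>x. x - (1/M) *\<^sub>R T x)"
  have Tb: "(\<lambda>x. (1/M) *\<^sub>R T x) \<in> bounded_ops" using pos_opD(1)[OF pos_op_scaleR[OF T, of "1/M"]] M by simp
  have Sb: "S \<in> bounded_ops" unfolding S_def by (intro bounded_ops_diff bounded_ops_id' Tb)
  have Ssa: "op_adjoint S = S" by (rule op_adjointI[OF Sb]) (simp add: S_def selfadjoint_cinner[OF b(1,2)])
  have qS: "Re (cinner v (S v)) = (norm v)\<^sup>2 - (1/M) * Re (cinner v (T v))" for v
    by (simp add: S_def cinner_self del: of_real_power)
  have "Re (cinner v (T v)) \<le> M * (norm v)\<^sup>2" for v
  proof -
    have "Re (cinner v (T v)) \<le> norm v * norm (T v)"
      using cmod_cinner_le[of v "T v"] complex_Re_le_cmod order_trans by blast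
    also have "\<dots> \<le> norm v * (onorm T * norm v)" by (intro mult_left_mono norm_op_le b(1)) simp
    also have "\<dots> \<le> M * (norm v)\<^sup>2" by (simp add: M_def power2_eq_square algebra_simps)
    finally show ?thesis .
  qed
  hence "0 \<le> Re (cinner v (S v))" for v unfolding qS using M by (simp add: field_simps)
  hence Sp: "pos_op S" using Sb Ssa by (simp add: pos_op_def)
  have "Re (cinner v (S v)) \<le> (norm v)\<^sup>2" for v unfolding qS using M b(3)[of v] by simp
  hence contr: "norm (S v) \<le> norm v" for v by (rule pos_op_contraction[OF Sp])
  obtain R where R: "pos_op R" "\<And>x. R (R x) = x - S x"
      "\<And>D. cstar_subalgebra B_alg D \<Longrightarrow> S \<in> D \<Longrightarrow> R \<in> D"
    using sqrt_one_minus[OF Sb Ssa contr] by blast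
  show ?thesis
  proof (rule that[of "\<lambda>x. sqrt M *\<^sub>R R x"])
    show "pos_op (\<lambda>x. sqrt M *\<^sub>R R x)" by (rule pos_op_scaleR[OF R(1)]) (use M in simp)
    show "sqrt M *\<^sub>R R (sqrt M *\<^sub>R R x) = T x" for x
      using M by (simp add: bounded_ops_lin[OF pos_opD(1)[OF R(1)]] R(2) S_def)
    fix D assume D: "cstar_subalgebra B_alg D" "T \<in> D"
    note d = cstar_subalgebra_B_algD[OF D(1)]
    from d(4)[OF d(2) d(6)[OF D(2), of "of_real (1/M)"]] have "S \<in> D" by (simp add: S_def scaleR_scaleC)
    from d(6)[OF R(3)[OF D(1) this], of "of_real (sqrt M)"] show "(\<lambda>x. sqrt M *\<^sub>R R x) \<in> D"
      by (simp add: scaleR_scaleC)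
  qed
qed

text \<open>Provides the C*-subalgebra which forces the square root of \<open>T \<circ> T\<close> to
  commute with \<open>T\<close>.\<close>

lemma commutant_cstar_subalgebra:
  assumes T: "T \<in> bounded_ops" "op_adjoint T = T"
  shows "cstar_subalgebra B_alg {X \<in> bounded_ops. \<forall>x. X (T x) = T (X x)}"
  (is "cstar_subalgebra B_alg ?D")
proof (rule cstar_subalgebra_B_algI)
  fix X assume "X \<in> ?D"
  hence X: "X \<in> bounded_ops" "\<forall>x. X (T x) = T (X x)" by auto
  have "op_adjoint X (T x) = T (op_adjoint X x)" for x
  proof (rule cinner_eqI)
    fix z
    have "cinner z (op_adjoint X (T x)) = cinner (T (X z)) x"
      by (simp add: cinner_op_adjoint'[OF X(1)] selfadjoint_cinner[OF T])
    also have "\<dots> = cinner z (T (op_adjoint X x))"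
      by (simp add: X(2)[rule_format, symmetric] selfadjoint_cinner[OF T, symmetric] cinner_op_adjoint'[OF X(1)])
    finally show "cinner z (op_adjoint X (T x)) = cinner z (T (op_adjoint X x))" .
  qed
  thus "op_adjoint X \<in> ?D" using X(1) by simp
next
  fix \<sigma> L assume s: "\<And>n. \<sigma> n \<in> {X \<in> bounded_ops. \<forall>x. X (T x) = T (X x)}" and L: "L \<in> bounded_ops"
    and lim: "(\<lambda>n. onorm (\<lambda>x. \<sigma> n x - L x)) \<longlonglongrightarrow> 0"
  have sb: "\<And>n. \<sigma> n \<in> bounded_ops" and sc: "\<And>n x. \<sigma> n (T x) = T (\<sigma> n x)" using s by blast+
  have pl: "(\<lambda>n. \<sigma> n x) \<longlonglongrightarrow> L x" for x
  proof (rule LIM_zero_cancel, rule Lim_null_comparison)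
    show "\<forall>\<^sub>F n in sequentially. norm (\<sigma> n x - L x) \<le> onorm (\<lambda>x. \<sigma> n x - L x) * norm x"
      using norm_op_le[OF bounded_ops_diff[OF sb L]] by (simp add: always_eventually)
    show "(\<lambda>n. onorm (\<lambda>x. \<sigma> n x - L x) * norm x) \<longlonglongrightarrow> 0" using tendsto_mult_left_zero[OF lim] .
  qed
  have "L (T x) = T (L x)" for x
  proof -
    have "(\<lambda>n. \<sigma> n (T x)) \<longlonglongrightarrow> T (L x)" unfolding sc by (rule bounded_ops_tendsto[OF T(1) pl])
    thus ?thesis by (rule LIMSEQ_unique[OF pl])
  qed
  thus "L \<in> ?D" using L by simp
qed (simp_all add: bounded_ops_lin[OF T(1)] subset_iff bounded_ops_add bounded_ops_comp bounded_ops_scaleC)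

section \<open>Compact operators and essential positivity\<close>

text \<open>The quantitative form of compactness; for bounded operators the two are equivalent by
  \<open>compact_ops_iff\<close>.\<close>

definition tail_small :: "(ell2 \<Rightarrow> ell2) \<Rightarrow> bool" where
  "tail_small T \<longleftrightarrow> (\<forall>\<epsilon>>0. \<exists>N. \<forall>v. norm (T (tailp N v)) \<le> \<epsilon> * norm v)"

lemma tail_smallI: "(\<And>\<epsilon>. 0 < \<epsilon> \<Longrightarrow> \<exists>N. \<forall>v. norm (T (tailp N v)) \<le> \<epsilon> * norm v) \<Longrightarrow> tail_small T"
  by (simp add: tail_small_def)

lemma tailp_tailp: "N \<le> M \<Longrightarrow> tailp N (tailp M v) = tailp M v"
  by (rule ell2_eqI) auto

text \<open>Tails are nested, so the bound found at one \<open>N\<close> persists at all later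
  ones.\<close>

lemma tail_smallD:
  assumes "tail_small T" "0 < \<epsilon>"
  obtains N where "\<And>M v. N \<le> M \<Longrightarrow> norm (T (tailp M v)) \<le> \<epsilon> * norm v"
proof -
  obtain N where N: "\<forall>v. norm (T (tailp N v)) \<le> \<epsilon> * norm v" using assms unfolding tail_small_def by blast
  show ?thesis
  proof (rule that[of N])
    fix M v assume "N \<le> M"
    hence "norm (T (tailp M v)) \<le> \<epsilon> * norm (tailp M v)" using N[rule_format, of "tailp M v"] by (simp add: tailp_tailp)
    also have "\<dots> \<le> \<epsilon> * norm v" by (intro mult_left_mono norm_tailp_le) (use assms in simp)
    finally show "norm (T (tailp M v)) \<le> \<epsilon> * norm v" .
  qed
qed

lemma tail_small_comp_left:
  assumes S: "S \<in> bounded_ops" and T: "tail_small T" shows "tail_small (\<lambda>x. S (T x))"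
proof (rule tail_smallI)
  fix e :: real assume e: "0 < e"
  define K where "K = onorm S + 1"
  have K: "0 < K" "onorm S \<le> K" using onorm_op_nonneg[OF S] by (auto simp: K_def)
  obtain N where N: "\<And>M v. N \<le> M \<Longrightarrow> norm (T (tailp M v)) \<le> (e / K) * norm v"
    using tail_smallD[OF T, of "e / K"] e K by (metis divide_pos_pos)
  have "norm (S (T (tailp N v))) \<le> e * norm v" for v
  proof -
    have "norm (S (T (tailp N v))) \<le> onorm S * norm (T (tailp N v))" by (rule norm_op_le[OF S])
    also have "\<dots> \<le> K * ((e / K) * norm v)" using K by (intro mult_mono N) auto
    finally show ?thesis using K by simp
  qed
  thus "\<exists>N. \<forall>v. norm (S (T (tailp N v))) \<le> e * norm v" by blast
qed

lemma tail_small_add: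
  assumes "tail_small S" "tail_small T" shows "tail_small (\<lambda>x. S x + T x)"
proof (rule tail_smallI)
  fix e :: real assume e: "0 < e"
  obtain N where N: "\<And>M v. N \<le> M \<Longrightarrow> norm (S (tailp M v)) \<le> (e/2) * norm v"
    using tail_smallD[OF assms(1), of "e/2"] e by auto
  obtain N' where N': "\<And>M v. N' \<le> M \<Longrightarrow> norm (T (tailp M v)) \<le> (e/2) * norm v"
    using tail_smallD[OF assms(2), of "e/2"] e by auto
  have "norm (S (tailp (max N N') v) + T (tailp (max N N') v)) \<le> e * norm v" for v
    using norm_triangle_ineq[of "S (tailp (max N N') v)" "T (tailp (max N N') v)"] 
      N[of "max N N'" v] N'[of "max N N'" v] by simp
  thus "\<exists>N. \<forall>v. norm (S (tailp N v) + T (tailp N v)) \<le> e * norm v" by blast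
qed

lemma tail_small_scaleC: "tail_small T \<Longrightarrow> tail_small (\<lambda>x. scaleC c (T x))"
  using tail_small_comp_left[OF bounded_ops_scaleC[OF bounded_ops_id', of c]] by simp

lemma tail_small_uminus: "tail_small T \<Longrightarrow> tail_small (\<lambda>x. - T x)"
  using tail_small_scaleC[of T "-1"] by (simp add: scaleC_distribs)

lemma tail_small_diff: "tail_small S \<Longrightarrow> tail_small T \<Longrightarrow> tail_small (\<lambda>x. S x - T x)"
  using tail_small_add[OF _ tail_small_uminus, of S T] by simp

lemma tail_small_0 [simp]: "tail_small (\<lambda>x. 0)"
  by (rule tail_smallI) simp

lemma norm_le_sum_coords: "norm x \<le> (\<Sum>i<M. cmod (ell2_nth x i)) + norm (tailp M x)"
proof -
  have "norm x = norm ((\<Sum>i<M. scaleC (ell2_nth x i) (ebasis i)) + tailp M x)" using head_tail[of x M] by simp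
  also have "\<dots> \<le> norm (\<Sum>i<M. scaleC (ell2_nth x i) (ebasis i)) + norm (tailp M x)" by (rule norm_triangle_ineq)
  also have "norm (\<Sum>i<M. scaleC (ell2_nth x i) (ebasis i)) \<le> (\<Sum>i<M. cmod (ell2_nth x i))"
    by (rule order_trans[OF norm_sum]) simp
  finally show ?thesis by simp
qed

text \<open>Tails are asymptotically weakly null, so bounded operators almost map tails to tails.\<close>

lemma head_small:
  assumes C: "C \<in> bounded_ops" and d: "0 < \<delta>"
  shows "\<exists>N. \<forall>N'\<ge>N. \<forall>v. (\<Sum>i<M. cmod (ell2_nth (C (tailp N' v)) i)) \<le> \<delta> * norm v"
proof -
  \<comment> \<open>The tolerance is shared among the \<open>M\<close> coordinates; the summand
    \<open>1\<close> avoids division by zero.\<close>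
  define \<delta>' where "\<delta>' = \<delta> / (real M + 1)"
  have d': "0 < \<delta>'" using d by (simp add: \<delta>'_def)
  have "\<exists>N. \<forall>N'\<ge>N. norm (tailp N' (op_adjoint C (ebasis i))) < \<delta>'" for i
    using LIMSEQ_D[OF norm_tailp_tendsto d', of "op_adjoint C (ebasis i)"] by simp
  then obtain f where f: "\<And>i N'. f i \<le> N' \<Longrightarrow> norm (tailp N' (op_adjoint C (ebasis i))) < \<delta>'" by metis
  define N where "N = (\<Sum>i<M. f i)"
  have "(\<Sum>i<M. cmod (ell2_nth (C (tailp N' v)) i)) \<le> \<delta> * norm v" if N': "N \<le> N'" for N' v
  proof -
    have "cmod (ell2_nth (C (tailp N' v)) i) \<le> \<delta>' * norm v" if i: "i < M" for i
    proof -
      have "f i \<le> N" unfolding N_def using i by (intro member_le_sum) auto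
      hence le: "norm (tailp N' (op_adjoint C (ebasis i))) \<le> \<delta>'" using f[of i N'] N' by simp
      have "ell2_nth (C (tailp N' v)) i = cinner (tailp N' (op_adjoint C (ebasis i))) v"
        by (simp add: cinner_tailp cinner_op_adjoint[OF C])
      hence "cmod (ell2_nth (C (tailp N' v)) i) \<le> norm (tailp N' (op_adjoint C (ebasis i))) * norm v"
        by (metis cmod_cinner_le)
      also have "\<dots> \<le> \<delta>' * norm v" by (intro mult_right_mono le) simp
      finally show ?thesis .
    qed
    hence "(\<Sum>i<M. cmod (ell2_nth (C (tailp N' v)) i)) \<le> (\<Sum>i<M. \<delta>' * norm v)" by (intro sum_mono) simp
    also have "\<dots> = (real M * \<delta>') * norm v" by simp
    also have "\<dots> \<le> \<delta> * norm v" using d by (intro mult_right_mono) (auto simp: \<delta>'_def field_simps)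
    finally show ?thesis .
  qed
  thus ?thesis by blast
qed

text \<open>Duality turns smallness of \<open>T\<close> on tails into smallness of the tails of the
  range of the adjoint; the finitely many remaining coordinates are small on far tails by
  \<open>head_small\<close>.\<close>

lemma tail_small_adjoint:
  assumes T: "T \<in> bounded_ops" and ts: "tail_small T" shows "tail_small (op_adjoint T)"
proof (rule tail_smallI)
  fix e :: real assume e: "0 < e"
  obtain M where M: "\<And>M' v. M \<le> M' \<Longrightarrow> norm (T (tailp M' v)) \<le> (e/2) * norm v"
    using tail_smallD[OF ts, of "e/2"] e by auto
  let ?A = "op_adjoint T"
  have r: "norm (tailp M (?A v)) \<le> (e/2) * norm v" for v
  proof -
    let ?w = "tailp M (?A v)"
    have "(norm ?w)\<^sup>2 = cmod (cinner ?w ?w)" by (simp only: cinner_self norm_of_real abs_of_nonneg zero_le_power2)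
    also have "cinner ?w ?w = cinner v (T ?w)" by (simp add: cinner_tailp cinner_op_adjoint[OF T])
    also have "cmod \<dots> \<le> norm v * norm (T ?w)" by (rule cmod_cinner_le)
    also have "\<dots> \<le> norm v * ((e/2) * norm ?w)" using M[of M ?w] by (intro mult_left_mono) simp_all
    finally have le: "norm ?w * norm ?w \<le> ((e/2) * norm v) * norm ?w"
      by (simp only: power2_eq_square mult_ac)
    show ?thesis
    proof (cases "norm ?w = 0")
      case False
      hence "0 < norm ?w" by simp
      from mult_right_le_imp_le[OF le this] show ?thesis .
    qed (use e in simp)
  qed
  have Ab: "?A \<in> bounded_ops" using T by simp
  obtain N where N: "\<forall>N'\<ge>N. \<forall>v. (\<Sum>i<M. cmod (ell2_nth (?A (tailp N' v)) i)) \<le> (e/2) * norm v"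
    using head_small[OF Ab, of "e/2" M] e by auto
  have "norm (?A (tailp N v)) \<le> e * norm v" for v
  proof -
    have "norm (tailp M (?A (tailp N v))) \<le> (e/2) * norm v"
      using r[of "tailp N v"] mult_left_mono[OF norm_tailp_le[of N v], of "e/2"] e by linarith
    moreover have "(\<Sum>i<M. cmod (ell2_nth (?A (tailp N v)) i)) \<le> (e/2) * norm v" using N by blast
    ultimately show ?thesis using norm_le_sum_coords[of "?A (tailp N v)" M] by simp
  qed
  thus "\<exists>N. \<forall>v. norm (?A (tailp N v)) \<le> e * norm v" by blast
qed

text \<open>The adjoint turns a right factor into a left factor, for which the estimate is
  immediate.\<close>

lemma tail_small_comp_right:
  assumes S: "S \<in> bounded_ops" and T: "T \<in> bounded_ops" "tail_small T" shows "tail_small (\<lambda>x. T (S x))"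
proof -
  have "tail_small (\<lambda>x. op_adjoint S (op_adjoint T x))"
    by (rule tail_small_comp_left[OF op_adjoint_bounded[OF S] tail_small_adjoint[OF T]])
  hence "tail_small (op_adjoint (op_adjoint S \<circ> op_adjoint T))"
    by (intro tail_small_adjoint bounded_ops_comp op_adjoint_bounded S T) (simp add: comp_def)
  moreover have "op_adjoint (op_adjoint S \<circ> op_adjoint T) = T \<circ> S"
    using S T by (simp add: op_adjoint_comp)
  ultimately show ?thesis by (simp add: comp_def)
qed

lemma tail_small_limit:
  assumes \<sigma>: "\<And>n. \<sigma> n \<in> bounded_ops" "\<And>n. tail_small (\<sigma> n)" and L: "L \<in> bounded_ops"
    and lim: "(\<lambda>n. onorm (\<lambda>x. \<sigma> n x - L x)) \<longlonglongrightarrow> 0"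
  shows "tail_small L"
proof (rule tail_smallI)
  fix e :: real assume e: "0 < e"
  obtain n where "norm (onorm (\<lambda>x. \<sigma> n x - L x) - 0) < e/2" using LIMSEQ_D[OF lim, of "e/2"] e by auto
  hence n: "onorm (\<lambda>x. \<sigma> n x - L x) \<le> e/2" by simp
  obtain N where N: "\<And>M v. N \<le> M \<Longrightarrow> norm (\<sigma> n (tailp M v)) \<le> (e/2) * norm v"
    using tail_smallD[OF \<sigma>(2)[of n], of "e/2"] e by auto
  have "norm (L (tailp N v)) \<le> e * norm v" for v
  proof -
    let ?w = "tailp N v"
    have "norm (\<sigma> n ?w - L ?w) \<le> onorm (\<lambda>x. \<sigma> n x - L x) * norm ?w"
      by (rule norm_op_le[OF bounded_ops_diff[OF \<sigma>(1) L]])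
    also have "\<dots> \<le> (e/2) * norm v" using e by (intro mult_mono n norm_tailp_le) auto
    finally show ?thesis using N[of N v] norm_triangle_sub[of "L ?w" "\<sigma> n ?w"] by (simp add: norm_minus_commute)
  qed
  thus "\<exists>N. \<forall>v. norm (L (tailp N v)) \<le> e * norm v" by blast
qed

text \<open>Covers the image under an operator of the first \<open>N\<close> coordinates of the unit
  ball, and the box around a finite-dimensional unit sphere.\<close>

lemma compact_box:
  fixes N :: nat
  shows "compact {\<Sum>i<N. scaleC (c i) (w i) | c. \<forall>i. cmod (c i) \<le> 1}"
proof (induction N)
  case 0
  have "{\<Sum>i<0. scaleC (c i) (w i) | c. \<forall>i. cmod (c i) \<le> 1} = {0}" by (auto intro: exI[of _ "\<lambda>_. 0"])
  thus ?case by simp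
next
  case (Suc N)
  have "continuous_on (cball 0 1) (\<lambda>z. scaleC z (w N))"
  proof -
    have "bounded_linear (\<lambda>z. scaleC z (w N))"
      by (rule bounded_linear_intro[of _ "norm (w N)"]) (auto simp: scaleC_distribs scaleR_scaleC scaleR_conv_of_real)
    thus ?thesis by (rule linear_continuous_on)
  qed
  hence "compact ((\<lambda>z. scaleC z (w N)) ` cball 0 1)" by (intro compact_continuous_image) auto
  from compact_sums'[OF Suc this]
  have "compact {x + y |x y. x \<in> {\<Sum>i<N. scaleC (c i) (w i) | c. \<forall>i. cmod (c i) \<le> 1} \<and> y \<in> (\<lambda>z. scaleC z (w N)) ` cball 0 1}"
    by (rule back_subst) blast
  also have "{x + y |x y. x \<in> {\<Sum>i<N. scaleC (c i) (w i) | c. \<forall>i. cmod (c i) \<le> 1} \<and> y \<in> (\<lambda>z. scaleC z (w N)) ` cball 0 1}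
      = {\<Sum>i<Suc N. scaleC (c i) (w i) | c. \<forall>i. cmod (c i) \<le> 1}" (is "?L = ?R")
  proof (intro equalityI subsetI)
    fix x assume "x \<in> ?L"
    then obtain c z where c: "\<forall>i. cmod (c i) \<le> 1" "cmod z \<le> 1" "x = (\<Sum>i<N. scaleC (c i) (w i)) + scaleC z (w N)" by auto
    have "x = (\<Sum>i<Suc N. scaleC ((c(N := z)) i) (w i))" using c(3) by simp
    moreover have "\<forall>i. cmod ((c(N := z)) i) \<le> 1" using c by simp
    ultimately show "x \<in> ?R" by blast
  next
    fix x assume "x \<in> ?R"
    then obtain c where "\<forall>i. cmod (c i) \<le> 1" "x = (\<Sum>i<N. scaleC (c i) (w i)) + scaleC (c N) (w N)" by auto
    moreover from this have "(\<Sum>i<N. scaleC (c i) (w i)) \<in> {\<Sum>i<N. scaleC (c i) (w i) | c. \<forall>i. cmod (c i) \<le> 1}" by blast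
    moreover have "scaleC (c N) (w N) \<in> (\<lambda>z. scaleC z (w N)) ` cball 0 1" using calculation by simp
    ultimately show "x \<in> ?L" by blast
  qed
  finally show ?case .
qed

text \<open>The head of a unit-ball vector is mapped into a compact box and the tail into a small
  ball, so the image is totally bounded.\<close>

lemma tail_small_imp_compact:
  assumes T: "T \<in> bounded_ops" and ts: "tail_small T"
  shows "compact (closure (T ` cball 0 1))"
  unfolding compact_eq_totally_bounded
proof (intro conjI allI impI)
  show "complete (closure (T ` cball 0 1))" by (simp add: complete_eq_closed)
  fix e :: real assume e: "0 < e"
  \<comment> \<open>A quarter of \<open>e\<close> goes to the tail and a quarter to the net; the
    resulting closed balls of radius \<open>e/2\<close> have a closed union, which therefore also
    covers the closure.\<close>
  obtain N where N: "\<And>M v. N \<le> M \<Longrightarrow> norm (T (tailp M v)) \<le> (e/4) * norm v"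
    using tail_smallD[OF ts, of "e/4"] e by auto
  let ?C = "{\<Sum>i<N. scaleC (c i) (T (ebasis i)) | c. \<forall>i. cmod (c i) \<le> 1}"
  obtain k where k: "finite k" "?C \<subseteq> (\<Union>x\<in>k. ball x (e/4))"
    using compact_box[where N = N and w = "\<lambda>i. T (ebasis i)"] e unfolding compact_eq_totally_bounded by (meson zero_less_divide_iff zero_less_numeral)
  have "T v \<in> (\<Union>x\<in>k. cball x (e/2))" if v: "norm v \<le> 1" for v
  proof -
    let ?h = "\<Sum>i<N. scaleC (ell2_nth v i) (T (ebasis i))"
    define c where "c = (\<lambda>i. ell2_nth v i)"
    have "\<forall>i. cmod (c i) \<le> 1" using order_trans[OF cmod_ell2_nth_le v] by (simp add: c_def)
    hence "?h \<in> ?C" unfolding c_def[symmetric] using c_def by blast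
    then obtain x where x: "x \<in> k" "dist x ?h < e/4" using k(2) by auto
    have "T v = T ((\<Sum>i<N. scaleC (ell2_nth v i) (ebasis i)) + tailp N v)" using head_tail[of v N] by simp
    also have "\<dots> = ?h + T (tailp N v)" by (simp only: bounded_ops_lin[OF T] bounded_ops_sum[OF T])
    finally have "dist ?h (T v) = norm (T (tailp N v))" by (simp add: dist_norm norm_minus_commute)
    also have "\<dots> \<le> e/4" using order_trans[OF N[of N v] mult_left_mono[OF v, of "e/4"]] e by simp
    finally have "dist x (T v) \<le> e/2" using x(2) dist_triangle[of x "T v" ?h] by simp
    thus ?thesis using x(1) by auto
  qed
  hence "T ` cball 0 1 \<subseteq> (\<Union>x\<in>k. cball x (e/2))" by auto
  moreover have "closed (\<Union>x\<in>k. cball x (e/2))" by (intro closed_UN k) simp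
  ultimately have "closure (T ` cball 0 1) \<subseteq> (\<Union>x\<in>k. cball x (e/2))" by (rule closure_minimal)
  also have "\<dots> \<subseteq> (\<Union>x\<in>k. ball x e)" using e by (intro UN_mono) auto
  finally show "\<exists>k. finite k \<and> closure (T ` cball 0 1) \<subseteq> (\<Union>x\<in>k. ball x e)" using k(1) by blast
qed

text \<open>Otherwise there are vectors in the unit ball, supported on ever later tails, with images
  bounded away from zero. They converge weakly to zero, so a norm limit of their images is
  orthogonal to itself and vanishes.\<close>

lemma compact_imp_tail_small:
  assumes T: "T \<in> bounded_ops" and comp: "compact (closure (T ` cball 0 1))"
  shows "tail_small T"
proof (rule ccontr)
  assume "\<not> tail_small T"
  then obtain e where e: "0 < e" "\<And>N. \<exists>v. \<not> norm (T (tailp N v)) \<le> e * norm v"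
    unfolding tail_small_def by blast
  have "\<exists>w. norm w \<le> 1 \<and> tailp N w = w \<and> e \<le> norm (T w)" for N
  proof -
    obtain v where v: "e * norm v < norm (T (tailp N v))" using e(2)[of N] unfolding not_le by blast
    let ?u = "tailp N v"
    have u: "e * norm ?u < norm (T ?u)" using v mult_left_mono[OF norm_tailp_le[of N v], of e] e(1) by linarith
    hence "?u \<noteq> 0" using bounded_ops_lin(3)[OF T] by auto
    hence n: "0 < norm ?u" by simp
    define w where "w = (1 / norm ?u) *\<^sub>R ?u"
    have "norm w \<le> 1" using n by (simp add: w_def)
    moreover have "tailp N w = w" by (simp add: w_def scaleR_scaleC)
    moreover have "e \<le> norm (T w)" using u n by (simp add: w_def bounded_ops_lin[OF T] field_simps)
    ultimately show ?thesis by blast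
  qed
  then obtain w where w: "\<And>N. norm (w N) \<le> 1" "\<And>N. tailp N (w N) = w N" "\<And>N. e \<le> norm (T (w N))" by metis
  have "T (w n) \<in> closure (T ` cball 0 1)" for n
    by (rule subsetD[OF closure_subset imageI]) (simp add: w(1))
  hence "\<forall>n. (\<lambda>n. T (w n)) n \<in> closure (T ` cball 0 1)" by simp
  from seq_compactE[OF compact_imp_seq_compact[OF comp] this]
  obtain z r where r: "strict_mono (r :: nat \<Rightarrow> nat)" "((\<lambda>n. T (w n)) \<circ> r) \<longlonglongrightarrow> z" by blast
  have "(\<lambda>n. cinner (T (w (r n))) z) \<longlonglongrightarrow> 0"
  proof (rule Lim_null_comparison)
    show "\<forall>\<^sub>F n in sequentially. norm (cinner (T (w (r n))) z) \<le> norm (tailp (r n) (op_adjoint T z))"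
    proof (rule always_eventually, rule allI)
      fix n
      have "cinner (T (w (r n))) z = cinner (w (r n)) (op_adjoint T z)" by (simp add: cinner_op_adjoint'[OF T])
      also have "\<dots> = cinner (tailp (r n) (w (r n))) (op_adjoint T z)" by (simp only: w(2))
      also have "\<dots> = cinner (w (r n)) (tailp (r n) (op_adjoint T z))" by (rule cinner_tailp)
      finally have "norm (cinner (T (w (r n))) z) \<le> norm (w (r n)) * norm (tailp (r n) (op_adjoint T z))"
        by (metis cmod_cinner_le)
      also have "\<dots> \<le> 1 * norm (tailp (r n) (op_adjoint T z))" by (intro mult_right_mono w) simp
      finally show "norm (cinner (T (w (r n))) z) \<le> norm (tailp (r n) (op_adjoint T z))" by simp
    qed
    show "(\<lambda>n. norm (tailp (r n) (op_adjoint T z))) \<longlonglongrightarrow> 0"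
      using LIMSEQ_subseq_LIMSEQ[OF norm_tailp_tendsto r(1)] by (simp add: comp_def)
  qed
  moreover have "(\<lambda>n. cinner (T (w (r n))) z) \<longlonglongrightarrow> cinner z z"
    using r(2) by (intro tendsto_cinner tendsto_const) (simp add: comp_def)
  ultimately have "cinner z z = 0" using LIMSEQ_unique by blast
  hence "z = 0" by (simp add: cinner_self)
  hence "(\<lambda>n. norm (T (w (r n)))) \<longlonglongrightarrow> 0" using tendsto_norm[OF r(2)] by (simp add: comp_def)
  hence "e \<le> 0" by (rule LIMSEQ_le_const) (use w(3) in blast)
  thus False using e(1) by simp
qed

lemma compact_ops_iff: "T \<in> compact_ops \<longleftrightarrow> T \<in> bounded_ops \<and> tail_small T"
  unfolding compact_ops_def using tail_small_imp_compact compact_imp_tail_small by blast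

section \<open>Positivity modulo the compact operators\<close>

definition ess_pos :: "(ell2 \<Rightarrow> ell2) \<Rightarrow> bool" where
  "ess_pos T \<longleftrightarrow> (\<forall>\<epsilon>>0. \<exists>N. \<forall>N'\<ge>N. \<forall>v. - (\<epsilon> * (norm v)\<^sup>2) \<le> Re (cinner (tailp N' v) (T (tailp N' v))))"

text \<open>Far tails are mapped by \<open>C\<close> almost into the \<open>M\<close>-th tail, where
  the form of \<open>T\<close> is nearly nonnegative; the remaining head \<open>h\<close> only
  enters through two terms proportional to its norm.\<close>

lemma ess_pos_conj:
  assumes T: "T \<in> bounded_ops" "ess_pos T" and C: "C \<in> bounded_ops" and e: "0 < \<epsilon>"
  shows "\<exists>N. \<forall>v. - (\<epsilon> * (norm v)\<^sup>2) \<le> Re (cinner (C (tailp N v)) (T (C (tailp N v))))"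
proof -
  define c where "c = onorm C + 1" 
  define t where "t = onorm T + 1"
  have c: "0 < c" "\<And>x. norm (C x) \<le> c * norm x" 
    using onorm_op_nonneg[OF C] order_trans[OF norm_op_le[OF C] mult_right_mono[of "onorm C" c, OF _ norm_ge_zero]]
    by (simp_all add: c_def)
  have t: "0 < t" "\<And>x. norm (T x) \<le> t * norm x" 
    using onorm_op_nonneg[OF T(1)] order_trans[OF norm_op_le[OF T(1)] mult_right_mono[of "onorm T" t, OF _ norm_ge_zero]]
    by (simp_all add: t_def)
  \<comment> \<open>With \<open>c\<close> bounding \<open>C\<close>, the tail part costs
    \<open>\<epsilon>/2\<close>; below, \<open>\<delta>\<close> is chosen so that each of the two
    terms with the head costs \<open>\<epsilon>/4\<close>.\<close>
  define \<epsilon>' where "\<epsilon>' = \<epsilon> / (2 * c\<^sup>2)"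
  have "0 < \<epsilon>'" using e c by (simp add: \<epsilon>'_def)
  then obtain M where M: "\<forall>v. - (\<epsilon>' * (norm v)\<^sup>2) \<le> Re (cinner (tailp M v) (T (tailp M v)))"
    using T(2) unfolding ess_pos_def by blast
  define \<delta> where "\<delta> = \<epsilon> / (4 * t * c)"
  have d: "0 < \<delta>" using e c t by (simp add: \<delta>_def)
  obtain N where N: "\<And>v. (\<Sum>i<M. cmod (ell2_nth (C (tailp N v)) i)) \<le> \<delta> * norm v"
    using head_small[OF C d, of M] by blast
  have "- (\<epsilon> * (norm v)\<^sup>2) \<le> Re (cinner (C (tailp N v)) (T (C (tailp N v))))" for v
  proof -
    define x where "x = C (tailp N v)"
    define h where "h = (\<Sum>i<M. scaleC (ell2_nth x i) (ebasis i))"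
    define y where "y = tailp M x"
    have x: "x = h + y" unfolding h_def y_def by (rule head_tail)
    have nx: "norm x \<le> c * norm v"
      using c(2)[of "tailp N v"] mult_left_mono[OF norm_tailp_le[of N v], of c] c(1) unfolding x_def by linarith
    have ny: "norm y \<le> c * norm v" using norm_tailp_le[of M x] nx unfolding y_def by linarith
    have nh: "norm h \<le> \<delta> * norm v"
    proof -
      have "norm h \<le> (\<Sum>i<M. cmod (ell2_nth x i))" unfolding h_def by (rule order_trans[OF norm_sum]) simp
      thus ?thesis using N[of v] unfolding x_def by linarith
    qed
    have "- (\<epsilon>' * (norm x)\<^sup>2) \<le> Re (cinner y (T y))" using M[rule_format, of x] unfolding y_def by simp
    moreover have "\<epsilon>' * (norm x)\<^sup>2 \<le> \<epsilon>' * (c * norm v)\<^sup>2"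
      using \<open>0 < \<epsilon>'\<close> nx by (intro mult_left_mono power_mono) auto
    moreover have "\<epsilon>' * (c * norm v)\<^sup>2 = (\<epsilon>/2) * (norm v)\<^sup>2"
      using c(1) by (simp add: \<epsilon>'_def power_mult_distrib)
    ultimately have 1: "- ((\<epsilon>/2) * (norm v)\<^sup>2) \<le> Re (cinner y (T y))" by linarith
    have cross: "cmod (cinner a (T b)) \<le> t * (norm a * norm b)" for a b
    proof -
      have "cmod (cinner a (T b)) \<le> norm a * norm (T b)" by (rule cmod_cinner_le)
      also have "\<dots> \<le> norm a * (t * norm b)" by (intro mult_left_mono t) simp
      finally show ?thesis by (simp add: mult_ac)
    qed
    have hle: "norm h * norm x \<le> (\<delta> * norm v) * (c * norm v)" by (intro mult_mono nh nx) (use d in auto)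
    have 2: "cmod (cinner h (T x)) \<le> (\<epsilon>/4) * (norm v)\<^sup>2"
    proof -
      have "cmod (cinner h (T x)) \<le> t * (norm h * norm x)" by (rule cross)
      also have "\<dots> \<le> t * ((\<delta> * norm v) * (c * norm v))"
        using hle by (intro mult_left_mono) (use t in \<open>simp_all add: mult_ac\<close>)
      also have "\<dots> = (\<epsilon>/4) * (norm v)\<^sup>2" using t(1) c(1) by (simp add: \<delta>_def power2_eq_square)
      finally show ?thesis .
    qed
    have yle: "norm y * norm h \<le> (c * norm v) * (\<delta> * norm v)" by (intro mult_mono nh ny) (use c in auto)
    have 3: "cmod (cinner y (T h)) \<le> (\<epsilon>/4) * (norm v)\<^sup>2"
    proof -
      have "cmod (cinner y (T h)) \<le> t * (norm y * norm h)" by (rule cross)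
      also have "\<dots> \<le> t * ((\<delta> * norm v) * (c * norm v))"
        using yle by (intro mult_left_mono) (use t in \<open>simp_all add: mult_ac\<close>)
      also have "\<dots> = (\<epsilon>/4) * (norm v)\<^sup>2" using t(1) c(1) by (simp add: \<delta>_def power2_eq_square)
      finally show ?thesis .
    qed
    have "cinner x (T x) = cinner h (T x) + cinner y (T h) + cinner y (T y)"
    proof -
      have "cinner (h + y) (T (h + y)) = cinner h (T (h + y)) + cinner y (T h) + cinner y (T y)"
        by (simp add: bounded_ops_lin[OF T(1)])
      thus ?thesis by (simp only: x[symmetric])
    qed
    hence "Re (cinner x (T x)) = Re (cinner h (T x)) + Re (cinner y (T h)) + Re (cinner y (T y))" by simp
    thus ?thesis using 1 2 3 abs_Re_le_cmod[of "cinner h (T x)"] abs_Re_le_cmod[of "cinner y (T h)"]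
      unfolding x_def[symmetric] by linarith
  qed
  thus ?thesis by blast
qed

text \<open>With \<open>R = |T|\<close> and \<open>B = R - T\<close> one has \<open>B\<^sup>2 = 2RB\<close> and \<open>BTB = -BRB\<close>, so essential positivity of
  \<open>T\<close> forces \<open>RB\<close>, hence \<open>B\<close>, to be compact.\<close>

lemma ess_pos_decomp:
  assumes T: "T \<in> bounded_ops" "op_adjoint T = T" "ess_pos T"
  obtains R where "pos_op R" "tail_small (\<lambda>x. R x - T x)"
    "\<And>D. cstar_subalgebra B_alg D \<Longrightarrow> T \<in> D \<Longrightarrow> R \<in> D"
proof -
  have sa: "cinner (T x) y = cinner x (T y)" for x y by (rule selfadjoint_cinner[OF T(1,2)])
  have "pos_op (T \<circ> T)" unfolding pos_op_def
  proof (intro conjI allI)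
    show "T \<circ> T \<in> bounded_ops" using T(1) by (rule bounded_ops_comp[OF _ T(1)])
    show "op_adjoint (T \<circ> T) = T \<circ> T" by (simp add: op_adjoint_comp T(1,2))
    fix v show "0 \<le> Re (cinner v ((T \<circ> T) v))" by (simp add: sa[symmetric] cinner_self del: of_real_power)
  qed
  then obtain R where R: "pos_op R" "\<And>x. R (R x) = (T \<circ> T) x"
    and RD: "\<And>D. cstar_subalgebra B_alg D \<Longrightarrow> T \<circ> T \<in> D \<Longrightarrow> R \<in> D"
    using pos_op_sqrt by blast
  \<comment> \<open>The square root belongs to the commutant of \<open>T\<close>, a C*-subalgebra
    containing \<open>T \<circ> T\<close>.\<close>
  have "R \<in> {X \<in> bounded_ops. \<forall>x. X (T x) = T (X x)}"
    by (rule RD[OF commutant_cstar_subalgebra[OF T(1,2)]]) (simp add: bounded_ops_comp[OF T(1) T(1)])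
  hence RT: "R (T x) = T (R x)" for x by blast
  note Rb = pos_opD(1)[OF R(1)]
  have Rsa: "cinner (R x) y = cinner x (R y)" for x y by (rule selfadjoint_cinner[OF pos_opD(1,2)[OF R(1)]])
  define B where "B = (\<lambda>x. R x - T x)"
  have Bb: "B \<in> bounded_ops" unfolding B_def by (intro bounded_ops_diff Rb T)
  have Bsa: "cinner (B x) y = cinner x (B y)" for x y by (simp add: B_def sa Rsa)
  have BB: "B (B x) = R (B x) + R (B x)" for x
    using R(2)[of x] by (simp add: B_def bounded_ops_lin[OF Rb] bounded_ops_lin[OF T(1)] RT algebra_simps)
  have TB: "T (B x) = - R (B x)" for x
    using R(2)[of x] by (simp add: B_def bounded_ops_lin[OF Rb] bounded_ops_lin[OF T(1)] RT algebra_simps)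
  have "tail_small B"
  proof (rule tail_smallI)
    fix \<eta> :: real assume \<eta>: "0 < \<eta>"
    define r where "r = onorm R + 1"
    have r: "0 < r" "onorm R \<le> r" using onorm_op_nonneg[OF Rb] by (auto simp: r_def)
    \<comment> \<open>Chosen so that \<open>r * e\<close> is the square of
      \<open>\<eta>\<^sup>2 / 2\<close>: on the tail, \<open>R B\<close> is then bounded by
      \<open>\<eta>\<^sup>2 / 2\<close>, \<open>B B = 2 R B\<close> by
      \<open>\<eta>\<^sup>2\<close>, and \<open>B\<close> itself by \<open>\<eta>\<close>.\<close>
    define e where "e = \<eta>^4 / (4 * r)"
    have e: "0 < e" using \<eta> r by (simp add: e_def)
    obtain N where N: "\<forall>v. - (e * (norm v)\<^sup>2) \<le> Re (cinner (B (tailp N v)) (T (B (tailp N v))))"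
      using ess_pos_conj[OF T(1,3) Bb e] by blast
    have "norm (B (tailp N v)) \<le> \<eta> * norm v" for v
    proof -
      let ?w = "tailp N v"
      have q: "Re (cinner (B ?w) (R (B ?w))) \<le> e * (norm v)\<^sup>2" using N[rule_format, of v] by (simp add: TB)
      have "(norm (R (B ?w)))\<^sup>2 \<le> onorm R * Re (cinner (B ?w) (R (B ?w)))" by (rule pos_op_norm_le[OF R(1)])
      also have "\<dots> \<le> r * (e * (norm v)\<^sup>2)" by (intro mult_mono r q pos_opD(3)[OF R(1)]) (use r in auto)
      also have "\<dots> = (\<eta>\<^sup>2 / 2 * norm v)\<^sup>2" using r by (simp add: e_def power_mult_distrib power_divide)
      finally have RB: "norm (R (B ?w)) \<le> \<eta>\<^sup>2 / 2 * norm v" by (rule power2_le_imp_le) simp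
      have "(norm (B ?w))\<^sup>2 = cmod (cinner (B ?w) (B ?w))" by (simp only: cinner_self norm_of_real abs_of_nonneg zero_le_power2)
      also have "\<dots> = cmod (cinner ?w (B (B ?w)))" by (simp only: Bsa)
      also have "\<dots> \<le> norm ?w * norm (B (B ?w))" by (rule cmod_cinner_le)
      also have "\<dots> \<le> norm v * (\<eta>\<^sup>2 * norm v)"
      proof (intro mult_mono norm_tailp_le)
        show "norm (B (B ?w)) \<le> \<eta>\<^sup>2 * norm v"
          unfolding BB using norm_triangle_ineq[of "R (B ?w)" "R (B ?w)"] RB by simp
      qed auto
      also have "\<dots> = (\<eta> * norm v)\<^sup>2" by (simp add: power2_eq_square)
      finally show ?thesis by (rule power2_le_imp_le) (use \<eta> in simp)
    qed
    thus "\<exists>N. \<forall>v. norm (B (tailp N v)) \<le> \<eta> * norm v" by blast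
  qed
  moreover have "R \<in> D" if "cstar_subalgebra B_alg D" "T \<in> D" for D
    by (rule RD[OF that(1) cstar_subalgebra_B_algD(5)[OF that(1) that(2) that(2)]])
  ultimately show ?thesis using that[OF R(1)] unfolding B_def by blast
qed

text \<open>The imaginary part is controlled as well, because the operators obtained from the
  \<open>x l\<close> need not be self-adjoint.\<close>

definition ess_nonneg :: "(ell2 \<Rightarrow> ell2) \<Rightarrow> bool" where
  "ess_nonneg T \<longleftrightarrow> (\<forall>\<epsilon>>0. \<exists>N. \<forall>N'\<ge>N. \<forall>v. - (\<epsilon> * (norm v)\<^sup>2) \<le> Re (cinner (tailp N' v) (T (tailp N' v)))
     \<and> \<bar>Im (cinner (tailp N' v) (T (tailp N' v)))\<bar> \<le> \<epsilon> * (norm v)\<^sup>2)"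

text \<open>Modulo a compact operator \<open>T\<close> is a positive \<open>R\<close>; the form of
  \<open>R\<close> is then also small on tails, and \<open>pos_op_norm_le\<close> converts this into
  a small norm.\<close>

lemma tail_small_if_quadratic_small:
  assumes T: "T \<in> bounded_ops" "op_adjoint T = T" "ess_pos T" "ess_pos (\<lambda>x. - T x)"
  shows "tail_small T"
proof -
  obtain R where R: "pos_op R" "tail_small (\<lambda>x. R x - T x)"
    by (rule ess_pos_decomp[OF T(1-3)])
  note Rb = pos_opD(1)[OF R(1)]
  have "tail_small R"
  proof (rule tail_smallI)
    fix \<eta> :: real assume \<eta>: "0 < \<eta>"
    define r where "r = onorm R + 1"
    have r: "0 < r" "onorm R \<le> r" using onorm_op_nonneg[OF Rb] by (auto simp: r_def)
    \<comment> \<open>The form of \<open>R\<close> is at most \<open>2 * e\<close> on the tail, one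
      \<open>e\<close> from \<open>T\<close> and one from the compact difference, and
      \<open>r * (2 * e) = \<eta>\<^sup>2\<close>.\<close>
    define e where "e = \<eta>\<^sup>2 / (2 * r)"
    have e: "0 < e" using \<eta> r by (simp add: e_def)
    obtain N1 where N1: "\<And>N' v. N1 \<le> N' \<Longrightarrow> - (e * (norm v)\<^sup>2) \<le> Re (cinner (tailp N' v) (- T (tailp N' v)))"
      using T(4)[unfolded ess_pos_def, rule_format, OF e] by blast
    obtain N2 where N2: "\<And>M v. N2 \<le> M \<Longrightarrow> norm (R (tailp M v) - T (tailp M v)) \<le> e * norm v"
      by (rule tail_smallD[OF R(2) e]) (rule that)
    define N where "N = max N1 N2"
    have "norm (R (tailp N v)) \<le> \<eta> * norm v" for v
    proof -
      let ?w = "tailp N v"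
      have "Re (cinner ?w (R ?w - T ?w)) \<le> norm ?w * norm (R ?w - T ?w)"
        using cmod_cinner_le[of ?w "R ?w - T ?w"] complex_Re_le_cmod order_trans by blast
      also have "\<dots> \<le> norm v * (e * norm v)" by (intro mult_mono norm_tailp_le N2) (auto simp: N_def)
      also have "\<dots> = e * (norm v)\<^sup>2" by (simp add: power2_eq_square)
      finally have "Re (cinner ?w (R ?w)) \<le> Re (cinner ?w (T ?w)) + e * (norm v)\<^sup>2" by simp
      moreover have "Re (cinner ?w (T ?w)) \<le> e * (norm v)\<^sup>2" using N1[of N v] by (simp add: N_def)
      ultimately have q: "Re (cinner ?w (R ?w)) \<le> 2 * e * (norm v)\<^sup>2" by simp
      have "(norm (R ?w))\<^sup>2 \<le> onorm R * Re (cinner ?w (R ?w))" by (rule pos_op_norm_le[OF R(1)])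
      also have "\<dots> \<le> r * (2 * e * (norm v)\<^sup>2)" by (intro mult_mono r q pos_opD(3)[OF R(1)]) (use r in auto)
      also have "\<dots> = (\<eta> * norm v)\<^sup>2" using r by (simp add: e_def power_mult_distrib)
      finally show ?thesis by (rule power2_le_imp_le) (use \<eta> in simp)
    qed
    thus "\<exists>N. \<forall>v. norm (R (tailp N v)) \<le> \<eta> * norm v" by blast
  qed
  from tail_small_diff[OF this R(2)] show ?thesis by simp
qed

text \<open>Cartesian decomposition \<open>T = H + \<i> K\<close>: the form of \<open>H\<close> is
  essentially nonnegative and that of \<open>K\<close> essentially zero, so \<open>K\<close> is
  compact and \<open>H\<close> is positive up to a compact operator.\<close>

lemma ess_nonneg_decomp:
  assumes T: "T \<in> bounded_ops" "ess_nonneg T"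
  obtains R where "pos_op R" "tail_small (\<lambda>x. T x - R x)"
proof -
  let ?A = "op_adjoint T"
  have Ab: "?A \<in> bounded_ops" using T by simp
  define H where "H = (\<lambda>x. scaleC (1/2) (T x + ?A x))"
  define K where "K = (\<lambda>x. scaleC (-\<i>/2) (T x - ?A x))"
  have Hb: "H \<in> bounded_ops" unfolding H_def by (intro bounded_ops_scaleC bounded_ops_add T Ab)
  have Kb: "K \<in> bounded_ops" unfolding K_def by (intro bounded_ops_scaleC bounded_ops_diff T Ab)
  have Hs: "op_adjoint H = H"
    by (rule op_adjointI[OF Hb]) (simp add: H_def cinner_op_adjoint[OF T(1)] cinner_op_adjoint'[OF T(1)] add.commute)
  have Ks: "op_adjoint K = K"
    by (rule op_adjointI[OF Kb]) (simp add: K_def cinner_op_adjoint[OF T(1)] cinner_op_adjoint'[OF T(1)] algebra_simps)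
  have cA: "cinner v (?A v) = cnj (cinner v (T v))" for v
    by (simp add: cinner_op_adjoint'[OF T(1)] cnj_cinner)
  have qH: "Re (cinner v (H v)) = Re (cinner v (T v))" for v by (simp add: H_def cA)
  have qK: "Re (cinner v (K v)) = Im (cinner v (T v))" for v by (simp add: K_def cA)
  have eH: "ess_pos H" using T(2) unfolding ess_pos_def ess_nonneg_def qH by blast
  have eK: "ess_pos K" unfolding ess_pos_def qK
  proof (intro allI impI)
    fix e :: real assume "0 < e"
    then obtain N where N: "\<And>N' v. N \<le> N' \<Longrightarrow> \<bar>Im (cinner (tailp N' v) (T (tailp N' v)))\<bar> \<le> e * (norm v)\<^sup>2"
      using T(2) unfolding ess_nonneg_def by blast
    show "\<exists>N. \<forall>N'\<ge>N. \<forall>v. - (e * (norm v)\<^sup>2) \<le> Im (cinner (tailp N' v) (T (tailp N' v)))"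
    proof (intro exI allI impI)
      fix N' v assume "N \<le> N'"
      from N[OF this, of v] show "- (e * (norm v)\<^sup>2) \<le> Im (cinner (tailp N' v) (T (tailp N' v)))" by linarith
    qed
  qed
  have eK': "ess_pos (\<lambda>x. - K x)" unfolding ess_pos_def cinner_minus uminus_complex.sel qK
  proof (intro allI impI)
    fix e :: real assume "0 < e"
    then obtain N where N: "\<And>N' v. N \<le> N' \<Longrightarrow> \<bar>Im (cinner (tailp N' v) (T (tailp N' v)))\<bar> \<le> e * (norm v)\<^sup>2"
      using T(2) unfolding ess_nonneg_def by blast
    show "\<exists>N. \<forall>N'\<ge>N. \<forall>v. - (e * (norm v)\<^sup>2) \<le> - Im (cinner (tailp N' v) (T (tailp N' v)))"
    proof (intro exI allI impI)
      fix N' v assume "N \<le> N'"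
      from N[OF this, of v] show "- (e * (norm v)\<^sup>2) \<le> - Im (cinner (tailp N' v) (T (tailp N' v)))" by linarith
    qed
  qed
  have tK: "tail_small K" by (rule tail_small_if_quadratic_small[OF Kb Ks eK eK'])
  obtain R where R: "pos_op R" "tail_small (\<lambda>x. R x - H x)"
    by (rule ess_pos_decomp[OF Hb Hs eH])
  have eq: "T x - R x = scaleC \<i> (K x) - (R x - H x)" for x
  proof -
    have "H x + scaleC \<i> (K x) = T x" by (rule ell2_eqI) (simp add: H_def K_def field_simps)
    thus ?thesis by (simp add: algebra_simps)
  qed
  have "tail_small (\<lambda>x. T x - R x)" unfolding eq by (rule tail_small_diff[OF tail_small_scaleC[OF tK, of \<i>] R(2)])
  thus ?thesis using that R(1) by blast
qed

section \<open>Matrices over the bounded operators\<close>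

text \<open>Turns sums in a record into ordinary sums by an additive \<open>ev\<close>: evaluation
  of an operator at a vector, of a function at a point, or of a matrix at an index pair.\<close>

lemma (in abelian_monoid) additive_finsum:
  assumes "finite F" "f \<in> F \<rightarrow> carrier G" "ev \<zero> = 0"
    and "\<And>x y. x \<in> carrier G \<Longrightarrow> y \<in> carrier G \<Longrightarrow> ev (x \<oplus> y) = ev x + ev y"
  shows "ev (finsum G f F) = (\<Sum>i\<in>F. ev (f i))"
  using assms(1,2)
proof (induction F rule: finite_induct)
  case (insert a F)
  hence "f \<in> F \<rightarrow> carrier G" "f a \<in> carrier G" by auto
  thus ?case using insert assms(4)[of "f a" "finsum G f F"] by simp
qed (simp add: assms(3))

lemma abelian_monoid_B_sub:
  assumes "cstar_subalgebra B_alg D" shows "abelian_monoid (B_alg\<lparr>carrier := D\<rparr>)"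
proof (rule abelian_monoidI)
  fix S T assume "S \<in> carrier (B_alg\<lparr>carrier := D\<rparr>)" "T \<in> carrier (B_alg\<lparr>carrier := D\<rparr>)"
  thus "S \<oplus>\<^bsub>B_alg\<lparr>carrier := D\<rparr>\<^esub> T \<in> carrier (B_alg\<lparr>carrier := D\<rparr>)"
    using cstar_subalgebra_B_algD(3)[OF assms] by simp
qed (simp_all add: add_ac cstar_subalgebra_B_algD(8)[OF assms])

lemma finsum_B_sub:
  assumes D: "cstar_subalgebra B_alg D" and "finite F" "\<And>i. i \<in> F \<Longrightarrow> f i \<in> D"
  shows "finsum (B_alg\<lparr>carrier := D\<rparr>) f F = (\<lambda>x. \<Sum>i\<in>F. f i x)"
proof
  fix x
  interpret abelian_monoid "B_alg\<lparr>carrier := D\<rparr>" by (rule abelian_monoid_B_sub[OF D])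
  show "finsum (B_alg\<lparr>carrier := D\<rparr>) f F x = (\<Sum>i\<in>F. f i x)"
    by (rule additive_finsum[where ev = "\<lambda>T. T x"]) (use assms in auto)
qed

lemma cstar_subalgebra_bounded_ops: "cstar_subalgebra B_alg bounded_ops"
  by (rule cstar_subalgebra_B_algI) auto

lemma B_alg_update: "B_alg\<lparr>carrier := bounded_ops\<rparr> = B_alg"
  by (simp add: B_alg_def)

lemma finsum_B_alg:
  "finite F \<Longrightarrow> (\<And>i. i \<in> F \<Longrightarrow> f i \<in> bounded_ops) \<Longrightarrow> finsum B_alg f F = (\<lambda>x. \<Sum>i\<in>F. f i x)"
  using finsum_B_sub[OF cstar_subalgebra_bounded_ops, unfolded B_alg_update] .

lemma cstar_subalgebra_sum:
  assumes D: "cstar_subalgebra B_alg D" and "\<And>i. i \<in> F \<Longrightarrow> f i \<in> D"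
  shows "(\<lambda>x. \<Sum>i\<in>F. f i x) \<in> D"
  using assms(2)
proof (induction F rule: infinite_finite_induct)
  case (insert a F)
  thus ?case using cstar_subalgebra_B_algD(3)[OF D, of "f a" "\<lambda>x. \<Sum>i\<in>F. f i x"] by simp
qed (simp_all add: cstar_subalgebra_B_algD(8)[OF D])

lemma positive_matrix_B_sub:
  assumes D: "cstar_subalgebra B_alg D"
  shows "positive_matrix (B_alg\<lparr>carrier := D\<rparr>) n X \<longleftrightarrow>
    (\<exists>Y. (\<forall>i<n. \<forall>j<n. Y i j \<in> D) \<and>
         (\<forall>i<n. \<forall>j<n. X i j = (\<lambda>x. \<Sum>k<n. op_adjoint (Y k i) (Y k j x))))"
proof -
  have "(\<Oplus>\<^bsub>B_alg\<lparr>carrier := D\<rparr>\<^esub>k\<in>{..<n}. op_adjoint (Y k i) \<circ> Y k j) = (\<lambda>x. \<Sum>k<n. op_adjoint (Y k i) (Y k j x))"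
    if "\<forall>i<n. \<forall>j<n. Y i j \<in> D" "i < n" "j < n" for Y i j
  proof -
    have m: "op_adjoint (Y k i) \<circ> Y k j \<in> D" if "k \<in> {..<n}" for k
      by (intro cstar_subalgebra_B_algD(5,7)[OF D]) (use that \<open>i < n\<close> \<open>j < n\<close> \<open>\<forall>i<n. \<forall>j<n. Y i j \<in> D\<close> in auto)
    show ?thesis by (subst finsum_B_sub[OF D finite_lessThan m]) auto
  qed
  thus ?thesis by (simp add: positive_matrix_def cong: conj_cong)
qed

text \<open>For \<open>X = Y\<^sup>* Y\<close> the form is the sum of the squared norms of the rows
  of \<open>Y\<close> applied to \<open>v\<close>.\<close>

lemma positive_matrix_quadratic:
  assumes Y: "\<And>i j. i < n \<Longrightarrow> j < n \<Longrightarrow> Y i j \<in> bounded_ops"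
    and X: "\<And>i j. i < n \<Longrightarrow> j < n \<Longrightarrow> X i j = (\<lambda>x. \<Sum>k<n. op_adjoint (Y k i) (Y k j x))"
  shows "(\<Sum>i<n. \<Sum>j<n. cinner (v i) (X i j (v j))) \<in> \<real>\<^sub>\<ge>\<^sub>0"
proof -
  have "(\<Sum>i<n. \<Sum>j<n. cinner (v i) (X i j (v j))) = (\<Sum>i<n. \<Sum>j<n. \<Sum>k<n. cinner (Y k i (v i)) (Y k j (v j)))"
    by (intro sum.cong refl) (simp add: X Y cinner_sum_right cinner_op_adjoint')
  also have "\<dots> = (\<Sum>i<n. \<Sum>k<n. \<Sum>j<n. cinner (Y k i (v i)) (Y k j (v j)))"
    by (intro sum.cong refl sum.swap)
  also have "\<dots> = (\<Sum>k<n. \<Sum>i<n. \<Sum>j<n. cinner (Y k i (v i)) (Y k j (v j)))"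
    by (rule sum.swap)
  also have "\<dots> = (\<Sum>k<n. cinner (\<Sum>i<n. Y k i (v i)) (\<Sum>j<n. Y k j (v j)))"
    by (simp add: cinner_sum_left cinner_sum_right) (rule sum.cong[OF refl], rule sum.swap)
  also have "\<dots> = of_real (\<Sum>k<n. (norm (\<Sum>i<n. Y k i (v i)))\<^sup>2)"
    by (simp add: cinner_self)
  finally have eq: "(\<Sum>i<n. \<Sum>j<n. cinner (v i) (X i j (v j))) = of_real (\<Sum>k<n. (norm (\<Sum>i<n. Y k i (v i)))\<^sup>2)" .
  show ?thesis unfolding eq nonneg_Reals_of_real_iff by (simp add: sum_nonneg)
qed

text \<open>The isometries \<open>S\<^sub>i e\<^sub>k = e\<^bsub>kn+i\<^esub>\<close>, \<open>i < n\<close>, satisfy the Cuntz relations and identify \<open>M\<^sub>n\<close> over the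
  bounded operators with the bounded operators themselves.\<close>

lift_definition cuntz_adj :: "nat \<Rightarrow> nat \<Rightarrow> ell2 \<Rightarrow> ell2" is
  "\<lambda>n i f k. if i < n then f (k * n + i) else 0"
proof -
  fix n i and f :: "nat \<Rightarrow> complex" assume f: "summable (\<lambda>n. (cmod (f n))\<^sup>2)"
  show "summable (\<lambda>k. (cmod (if i < n then f (k * n + i) else 0))\<^sup>2)"
  proof (cases "i < n")
    case True
    have "inj (\<lambda>k. k * n + i)" using True by (auto simp: inj_on_def)
    from summable_reindex[OF f this] show ?thesis using True by (simp add: comp_def)
  qed simp
qed

definition cuntz :: "nat \<Rightarrow> nat \<Rightarrow> ell2 \<Rightarrow> ell2" where "cuntz n i = op_adjoint (cuntz_adj n i)"

lemma ell2_nth_cuntz_adj: "ell2_nth (cuntz_adj n i x) k = (if i < n then ell2_nth x (k * n + i) else 0)"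
  by (simp add: cuntz_adj.rep_eq)

lemma norm_cuntz_adj_le: "norm (cuntz_adj n i x) \<le> norm x"
proof (cases "i < n")
  case True
  have "inj (\<lambda>k. k * n + i)" using True by (auto simp: inj_on_def)
  from suminf_reindex_mono[OF summable_ell2_nth this, of x]
  have "(norm (cuntz_adj n i x))\<^sup>2 \<le> (norm x)\<^sup>2"
    using True by (simp add: norm_ell2_sq ell2_nth_cuntz_adj comp_def)
  thus ?thesis by (rule power2_le_imp_le) simp
next
  case False
  hence "cuntz_adj n i x = 0" by (intro ell2_eqI) (simp add: ell2_nth_cuntz_adj)
  thus ?thesis by simp
qed

lemma cuntz_adj_bounded [simp]: "cuntz_adj n i \<in> bounded_ops"
proof (rule bounded_opsI)
  fix x show "norm (cuntz_adj n i x) \<le> 1 * norm x" using norm_cuntz_adj_le by simp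
qed (auto intro!: ell2_eqI simp: ell2_nth_cuntz_adj)

lemma cuntz_bounded [simp]: "cuntz n i \<in> bounded_ops"
  by (simp add: cuntz_def)

lemma op_adjoint_cuntz [simp]: "op_adjoint (cuntz n i) = cuntz_adj n i" "op_adjoint (cuntz_adj n i) = cuntz n i"
  by (simp_all add: cuntz_def)

lemma cinner_cuntz:
  "cinner (cuntz_adj n i x) y = cinner x (cuntz n i y)" "cinner (cuntz n i x) y = cinner x (cuntz_adj n i y)"
  using cinner_op_adjoint[OF cuntz_bounded, of n i x y] cinner_op_adjoint'[OF cuntz_bounded, of x n i y] by simp_all

lemma ell2_nth_cuntz:
  assumes "i < n"
  shows "ell2_nth (cuntz n i x) m = (if m mod n = i then ell2_nth x (m div n) else 0)"
proof -
  have *: "(k * n + i = m) = (m mod n = i \<and> k = m div n)" for k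
  proof
    assume "k * n + i = m"
    hence "m = k * n + i" by simp
    thus "m mod n = i \<and> k = m div n" using assms by simp
  next
    assume "m mod n = i \<and> k = m div n"
    thus "k * n + i = m" using div_mult_mod_eq[of m n] by simp
  qed
  have "cuntz_adj n i (ebasis m) = (if m mod n = i then ebasis (m div n) else 0)"
  proof (rule ell2_eqI)
    fix k
    show "ell2_nth (cuntz_adj n i (ebasis m)) k = ell2_nth (if m mod n = i then ebasis (m div n) else 0) k"
      unfolding ell2_nth_cuntz_adj ell2_nth_ebasis * using assms by simp
  qed
  moreover have "ell2_nth (cuntz n i x) m = cinner (cuntz_adj n i (ebasis m)) x"
    by (simp add: cinner_cuntz)
  ultimately show ?thesis by simp
qed

lemma cuntz_adj_cuntz:
  "i < n \<Longrightarrow> j < n \<Longrightarrow> cuntz_adj n i (cuntz n j x) = (if i = j then x else 0)"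
  by (rule ell2_eqI) (auto simp: ell2_nth_cuntz_adj ell2_nth_cuntz)

lemma cuntz_sum:
  assumes "0 < n" shows "(\<Sum>i<n. cuntz n i (cuntz_adj n i x)) = x"
proof (rule ell2_eqI)
  fix m
  have "m mod n < n" using assms by simp
  have "ell2_nth (\<Sum>i<n. cuntz n i (cuntz_adj n i x)) m = (\<Sum>i<n. if m mod n = i then ell2_nth x (m div n * n + i) else 0)"
    unfolding ell2_nth_sum by (intro sum.cong refl) (simp add: ell2_nth_cuntz ell2_nth_cuntz_adj)
  also have "\<dots> = ell2_nth x (m div n * n + m mod n)"
    using \<open>m mod n < n\<close> by (subst sum.delta') auto
  finally show "ell2_nth (\<Sum>i<n. cuntz n i (cuntz_adj n i x)) m = ell2_nth x m" by simp
qed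

text \<open>Coordinate \<open>k\<close> of the \<open>i\<close>-th component is coordinate
  \<open>k * n + i\<close> of the vector, so components of vectors beyond \<open>M * n\<close> lie
  beyond \<open>M\<close>: an escaping vector has escaping components.\<close>

lemma tailp_cuntz_adj: "tailp M (cuntz_adj n i (tailp (M * n) x)) = cuntz_adj n i (tailp (M * n) x)"
proof (rule ell2_eqI)
  fix k
  have "k * n + i < M * n" if "k < M" "i < n"
  proof -
    have "k * n + i < (k + 1) * n" using that(2) by simp
    also have "\<dots> \<le> M * n" using that(1) by (intro mult_right_mono) auto
    finally show ?thesis .
  qed
  thus "ell2_nth (tailp M (cuntz_adj n i (tailp (M * n) x))) k = ell2_nth (cuntz_adj n i (tailp (M * n) x)) k"
    by (auto simp: ell2_nth_cuntz_adj)
qed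

text \<open>The image of the matrix \<open>X\<close> under the Cuntz identification; its quadratic
  form at \<open>v\<close> is the matrix form at the components of \<open>v\<close>.\<close>

definition block_op :: "nat \<Rightarrow> (nat \<Rightarrow> nat \<Rightarrow> ell2 \<Rightarrow> ell2) \<Rightarrow> ell2 \<Rightarrow> ell2" where
  "block_op n X v = (\<Sum>i<n. \<Sum>j<n. cuntz n i (X i j (cuntz_adj n j v)))"

lemma block_op_bounded:
  assumes "\<And>i j. i < n \<Longrightarrow> j < n \<Longrightarrow> X i j \<in> bounded_ops" shows "block_op n X \<in> bounded_ops"
  unfolding block_op_def
  by (intro bounded_ops_sum_fun bounded_ops_comp'[OF cuntz_bounded] bounded_ops_comp'[OF _ cuntz_adj_bounded] assms) auto

lemma cinner_block_op:
  "cinner v (block_op n X v) = (\<Sum>i<n. \<Sum>j<n. cinner (cuntz_adj n i v) (X i j (cuntz_adj n j v)))"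
  unfolding block_op_def cinner_sum_right
  by (intro sum.cong refl) (simp add: cinner_cuntz)

lemma block_op_entry:
  assumes X: "\<And>i j. i < n \<Longrightarrow> j < n \<Longrightarrow> X i j \<in> bounded_ops" and ij: "i < n" "j < n"
  shows "cuntz_adj n i (block_op n X (cuntz n j x)) = X i j x"
proof -
  have "block_op n X (cuntz n j x) = (\<Sum>a<n. \<Sum>b<n. if b = j then cuntz n a (X a j x) else 0)"
    unfolding block_op_def by (intro sum.cong refl)
      (auto simp: cuntz_adj_cuntz ij bounded_ops_lin(3)[OF X] bounded_ops_lin(3)[OF cuntz_bounded])
  also have "\<dots> = (\<Sum>a<n. cuntz n a (X a j x))" using ij by simp
  finally have "cuntz_adj n i (block_op n X (cuntz n j x)) = (\<Sum>a<n. if i = a then X a j x else 0)"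
    by (simp only: bounded_ops_sum[OF cuntz_adj_bounded]) (intro sum.cong refl, use ij in \<open>simp add: cuntz_adj_cuntz\<close>)
  thus ?thesis using ij by simp
qed

text \<open>Inserting the relation \<open>cuntz_sum\<close> between the factors shows that corners
  multiply like matrix entries.\<close>

lemma corner_mult:
  assumes A: "A \<in> bounded_ops" and n: "0 < n"
  shows "cuntz_adj n i (A (B (cuntz n j x))) =
    (\<Sum>k<n. cuntz_adj n i (A (cuntz n k (cuntz_adj n k (B (cuntz n j x))))))"
proof -
  have "A (B (cuntz n j x)) = A (\<Sum>k<n. cuntz n k (cuntz_adj n k (B (cuntz n j x))))"
    by (simp add: cuntz_sum[OF n])
  thus ?thesis by (simp add: bounded_ops_sum[OF A] bounded_ops_sum[OF cuntz_adj_bounded])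
qed

lemma corner_bounded: "T \<in> bounded_ops \<Longrightarrow> (\<lambda>x. cuntz_adj n i (T (cuntz n j x))) \<in> bounded_ops"
  by (intro bounded_ops_comp'[OF cuntz_adj_bounded] bounded_ops_comp'[OF _ cuntz_bounded])

lemma norm_cuntz_le: "norm (cuntz n i x) \<le> norm x"
proof -
  have "onorm (cuntz_adj n i) \<le> 1" by (rule onorm_bound) (simp_all add: norm_cuntz_adj_le)
  hence "onorm (cuntz n i) \<le> 1" using onorm_op_adjoint_le[OF cuntz_adj_bounded, of n i] by simp
  thus ?thesis using norm_op_le[OF cuntz_bounded, of n i x] mult_right_mono[of "onorm (cuntz n i)" 1 "norm x"] by simp
qed

lemma onorm_corner_le:
  assumes T: "T \<in> bounded_ops" shows "onorm (\<lambda>x. cuntz_adj n i (T (cuntz n j x))) \<le> onorm T"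
proof (rule onorm_bound[OF onorm_op_nonneg[OF T]])
  fix x
  have "norm (cuntz_adj n i (T (cuntz n j x))) \<le> onorm T * norm (cuntz n j x)"
    using norm_cuntz_adj_le norm_op_le[OF T] order_trans by blast
  also have "\<dots> \<le> onorm T * norm x" by (intro mult_left_mono norm_cuntz_le onorm_op_nonneg T)
  finally show "norm (cuntz_adj n i (T (cuntz n j x))) \<le> onorm T * norm x" .
qed

lemma op_adjoint_corner:
  assumes T: "T \<in> bounded_ops"
  shows "op_adjoint (\<lambda>x. cuntz_adj n i (T (cuntz n j x))) = (\<lambda>x. cuntz_adj n j (op_adjoint T (cuntz n i x)))"
  by (rule op_adjointI[OF corner_bounded[OF op_adjoint_bounded[OF T]]])
    (simp add: cinner_cuntz cinner_op_adjoint[OF T])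

text \<open>These are the matrices with entries in \<open>D\<close>; being a C*-subalgebra, they
  contain the square roots of their positive elements.\<close>

lemma corners_cstar_subalgebra:
  assumes D: "cstar_subalgebra B_alg D" and n: "0 < n"
  shows "cstar_subalgebra B_alg {T \<in> bounded_ops. \<forall>i<n. \<forall>j<n. (\<lambda>x. cuntz_adj n i (T (cuntz n j x))) \<in> D}"
    (is "cstar_subalgebra B_alg ?C")
proof -
  note d = cstar_subalgebra_B_algD[OF D]
  have CI: "T \<in> ?C" if "T \<in> bounded_ops" "\<And>i j. i < n \<Longrightarrow> j < n \<Longrightarrow> (\<lambda>x. cuntz_adj n i (T (cuntz n j x))) \<in> D" for T
    using that by simp
  have CD: "(\<lambda>x. cuntz_adj n i (T (cuntz n j x))) \<in> D" if "T \<in> ?C" "i < n" "j < n" for T i j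
    using that by simp
  have Cb: "T \<in> bounded_ops" if "T \<in> ?C" for T using that by simp
  note lin = bounded_ops_lin[OF cuntz_adj_bounded]
  show ?thesis
  proof (rule cstar_subalgebra_B_algI)
    show "?C \<subseteq> bounded_ops" by blast
    show "id \<in> ?C"
    proof (rule CI)
      fix i j assume "i < n" "j < n"
      hence "(\<lambda>x. cuntz_adj n i (id (cuntz n j x))) = (if i = j then id else (\<lambda>x. 0))"
        by (auto simp: cuntz_adj_cuntz fun_eq_iff)
      thus "(\<lambda>x. cuntz_adj n i (id (cuntz n j x))) \<in> D" using d(2,8) by simp
    qed simp
  next
    fix S T assume S: "S \<in> ?C" and T: "T \<in> ?C"
    show "(\<lambda>x. S x + T x) \<in> ?C"
    proof (rule CI)
      fix i j assume "i < n" "j < n"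
      from d(3)[OF CD[OF S this] CD[OF T this]]
      show "(\<lambda>x. cuntz_adj n i (S (cuntz n j x) + T (cuntz n j x))) \<in> D" by (simp only: lin)
    qed (intro bounded_ops_add Cb S T)
    show "S \<circ> T \<in> ?C"
    proof (rule CI)
      fix i j assume ij: "i < n" "j < n"
      have "(\<lambda>x. cuntz_adj n i ((S \<circ> T) (cuntz n j x))) =
          (\<lambda>x. \<Sum>k<n. cuntz_adj n i (S (cuntz n k (cuntz_adj n k (T (cuntz n j x))))))"
        unfolding comp_def by (rule ext) (rule corner_mult[OF Cb[OF S] n])
      also have "\<dots> \<in> D"
      proof (rule cstar_subalgebra_sum[OF D])
        fix k assume "k \<in> {..<n}"
        hence k: "k < n" by simp
        from d(5)[OF CD[OF S ij(1) k] CD[OF T k ij(2)]]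
        show "(\<lambda>x. cuntz_adj n i (S (cuntz n k (cuntz_adj n k (T (cuntz n j x)))))) \<in> D" by (simp add: comp_def)
      qed
      finally show "(\<lambda>x. cuntz_adj n i ((S \<circ> T) (cuntz n j x))) \<in> D" .
    qed (intro bounded_ops_comp Cb S T)
  next
    fix c T assume T: "T \<in> ?C"
    show "(\<lambda>x. scaleC c (T x)) \<in> ?C"
    proof (rule CI)
      fix i j assume "i < n" "j < n"
      from d(6)[OF CD[OF T this], of c]
      show "(\<lambda>x. cuntz_adj n i (scaleC c (T (cuntz n j x)))) \<in> D" by (simp only: lin)
    qed (intro bounded_ops_scaleC Cb T)
  next
    fix T assume T: "T \<in> ?C"
    show "op_adjoint T \<in> ?C"
    proof (rule CI)
      fix i j assume ij: "i < n" "j < n"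
      from d(7)[OF CD[OF T ij(2,1)]]
      show "(\<lambda>x. cuntz_adj n i (op_adjoint T (cuntz n j x))) \<in> D" by (simp only: op_adjoint_corner[OF Cb[OF T]])
    qed (intro op_adjoint_bounded Cb T)
  next
    fix \<sigma> L assume s: "\<And>m. \<sigma> m \<in> ?C" and L: "L \<in> bounded_ops"
      and lim: "(\<lambda>m. onorm (\<lambda>x. \<sigma> m x - L x)) \<longlonglongrightarrow> 0"
    show "L \<in> ?C"
    proof (rule CI[OF L])
      fix i j assume ij: "i < n" "j < n"
      have b: "(\<lambda>x. \<sigma> m x - L x) \<in> bounded_ops" for m by (rule bounded_ops_diff[OF Cb[OF s] L])
      show "(\<lambda>x. cuntz_adj n i (L (cuntz n j x))) \<in> D"
      proof (rule d(9)[OF CD[OF s ij] corner_bounded[OF L]])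
        show "(\<lambda>m. onorm (\<lambda>x. cuntz_adj n i (\<sigma> m (cuntz n j x)) - cuntz_adj n i (L (cuntz n j x)))) \<longlonglongrightarrow> 0"
        proof (rule Lim_null_comparison[OF always_eventually lim], rule allI)
          fix m
          show "norm (onorm (\<lambda>x. cuntz_adj n i (\<sigma> m (cuntz n j x)) - cuntz_adj n i (L (cuntz n j x))))
              \<le> onorm (\<lambda>x. \<sigma> m x - L x)"
            using onorm_corner_le[OF b, of n i m j] onorm_op_nonneg[OF corner_bounded[OF b, of n i m j]] by (simp add: lin)
        qed
      qed
    qed
  qed
qed

lemma pos_op_sqrt_ex:
  assumes "pos_op T"
  shows "\<exists>R. pos_op R \<and> (\<forall>x. R (R x) = T x) \<and> (\<forall>D. cstar_subalgebra B_alg D \<longrightarrow> T \<in> D \<longrightarrow> R \<in> D)"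
  by (rule pos_op_sqrt[OF assms]) blast

text \<open>Reading \<open>R = Q\<^sup>* Q\<close> entrywise, with \<open>Q\<close> the square root
  of \<open>R\<close>, gives the factors. If the entries of \<open>R\<close> lie in
  \<open>D\<close>, so do those of \<open>Q\<close>, because the matrices over \<open>D\<close> form
  a C*-subalgebra.\<close>

lemma pos_op_corners:
  assumes R: "pos_op R"
  shows "\<exists>Y. (\<forall>i j. Y i j \<in> bounded_ops) \<and>
    (\<forall>i<n. \<forall>j<n. \<forall>x. cuntz_adj n i (R (cuntz n j x)) = (\<Sum>k<n. op_adjoint (Y k i) (Y k j x))) \<and>
    (\<forall>D. cstar_subalgebra B_alg D \<longrightarrow> (\<forall>i<n. \<forall>j<n. (\<lambda>x. cuntz_adj n i (R (cuntz n j x))) \<in> D) \<longrightarrow>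
       (\<forall>i<n. \<forall>j<n. Y i j \<in> D))"
proof -
  obtain Q where Q': "pos_op Q \<and> (\<forall>x. Q (Q x) = R x) \<and> (\<forall>D. cstar_subalgebra B_alg D \<longrightarrow> R \<in> D \<longrightarrow> Q \<in> D)"
    by (rule exE[OF pos_op_sqrt_ex[OF R]])
  hence Q: "pos_op Q" "\<And>x. Q (Q x) = R x" and QD: "\<And>D. cstar_subalgebra B_alg D \<Longrightarrow> R \<in> D \<Longrightarrow> Q \<in> D"
    by simp_all
  note Qb = pos_opD(1)[OF Q(1)]
  show ?thesis
  proof (intro exI[of _ "\<lambda>i j x. cuntz_adj n i (Q (cuntz n j x))"] conjI allI impI)
    show "(\<lambda>x. cuntz_adj n i (Q (cuntz n j x))) \<in> bounded_ops" for i j by (rule corner_bounded[OF Qb])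
  next
    fix i j x assume ij: "i < n" "j < n"
    hence "0 < n" by simp
    thus "cuntz_adj n i (R (cuntz n j x)) = (\<Sum>k<n. op_adjoint (\<lambda>x. cuntz_adj n k (Q (cuntz n i x))) (cuntz_adj n k (Q (cuntz n j x))))"
      unfolding op_adjoint_corner[OF Qb] pos_opD(2)[OF Q(1)] Q(2)[symmetric] by (rule corner_mult[OF Qb])
  next
    fix D i j assume D: "cstar_subalgebra B_alg D" and c: "\<forall>i<n. \<forall>j<n. (\<lambda>x. cuntz_adj n i (R (cuntz n j x))) \<in> D"
      and ij: "i < n" "j < n"
    have "0 < n" using ij by simp
    from QD[OF corners_cstar_subalgebra[OF D this]] c pos_opD(1)[OF R]
    show "(\<lambda>x. cuntz_adj n i (Q (cuntz n j x))) \<in> D" using ij by simp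
  qed
qed

text \<open>The square root of the block operator has entries in \<open>D\<close>, so positivity
  over all bounded operators already gives a factorization inside \<open>D\<close>. This matters
  because the ucp maps in \<open>matrix_range\<close> only respond to factorizations within the
  generated algebra.\<close>

lemma positive_matrix_shrink:
  assumes pm: "positive_matrix B_alg n X" and D: "cstar_subalgebra B_alg D"
    and X: "\<And>i j. i < n \<Longrightarrow> j < n \<Longrightarrow> X i j \<in> D"
  shows "positive_matrix (B_alg\<lparr>carrier := D\<rparr>) n X"
proof -
  obtain Y where Y': "(\<forall>i<n. \<forall>j<n. Y i j \<in> bounded_ops) \<and>
      (\<forall>i<n. \<forall>j<n. X i j = (\<lambda>x. \<Sum>k<n. op_adjoint (Y k i) (Y k j x)))"
    by (rule exE[OF iffD1[OF positive_matrix_B_sub[OF cstar_subalgebra_bounded_ops, unfolded B_alg_update] pm]])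
  have Y: "\<And>i j. i < n \<Longrightarrow> j < n \<Longrightarrow> Y i j \<in> bounded_ops"
    "\<And>i j. i < n \<Longrightarrow> j < n \<Longrightarrow> X i j = (\<lambda>x. \<Sum>k<n. op_adjoint (Y k i) (Y k j x))"
    using Y' by simp_all
  have Xb: "\<And>i j. i < n \<Longrightarrow> j < n \<Longrightarrow> X i j \<in> bounded_ops" using X cstar_subalgebra_B_algD(1)[OF D] by blast
  have b: "block_op n X \<in> bounded_ops" by (rule block_op_bounded[OF Xb])
  have q: "cinner v (block_op n X v) \<in> \<real>\<^sub>\<ge>\<^sub>0" for v
    unfolding cinner_block_op by (rule positive_matrix_quadratic[OF Y])
  have Xadj: "op_adjoint (X i j) = X j i" if "i < n" "j < n" for i j
  proof -
    have "op_adjoint (X i j) = (\<lambda>x. \<Sum>k<n. op_adjoint (\<lambda>x. op_adjoint (Y k i) (Y k j x)) x)"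
      unfolding Y(2)[OF that] by (rule op_adjoint_sum, rule bounded_ops_comp'[OF op_adjoint_bounded[OF Y(1)] Y(1)])
        (use that in simp_all)
    also have "\<dots> = X j i"
      unfolding Y(2)[OF that(2,1)]
    proof (rule ext, rule sum.cong[OF refl])
      fix x k assume "k \<in> {..<n}"
      thus "op_adjoint (\<lambda>x. op_adjoint (Y k i) (Y k j x)) x = op_adjoint (Y k j) (Y k i x)"
        using op_adjoint_comp[of "op_adjoint (Y k i)" "Y k j"] Y(1) that by (simp add: comp_def)
    qed
    finally show ?thesis .
  qed
  have "op_adjoint (block_op n X) = block_op n X"
  proof (rule op_adjointI[OF b])
    fix x y
    have "cinner (block_op n X x) y = (\<Sum>i<n. \<Sum>j<n. cinner (X i j (cuntz_adj n j x)) (cuntz_adj n i y))"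
      unfolding block_op_def cinner_sum_left by (intro sum.cong refl) (simp add: cinner_cuntz)
    also have "\<dots> = (\<Sum>i<n. \<Sum>j<n. cinner (cuntz_adj n j x) (X j i (cuntz_adj n i y)))"
    proof (intro sum.cong refl)
      fix i j assume "i \<in> {..<n}" "j \<in> {..<n}"
      hence ij: "i < n" "j < n" by simp_all
      show "cinner (X i j (cuntz_adj n j x)) (cuntz_adj n i y) = cinner (cuntz_adj n j x) (X j i (cuntz_adj n i y))"
        using cinner_op_adjoint'[OF Xb[OF ij], of "cuntz_adj n j x" "cuntz_adj n i y"] unfolding Xadj[OF ij] by simp
    qed
    also have "\<dots> = (\<Sum>j<n. \<Sum>i<n. cinner (cuntz_adj n j x) (X j i (cuntz_adj n i y)))" by (rule sum.swap)
    also have "\<dots> = cinner x (block_op n X y)"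
      unfolding block_op_def cinner_sum_right by (intro sum.cong refl) (simp add: cinner_cuntz)
    finally show "cinner (block_op n X x) y = cinner x (block_op n X y)" .
  qed
  hence pb: "pos_op (block_op n X)" using b q by (simp add: pos_op_def complex_nonneg_Reals_iff)
  obtain Z where Z: "(\<forall>i j. Z i j \<in> bounded_ops) \<and>
    (\<forall>i<n. \<forall>j<n. \<forall>x. cuntz_adj n i (block_op n X (cuntz n j x)) = (\<Sum>k<n. op_adjoint (Z k i) (Z k j x))) \<and>
    (\<forall>D. cstar_subalgebra B_alg D \<longrightarrow> (\<forall>i<n. \<forall>j<n. (\<lambda>x. cuntz_adj n i (block_op n X (cuntz n j x))) \<in> D) \<longrightarrow>
       (\<forall>i<n. \<forall>j<n. Z i j \<in> D))"
    by (rule exE[OF pos_op_corners[OF pb, of n]])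
  have e: "\<And>i j x. i < n \<Longrightarrow> j < n \<Longrightarrow> cuntz_adj n i (block_op n X (cuntz n j x)) = X i j x"
    by (rule block_op_entry[OF Xb])
  show ?thesis
    unfolding positive_matrix_B_sub[OF D]
  proof (intro exI[of _ Z] conjI allI impI)
    fix i j assume ij: "i < n" "j < n"
    have "\<forall>i<n. \<forall>j<n. (\<lambda>x. cuntz_adj n i (block_op n X (cuntz n j x))) \<in> D" by (simp add: e X)
    thus "Z i j \<in> D" using Z D ij by blast
    show "X i j = (\<lambda>x. \<Sum>k<n. op_adjoint (Z k i) (Z k j x))"
      using conjunct1[OF conjunct2[OF Z]] ij by (simp add: e fun_eq_iff)
  qed
qed

text \<open>The block operator is a positive operator up to a compact one; the entries of the square
  root of the positive one give \<open>Y\<close>, and the corners of the compact difference are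
  compact.\<close>

lemma ess_nonneg_corners:
  assumes X: "\<And>i j. i < n \<Longrightarrow> j < n \<Longrightarrow> X i j \<in> bounded_ops" and e: "ess_nonneg (block_op n X)"
  obtains Y where "\<And>i j. Y i j \<in> bounded_ops"
    "\<And>i j. i < n \<Longrightarrow> j < n \<Longrightarrow> tail_small (\<lambda>x. X i j x - (\<Sum>k<n. op_adjoint (Y k i) (Y k j x)))"
proof -
  have b: "block_op n X \<in> bounded_ops" by (rule block_op_bounded[OF X])
  obtain R where R: "pos_op R" "tail_small (\<lambda>x. block_op n X x - R x)"
    by (rule ess_nonneg_decomp[OF b e])
  note Rb = pos_opD(1)[OF R(1)]
  obtain Y where Y': "(\<forall>i j. Y i j \<in> bounded_ops) \<and>
    (\<forall>i<n. \<forall>j<n. \<forall>x. cuntz_adj n i (R (cuntz n j x)) = (\<Sum>k<n. op_adjoint (Y k i) (Y k j x))) \<and>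
    (\<forall>D. cstar_subalgebra B_alg D \<longrightarrow> (\<forall>i<n. \<forall>j<n. (\<lambda>x. cuntz_adj n i (R (cuntz n j x))) \<in> D) \<longrightarrow>
       (\<forall>i<n. \<forall>j<n. Y i j \<in> D))"
    by (rule exE[OF pos_op_corners[OF R(1), of n]])
  hence Y: "\<And>i j. Y i j \<in> bounded_ops"
    "\<And>i j x. i < n \<Longrightarrow> j < n \<Longrightarrow> cuntz_adj n i (R (cuntz n j x)) = (\<Sum>k<n. op_adjoint (Y k i) (Y k j x))"
    by blast+
  show ?thesis
  proof (rule that[of Y, OF Y(1)])
    fix i j assume ij: "i < n" "j < n"
    have "tail_small (\<lambda>x. cuntz_adj n i (block_op n X (cuntz n j x) - R (cuntz n j x)))"
      by (intro tail_small_comp_left[OF cuntz_adj_bounded] tail_small_comp_right[OF cuntz_bounded bounded_ops_diff[OF b Rb] R(2)])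
    thus "tail_small (\<lambda>x. X i j x - (\<Sum>k<n. op_adjoint (Y k i) (Y k j x)))"
      by (simp only: bounded_ops_lin(4)[OF cuntz_adj_bounded] block_op_entry[of n X, OF X ij] Y(2)[OF ij, symmetric])
  qed
qed

section \<open>Cholesky factorization\<close>

definition quad :: "nat \<Rightarrow> (nat \<Rightarrow> nat \<Rightarrow> complex) \<Rightarrow> (nat \<Rightarrow> complex) \<Rightarrow> complex" where
  "quad n G v = (\<Sum>i<n. \<Sum>j<n. cnj (v i) * G i j * v j)"

text \<open>Requiring the form to be real as well makes Hermitian symmetry a consequence, see
  \<open>psd_hermitian\<close>. Only the first \<open>n\<close> values of \<open>v\<close>
  matter.\<close>

definition psd :: "nat \<Rightarrow> (nat \<Rightarrow> nat \<Rightarrow> complex) \<Rightarrow> bool" where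
  "psd n G \<longleftrightarrow> (\<forall>v. quad n G v \<in> \<real>\<^sub>\<ge>\<^sub>0)"

lemma quad_cong: "(\<And>i j. i < n \<Longrightarrow> j < n \<Longrightarrow> G i j = H i j) \<Longrightarrow> quad n G v = quad n H v"
  unfolding quad_def by (intro sum.cong refl) simp

lemma psd_cong:
  assumes "\<And>i j. i < n \<Longrightarrow> j < n \<Longrightarrow> G i j = H i j" shows "psd n G = psd n H"
  unfolding psd_def by (simp only: quad_cong[of n G H, OF assms])

lemma nonneg_Reals_mult_cnj: "cnj z * z \<in> \<real>\<^sub>\<ge>\<^sub>0"
  using nonneg_Reals_of_real_iff[of "(cmod z)\<^sup>2", where 'a = complex]
  by (simp only: complex_norm_square mult.commute[of "cnj z"]) simp

lemma nonneg_Reals_sum: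
  fixes f :: "'i \<Rightarrow> complex"
  shows "(\<And>i. i \<in> F \<Longrightarrow> f i \<in> \<real>\<^sub>\<ge>\<^sub>0) \<Longrightarrow> (\<Sum>i\<in>F. f i) \<in> \<real>\<^sub>\<ge>\<^sub>0"
  by (induction F rule: infinite_finite_induct) (auto intro: nonneg_Reals_add_I)

lemma gram_psd: "psd n (\<lambda>i j. \<Sum>k\<in>F. cnj (Y k i) * Y k j)"
  unfolding psd_def
proof
  fix v
  have "quad n (\<lambda>i j. \<Sum>k\<in>F. cnj (Y k i) * Y k j) v = (\<Sum>i<n. \<Sum>j<n. \<Sum>k\<in>F. cnj (Y k i * v i) * (Y k j * v j))"
    unfolding quad_def by (intro sum.cong refl) (simp add: sum_distrib_left sum_distrib_right mult_ac)
  also have "\<dots> = (\<Sum>i<n. \<Sum>k\<in>F. \<Sum>j<n. cnj (Y k i * v i) * (Y k j * v j))"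
    by (intro sum.cong refl sum.swap)
  also have "\<dots> = (\<Sum>k\<in>F. \<Sum>i<n. \<Sum>j<n. cnj (Y k i * v i) * (Y k j * v j))"
    by (rule sum.swap)
  also have "\<dots> = (\<Sum>k\<in>F. cnj (\<Sum>i<n. Y k i * v i) * (\<Sum>j<n. Y k j * v j))"
    unfolding cnj_sum by (intro sum.cong refl) (rule sum_product[symmetric])
  also have "\<dots> \<in> \<real>\<^sub>\<ge>\<^sub>0" by (intro nonneg_Reals_sum nonneg_Reals_mult_cnj)
  finally show "quad n (\<lambda>i j. \<Sum>k\<in>F. cnj (Y k i) * Y k j) v \<in> \<real>\<^sub>\<ge>\<^sub>0" .
qed

lemma sum_two_support:
  fixes f :: "nat \<Rightarrow> complex"
  assumes "i < n" "j < n" "i \<noteq> j"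
  shows "(\<Sum>k<n. f k * (if k = i then a else if k = j then b else 0)) = f i * a + f j * b"
proof -
  have "(\<Sum>k<n. f k * (if k = i then a else if k = j then b else 0)) =
      (\<Sum>k<n. (if k = i then f i * a else 0) + (if k = j then f j * b else 0))"
    by (intro sum.cong refl) (use assms in auto)
  also have "\<dots> = f i * a + f j * b" using assms by (simp add: sum.distrib)
  finally show ?thesis .
qed

lemma quad_two_support:
  assumes "i < n" "j < n" "i \<noteq> j"
  shows "quad n G (\<lambda>k. if k = i then a else if k = j then b else 0) =
    cnj a * (G i i * a + G i j * b) + cnj b * (G j i * a + G j j * b)"
proof -
  let ?v = "\<lambda>k. if k = i then a else if k = j then b else 0"
  have "quad n G ?v = (\<Sum>k<n. cnj (?v k) * (\<Sum>l<n. G k l * ?v l))"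
    unfolding quad_def by (simp add: sum_distrib_left mult.assoc)
  also have "\<dots> = (\<Sum>k<n. (G k i * a + G k j * b) * (if k = i then cnj a else if k = j then cnj b else 0))"
  proof (intro sum.cong refl)
    fix k
    show "cnj (?v k) * (\<Sum>l<n. G k l * ?v l) = (G k i * a + G k j * b) * (if k = i then cnj a else if k = j then cnj b else 0)"
      unfolding sum_two_support[OF assms] by auto
  qed
  also have "\<dots> = (G i i * a + G i j * b) * cnj a + (G j i * a + G j j * b) * cnj b"
    by (rule sum_two_support[OF assms])
  finally show ?thesis by (simp add: mult.commute)
qed

lemma psd_diag:
  assumes "psd n G" "i < n" shows "G i i \<in> \<real>\<^sub>\<ge>\<^sub>0"
proof -
  have "quad n G (\<lambda>k. if k = i then 1 else 0) = (\<Sum>k<n. if k = i then G i i else 0)"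
    unfolding quad_def
  proof (intro sum.cong refl)
    fix k assume "k \<in> {..<n}"
    have "(\<Sum>j<n. cnj (if k = i then 1 else 0) * G k j * (if j = i then 1 else 0)) =
        (\<Sum>j<n. if j = i then (if k = i then G i i else 0) else 0)" by (intro sum.cong refl) auto
    thus "(\<Sum>j<n. cnj (if k = i then 1 else 0) * G k j * (if j = i then 1 else 0)) = (if k = i then G i i else 0)"
      using assms(2) by simp
  qed
  hence eq: "quad n G (\<lambda>k. if k = i then 1 else 0) = G i i" using assms(2) by simp
  show ?thesis using assms(1)[unfolded psd_def, rule_format, of "\<lambda>k. if k = i then 1 else 0"] unfolding eq .
qed

text \<open>The form is real at \<open>e\<^sub>i + e\<^sub>j\<close>, which compares imaginary
  parts, and at \<open>e\<^sub>i + \<i> e\<^sub>j\<close>, which compares real parts.\<close>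

lemma psd_hermitian:
  assumes G: "psd n G" and ij: "i < n" "j < n" shows "G j i = cnj (G i j)"
proof (cases "i = j")
  case True
  thus ?thesis using psd_diag[OF G ij(1)] by (simp add: complex_nonneg_Reals_iff complex_eq_iff)
next
  case False
  note q = quad_two_support[OF ij False, of G]
  have d: "Im (G i i) = 0" "Im (G j j) = 0" using psd_diag[OF G] ij by (simp_all add: complex_nonneg_Reals_iff)
  have *: "quad n G v \<in> \<real>\<^sub>\<ge>\<^sub>0" for v using G unfolding psd_def by (rule spec)
  have "G i i + G i j + (G j i + G j j) \<in> \<real>\<^sub>\<ge>\<^sub>0"
    using *[of "\<lambda>k. if k = i then 1 else if k = j then 1 else 0"] unfolding q by simp
  moreover have "G i i + G i j * \<i> + (- \<i>) * (G j i + G j j * \<i>) \<in> \<real>\<^sub>\<ge>\<^sub>0"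
    using *[of "\<lambda>k. if k = i then 1 else if k = j then \<i> else 0"] unfolding q by simp
  ultimately show ?thesis using d by (simp add: complex_nonneg_Reals_iff complex_eq_iff)
qed

text \<open>With a zero diagonal entry the form is affine along the direction
  \<open>e\<^sub>m\<close>, so a nonzero \<open>G i m\<close> would make it negative far
  out.\<close>

lemma psd_zero_diag:
  assumes G: "psd n G" and ij: "i < n" "m < n" and z: "G m m = 0" shows "G i m = 0"
proof (cases "i = m")
  case False
  note q = quad_two_support[OF ij False, of G]
  show ?thesis
  proof (rule ccontr)
    assume nz: "G i m \<noteq> 0"
    define c where "c = (cmod (G i m))\<^sup>2"
    have c: "0 < c" using nz by (simp add: c_def)
    have cc: "complex_of_real c = G i m * cnj (G i m)" unfolding c_def by (rule complex_norm_square)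
    \<comment> \<open>Makes \<open>s * c\<close> exceed \<open>Re (G i i)\<close> by one, so that
      the form at \<open>e\<^sub>i + b e\<^sub>m\<close> is at most \<open>-2\<close>.\<close>
    define s where "s = (Re (G i i) + 1) / c"
    define b where "b = - (of_real s * cnj (G i m))"
    have "G i m * b = - of_real (s * c)"
      by (simp add: b_def cc mult_ac)
    moreover have "cnj b * G m i = - of_real (s * c)"
      unfolding psd_hermitian[OF G ij] by (simp add: b_def cc mult_ac)
    moreover have "quad n G (\<lambda>k. if k = i then 1 else if k = m then b else 0) = G i i + G i m * b + cnj b * G m i"
      unfolding q z by simp
    ultimately have "quad n G (\<lambda>k. if k = i then 1 else if k = m then b else 0) = G i i - of_real (2 * (s * c))"
      by simp
    hence "0 \<le> Re (G i i - of_real (2 * (s * c)))"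
      using G[unfolded psd_def, rule_format, of "\<lambda>k. if k = i then 1 else if k = m then b else 0"]
      by (simp only: complex_nonneg_Reals_iff)
    moreover have "s * c = Re (G i i) + 1" using c by (simp add: s_def)
    moreover have "0 \<le> Re (G i i)" using psd_diag[OF G ij(1)] by (simp add: complex_nonneg_Reals_iff)
    ultimately show False by simp
  qed
qed (use z in simp)

text \<open>Schur complement of the last diagonal entry. For \<open>G n n = 0\<close> the division
  returns zero, which is right for semidefinite \<open>G\<close> because the last row and column
  vanish too.\<close>

definition schur :: "nat \<Rightarrow> (nat \<Rightarrow> nat \<Rightarrow> complex) \<Rightarrow> nat \<Rightarrow> nat \<Rightarrow> complex" where
  "schur n G = (\<lambda>i j. G i j - G i n * G n j / G n n)"

text \<open>Completing the square: the chosen last coordinate minimizes the form over that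
  coordinate. The identity transfers both semidefiniteness and strictness from \<open>G\<close> to
  its Schur complement.\<close>

lemma schur_quad:
  assumes G: "psd (Suc n) G"
  shows "quad (Suc n) G (v(n := - (\<Sum>j<n. G n j * v j) / G n n)) = quad n (schur n G) v"
proof -
  define s where "s = (\<Sum>j<n. G n j * v j)"
  define d where "d = G n n"
  define A where "A = quad n G v"
  let ?w = "- s / d"
  have t: "(\<Sum>i<n. cnj (v i) * G i n) = cnj s"
    unfolding s_def cnj_sum by (intro sum.cong refl) (simp add: psd_hermitian[OF G, of n] mult.commute)
  have d: "cnj d = d" using psd_hermitian[OF G, of n n] by (simp add: d_def)
  have "quad (Suc n) G (v(n := ?w)) = (\<Sum>i<n. (\<Sum>j<n. cnj (v i) * G i j * v j) + cnj (v i) * G i n * ?w)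
      + ((\<Sum>j<n. cnj ?w * G n j * v j) + cnj ?w * d * ?w)"
    unfolding quad_def by (simp add: d_def)
  also have "\<dots> = A + cnj s * ?w + cnj ?w * s + cnj ?w * d * ?w"
  proof -
    have "(\<Sum>i<n. (\<Sum>j<n. cnj (v i) * G i j * v j) + cnj (v i) * G i n * c) = A + cnj s * c" for c
      by (simp only: sum.distrib A_def quad_def t[symmetric] sum_distrib_right)
    moreover have "(\<Sum>j<n. c * G n j * v j) = c * s" for c
      by (simp only: s_def sum_distrib_left mult.assoc)
    ultimately show ?thesis by (simp only: add.assoc)
  qed
  also have "\<dots> = A - cnj s * s / d"
  proof (cases "d = 0")
    case False
    have "cnj ?w = - cnj s / d" by (simp add: d)
    thus ?thesis using False by (simp add: field_simps)
  qed simp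
  finally have L: "quad (Suc n) G (v(n := ?w)) = A - cnj s * s / d" .
  have "quad n (schur n G) v = (\<Sum>i<n. \<Sum>j<n. cnj (v i) * G i j * v j - (cnj (v i) * G i n) * (G n j * v j) / d)"
    unfolding quad_def schur_def d_def by (intro sum.cong refl) (simp add: algebra_simps)
  also have "\<dots> = A - (\<Sum>i<n. \<Sum>j<n. (cnj (v i) * G i n) * (G n j * v j)) / d"
    by (simp add: A_def quad_def sum_subtractf sum_divide_distrib)
  also have "(\<Sum>i<n. \<Sum>j<n. (cnj (v i) * G i n) * (G n j * v j)) =
      (\<Sum>i<n. cnj (v i) * G i n) * (\<Sum>j<n. G n j * v j)" by (rule sum_product[symmetric])
  also have "\<dots> = cnj s * s" by (simp only: t flip: s_def)
  finally show ?thesis using L by (simp add: s_def d_def)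
qed

lemma schur_psd:
  assumes "psd (Suc n) G" shows "psd n (schur n G)"
  using assms unfolding psd_def schur_quad[OF assms, symmetric] by blast

text \<open>An explicit lower triangular \<open>Y\<close> with \<open>Y\<^sup>* Y = G\<close>,
  eliminating the last index first; being a formula, it can be tracked continuously along a family
  of matrices.\<close>

primrec chol :: "nat \<Rightarrow> (nat \<Rightarrow> nat \<Rightarrow> complex) \<Rightarrow> nat \<Rightarrow> nat \<Rightarrow> complex" where
  "chol 0 G = (\<lambda>k j. 0)"
| "chol (Suc n) G = (\<lambda>k j. if k = n then G n j / of_real (sqrt (Re (G n n)))
     else if j = n then 0 else chol n (schur n G) k j)"

lemma chol_correct:
  "psd n G \<Longrightarrow> i < n \<Longrightarrow> j < n \<Longrightarrow> (\<Sum>k<n. cnj (chol n G k i) * chol n G k j) = G i j"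
proof (induction n arbitrary: G i j)
  case (Suc n)
  note G = Suc.prems(1)
  let ?Y = "chol (Suc n) G"
  define d where "d = Re (G n n)"
  have Gd: "G n n = of_real d" and d0: "0 \<le> d"
    using psd_diag[OF G, of n] by (auto simp: d_def complex_nonneg_Reals_iff complex_eq_iff)
  have "cnj (?Y n i) * ?Y n j = cnj (G n i) * G n j / (of_real (sqrt d) * of_real (sqrt d))"
    by (simp add: d_def)
  also have "of_real (sqrt d) * of_real (sqrt d) = G n n"
    using d0 by (simp add: Gd flip: of_real_mult)
  also have "cnj (G n i) = G i n" using psd_hermitian[OF G, of n i] Suc.prems(2) by simp
  finally have last: "cnj (?Y n i) * ?Y n j = G i n * G n j / G n n" .
  have "(\<Sum>k<Suc n. cnj (?Y k i) * ?Y k j) = (\<Sum>k<n. cnj (?Y k i) * ?Y k j) + G i n * G n j / G n n"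
    by (simp only: sum.lessThan_Suc last)
  also have "\<dots> = G i j"
  proof (cases "i < n \<and> j < n")
    case True
    hence "(\<Sum>k<n. cnj (?Y k i) * ?Y k j) = (\<Sum>k<n. cnj (chol n (schur n G) k i) * chol n (schur n G) k j)"
      by (intro sum.cong refl) auto
    also have "\<dots> = schur n G i j" using True by (intro Suc.IH schur_psd G) auto
    finally show ?thesis by (simp add: schur_def)
  next
    case False
    hence "i = n \<or> j = n" using Suc.prems by auto
    hence "(\<Sum>k<n. cnj (?Y k i) * ?Y k j) = 0" by (intro sum.neutral) auto
    moreover have "G i n * G n j / G n n = G i j"
    \<comment> \<open>A zero pivot forces the last row and column to vanish, so the default value of
      the division is correct.\<close>
    proof (cases "G n n = 0")
      case True
      have "G i n = 0" "G j n = 0" using psd_zero_diag[OF G] True Suc.prems by auto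
      moreover have "G n j = 0" using psd_hermitian[OF G, of j n] Suc.prems \<open>G j n = 0\<close> by simp
      ultimately show ?thesis using \<open>i = n \<or> j = n\<close> by auto
    qed (use \<open>i = n \<or> j = n\<close> in auto)
    ultimately show ?thesis by simp
  qed
  finally show ?case .
qed simp

text \<open>Strict definiteness makes all pivots nonzero and is inherited by Schur complements
  through \<open>schur_quad\<close>, so the recursion only divides by functions without
  zeros.\<close>

lemma chol_continuous:
  assumes "\<And>i j. i < n \<Longrightarrow> j < n \<Longrightarrow> continuous_on K (\<lambda>x. G x i j)"
    and "\<And>x. x \<in> K \<Longrightarrow> psd n (G x)" 
    and "\<And>x v. x \<in> K \<Longrightarrow> \<exists>i<n. v i \<noteq> 0 \<Longrightarrow> quad n (G x) v \<noteq> 0"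
    and "k < n" "j < n"
  shows "continuous_on K (\<lambda>x. chol n (G x) k j)"
  using assms
proof (induction n arbitrary: G k j)
  case (Suc n)
  note cont = Suc.prems(1) and psd = Suc.prems(2) and strict = Suc.prems(3)
  have nz: "G x n n \<noteq> 0" if x: "x \<in> K" for x
  proof
    assume z: "G x n n = 0"
    let ?v = "\<lambda>k. if k = n then 1 else 0 :: complex"
    have c: "G x i n = 0" if "i < Suc n" for i using psd_zero_diag[OF psd[OF x] that, of n] z by simp
    have "quad (Suc n) (G x) ?v = 0" unfolding quad_def
    proof (intro sum.neutral ballI)
      fix i j assume "i \<in> {..<Suc n}" "j \<in> {..<Suc n}"
      thus "cnj (if i = n then 1 else 0) * G x i j * (if j = n then 1 else 0) = 0" using c by auto
    qed
    moreover have "\<exists>i<Suc n. ?v i \<noteq> 0" by (rule exI[of _ n]) simp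
    ultimately show False using strict[OF x, of ?v] by blast
  qed
  have pos: "0 < Re (G x n n)" if x: "x \<in> K" for x
    using psd_diag[OF psd[OF x], of n] nz[OF x] by (auto simp: complex_nonneg_Reals_iff complex_eq_iff)
  show ?case
  proof (cases "k = n")
    case True
    have "continuous_on K (\<lambda>x. G x n j / of_real (sqrt (Re (G x n n))))"
      by (intro continuous_intros cont) (use Suc.prems(5) pos in \<open>auto simp: less_imp_neq[symmetric]\<close>)
    thus ?thesis using True by simp
  next
    case False
    show ?thesis
    proof (cases "j = n")
      case jn: False
      have "continuous_on K (\<lambda>x. chol n (schur n (G x)) k j)"
      proof (rule Suc.IH[where G = "\<lambda>x. schur n (G x)"])
        show "continuous_on K (\<lambda>x. schur n (G x) i j)" if "i < n" "j < n" for i j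
          unfolding schur_def by (intro continuous_intros cont) (use that nz in auto)
        show "psd n (schur n (G x))" if "x \<in> K" for x by (rule schur_psd[OF psd[OF that]])
        show "quad n (schur n (G x)) v \<noteq> 0" if x: "x \<in> K" and v: "\<exists>i<n. v i \<noteq> 0" for x v
        proof -
          obtain i where i: "i < n" "v i \<noteq> 0" using v by blast
          let ?w = "v(n := - (\<Sum>j<n. G x n j * v j) / G x n n)"
          have "\<exists>i<Suc n. ?w i \<noteq> 0" using i by (intro exI[of _ i]) simp
          from strict[OF x this] show ?thesis unfolding schur_quad[OF psd[OF x]] .
        qed
        show "k < n" "j < n" using Suc.prems(4,5) False jn by auto
      qed
      thus ?thesis using False jn by simp
    qed (use False in simp)
  qed
qed simp

section \<open>Positive matrices over continuous functions\<close>

lemma C_alg_sel [simp]: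
  "carrier (C_alg K) = {f. continuous_on K f \<and> (\<forall>\<zeta>. \<zeta> \<notin> K \<longrightarrow> f \<zeta> = 0)}"
  "mult (C_alg K) = (\<lambda>f g \<zeta>. f \<zeta> * g \<zeta>)" "one (C_alg K) = (\<lambda>\<zeta>. if \<zeta> \<in> K then 1 else 0)"
  "zero (C_alg K) = (\<lambda>_. 0)" "add (C_alg K) = (\<lambda>f g \<zeta>. f \<zeta> + g \<zeta>)"
  "smult (C_alg K) = (\<lambda>c f \<zeta>. c * f \<zeta>)" "star (C_alg K) = (\<lambda>f \<zeta>. cnj (f \<zeta>))"
  by (simp_all add: C_alg_def)

lemma abelian_monoid_C_alg: "abelian_monoid (C_alg K)"
  by (rule abelian_monoidI) (auto intro: continuous_on_add simp: add_ac)

lemma finsum_C_alg: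
  assumes "finite F" "\<And>i. i \<in> F \<Longrightarrow> f i \<in> carrier (C_alg K)"
  shows "finsum (C_alg K) f F = (\<lambda>\<zeta>. \<Sum>i\<in>F. f i \<zeta>)"
proof
  fix x
  interpret abelian_monoid "C_alg K" by (rule abelian_monoid_C_alg)
  show "finsum (C_alg K) f F x = (\<Sum>i\<in>F. f i x)"
    by (rule additive_finsum[where ev = "\<lambda>T. T x"]) (use assms in auto)
qed

lemma positive_matrix_C_alg:
  "positive_matrix (C_alg K) n X \<longleftrightarrow>
    (\<exists>Y. (\<forall>i<n. \<forall>j<n. Y i j \<in> carrier (C_alg K)) \<and>
         (\<forall>i<n. \<forall>j<n. X i j = (\<lambda>\<zeta>. \<Sum>k<n. cnj (Y k i \<zeta>) * Y k j \<zeta>)))"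
proof -
  have "(\<Oplus>\<^bsub>C_alg K\<^esub>k\<in>{..<n}. star (C_alg K) (Y k i) \<otimes>\<^bsub>C_alg K\<^esub> Y k j) = (\<lambda>\<zeta>. \<Sum>k<n. cnj (Y k i \<zeta>) * Y k j \<zeta>)"
    if "\<forall>i<n. \<forall>j<n. Y i j \<in> carrier (C_alg K)" "i < n" "j < n" for Y i j
  proof -
    have m: "star (C_alg K) (Y k i) \<otimes>\<^bsub>C_alg K\<^esub> Y k j \<in> carrier (C_alg K)" if "k \<in> {..<n}" for k
      using that \<open>\<forall>i<n. \<forall>j<n. Y i j \<in> carrier (C_alg K)\<close> \<open>i < n\<close> \<open>j < n\<close>
      by (auto intro!: continuous_intros)
    show ?thesis by (subst finsum_C_alg[OF finite_lessThan m]) auto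
  qed
  thus ?thesis by (simp add: positive_matrix_def cong: conj_cong del: C_alg_sel)
qed

lemma positive_matrix_C_algD:
  assumes "positive_matrix (C_alg K) n X" shows "psd n (\<lambda>i j. X i j \<zeta>)"
proof -
  obtain Y where "\<forall>i<n. \<forall>j<n. X i j = (\<lambda>\<zeta>. \<Sum>k<n. cnj (Y k i \<zeta>) * Y k j \<zeta>)"
    using assms unfolding positive_matrix_C_alg by blast
  hence "psd n (\<lambda>i j. X i j \<zeta>) = psd n (\<lambda>i j. \<Sum>k<n. cnj (Y k i \<zeta>) * Y k j \<zeta>)" by (intro psd_cong) simp
  thus ?thesis using gram_psd[of n "\<lambda>k i. Y k i \<zeta>" "{..<n}"] by simp
qed

text \<open>The factors are pointwise Cholesky factors. Their continuity rests on strictness, which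
  is why \<open>Kmin_separation\<close> is arranged to produce strictly positive functions.\<close>

lemma positive_matrix_C_algI:
  assumes "\<And>i j. i < n \<Longrightarrow> j < n \<Longrightarrow> continuous_on K (\<lambda>x. G x i j)"
    and psd: "\<And>x. x \<in> K \<Longrightarrow> psd n (G x)" 
    and "\<And>x v. x \<in> K \<Longrightarrow> \<exists>i<n. v i \<noteq> 0 \<Longrightarrow> quad n (G x) v \<noteq> 0"
  shows "positive_matrix (C_alg K) n (\<lambda>i j \<zeta>. if \<zeta> \<in> K then G \<zeta> i j else 0)"
  unfolding positive_matrix_C_alg
proof (intro exI[of _ "\<lambda>i j \<zeta>. if \<zeta> \<in> K then chol n (G \<zeta>) i j else 0"] conjI allI impI)
  fix i j assume ij: "i < n" "j < n"
  show "(\<lambda>\<zeta>. if \<zeta> \<in> K then chol n (G \<zeta>) i j else 0) \<in> carrier (C_alg K)"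
  proof -
    have "continuous_on K (\<lambda>\<zeta>. if \<zeta> \<in> K then chol n (G \<zeta>) i j else 0)"
      by (rule continuous_on_eq[OF chol_continuous[OF assms ij]]) auto
    thus ?thesis by simp
  qed
  show "(\<lambda>\<zeta>. if \<zeta> \<in> K then G \<zeta> i j else 0) = (\<lambda>\<zeta>. \<Sum>k<n. cnj (if \<zeta> \<in> K then chol n (G \<zeta>) k i else 0) *
      (if \<zeta> \<in> K then chol n (G \<zeta>) k j else 0))"
    using chol_correct[OF psd ij] by (auto simp: fun_eq_iff)
qed

section \<open>Positive matrices over matrix algebras\<close>

lemma M_alg_sel [simp]:
  "carrier (M_alg n) = carrier_mat n n" "mult (M_alg n) = (*)" "one (M_alg n) = 1\<^sub>m n"
  "zero (M_alg n) = 0\<^sub>m n n" "add (M_alg n) = (+)" "smult (M_alg n) = (\<cdot>\<^sub>m)" "star (M_alg n) = mat_adjoint"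
  by (simp_all add: M_alg_def)

lemma index_mat_adjoint [simp]:
  "i < dim_col A \<Longrightarrow> j < dim_row A \<Longrightarrow> mat_adjoint A $$ (i, j) = cnj (A $$ (j, i))"
  for A :: "complex mat"
  by (simp add: mat_adjoint_def mat_of_rows_def)

lemma dim_mat_adjoint [simp]: "dim_row (mat_adjoint A) = dim_col A" "dim_col (mat_adjoint A) = dim_row A"
  by (simp_all add: mat_adjoint_def)

lemma mat_adjoint_carrier [simp]: "A \<in> carrier_mat m n \<Longrightarrow> mat_adjoint A \<in> carrier_mat n m"
  by (metis carrier_matD carrier_matI dim_mat_adjoint)

lemma abelian_monoid_M_alg: "abelian_monoid (M_alg n)"
  by (rule abelian_monoidI) (auto simp: comm_add_mat)

lemma finsum_M_alg:
  assumes "finite F" "\<And>i. i \<in> F \<Longrightarrow> f i \<in> carrier_mat n n"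
  shows "finsum (M_alg n) f F \<in> carrier_mat n n"
    and "p < n \<Longrightarrow> q < n \<Longrightarrow> finsum (M_alg n) f F $$ (p, q) = (\<Sum>i\<in>F. f i $$ (p, q))"
proof -
  interpret abelian_monoid "M_alg n" by (rule abelian_monoid_M_alg)
  show "finsum (M_alg n) f F \<in> carrier_mat n n" using finsum_closed[of f F] assms by auto
  show "finsum (M_alg n) f F $$ (p, q) = (\<Sum>i\<in>F. f i $$ (p, q))" if "p < n" "q < n"
    by (rule additive_finsum[where ev = "\<lambda>T. T $$ (p, q)"]) (use assms that in auto)
qed

lemma index_adjoint_mult:
  fixes A B :: "complex mat"
  assumes "A \<in> carrier_mat m n" "B \<in> carrier_mat m n'" "p < n" "q < n'"
  shows "(mat_adjoint A * B) $$ (p, q) = (\<Sum>r<m. cnj (A $$ (r, p)) * B $$ (r, q))"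
  using assms by (auto simp: scalar_prod_def lessThan_atLeast0 intro!: sum.cong)

lemma sum_div_mod:
  fixes f :: "nat \<Rightarrow> nat \<Rightarrow> 'a::comm_monoid_add"
  assumes "0 < n"
  shows "(\<Sum>s<k. \<Sum>r<n. f s r) = (\<Sum>c<k * n. f (c div n) (c mod n))"
proof -
  have "(\<Sum>s<k. \<Sum>r<n. f s r) = (\<Sum>(s, r)\<in>{..<k} \<times> {..<n}. f s r)" by (rule sum.cartesian_product)
  also have "\<dots> = (\<Sum>c<k * n. f (c div n) (c mod n))"
  proof (rule sum.reindex_bij_witness[where i = "\<lambda>c. (c div n, c mod n)" and j = "\<lambda>(s, r). s * n + r"])
    fix a assume "a \<in> {..<k} \<times> {..<n}"
    then obtain s r where a: "a = (s, r)" "s < k" "r < n" by auto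
    have "s * n + r < (s + 1) * n" using a(3) by simp
    also have "\<dots> \<le> k * n" using a(2) by (intro mult_right_mono) auto
    finally show "(case a of (s, r) \<Rightarrow> s * n + r) \<in> {..<k * n}" using a by simp
    show "((case a of (s, r) \<Rightarrow> s * n + r) div n, (case a of (s, r) \<Rightarrow> s * n + r) mod n) = a" using a by simp
    show "f ((case a of (s, r) \<Rightarrow> s * n + r) div n) ((case a of (s, r) \<Rightarrow> s * n + r) mod n) = (case a of (s, r) \<Rightarrow> f s r)"
      using a by simp
  next
    fix c assume "c \<in> {..<k * n}"
    hence "c div n < k" by (simp add: less_mult_imp_div_less)
    thus "(c div n, c mod n) \<in> {..<k} \<times> {..<n}" using assms by simp
    show "(case (c div n, c mod n) of (s, r) \<Rightarrow> s * n + r) = c" by simp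
  qed
  finally show ?thesis .
qed

text \<open>A \<open>k\<close>-by-\<open>k\<close> matrix over the
  \<open>n\<close>-by-\<open>n\<close> matrices as one scalar matrix of size \<open>k * n\<close>,
  so that positivity over \<open>M_alg n\<close> reduces to \<open>psd\<close>.\<close>

definition blockmat :: "nat \<Rightarrow> (nat \<Rightarrow> nat \<Rightarrow> complex mat) \<Rightarrow> nat \<Rightarrow> nat \<Rightarrow> complex" where
  "blockmat n X = (\<lambda>a b. X (a div n) (b div n) $$ (a mod n, b mod n))"

lemma quad_blockmat:
  assumes "0 < n"
  shows "quad (k * n) (blockmat n X) (\<lambda>a. \<xi> (a div n) (a mod n)) =
    (\<Sum>i<k. \<Sum>p<n. \<Sum>j<k. \<Sum>q<n. cnj (\<xi> i p) * X i j $$ (p, q) * \<xi> j q)"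
proof -
  have "(\<Sum>i<k. \<Sum>p<n. \<Sum>j<k. \<Sum>q<n. cnj (\<xi> i p) * X i j $$ (p, q) * \<xi> j q) =
      (\<Sum>i<k. \<Sum>p<n. \<Sum>b<k * n. cnj (\<xi> i p) * X i (b div n) $$ (p, b mod n) * \<xi> (b div n) (b mod n))"
    by (simp only: sum_div_mod[OF assms])
  also have "\<dots> = quad (k * n) (blockmat n X) (\<lambda>a. \<xi> (a div n) (a mod n))"
    unfolding quad_def blockmat_def by (simp only: sum_div_mod[OF assms])
  finally show ?thesis by (rule sym)
qed

lemma psd_blockmat:
  assumes n: "0 < n"
  shows "psd (k * n) (blockmat n X) \<longleftrightarrow>
    (\<forall>\<xi>. (\<Sum>i<k. \<Sum>p<n. \<Sum>j<k. \<Sum>q<n. cnj (\<xi> i p) * X i j $$ (p, q) * \<xi> j q) \<in> \<real>\<^sub>\<ge>\<^sub>0)"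
proof
  assume "psd (k * n) (blockmat n X)"
  thus "\<forall>\<xi>. (\<Sum>i<k. \<Sum>p<n. \<Sum>j<k. \<Sum>q<n. cnj (\<xi> i p) * X i j $$ (p, q) * \<xi> j q) \<in> \<real>\<^sub>\<ge>\<^sub>0"
    unfolding psd_def quad_blockmat[OF n, symmetric] by blast
next
  assume R: "\<forall>\<xi>. (\<Sum>i<k. \<Sum>p<n. \<Sum>j<k. \<Sum>q<n. cnj (\<xi> i p) * X i j $$ (p, q) * \<xi> j q) \<in> \<real>\<^sub>\<ge>\<^sub>0"
  show "psd (k * n) (blockmat n X)" unfolding psd_def
  proof
    fix v :: "nat \<Rightarrow> complex"
    have "quad (k * n) (blockmat n X) (\<lambda>a. (\<lambda>i p. v (i * n + p)) (a div n) (a mod n)) \<in> \<real>\<^sub>\<ge>\<^sub>0"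
      by (subst quad_blockmat[OF n]) (rule R[rule_format])
    thus "quad (k * n) (blockmat n X) v \<in> \<real>\<^sub>\<ge>\<^sub>0" by simp
  qed
qed

text \<open>The blocks of the factor flatten to a scalar factor, so the flattened matrix is a Gram
  matrix.\<close>

lemma positive_matrix_M_algD:
  assumes n: "0 < n" and "positive_matrix (M_alg n) k X"
  shows "i < k \<Longrightarrow> j < k \<Longrightarrow> X i j \<in> carrier_mat n n" "psd (k * n) (blockmat n X)"
proof -
  obtain Y where "(\<forall>i<k. \<forall>j<k. Y i j \<in> carrier_mat n n) \<and>
      (\<forall>i<k. \<forall>j<k. X i j = (\<Oplus>\<^bsub>M_alg n\<^esub>s\<in>{..<k}. mat_adjoint (Y s i) * Y s j))"
    using assms(2) unfolding positive_matrix_def M_alg_sel by (rule exE)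
  hence Y: "\<And>i j. i < k \<Longrightarrow> j < k \<Longrightarrow> Y i j \<in> carrier_mat n n"
    and X: "\<And>i j. i < k \<Longrightarrow> j < k \<Longrightarrow> X i j = (\<Oplus>\<^bsub>M_alg n\<^esub>s\<in>{..<k}. mat_adjoint (Y s i) * Y s j)"
    by simp_all
  have c: "mat_adjoint (Y s i) * Y s j \<in> carrier_mat n n" if "s \<in> {..<k}" "i < k" "j < k" for s i j
    by (rule mult_carrier_mat[OF mat_adjoint_carrier[OF Y] Y]) (use that in auto)
  show "X i j \<in> carrier_mat n n" if "i < k" "j < k"
    unfolding X[OF that] by (rule finsum_M_alg(1)[OF finite_lessThan c]) (use that in auto)
  define Z where "Z = (\<lambda>c a. Y (c div n) (a div n) $$ (c mod n, a mod n))"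
  have "blockmat n X a b = (\<Sum>c<k * n. cnj (Z c a) * Z c b)" if ab: "a < k * n" "b < k * n" for a b
  proof -
    have d: "a div n < k" "b div n < k" "a mod n < n" "b mod n < n"
      using ab n by (auto simp: less_mult_imp_div_less)
    have "blockmat n X a b = (\<Sum>s<k. (mat_adjoint (Y s (a div n)) * Y s (b div n)) $$ (a mod n, b mod n))"
      unfolding blockmat_def X[OF d(1,2)] by (rule finsum_M_alg(2)[OF finite_lessThan c]) (use d in auto)
    also have "\<dots> = (\<Sum>s<k. \<Sum>r<n. cnj (Y s (a div n) $$ (r, a mod n)) * Y s (b div n) $$ (r, b mod n))"
    proof (intro sum.cong refl)
      fix s assume "s \<in> {..<k}"
      hence "s < k" by simp
      from index_adjoint_mult[OF Y[OF this d(1)] Y[OF this d(2)] d(3,4)]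
      show "(mat_adjoint (Y s (a div n)) * Y s (b div n)) $$ (a mod n, b mod n) =
        (\<Sum>r<n. cnj (Y s (a div n) $$ (r, a mod n)) * Y s (b div n) $$ (r, b mod n))" .
    qed
    also have "\<dots> = (\<Sum>c<k * n. cnj (Z c a) * Z c b)" unfolding Z_def by (rule sum_div_mod[OF n])
    finally show ?thesis .
  qed
  hence "psd (k * n) (blockmat n X) = psd (k * n) (\<lambda>a b. \<Sum>c<k * n. cnj (Z c a) * Z c b)"
    by (intro psd_cong)
  thus "psd (k * n) (blockmat n X)" using gram_psd by simp
qed

text \<open>The Cholesky factor of the flattened matrix is cut back into blocks of size
  \<open>n\<close>.\<close>

lemma positive_matrix_M_algI:
  assumes n: "0 < n" and X: "\<And>i j. i < k \<Longrightarrow> j < k \<Longrightarrow> X i j \<in> carrier_mat n n"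
    and psd: "psd (k * n) (blockmat n X)"
  shows "positive_matrix (M_alg n) k X"
proof -
  define Y where "Y = (\<lambda>s i. mat n n (\<lambda>(r, p). chol (k * n) (blockmat n X) (s * n + r) (i * n + p)))"
  have Y: "Y s i \<in> carrier_mat n n" for s i by (simp add: Y_def)
  have c: "mat_adjoint (Y s i) * Y s j \<in> carrier_mat n n" for s i j
    by (rule mult_carrier_mat[OF mat_adjoint_carrier[OF Y] Y])
  have lt: "i * n + p < k * n" if "i < k" "p < n" for i p
  proof -
    have "i * n + p < (i + 1) * n" using that(2) by simp
    also have "\<dots> \<le> k * n" using that(1) by (intro mult_right_mono) auto
    finally show ?thesis .
  qed
  have "X i j = (\<Oplus>\<^bsub>M_alg n\<^esub>s\<in>{..<k}. mat_adjoint (Y s i) * Y s j)" if ij: "i < k" "j < k" for i j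
  proof (rule eq_matI)
    have fc: "(\<Oplus>\<^bsub>M_alg n\<^esub>s\<in>{..<k}. mat_adjoint (Y s i) * Y s j) \<in> carrier_mat n n"
      by (rule finsum_M_alg(1)[OF finite_lessThan c])
    show "dim_row (X i j) = dim_row (\<Oplus>\<^bsub>M_alg n\<^esub>s\<in>{..<k}. mat_adjoint (Y s i) * Y s j)"
      "dim_col (X i j) = dim_col (\<Oplus>\<^bsub>M_alg n\<^esub>s\<in>{..<k}. mat_adjoint (Y s i) * Y s j)"
      using fc X[OF ij] by auto
    fix p q assume "p < dim_row (\<Oplus>\<^bsub>M_alg n\<^esub>s\<in>{..<k}. mat_adjoint (Y s i) * Y s j)"
      "q < dim_col (\<Oplus>\<^bsub>M_alg n\<^esub>s\<in>{..<k}. mat_adjoint (Y s i) * Y s j)"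
    hence pq: "p < n" "q < n" using fc by auto
    have "(\<Oplus>\<^bsub>M_alg n\<^esub>s\<in>{..<k}. mat_adjoint (Y s i) * Y s j) $$ (p, q) = (\<Sum>s<k. (mat_adjoint (Y s i) * Y s j) $$ (p, q))"
      by (rule finsum_M_alg(2)[OF finite_lessThan c pq])
    also have "\<dots> = (\<Sum>s<k. \<Sum>r<n. cnj (Y s i $$ (r, p)) * Y s j $$ (r, q))"
      by (intro sum.cong refl index_adjoint_mult[OF Y Y pq])
    also have "\<dots> = (\<Sum>s<k. \<Sum>r<n. cnj (chol (k * n) (blockmat n X) (s * n + r) (i * n + p)) *
        chol (k * n) (blockmat n X) (s * n + r) (j * n + q))"
      by (intro sum.cong refl) (simp add: Y_def pq)
    also have "\<dots> = (\<Sum>c<k * n. cnj (chol (k * n) (blockmat n X) c (i * n + p)) * chol (k * n) (blockmat n X) c (j * n + q))"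
      unfolding sum_div_mod[OF n] by simp
    also have "\<dots> = blockmat n X (i * n + p) (j * n + q)"
      by (rule chol_correct[OF psd lt[OF ij(1) pq(1)] lt[OF ij(2) pq(2)]])
    also have "\<dots> = X i j $$ (p, q)" using pq by (simp add: blockmat_def)
    finally show "X i j $$ (p, q) = (\<Oplus>\<^bsub>M_alg n\<^esub>s\<in>{..<k}. mat_adjoint (Y s i) * Y s j) $$ (p, q)" by simp
  qed
  thus ?thesis unfolding positive_matrix_def M_alg_sel using Y by blast
qed

section \<open>Rank-one description of the minimal matrix convex set\<close>

text \<open>A positive operator-valued measure whose effects have rank one,
  \<open>w\<^sub>j w\<^sub>j\<^sup>*\<close>; vectors are easier to compress and to normalize than
  positive matrices.\<close>

definition povm :: "(real^'d) set \<Rightarrow> nat \<Rightarrow> nat \<Rightarrow> (nat \<Rightarrow> nat \<Rightarrow> complex) \<Rightarrow> (nat \<Rightarrow> real^'d) \<Rightarrow> ('d \<Rightarrow> complex mat) \<Rightarrow> bool" where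
  "povm K n m w \<Lambda> a \<longleftrightarrow> (\<forall>j<m. \<Lambda> j \<in> K) \<and>
     (\<forall>p<n. \<forall>q<n. (\<Sum>j<m. w j p * cnj (w j q)) = (if p = q then 1 else 0)) \<and>
     (\<forall>l. a l \<in> carrier_mat n n \<and> (\<forall>p<n. \<forall>q<n. a l $$ (p, q) = (\<Sum>j<m. of_real (vec_nth (\<Lambda> j) l) * (w j p * cnj (w j q)))))"

text \<open>An effect \<open>h = y\<^sup>* y\<close> is the sum of the rank-one matrices given by
  the rows of \<open>y\<close>; the index \<open>c < m * n\<close> encodes the pair of effect and
  row.\<close>

lemma Kmin_imp_povm:
  assumes "(n, a) \<in> Kmin K" shows "\<exists>m w \<Lambda>. povm K n m w \<Lambda> a"
proof -
  have n: "1 \<le> n" using assms unfolding Kmin_def by simp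
  have "\<exists>(m :: nat) h \<Lambda>. (\<forall>j<m. positive_elem (M_alg n) (h j) \<and> \<Lambda> j \<in> K) \<and>
        (\<Oplus>\<^bsub>M_alg n\<^esub>j\<in>{..<m}. h j) = 1\<^sub>m n \<and>
        (\<forall>l. a l = (\<Oplus>\<^bsub>M_alg n\<^esub>j\<in>{..<m}. complex_of_real (vec_nth (\<Lambda> j) l) \<cdot>\<^sub>m h j))"
    using assms unfolding Kmin_def by (simp only: mem_Sigma_iff mem_Collect_eq)
  then obtain m :: nat and h \<Lambda> where h: "\<forall>j<m. positive_elem (M_alg n) (h j) \<and> \<Lambda> j \<in> K"
    and one: "(\<Oplus>\<^bsub>M_alg n\<^esub>j\<in>{..<m}. h j) = 1\<^sub>m n"
    and a: "\<forall>l. a l = (\<Oplus>\<^bsub>M_alg n\<^esub>j\<in>{..<m}. complex_of_real (vec_nth (\<Lambda> j) l) \<cdot>\<^sub>m h j)"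
    by blast
  have "\<forall>j. \<exists>y. j < m \<longrightarrow> y \<in> carrier_mat n n \<and> h j = mat_adjoint y * y"
    using h unfolding positive_elem_def by auto
  then obtain y where y: "\<And>j. j < m \<Longrightarrow> y j \<in> carrier_mat n n" "\<And>j. j < m \<Longrightarrow> h j = mat_adjoint (y j) * y j"
    by metis
  have hc: "h j \<in> carrier_mat n n" if "j \<in> {..<m}" for j
  proof -
    have j: "j < m" using that by simp
    show ?thesis unfolding y(2)[OF j]
      by (rule mult_carrier_mat[OF mat_adjoint_carrier[OF y(1)[OF j]] y(1)[OF j]])
  qed
  have hpq: "h j $$ (p, q) = (\<Sum>r<n. cnj (y j $$ (r, p)) * y j $$ (r, q))" if "j < m" "p < n" "q < n" for j p q
    unfolding y(2)[OF that(1)] by (rule index_adjoint_mult[OF y(1) y(1)]) (use that in auto)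
  define w where "w = (\<lambda>c p. cnj (y (c div n) $$ (c mod n, p)))"
  have n0: "0 < n" using n by simp
  have "povm K n (m * n) w (\<lambda>c. \<Lambda> (c div n)) a" unfolding povm_def
  proof (intro conjI allI impI)
    fix c assume "c < m * n"
    thus "\<Lambda> (c div n) \<in> K" using h by (simp add: less_mult_imp_div_less)
  next
    fix p q assume pq: "p < n" "q < n"
    have "(\<Sum>c<m * n. w c p * cnj (w c q)) = (\<Sum>j<m. \<Sum>r<n. cnj (y j $$ (r, p)) * y j $$ (r, q))"
      unfolding sum_div_mod[OF n0] w_def by simp
    also have "\<dots> = (\<Sum>j<m. h j $$ (p, q))" using pq by (intro sum.cong refl) (simp add: hpq)
    also have "\<dots> = 1\<^sub>m n $$ (p, q)" unfolding one[symmetric] by (rule finsum_M_alg(2)[symmetric, OF finite_lessThan hc pq])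
    finally show "(\<Sum>c<m * n. w c p * cnj (w c q)) = (if p = q then 1 else 0)" using pq by simp
  next
    fix l
    have sc: "complex_of_real (vec_nth (\<Lambda> j) l) \<cdot>\<^sub>m h j \<in> carrier_mat n n" if "j \<in> {..<m}" for j using hc[OF that] by simp
    show "a l \<in> carrier_mat n n" unfolding a[rule_format] by (rule finsum_M_alg(1)[OF finite_lessThan sc])
    fix p q assume pq: "p < n" "q < n"
    have "a l $$ (p, q) = (\<Sum>j<m. (complex_of_real (vec_nth (\<Lambda> j) l) \<cdot>\<^sub>m h j) $$ (p, q))"
      unfolding a[rule_format] by (rule finsum_M_alg(2)[OF finite_lessThan sc pq])
    also have "\<dots> = (\<Sum>j<m. \<Sum>r<n. complex_of_real (vec_nth (\<Lambda> j) l) * (cnj (y j $$ (r, p)) * y j $$ (r, q)))"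
    proof (intro sum.cong refl)
      fix j assume j: "j \<in> {..<m}"
      have "(complex_of_real (vec_nth (\<Lambda> j) l) \<cdot>\<^sub>m h j) $$ (p, q) = complex_of_real (vec_nth (\<Lambda> j) l) * h j $$ (p, q)"
        using hc[OF j] pq by simp
      thus "(complex_of_real (vec_nth (\<Lambda> j) l) \<cdot>\<^sub>m h j) $$ (p, q) =
          (\<Sum>r<n. complex_of_real (vec_nth (\<Lambda> j) l) * (cnj (y j $$ (r, p)) * y j $$ (r, q)))"
        using j pq by (simp add: hpq sum_distrib_left)
    qed
    also have "\<dots> = (\<Sum>c<m * n. complex_of_real (vec_nth (\<Lambda> (c div n)) l) * (w c p * cnj (w c q)))"
      unfolding sum_div_mod[OF n0] w_def by simp
    finally show "a l $$ (p, q) = (\<Sum>c<m * n. complex_of_real (vec_nth (\<Lambda> (c div n)) l) * (w c p * cnj (w c q)))" .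
  qed
  thus ?thesis by blast
qed

lemma povm_imp_Kmin:
  assumes n: "1 \<le> n" and "povm K n m w \<Lambda> a" shows "(n, a) \<in> Kmin K"
proof -
  have \<Lambda>: "\<And>j. j < m \<Longrightarrow> \<Lambda> j \<in> K"
    and one: "\<And>p q. p < n \<Longrightarrow> q < n \<Longrightarrow> (\<Sum>j<m. w j p * cnj (w j q)) = (if p = q then 1 else 0)"
    and ac: "\<And>l. a l \<in> carrier_mat n n"
    and a: "\<And>l p q. p < n \<Longrightarrow> q < n \<Longrightarrow> a l $$ (p, q) = (\<Sum>j<m. of_real (vec_nth (\<Lambda> j) l) * (w j p * cnj (w j q)))"
    using assms(2) unfolding povm_def by blast+
  define h where "h = (\<lambda>j. mat n n (\<lambda>(p, q). w j p * cnj (w j q)))"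
  have hc: "h j \<in> carrier_mat n n" for j by (simp add: h_def)
  have sc: "complex_of_real (vec_nth (\<Lambda> j) l) \<cdot>\<^sub>m h j \<in> carrier_mat n n" for j l using hc by simp
  have pos: "positive_elem (M_alg n) (h j)" for j
  proof -
    \<comment> \<open>The factor of a rank-one matrix is one row padded with zeros; row
      \<open>0\<close> exists because \<open>1 \<le> n\<close>.\<close>
    define y where "y = mat n n (\<lambda>(r, p). if r = 0 then cnj (w j p) else 0)"
    have yc: "y \<in> carrier_mat n n" by (simp add: y_def)
    have "h j = mat_adjoint y * y"
    proof (rule eq_matI)
      fix p q assume "p < dim_row (mat_adjoint y * y)" "q < dim_col (mat_adjoint y * y)"
      hence pq: "p < n" "q < n" using yc by auto
      have "(mat_adjoint y * y) $$ (p, q) = (\<Sum>r<n. cnj (y $$ (r, p)) * y $$ (r, q))"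
        by (rule index_adjoint_mult[OF yc yc pq])
      also have "\<dots> = (\<Sum>r<n. if r = 0 then w j p * cnj (w j q) else 0)"
        using pq by (intro sum.cong refl) (auto simp: y_def)
      also have "\<dots> = h j $$ (p, q)" using n pq by (simp add: h_def)
      finally show "h j $$ (p, q) = (mat_adjoint y * y) $$ (p, q)" by simp
    qed (use yc hc[of j] in auto)
    thus ?thesis unfolding positive_elem_def M_alg_sel using yc by blast
  qed
  have fc1: "(\<Oplus>\<^bsub>M_alg n\<^esub>j\<in>{..<m}. h j) \<in> carrier_mat n n"
    by (rule finsum_M_alg(1)[OF finite_lessThan hc])
  have "(\<Oplus>\<^bsub>M_alg n\<^esub>j\<in>{..<m}. h j) = 1\<^sub>m n"
  proof (rule eq_matI)
    fix p q assume "p < dim_row (1\<^sub>m n)" "q < dim_col (1\<^sub>m n)"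
    hence pq: "p < n" "q < n" by auto
    show "(\<Oplus>\<^bsub>M_alg n\<^esub>j\<in>{..<m}. h j) $$ (p, q) = 1\<^sub>m n $$ (p, q)"
      unfolding finsum_M_alg(2)[OF finite_lessThan hc pq] using one[OF pq] pq by (simp add: h_def)
  qed (use fc1 in auto)
  moreover have "a l = (\<Oplus>\<^bsub>M_alg n\<^esub>j\<in>{..<m}. complex_of_real (vec_nth (\<Lambda> j) l) \<cdot>\<^sub>m h j)" for l
  proof (rule eq_matI)
    have fc: "(\<Oplus>\<^bsub>M_alg n\<^esub>j\<in>{..<m}. complex_of_real (vec_nth (\<Lambda> j) l) \<cdot>\<^sub>m h j) \<in> carrier_mat n n"
      by (rule finsum_M_alg(1)[OF finite_lessThan sc])
    show "dim_row (a l) = dim_row (\<Oplus>\<^bsub>M_alg n\<^esub>j\<in>{..<m}. complex_of_real (vec_nth (\<Lambda> j) l) \<cdot>\<^sub>m h j)"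
      "dim_col (a l) = dim_col (\<Oplus>\<^bsub>M_alg n\<^esub>j\<in>{..<m}. complex_of_real (vec_nth (\<Lambda> j) l) \<cdot>\<^sub>m h j)"
      using fc ac[of l] by auto
    fix p q assume "p < dim_row (\<Oplus>\<^bsub>M_alg n\<^esub>j\<in>{..<m}. complex_of_real (vec_nth (\<Lambda> j) l) \<cdot>\<^sub>m h j)"
       "q < dim_col (\<Oplus>\<^bsub>M_alg n\<^esub>j\<in>{..<m}. complex_of_real (vec_nth (\<Lambda> j) l) \<cdot>\<^sub>m h j)"
    hence pq: "p < n" "q < n" using fc by auto
    show "a l $$ (p, q) = (\<Oplus>\<^bsub>M_alg n\<^esub>j\<in>{..<m}. complex_of_real (vec_nth (\<Lambda> j) l) \<cdot>\<^sub>m h j) $$ (p, q)"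
      unfolding finsum_M_alg(2)[OF finite_lessThan sc pq] using a[OF pq] pq by (simp add: h_def)
  qed
  ultimately have "(\<forall>j<m. positive_elem (M_alg n) (h j) \<and> \<Lambda> j \<in> K) \<and>
        (\<Oplus>\<^bsub>M_alg n\<^esub>j\<in>{..<m}. h j) = 1\<^sub>m n \<and>
        (\<forall>l. a l = (\<Oplus>\<^bsub>M_alg n\<^esub>j\<in>{..<m}. complex_of_real (vec_nth (\<Lambda> j) l) \<cdot>\<^sub>m h j))"
    using pos \<Lambda> by blast
  thus ?thesis unfolding Kmin_def mem_Sigma_iff mem_Collect_eq using n
    by (intro conjI[OF _ exI[of _ m, OF exI[of _ h, OF exI[of _ \<Lambda>]]]]) simp_all
qed

lemma Kmin_iff_povm: "(n, a) \<in> Kmin K \<longleftrightarrow> 1 \<le> n \<and> (\<exists>m w \<Lambda>. povm K n m w \<Lambda> a)"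
  using Kmin_imp_povm povm_imp_Kmin unfolding Kmin_def by blast

section \<open>Compactness and separation for the minimal matrix convex set\<close>

text \<open>The ambient space will be infinite-dimensional, so the bound on the number of points
  comes from a finite spanning set. A smallest representing set is small because along an affine
  dependence one can move until a coefficient vanishes.\<close>

lemma caratheodory_finite_span:
  fixes S :: "'a::real_vector set"
  assumes B: "finite B" "S \<subseteq> span B" and x: "x \<in> convex hull S"
  shows "\<exists>T. finite T \<and> T \<subseteq> S \<and> card T \<le> card B + 1 \<and> x \<in> convex hull T"
proof -
  define P where "P = (\<lambda>k. \<exists>T. finite T \<and> T \<subseteq> S \<and> card T = k \<and> x \<in> convex hull T)"
  obtain T0 u0 where T0: "finite T0" "T0 \<subseteq> S" "\<forall>y\<in>T0. 0 \<le> u0 y" "sum u0 T0 = 1" "(\<Sum>v\<in>T0. u0 v *\<^sub>R v) = x"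
    using x unfolding convex_hull_explicit by blast
  have "x \<in> convex hull T0" unfolding convex_hull_finite[OF T0(1)] using T0(3-5) by blast
  hence P0: "P (card T0)" unfolding P_def using T0(1,2) by blast
  have Pk: "P (Least P)" by (rule LeastI[of P, OF P0])
  have least: "\<And>k. P k \<Longrightarrow> Least P \<le> k" by (rule Least_le)
  obtain T where T: "finite T" "T \<subseteq> S" "card T = Least P" "x \<in> convex hull T" using Pk unfolding P_def by blast
  obtain u where u: "\<forall>y\<in>T. 0 \<le> u y" "sum u T = 1" "(\<Sum>v\<in>T. u v *\<^sub>R v) = x"
    using T(4) unfolding convex_hull_finite[OF T(1)] by blast
  have "card T \<le> card B + 1"
  proof (rule ccontr)
    assume big: "\<not> card T \<le> card B + 1"
    hence "T \<noteq> {}" by auto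
    then obtain a where a: "a \<in> T" by blast
    have "affine_dependent T"
    proof (rule ccontr)
      assume "\<not> affine_dependent T"
      hence ind: "independent ((\<lambda>y. - a + y) ` (T - {a}))" using affine_dependent_iff_dependent2[OF a] by blast
      have "(\<lambda>y. - a + y) ` (T - {a}) \<subseteq> span B"
      proof (rule image_subsetI)
        fix y assume "y \<in> T - {a}"
        hence "y \<in> span B" "a \<in> span B" using T(2) B(2) a by auto
        thus "- a + y \<in> span B" by (intro span_add span_neg)
      qed
      from independent_span_bound[OF B(1) ind this]
      have "card ((\<lambda>y. - a + y) ` (T - {a})) \<le> card B" by blast
      moreover have "card ((\<lambda>y. - a + y) ` (T - {a})) = card T - 1"
        using a T(1) by (subst card_image) (auto simp: inj_on_def)
      ultimately show False using big by simp
    qed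
    then obtain w where w: "sum w T = 0" "\<exists>v\<in>T. w v \<noteq> 0" "(\<Sum>v\<in>T. w v *\<^sub>R v) = 0"
      unfolding affine_dependent_explicit_finite[OF T(1)] by blast
    define N where "N = {v \<in> T. w v < 0}"
    have "N \<noteq> {}"
    proof
      assume "N = {}"
      hence "\<forall>v\<in>T. 0 \<le> w v" unfolding N_def by force
      hence "\<forall>v\<in>T. w v = 0" using w(1) T(1) by (subst (asm) sum_nonneg_eq_0_iff) auto
      thus False using w(2) by blast
    qed
    have fN: "finite N" using T(1) by (simp add: N_def)
    \<comment> \<open>The largest step along the dependence that keeps all coefficients nonnegative;
      it annihilates the coefficient of \<open>b\<close>.\<close>
    define t where "t = Min ((\<lambda>v. u v / (- w v)) ` N)"
    obtain b where b: "b \<in> N" "t = u b / (- w b)"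
    proof -
      have "t \<in> (\<lambda>v. u v / (- w v)) ` N" unfolding t_def using fN \<open>N \<noteq> {}\<close> by (intro Min_in) auto
      thus ?thesis using that by blast
    qed
    have tle: "t \<le> u v / (- w v)" if "v \<in> N" for v unfolding t_def using fN that by (intro Min_le) auto
    have t0: "0 \<le> t" using b u(1) unfolding N_def by (auto intro!: divide_nonneg_nonpos)
    define c where "c = (\<lambda>v. u v + t * w v)"
    have bT: "b \<in> T" using b(1) by (simp add: N_def)
    have cb: "c b = 0" using b by (simp add: c_def N_def)
    have c0: "0 \<le> c v" if "v \<in> T" for v
    proof (cases "w v < 0")
      case True
      hence "v \<in> N" using that by (simp add: N_def)
      hence le: "t \<le> u v / (- w v)" by (rule tle)
      have "0 < - w v" using True by simp
      from iffD1[OF pos_le_divide_eq[OF this] le] have "t * (- w v) \<le> u v" .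
      thus ?thesis by (simp add: c_def)
    next
      case False
      thus ?thesis using u(1) that t0 by (simp add: c_def)
    qed
    have c1: "sum c T = 1" using u(2) w(1) by (simp add: c_def sum.distrib sum_distrib_left[symmetric])
    have cx: "(\<Sum>v\<in>T. c v *\<^sub>R v) = x"
    proof -
      have "(\<Sum>v\<in>T. c v *\<^sub>R v) = (\<Sum>v\<in>T. u v *\<^sub>R v) + t *\<^sub>R (\<Sum>v\<in>T. w v *\<^sub>R v)"
        by (simp add: c_def scaleR_add_left sum.distrib scaleR_sum_right)
      thus ?thesis using u(3) w(3) by simp
    qed
    have fT: "finite (T - {b})" using T(1) by simp
    have "sum c (T - {b}) = 1" "(\<Sum>v\<in>T - {b}. c v *\<^sub>R v) = x"
      using c1 cx cb sum.remove[OF T(1) bT, of c] sum.remove[OF T(1) bT, of "\<lambda>v. c v *\<^sub>R v"] by simp_all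
    hence "x \<in> convex hull (T - {b})" unfolding convex_hull_finite[OF fT] using c0 by blast
    hence "P (card (T - {b}))" unfolding P_def using fT T(2) by blast
    from least[OF this] have "card T \<le> card (T - {b})" using T(3) by simp
    thus False using card_Diff1_less[OF T(1) bT] by linarith
  qed
  thus ?thesis using T by blast
qed

text \<open>Convex combinations of \<open>k + 1\<close> points built by adding one point at a time,
  a form in which compactness follows by induction.\<close>

primrec hull_iter :: "'a::real_normed_vector set \<Rightarrow> nat \<Rightarrow> 'a set" where
  "hull_iter S 0 = S"
| "hull_iter S (Suc k) = {(1 - u) *\<^sub>R x + u *\<^sub>R y | x y u. 0 \<le> u \<and> u \<le> 1 \<and> x \<in> S \<and> y \<in> hull_iter S k}"

lemma hull_iter_subset: "hull_iter S k \<subseteq> convex hull S"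
proof (induction k)
  case (Suc k)
  show ?case
  proof
    fix z assume "z \<in> hull_iter S (Suc k)"
    then obtain x y u where z: "z = (1 - u) *\<^sub>R x + u *\<^sub>R y" "0 \<le> u" "u \<le> 1" "x \<in> S" "y \<in> hull_iter S k" by auto
    thus "z \<in> convex hull S" using Suc convexD[OF convex_convex_hull, of x S y "1 - u" u] hull_inc[of x S] by auto
  qed
qed (simp add: hull_subset)

lemma subset_hull_iter: "S \<subseteq> hull_iter S k"
proof (induction k)
  case (Suc k)
  show ?case
  proof
    fix x assume x: "x \<in> S"
    hence "x = (1 - 0) *\<^sub>R x + 0 *\<^sub>R x \<and> (0::real) \<le> 0 \<and> (0::real) \<le> 1 \<and> x \<in> S \<and> x \<in> hull_iter S k" using Suc by auto
    thus "x \<in> hull_iter S (Suc k)" unfolding hull_iter.simps mem_Collect_eq by blast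
  qed
qed simp

lemma hull_subset_hull_iter:
  "finite T \<Longrightarrow> T \<subseteq> S \<Longrightarrow> card T \<le> k + 1 \<Longrightarrow> convex hull T \<subseteq> hull_iter S k"
proof (induction k arbitrary: T)
  case 0
  hence "T = {} \<or> (\<exists>a. T = {a})" by (metis One_nat_def add_0 card_1_singletonE card_eq_0_iff le_Suc_eq le_zero_eq)
  thus ?case using 0 by auto
next
  case (Suc k)
  show ?case
  proof (cases "T = {}")
    case False
    then obtain a where a: "a \<in> T" by blast
    define U where "U = T - {a}"
    have T: "T = insert a U" using a by (auto simp: U_def)
    show ?thesis
    proof (cases "U = {}")
      case True
      thus ?thesis using T Suc.prems(2) subset_hull_iter[of S "Suc k"] by auto
    next
      case U: False
      have "card U \<le> k + 1" using a Suc.prems(1,3) by (simp add: U_def card_Diff_singleton)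
      moreover have "finite U" "U \<subseteq> S" using Suc.prems(1,2) by (auto simp: U_def)
      ultimately have IH: "convex hull U \<subseteq> hull_iter S k" by (intro Suc.IH)
      show ?thesis
      proof
        fix z assume "z \<in> convex hull T"
        then obtain u v b where z: "0 \<le> u" "0 \<le> v" "u + v = 1" "b \<in> convex hull U" "z = u *\<^sub>R a + v *\<^sub>R b"
          unfolding T convex_hull_insert[OF U] by blast
        have u: "u = 1 - v" using z(3) by simp
        have "z = (1 - v) *\<^sub>R a + v *\<^sub>R b \<and> 0 \<le> v \<and> v \<le> 1 \<and> a \<in> S \<and> b \<in> hull_iter S k"
          using z IH a Suc.prems(2) unfolding u by auto
        thus "z \<in> hull_iter S (Suc k)" unfolding hull_iter.simps mem_Collect_eq by blast
      qed
    qed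
  qed simp
qed

text \<open>The bound on the number of points makes the hull equal to a single
  \<open>hull_iter\<close>.\<close>

lemma compact_convex_hull_finite_span:
  fixes S :: "'a::real_normed_vector set"
  assumes B: "finite B" "S \<subseteq> span B" and S: "compact S"
  shows "compact (convex hull S)"
proof -
  have "convex hull S \<subseteq> hull_iter S (card B)"
  proof
    fix x assume "x \<in> convex hull S"
    from caratheodory_finite_span[OF B this] obtain T
      where "finite T" "T \<subseteq> S" "card T \<le> card B + 1" "x \<in> convex hull T" by blast
    thus "x \<in> hull_iter S (card B)" using hull_subset_hull_iter by blast
  qed
  hence "convex hull S = hull_iter S (card B)" using hull_iter_subset by blast
  moreover have "compact (hull_iter S k)" for k
  proof (induction k)
    case (Suc k) thus ?case using compact_convex_combinations[OF S Suc] by simp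
  qed (simp add: S)
  ultimately show ?thesis by simp
qed

text \<open>The direction from the point to the nearest point of the set separates, with the
  threshold halfway between.\<close>

lemma separate_point_compact:
  fixes C :: "'a::real_inner set"
  assumes C: "compact C" "convex C" "C \<noteq> {}" and a: "a \<notin> C"
  shows "\<exists>z b. inner z a < b \<and> (\<forall>y\<in>C. b < inner z y)"
proof -
  obtain x where x: "x \<in> C" "\<And>y. y \<in> C \<Longrightarrow> dist a x \<le> dist a y"
    using continuous_attains_inf[OF C(1,3) continuous_on_dist[OF continuous_on_const continuous_on_id]] by blast
  have "inner (a - x) (y - x) \<le> 0" if "y \<in> C" for y
    by (rule any_closest_point_dot[OF C(2) compact_imp_closed[OF C(1)] x(1) that]) (use x(2) in blast)
  hence le: "inner (x - a) x \<le> inner (x - a) y" if "y \<in> C" for y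
    using that by (simp add: inner_diff_left inner_diff_right algebra_simps)
  have "x \<noteq> a" using x(1) a by blast
  hence "0 < inner (x - a) (x - a)" by simp
  hence lt: "inner (x - a) a < inner (x - a) x" by (simp add: inner_diff_right)
  show ?thesis
  proof (intro exI conjI ballI)
    show "inner (x - a) a < (inner (x - a) a + inner (x - a) x) / 2" using lt by simp
    show "(inner (x - a) a + inner (x - a) x) / 2 < inner (x - a) y" if "y \<in> C" for y
      using lt le[OF that] by simp
  qed
qed

text \<open>Matrices are stored as finitely supported vectors, entry \<open>(p, q)\<close> at
  coordinate \<open>p * n + q\<close>: this gives matrices of every size one common inner product
  space, in which separation applies.\<close>

definition matvec :: "nat \<Rightarrow> (nat \<Rightarrow> nat \<Rightarrow> complex) \<Rightarrow> ell2" where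
  "matvec n f = (\<Sum>c<n * n. scaleC (f (c div n) (c mod n)) (ebasis c))"

lemma ell2_nth_matvec:
  assumes "p < n" "q < n" shows "ell2_nth (matvec n f) (p * n + q) = f p q"
proof -
  have "p * n + q < (p + 1) * n" using assms(2) by simp
  also have "\<dots> \<le> n * n" using assms(1) by (intro mult_right_mono) auto
  finally have lt: "p * n + q < n * n" .
  have "ell2_nth (matvec n f) (p * n + q) = (\<Sum>c<n * n. if c = p * n + q then f (c div n) (c mod n) else 0)"
    unfolding matvec_def ell2_nth_sum by (intro sum.cong refl) auto
  thus ?thesis using lt assms by simp
qed

lemma inner_matvec: "0 < n \<Longrightarrow> inner z (matvec n f) = Re (\<Sum>p<n. \<Sum>q<n. cnj (ell2_nth z (p * n + q)) * f p q)"
  unfolding inner_ell2_def matvec_def cinner_sum_right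
  by (simp add: sum_div_mod[where n = n and k = n] mult.commute)

lemma matvec_add: "matvec n (\<lambda>p q. f p q + g p q) = matvec n f + matvec n g"
  by (simp add: matvec_def scaleC_distribs sum.distrib)

lemma matvec_scaleR: "matvec n (\<lambda>p q. of_real r * f p q) = r *\<^sub>R matvec n f"
  by (simp add: matvec_def scaleC_sum scaleR_scaleC)

lemma matvec_sum: "matvec n (\<lambda>p q. \<Sum>i\<in>F. f i p q) = (\<Sum>i\<in>F. matvec n (f i))"
  by (induction F rule: infinite_finite_induct) (simp_all add: matvec_add, simp_all add: matvec_def)

lemma matvec_cong: "0 < n \<Longrightarrow> (\<And>p q. p < n \<Longrightarrow> q < n \<Longrightarrow> f p q = g p q) \<Longrightarrow> matvec n f = matvec n g"
  unfolding matvec_def by (intro sum.cong refl) (simp add: less_mult_imp_div_less)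

text \<open>The first component of \<open>rank_one n u \<mu>\<close> is \<open>uu\<^sup>*\<close>, the others are the \<open>\<mu>\<^sub>l uu\<^sup>*\<close>; normalized by the
  trace, the tuples in the minimal matrix convex set become convex combinations of these.\<close>

definition rank_one :: "nat \<Rightarrow> (nat \<Rightarrow> complex) \<Rightarrow> real^'d \<Rightarrow> ell2 \<times> (ell2^'d)" where
  "rank_one n u \<mu> = (matvec n (\<lambda>p q. u p * cnj (u q)), \<chi> l. vec_nth \<mu> l *\<^sub>R matvec n (\<lambda>p q. u p * cnj (u q)))"

text \<open>The condition \<open>tailp n x = 0\<close> confines the unit vectors to the first
  \<open>n\<close> coordinates, where the sphere is compact.\<close>

definition rank_ones :: "(real^'d) set \<Rightarrow> nat \<Rightarrow> (ell2 \<times> (ell2^'d)) set" where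
  "rank_ones K n = (\<lambda>(x, \<mu>). rank_one n (ell2_nth x) \<mu>) `
     ({x. norm x = 1 \<and> tailp n x = 0} \<times> K)"

lemma bounded_linear_ell2_nth: "bounded_linear (\<lambda>x. ell2_nth x n)"
  by (rule bounded_linear_intro[of _ 1]) (auto simp: cmod_ell2_nth_le scaleR_conv_of_real)

lemmas continuous_on_ell2_nth [continuous_intros] = bounded_linear.continuous_on[OF bounded_linear_ell2_nth]

lemma bounded_linear_scaleC_left: "bounded_linear (\<lambda>z. scaleC z w)"
  by (rule bounded_linear_intro[of _ "norm w"]) (auto simp: scaleC_distribs scaleR_scaleC scaleR_conv_of_real)

lemmas continuous_on_scaleC_left [continuous_intros] = bounded_linear.continuous_on[OF bounded_linear_scaleC_left]

lemma compact_unit_sphere: "compact {x. norm x = 1 \<and> tailp n x = 0}"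
proof -
  let ?box = "{\<Sum>i<n. scaleC (c i) (ebasis i) | c. \<forall>i. cmod (c i) \<le> 1}"
  have "{x. norm x = 1 \<and> tailp n x = 0} = ?box \<inter> ({x. norm x = 1} \<inter> {x. tailp n x = 0})"
  proof -
    have "x \<in> ?box" if "norm x = 1" "tailp n x = 0" for x
    proof -
      have "x = (\<Sum>i<n. scaleC (ell2_nth x i) (ebasis i))" using head_tail[of x n] that(2) by simp
      moreover have "\<forall>i. cmod (ell2_nth x i) \<le> 1" using cmod_ell2_nth_le[of x] that(1) by simp
      ultimately show ?thesis by blast
    qed
    thus ?thesis by blast
  qed
  moreover have "closed {x::ell2. norm x = 1}" by (intro closed_Collect_eq continuous_intros)
  moreover have "closed {x. tailp n x = 0}"
    by (intro closed_Collect_eq continuous_intros linear_continuous_on bounded_ops_bl tailp_bounded)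
  ultimately show ?thesis using compact_box[where N = n and w = ebasis] by (auto intro: compact_Int_closed)
qed

lemma compact_rank_ones:
  assumes "compact K" shows "compact (rank_ones K n)"
  unfolding rank_ones_def
proof (rule compact_continuous_image)
  let ?S = "{x. norm x = 1 \<and> tailp n x = 0} \<times> K"
  show "compact ?S" by (intro compact_Times compact_unit_sphere assms)
  have m: "continuous_on ?S (\<lambda>z. matvec n (\<lambda>p q. ell2_nth (fst z) p * cnj (ell2_nth (fst z) q)))"
    unfolding matvec_def by (intro continuous_intros)
  have "continuous_on ?S (\<lambda>z. rank_one n (ell2_nth (fst z)) (snd z))"
    unfolding rank_one_def
    by (intro continuous_on_Pair m continuous_on_vec_lambda continuous_on_scaleR
        bounded_linear.continuous_on[OF bounded_linear_vec_nth]
        continuous_on_snd continuous_on_id)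
  thus "continuous_on ?S (\<lambda>(x, \<mu>). rank_one n (ell2_nth x) \<mu>)" by (simp add: case_prod_unfold)
qed

lemma rank_ones_finite_span: "\<exists>B. finite B \<and> (rank_ones K n :: (ell2 \<times> (ell2^'d)) set) \<subseteq> span B"
proof -
  \<comment> \<open>Spans are real, so each coordinate contributes \<open>ebasis c\<close> and its
    multiple by \<open>\<i>\<close>.\<close>
  define F where "F = (\<lambda>(z, c). scaleC z (ebasis c)) ` ({1, \<i>} \<times> {..<n * n})"
  have mF: "matvec n f \<in> span F" for f
    unfolding matvec_def
  proof (rule span_sum)
    fix c assume c: "c \<in> {..<n * n}"
    let ?z = "f (c div n) (c mod n)"
    have "scaleC ?z (ebasis c) = Re ?z *\<^sub>R scaleC 1 (ebasis c) + Im ?z *\<^sub>R scaleC \<i> (ebasis c)"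
      by (rule ell2_eqI) (auto simp: complex_eq_iff)
    moreover have "scaleC 1 (ebasis c) \<in> F" "scaleC \<i> (ebasis c) \<in> F" using c unfolding F_def by force+
    ultimately show "scaleC ?z (ebasis c) \<in> span F"
      by (simp only:) (intro span_add span_scale span_base)
  qed
  define B where "B = (\<lambda>x. (x, 0 :: ell2^'d)) ` F \<union> (\<lambda>(l, x). (0 :: ell2, axis l x)) ` (UNIV \<times> F)"
  have "finite B" unfolding B_def F_def by (intro finite_UnI finite_imageI finite_cartesian_product) auto
  have l1: "linear (\<lambda>x. (x :: ell2, 0 :: ell2^'d))" by (rule linearI) auto
  have l2: "linear (\<lambda>x. (0 :: ell2, axis l x :: ell2^'d))" for l
    by (rule linearI) (auto simp: Finite_Cartesian_Product.vec_eq_iff axis_def)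
  have s1: "(x, 0) \<in> span B" if "x \<in> span F" for x
  proof -
    have "(\<lambda>x. (x, 0)) x \<in> span ((\<lambda>x. (x :: ell2, 0 :: ell2^'d)) ` F)"
      unfolding linear_span_image[OF l1] using that by blast
    thus ?thesis using span_mono[of "(\<lambda>x. (x, 0)) ` F" B] unfolding B_def by blast
  qed
  have s2: "(0, axis l x) \<in> span B" if "x \<in> span F" for x l
  proof -
    have "(\<lambda>x. (0, axis l x)) x \<in> span ((\<lambda>x. (0 :: ell2, axis l x :: ell2^'d)) ` F)"
      unfolding linear_span_image[OF l2] using that by blast
    moreover have "(\<lambda>x. (0 :: ell2, axis l x :: ell2^'d)) ` F \<subseteq> B" unfolding B_def by auto
    ultimately show ?thesis using span_mono by blast
  qed
  have "rank_one n u \<mu> \<in> span B" for u and \<mu> :: "real^'d"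
  proof -
    let ?m = "matvec n (\<lambda>p q. u p * cnj (u q))"
    have "(\<chi> l. vec_nth \<mu> l *\<^sub>R ?m) = (\<Sum>l\<in>UNIV. axis l (vec_nth \<mu> l *\<^sub>R ?m))"
      by (simp add: Finite_Cartesian_Product.vec_eq_iff axis_def if_distrib cong: if_cong)
    hence "rank_one n u \<mu> = (?m, 0) + (\<Sum>l\<in>UNIV. (0, axis l (vec_nth \<mu> l *\<^sub>R ?m)))"
      unfolding rank_one_def by (simp add: prod_eq_iff fst_sum snd_sum)
    also have "\<dots> \<in> span B" by (intro span_add span_sum s1 s2 span_scale mF)
    finally show ?thesis .
  qed
  hence "rank_ones K n \<subseteq> span B" unfolding rank_ones_def by auto
  thus ?thesis using \<open>finite B\<close> by blast
qed

lemma compact_hull_rank_ones: "compact K \<Longrightarrow> compact (convex hull (rank_ones K n))"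
  using rank_ones_finite_span compact_convex_hull_finite_span compact_rank_ones by metis

definition ident :: "nat \<Rightarrow> nat \<Rightarrow> complex" where "ident p q = (if p = q then 1 else 0)"

definition emb :: "nat \<Rightarrow> ('d \<Rightarrow> complex mat) \<Rightarrow> ell2 \<times> (ell2^'d)" where
  "emb n a = (matvec n ident, \<chi> l. matvec n (\<lambda>p q. a l $$ (p, q)))"

lemma rank_one_scale: "rank_one n (\<lambda>p. of_real r * u p) \<mu> = r\<^sup>2 *\<^sub>R rank_one n u \<mu>"
proof -
  have "matvec n (\<lambda>p q. of_real r * u p * cnj (of_real r * u q)) = r\<^sup>2 *\<^sub>R matvec n (\<lambda>p q. u p * cnj (u q))"
    unfolding matvec_scaleR[symmetric] by (simp add: power2_eq_square mult_ac)
  thus ?thesis by (simp add: rank_one_def Finite_Cartesian_Product.vec_eq_iff)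
qed

lemma povm_emb:
  assumes n: "0 < n" and P: "povm K n m w \<Lambda> a" shows "emb n a = (\<Sum>j<m. rank_one n (w j) (\<Lambda> j))"
proof -
  have "matvec n ident = matvec n (\<lambda>p q. \<Sum>j<m. w j p * cnj (w j q))"
    using P by (intro matvec_cong n) (simp add: povm_def ident_def)
  moreover have "matvec n (\<lambda>p q. a l $$ (p, q)) = (\<Sum>j<m. vec_nth (\<Lambda> j) l *\<^sub>R matvec n (\<lambda>p q. w j p * cnj (w j q)))" for l
  proof -
    have "matvec n (\<lambda>p q. a l $$ (p, q)) = matvec n (\<lambda>p q. \<Sum>j<m. of_real (vec_nth (\<Lambda> j) l) * (w j p * cnj (w j q)))"
      using P by (intro matvec_cong n) (simp add: povm_def)
    thus ?thesis by (simp add: matvec_sum matvec_scaleR)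
  qed
  ultimately show ?thesis
    by (simp add: emb_def rank_one_def prod_eq_iff fst_sum snd_sum Finite_Cartesian_Product.vec_eq_iff matvec_sum)
qed

lemma rank_one_in_rank_ones:
  assumes u: "(\<Sum>p<n. (cmod (u p))\<^sup>2) = 1" and \<mu>: "\<mu> \<in> K" and n: "0 < n" shows "rank_one n u \<mu> \<in> rank_ones K n"
proof -
  define x where "x = (\<Sum>i<n. scaleC (u i) (ebasis i))"
  have xn: "ell2_nth x p = (if p < n then u p else 0)" for p by (simp add: x_def if_distrib cong: if_cong)
  have "tailp n x = 0" by (rule ell2_eqI) (simp add: xn)
  moreover have "norm x = 1"
  proof -
    have "cinner x x = (\<Sum>i<n. cnj (u i) * u i)" 
      unfolding x_def cinner_sum_left by (simp add: x_def[symmetric] xn)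
    also have "\<dots> = of_real (\<Sum>p<n. (cmod (u p))\<^sup>2)"
      unfolding of_real_sum by (intro sum.cong refl) (simp only: complex_norm_square mult.commute)
    finally have "(norm x)\<^sup>2 = 1" unfolding u cinner_self by (simp only: of_real_eq_iff)
    thus ?thesis using power2_eq_iff_nonneg[of "norm x" 1] by simp
  qed
  moreover have "rank_one n u \<mu> = rank_one n (ell2_nth x) \<mu>"
  proof -
    have "matvec n (\<lambda>p q. u p * cnj (u q)) = matvec n (\<lambda>p q. ell2_nth x p * cnj (ell2_nth x q))"
      by (intro matvec_cong n) (simp add: xn)
    thus ?thesis by (simp add: rank_one_def)
  qed
  ultimately show ?thesis unfolding rank_ones_def using \<mu> by force
qed

text \<open>The squared lengths of the \<open>w j\<close> add up to the trace \<open>n\<close> of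
  the identity, so divided by \<open>n\<close> they are convex weights for the normalized
  vectors.\<close>

lemma Kmin_imp_hull:
  assumes "(n, a) \<in> Kmin K" shows "(1 / real n) *\<^sub>R emb n a \<in> convex hull (rank_ones K n)"
proof -
  obtain m w \<Lambda> where n: "1 \<le> n" and P: "povm K n m w \<Lambda> a" using assms unfolding Kmin_iff_povm by blast
  have n0: "0 < n" using n by simp
  define t where "t = (\<lambda>j. \<Sum>p<n. (cmod (w j p))\<^sup>2)"
  have t0: "0 \<le> t j" for j by (simp add: t_def sum_nonneg)
  have "complex_of_real (\<Sum>j<m. t j) = (\<Sum>j<m. \<Sum>p<n. w j p * cnj (w j p))"
    unfolding t_def of_real_sum by (intro sum.cong refl) (simp only: complex_norm_square)
  also have "\<dots> = (\<Sum>p<n. \<Sum>j<m. w j p * cnj (w j p))" by (rule sum.swap)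
  also have "\<dots> = (\<Sum>p<n. 1)" using P by (intro sum.cong refl) (simp add: povm_def)
  finally have "complex_of_real (\<Sum>j<m. t j) = of_real (real n)" by simp
  hence ts: "(\<Sum>j<m. t j) = real n" by (simp only: of_real_eq_iff)
  hence "m \<noteq> 0" using n0 by (intro notI) simp
  have \<Lambda>: "\<Lambda> j \<in> K" if "j < m" for j using P that by (simp add: povm_def)
  \<comment> \<open>A zero vector has weight zero; the first coordinate vector stands in for it to
    stay within unit vectors.\<close>
  define y where "y = (\<lambda>j. rank_one n (if t j = 0 then (\<lambda>p. if p = 0 then 1 else 0) else (\<lambda>p. of_real (1 / sqrt (t j)) * w j p)) (\<Lambda> j))"
  have yS: "y j \<in> rank_ones K n" if "j < m" for j
  proof (cases "t j = 0")
    case True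
    have "(\<Sum>p<n. (cmod (if p = 0 then 1 else 0))\<^sup>2) = (\<Sum>p<n. if p = 0 then 1 else (0::real))" by (intro sum.cong refl) auto
    hence "(\<Sum>p<n. (cmod (if p = 0 then 1 else 0))\<^sup>2) = 1" using n0 by simp
    from rank_one_in_rank_ones[OF this \<Lambda>[OF that] n0] show ?thesis using True by (simp add: y_def)
  next
    case False
    have "(\<Sum>p<n. (cmod (of_real (1 / sqrt (t j)) * w j p))\<^sup>2) = (\<Sum>p<n. (1 / t j) * (cmod (w j p))\<^sup>2)"
      using t0[of j] by (intro sum.cong refl) (simp only: norm_mult norm_of_real power_mult_distrib, simp add: power_divide)
    also have "\<dots> = (1 / t j) * t j" unfolding t_def by (rule sum_distrib_left[symmetric])
    also have "\<dots> = 1" using False by simp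
    finally show ?thesis using rank_one_in_rank_ones[OF _ \<Lambda>[OF that] n0] False by (simp add: y_def)
  qed
  have ty: "t j *\<^sub>R y j = rank_one n (w j) (\<Lambda> j)" for j
  proof (cases "t j = 0")
    case True
    hence "w j p = 0" if "p < n" for p using that unfolding t_def by (subst (asm) sum_nonneg_eq_0_iff) auto
    hence "matvec n (\<lambda>p q. w j p * cnj (w j q)) = matvec n (\<lambda>p q. 0)" by (intro matvec_cong n0) simp
    hence "matvec n (\<lambda>p q. w j p * cnj (w j q)) = 0" by (simp add: matvec_def)
    thus ?thesis using True by (simp add: rank_one_def prod_eq_iff Finite_Cartesian_Product.vec_eq_iff)
  next
    case False
    thus ?thesis using t0[of j] by (simp only: y_def if_False rank_one_scale) (simp add: power_divide)
  qed
  have "(1 / real n) *\<^sub>R emb n a = (\<Sum>j<m. (t j / real n) *\<^sub>R y j)"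
    unfolding povm_emb[OF n0 P] scaleR_sum_right ty[symmetric] by simp
  also have "\<dots> \<in> convex hull (rank_ones K n)"
  proof (rule convex_sum[OF _ convex_convex_hull])
    show "(\<Sum>j<m. t j / real n) = 1" unfolding sum_divide_distrib[symmetric] ts using n0 by simp
  qed (use t0 yS in \<open>auto intro: hull_inc\<close>)
  finally show ?thesis .
qed

definition unemb :: "nat \<Rightarrow> ell2 \<times> (ell2^'d) \<Rightarrow> 'd \<Rightarrow> complex mat" where
  "unemb n x = (\<lambda>l. mat n n (\<lambda>(p, q). of_nat n * ell2_nth (vec_nth (snd x) l) (p * n + q)))"

text \<open>Convex weights are multiplied by \<open>n\<close> and absorbed into the vectors as
  square roots; the condition on the first component says exactly that the resulting effects sum to
  the identity.\<close>

lemma hull_imp_Kmin: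
  assumes n: "1 \<le> n" and x: "x \<in> convex hull (rank_ones K n)" and f: "fst x = (1 / real n) *\<^sub>R matvec n ident"
  shows "(n, unemb n x) \<in> Kmin K"
proof -
  have n0: "0 < n" using n by simp
  obtain T c where T: "finite T" "T \<subseteq> rank_ones K n" "\<forall>y\<in>T. 0 \<le> c y" "sum c T = 1" "(\<Sum>v\<in>T. c v *\<^sub>R v) = x"
    using x unfolding convex_hull_explicit by blast
  have "\<forall>v\<in>T. \<exists>u \<mu>. v = rank_one n u \<mu> \<and> \<mu> \<in> K" using T(2) unfolding rank_ones_def by fastforce
  then obtain u \<mu> where ul: "\<And>v. v \<in> T \<Longrightarrow> v = rank_one n (u v) (\<mu> v)" "\<And>v. v \<in> T \<Longrightarrow> \<mu> v \<in> K" by metis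
  obtain b where b: "bij_betw b {..<card T} T" using ex_bij_betw_nat_finite[OF T(1)] by (auto simp: atLeast0LessThan)
  define w where "w = (\<lambda>j p. of_real (sqrt (real n * c (b j))) * u (b j) p)"
  have bT: "b j \<in> T" if "j < card T" for j using b that by (auto simp: bij_betw_def)
  have sx: "real n *\<^sub>R x = (\<Sum>j<card T. rank_one n (w j) (\<mu> (b j)))"
  proof -
    have "real n *\<^sub>R x = (\<Sum>v\<in>T. (real n * c v) *\<^sub>R v)" using T(5) by (simp add: scaleR_sum_right[symmetric] flip: scaleR_scaleR)
    also have "\<dots> = (\<Sum>j<card T. (real n * c (b j)) *\<^sub>R b j)" by (rule sum.reindex_bij_betw[OF b, symmetric])
    also have "\<dots> = (\<Sum>j<card T. rank_one n (w j) (\<mu> (b j)))"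
    proof (intro sum.cong refl)
      fix j assume "j \<in> {..<card T}"
      hence j: "b j \<in> T" using bT by simp
      have "0 \<le> real n * c (b j)" using T(3) j by simp
      hence "rank_one n (w j) (\<mu> (b j)) = (real n * c (b j)) *\<^sub>R rank_one n (u (b j)) (\<mu> (b j))"
        unfolding w_def rank_one_scale by simp
      thus "(real n * c (b j)) *\<^sub>R b j = rank_one n (w j) (\<mu> (b j))" using ul(1)[OF j] by simp
    qed
    finally show ?thesis .
  qed
  have fs: "matvec n ident = (\<Sum>j<card T. matvec n (\<lambda>p q. w j p * cnj (w j q)))"
    using arg_cong[OF sx, of fst] f n0 by (simp add: fst_sum rank_one_def)
  have ss: "real n *\<^sub>R vec_nth (snd x) l = (\<Sum>j<card T. vec_nth (\<mu> (b j)) l *\<^sub>R matvec n (\<lambda>p q. w j p * cnj (w j q)))" for l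
    using arg_cong[OF sx, of "\<lambda>x. vec_nth (snd x) l"] by (simp add: snd_sum rank_one_def)
  have "povm K n (card T) w (\<lambda>j. \<mu> (b j)) (unemb n x)" unfolding povm_def
  proof (intro conjI allI impI)
    fix j assume "j < card T" thus "\<mu> (b j) \<in> K" using bT ul(2) by blast
  next
    fix p q assume pq: "p < n" "q < n"
    have "(\<Sum>j<card T. w j p * cnj (w j q)) = ell2_nth (\<Sum>j<card T. matvec n (\<lambda>p q. w j p * cnj (w j q))) (p * n + q)"
      by (simp add: ell2_nth_matvec pq)
    also have "\<dots> = ident p q" unfolding fs[symmetric] by (rule ell2_nth_matvec[OF pq])
    finally show "(\<Sum>j<card T. w j p * cnj (w j q)) = (if p = q then 1 else 0)" by (simp add: ident_def)
  next
    fix l show "unemb n x l \<in> carrier_mat n n" by (simp add: unemb_def)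
    fix p q assume pq: "p < n" "q < n"
    have "unemb n x l $$ (p, q) = ell2_nth (real n *\<^sub>R vec_nth (snd x) l) (p * n + q)" using pq by (simp add: unemb_def)
    also have "\<dots> = (\<Sum>j<card T. of_real (vec_nth (\<mu> (b j)) l) * (w j p * cnj (w j q)))"
      unfolding ss by (simp add: ell2_nth_matvec pq)
    finally show "unemb n x l $$ (p, q) = (\<Sum>j<card T. of_real (vec_nth (\<mu> (b j)) l) * (w j p * cnj (w j q)))" .
  qed
  thus ?thesis using n unfolding Kmin_iff_povm by blast
qed

lemma unemb_emb:
  assumes "\<And>l. a l \<in> carrier_mat n n" "0 < n" shows "unemb n ((1 / real n) *\<^sub>R emb n a) = a"
proof
  fix l
  show "unemb n ((1 / real n) *\<^sub>R emb n a) l = a l"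
    by (rule eq_matI) (use assms(1)[of l] assms(2) in \<open>auto simp: unemb_def emb_def ell2_nth_matvec\<close>)
qed

lemma Kmin_carrier: "(n, a) \<in> Kmin K \<Longrightarrow> 1 \<le> n \<and> (\<forall>l. a l \<in> carrier_mat n n)"
  unfolding Kmin_iff_povm povm_def by blast

text \<open>The level is the continuous image of an affine slice of the compact convex hull.\<close>

lemma compact_Kmin_level:
  assumes K: "compact (K :: (real^'d) set)" and n: "1 \<le> n" shows "compact (mat_entries n ` (Kmin K `` {n}))"
proof -
  define C where "C = convex hull (rank_ones K n) \<inter> {x. fst x = (1 / real n) *\<^sub>R matvec n ident}"
  have "closed {x :: ell2 \<times> (ell2^'d). fst x = (1 / real n) *\<^sub>R matvec n ident}"
    by (intro closed_Collect_eq continuous_intros)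
  hence C: "compact C" unfolding C_def by (rule compact_Int_closed[OF compact_hull_rank_ones[OF K]])
  have "continuous_on C (\<lambda>x l i j. if i < n \<and> j < n then of_nat n * ell2_nth (vec_nth (snd x) l) (i * n + j) else 0)"
  proof (intro continuous_on_coordinatewise_then_product)
    fix l i j
    show "continuous_on C (\<lambda>x. if i < n \<and> j < n then of_nat n * ell2_nth (vec_nth (snd x) l) (i * n + j) else 0)"
      by (cases "i < n \<and> j < n") (auto intro!: continuous_intros)
  qed
  moreover have "(\<lambda>x l i j. if i < n \<and> j < n then of_nat n * ell2_nth (vec_nth (snd x) l) (i * n + j) else 0) = (\<lambda>x :: ell2 \<times> (ell2^'d). mat_entries n (unemb n x))"
    by (auto simp: mat_entries_def unemb_def fun_eq_iff)
  ultimately have cont: "continuous_on C (\<lambda>x. mat_entries n (unemb n x))" by (simp only:)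
  have "mat_entries n ` (Kmin K `` {n}) = (\<lambda>x. mat_entries n (unemb n x)) ` C"
  proof (intro equalityI subsetI)
    fix e assume "e \<in> mat_entries n ` (Kmin K `` {n})"
    then obtain a where a: "(n, a) \<in> Kmin K" "e = mat_entries n a" by blast
    have "(1 / real n) *\<^sub>R emb n a \<in> C" unfolding C_def using Kmin_imp_hull[OF a(1)] by (simp add: emb_def)
    moreover have "unemb n ((1 / real n) *\<^sub>R emb n a) = a" using Kmin_carrier[OF a(1)] n by (intro unemb_emb) auto
    ultimately show "e \<in> (\<lambda>x. mat_entries n (unemb n x)) ` C" using a(2) by (metis imageI)
  next
    fix e assume "e \<in> (\<lambda>x. mat_entries n (unemb n x)) ` C"
    thus "e \<in> mat_entries n ` (Kmin K `` {n})" using hull_imp_Kmin[OF n] unfolding C_def by blast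
  qed
  thus ?thesis using compact_continuous_image[OF cont C] by simp
qed

section \<open>Closure under matrix convex combinations\<close>

lemma povm_of_finite:
  assumes I: "finite I" and \<Lambda>: "\<And>i. i \<in> I \<Longrightarrow> \<Lambda> i \<in> K"
    and one: "\<And>p q. p < n \<Longrightarrow> q < n \<Longrightarrow> (\<Sum>i\<in>I. w i p * cnj (w i q)) = (if p = q then 1 else 0)"
    and ac: "\<And>l. a l \<in> carrier_mat n n"
    and a: "\<And>l p q. p < n \<Longrightarrow> q < n \<Longrightarrow> a l $$ (p, q) = (\<Sum>i\<in>I. of_real (vec_nth (\<Lambda> i) l) * (w i p * cnj (w i q)))"
  shows "\<exists>m w \<Lambda>. povm K n m w \<Lambda> a"
proof -
  obtain b where b: "bij_betw b {..<card I} I" using ex_bij_betw_nat_finite[OF I] by (auto simp: atLeast0LessThan)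
  have bI: "b j \<in> I" if "j < card I" for j using b that by (auto simp: bij_betw_def)
  have r: "(\<Sum>j<card I. f (b j)) = (\<Sum>i\<in>I. f i)" for f :: "'a \<Rightarrow> complex" by (rule sum.reindex_bij_betw[OF b])
  have "povm K n (card I) (\<lambda>j. w (b j)) (\<lambda>j. \<Lambda> (b j)) a"
    unfolding povm_def
  proof (intro conjI allI impI)
    fix p q assume pq: "p < n" "q < n"
    show "(\<Sum>j<card I. w (b j) p * cnj (w (b j) q)) = (if p = q then 1 else 0)"
      using r[of "\<lambda>i. w i p * cnj (w i q)"] one[OF pq] by simp
    show "a l $$ (p, q) = (\<Sum>j<card I. of_real (vec_nth (\<Lambda> (b j)) l) * (w (b j) p * cnj (w (b j) q)))" for l
      using r[of "\<lambda>i. of_real (vec_nth (\<Lambda> i) l) * (w i p * cnj (w i q))"] a[OF pq] by simp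
  qed (use bI \<Lambda> ac in auto)
  thus ?thesis by blast
qed

lemma index_conj_mult:
  fixes A G :: "complex mat"
  assumes A: "A \<in> carrier_mat N N" and G: "G \<in> carrier_mat N n" and pq: "p < n" "q < n"
  shows "(mat_adjoint G * A * G) $$ (p, q) = (\<Sum>r<N. \<Sum>s<N. cnj (G $$ (r, p)) * A $$ (r, s) * G $$ (s, q))"
proof -
  have AG: "A * G \<in> carrier_mat N n" by (rule mult_carrier_mat[OF A G])
  have "mat_adjoint G * A * G = mat_adjoint G * (A * G)" by (rule assoc_mult_mat[OF mat_adjoint_carrier[OF G] A G])
  also have "\<dots> $$ (p, q) = (\<Sum>r<N. cnj (G $$ (r, p)) * (A * G) $$ (r, q))"
    by (rule index_adjoint_mult[OF G AG pq])
  also have "\<dots> = (\<Sum>r<N. \<Sum>s<N. cnj (G $$ (r, p)) * A $$ (r, s) * G $$ (s, q))"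
  proof (intro sum.cong refl)
    fix r assume "r \<in> {..<N}"
    hence "(A * G) $$ (r, q) = (\<Sum>s<N. A $$ (r, s) * G $$ (s, q))"
      using A G pq by (auto simp: scalar_prod_def lessThan_atLeast0 intro!: sum.cong)
    thus "cnj (G $$ (r, p)) * (A * G) $$ (r, q) = (\<Sum>s<N. cnj (G $$ (r, p)) * A $$ (r, s) * G $$ (s, q))"
      by (simp add: sum_distrib_left mult.assoc)
  qed
  finally show ?thesis .
qed

text \<open>Expresses a sum of compressed rank-one terms through the entries of the uncompressed
  sum; this recurs wherever a rank-one measure meets a quadratic form.\<close>

lemma sum_rank_one_conj:
  fixes g h :: "nat \<Rightarrow> complex"
  shows "(\<Sum>i\<in>I. k i * ((\<Sum>r<N. g r * w i r) * cnj (\<Sum>s<N. cnj (h s) * w i s))) =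
    (\<Sum>r<N. \<Sum>s<N. g r * (\<Sum>i\<in>I. k i * (w i r * cnj (w i s))) * h s)"
proof -
  have "(\<Sum>i\<in>I. k i * ((\<Sum>r<N. g r * w i r) * cnj (\<Sum>s<N. cnj (h s) * w i s))) =
      (\<Sum>i\<in>I. \<Sum>r<N. \<Sum>s<N. g r * (k i * (w i r * cnj (w i s))) * h s)"
  proof (intro sum.cong refl)
    fix i
    have "(\<Sum>r<N. g r * w i r) * cnj (\<Sum>s<N. cnj (h s) * w i s) = (\<Sum>r<N. \<Sum>s<N. (g r * w i r) * (h s * cnj (w i s)))"
      unfolding cnj_sum by (simp add: sum_product)
    thus "k i * ((\<Sum>r<N. g r * w i r) * cnj (\<Sum>s<N. cnj (h s) * w i s)) =
        (\<Sum>r<N. \<Sum>s<N. g r * (k i * (w i r * cnj (w i s))) * h s)"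
      by (simp only: sum_distrib_left) (intro sum.cong refl, simp add: mult_ac)
  qed
  also have "\<dots> = (\<Sum>r<N. \<Sum>i\<in>I. \<Sum>s<N. g r * (k i * (w i r * cnj (w i s))) * h s)" by (rule sum.swap)
  also have "\<dots> = (\<Sum>r<N. \<Sum>s<N. \<Sum>i\<in>I. g r * (k i * (w i r * cnj (w i s))) * h s)"
    by (intro sum.cong refl sum.swap)
  also have "\<dots> = (\<Sum>r<N. \<Sum>s<N. g r * (\<Sum>i\<in>I. k i * (w i r * cnj (w i s))) * h s)"
    by (simp add: sum_distrib_left sum_distrib_right)
  finally show ?thesis .
qed

text \<open>Compressing by \<open>\<gamma> j\<close> multiplies the vectors \<open>w j i\<close> by
  the adjoint of \<open>\<gamma> j\<close>; the compressed families, indexed by pairs, form one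
  measure because the \<open>\<gamma>\<^sub>j\<^sup>* \<gamma>\<^sub>j\<close> sum to the
  identity.\<close>

lemma Kmin_convex_combination:
  fixes m :: nat
  assumes n: "1 \<le> n" and aj: "\<And>j. j < m \<Longrightarrow> (N j, a j) \<in> Kmin K" and gj: "\<And>j. j < m \<Longrightarrow> \<gamma> j \<in> carrier_mat (N j) n"
    and one: "(\<Oplus>\<^bsub>M_alg n\<^esub>j\<in>{..<m}. mat_adjoint (\<gamma> j) * \<gamma> j) = 1\<^sub>m n"
  shows "(n, \<lambda>l. \<Oplus>\<^bsub>M_alg n\<^esub>j\<in>{..<m}. mat_adjoint (\<gamma> j) * a j l * \<gamma> j) \<in> Kmin K"
proof -
  have "\<forall>j. \<exists>M w \<Lambda>. j < m \<longrightarrow> povm K (N j) M w \<Lambda> (a j)" using aj unfolding Kmin_iff_povm by blast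
  then obtain M w \<Lambda> where P: "\<And>j. j < m \<Longrightarrow> povm K (N j) (M j) (w j) (\<Lambda> j) (a j)" by metis
  have ac: "a j l \<in> carrier_mat (N j) (N j)" if "j < m" for j l using Kmin_carrier[OF aj[OF that]] by blast
  have gc: "mat_adjoint (\<gamma> j) * \<gamma> j \<in> carrier_mat n n" if "j \<in> {..<m}" for j
    using gj[of j] that by (intro mult_carrier_mat[OF mat_adjoint_carrier[OF gj] gj]) auto
  have gac: "mat_adjoint (\<gamma> j) * a j l * \<gamma> j \<in> carrier_mat n n" if "j \<in> {..<m}" for j l
  proof -
    have j: "j < m" using that by simp
    show ?thesis by (rule mult_carrier_mat[OF mult_carrier_mat[OF mat_adjoint_carrier[OF gj[OF j]] ac[OF j]] gj[OF j]])
  qed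
  let ?b = "\<lambda>l. \<Oplus>\<^bsub>M_alg n\<^esub>j\<in>{..<m}. mat_adjoint (\<gamma> j) * a j l * \<gamma> j"
  define I where "I = (SIGMA j:{..<m}. {..<M j})"
  define W :: "nat \<times> nat \<Rightarrow> nat \<Rightarrow> complex" where "W = (\<lambda>(j, i) p. \<Sum>r<N j. cnj (\<gamma> j $$ (r, p)) * w j i r)"
  define \<Omega> where "\<Omega> = (\<lambda>(j, i). \<Lambda> j i)"
  have S: "(\<Sum>x\<in>I. k x * (W x p * cnj (W x q))) =
      (\<Sum>j<m. \<Sum>r<N j. \<Sum>s<N j. cnj (\<gamma> j $$ (r, p)) * (\<Sum>i<M j. k (j, i) * (w j i r * cnj (w j i s))) * \<gamma> j $$ (s, q))"
    for k :: "nat \<times> nat \<Rightarrow> complex" and p q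
  proof -
    have "(\<Sum>x\<in>I. k x * (W x p * cnj (W x q))) = (\<Sum>j<m. \<Sum>i<M j. k (j, i) * (W (j, i) p * cnj (W (j, i) q)))"
      unfolding I_def by (subst sum.Sigma) (auto simp: case_prod_unfold)
    also have "\<dots> = (\<Sum>j<m. \<Sum>r<N j. \<Sum>s<N j. cnj (\<gamma> j $$ (r, p)) * (\<Sum>i<M j. k (j, i) * (w j i r * cnj (w j i s))) * \<gamma> j $$ (s, q))"
      unfolding W_def prod.case by (intro sum.cong refl sum_rank_one_conj)
    finally show ?thesis .
  qed
  have "\<exists>m w \<Lambda>. povm K n m w \<Lambda> ?b"
  proof (rule povm_of_finite[where I = I and w = W and \<Lambda> = \<Omega>])
    show "finite I" by (simp add: I_def)
    show "\<Omega> x \<in> K" if "x \<in> I" for x using that P unfolding I_def \<Omega>_def povm_def by auto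
    show "?b l \<in> carrier_mat n n" for l by (rule finsum_M_alg(1)[OF finite_lessThan gac])
  next
    fix p q assume pq: "p < n" "q < n"
    have "(\<Sum>x\<in>I. W x p * cnj (W x q)) =
        (\<Sum>j<m. \<Sum>r<N j. \<Sum>s<N j. cnj (\<gamma> j $$ (r, p)) * (\<Sum>i<M j. w j i r * cnj (w j i s)) * \<gamma> j $$ (s, q))"
      using S[of "\<lambda>_. 1" p q] by simp
    also have "\<dots> = (\<Sum>j<m. \<Sum>r<N j. \<Sum>s<N j. if s = r then cnj (\<gamma> j $$ (r, p)) * \<gamma> j $$ (r, q) else 0)"
      by (intro sum.cong refl) (use P in \<open>auto simp: povm_def\<close>)
    also have "\<dots> = (\<Sum>j<m. \<Sum>r<N j. cnj (\<gamma> j $$ (r, p)) * \<gamma> j $$ (r, q))" by (intro sum.cong refl) simp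
    also have "\<dots> = (\<Sum>j<m. (mat_adjoint (\<gamma> j) * \<gamma> j) $$ (p, q))"
      by (intro sum.cong refl index_adjoint_mult[symmetric, OF gj gj pq]) auto
    also have "\<dots> = 1\<^sub>m n $$ (p, q)" unfolding one[symmetric] by (rule finsum_M_alg(2)[symmetric, OF finite_lessThan gc pq])
    finally show "(\<Sum>x\<in>I. W x p * cnj (W x q)) = (if p = q then 1 else 0)" using pq by simp
    fix l
    have "?b l $$ (p, q) = (\<Sum>j<m. (mat_adjoint (\<gamma> j) * a j l * \<gamma> j) $$ (p, q))"
      by (rule finsum_M_alg(2)[OF finite_lessThan gac pq])
    also have "\<dots> = (\<Sum>j<m. \<Sum>r<N j. \<Sum>s<N j. cnj (\<gamma> j $$ (r, p)) * a j l $$ (r, s) * \<gamma> j $$ (s, q))"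
      by (intro sum.cong refl index_conj_mult[OF ac gj pq]) auto
    also have "\<dots> = (\<Sum>j<m. \<Sum>r<N j. \<Sum>s<N j. cnj (\<gamma> j $$ (r, p)) *
        (\<Sum>i<M j. of_real (vec_nth (\<Omega> (j, i)) l) * (w j i r * cnj (w j i s))) * \<gamma> j $$ (s, q))"
      by (intro sum.cong refl) (use P in \<open>auto simp: povm_def \<Omega>_def\<close>)
    also have "\<dots> = (\<Sum>x\<in>I. of_real (vec_nth (\<Omega> x) l) * (W x p * cnj (W x q)))" by (rule S[symmetric])
    finally show "?b l $$ (p, q) = (\<Sum>x\<in>I. of_real (vec_nth (\<Omega> x) l) * (W x p * cnj (W x q)))" .
  qed
  thus ?thesis using n unfolding Kmin_iff_povm by blast
qed

lemma compact_matrix_convex_Kmin: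
  assumes "compact (K :: (real^'d) set)" shows "compact_matrix_convex (Kmin K)"
  unfolding compact_matrix_convex_def
proof (intro conjI allI impI)
  show "Kmin K \<subseteq> (SIGMA n:{1..}. {a. \<forall>l. a l \<in> carrier_mat n n})" using Kmin_carrier by fastforce
  show "compact (mat_entries n ` (Kmin K `` {n}))" if "1 \<le> n" for n by (rule compact_Kmin_level[OF assms that])
next
  fix n m :: nat and N :: "nat \<Rightarrow> nat" and a and \<gamma> :: "nat \<Rightarrow> complex mat"
  assume "1 \<le> n" and h: "(\<forall>j<m. (N j, a j) \<in> Kmin K \<and> \<gamma> j \<in> carrier_mat (N j) n) \<and>
      (\<Oplus>\<^bsub>M_alg n\<^esub>j\<in>{..<m}. mat_adjoint (\<gamma> j) * \<gamma> j) = 1\<^sub>m n"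
  show "(n, \<lambda>l. \<Oplus>\<^bsub>M_alg n\<^esub>j\<in>{..<m}. mat_adjoint (\<gamma> j) * a j l * \<gamma> j) \<in> Kmin K"
    by (rule Kmin_convex_combination[OF \<open>1 \<le> n\<close>]) (use h in auto)
qed

section \<open>Separation by affine functions with matrix coefficients\<close>

lemma quad_add: "quad n (\<lambda>i j. f i j + g i j) v = quad n f v + quad n g v"
  unfolding quad_def by (simp add: algebra_simps sum.distrib)

lemma quad_scale: "quad n (\<lambda>i j. k * f i j) v = k * quad n f v"
  unfolding quad_def sum_distrib_left by (intro sum.cong refl) (simp add: mult_ac)

lemma quad_sum: "quad n (\<lambda>i j. \<Sum>l\<in>F. f l i j) v = (\<Sum>l\<in>F. quad n (f l) v)"
proof (induction F rule: infinite_finite_induct)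
  case (insert x F) thus ?case by (simp add: quad_add)
qed (simp_all add: quad_def)

lemma quad_ident: "quad n ident v = of_real (\<Sum>p<n. (cmod (v p))\<^sup>2)"
proof -
  have "quad n ident v = (\<Sum>i<n. \<Sum>j<n. if j = i then cnj (v i) * v i else 0)"
    unfolding quad_def by (intro sum.cong refl) (auto simp: ident_def)
  also have "\<dots> = (\<Sum>i<n. cnj (v i) * v i)" by simp
  also have "\<dots> = of_real (\<Sum>p<n. (cmod (v p))\<^sup>2)"
    unfolding of_real_sum by (intro sum.cong refl) (simp only: complex_norm_square mult.commute)
  finally show ?thesis .
qed

text \<open>A real linear functional on matrices has the Hermitian part of its coefficients as
  quadratic form; the value at \<open>v\<close> is the functional at the rank-one matrix built from
  \<open>cnj v\<close>.\<close>

lemma quad_herm: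
  "quad n (\<lambda>p q. (cnj (Z p q) + Z q p) / 2) v = of_real (Re (\<Sum>p<n. \<Sum>q<n. cnj (Z p q) * (cnj (v p) * v q)))"
proof -
  define A where "A = (\<Sum>p<n. \<Sum>q<n. cnj (Z p q) * (cnj (v p) * v q))"
  have "cnj A = (\<Sum>p<n. \<Sum>q<n. Z p q * (v p * cnj (v q)))" by (simp add: A_def)
  also have "\<dots> = (\<Sum>q<n. \<Sum>p<n. Z p q * (v p * cnj (v q)))" by (rule sum.swap)
  finally have cA: "cnj A = (\<Sum>p<n. \<Sum>q<n. Z q p * (v q * cnj (v p)))" .
  have "quad n (\<lambda>p q. (cnj (Z p q) + Z q p) / 2) v = (A + cnj A) / 2"
    unfolding cA unfolding A_def quad_def sum.distrib[symmetric] sum_divide_distrib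
    by (intro sum.cong refl) (simp add: field_simps)
  also have "\<dots> = of_real (Re A)" by (simp add: complex_add_cnj)
  finally show ?thesis by (simp add: A_def)
qed

text \<open>Against a Hermitian matrix only the Hermitian part of the coefficients contributes to
  the real part.\<close>

lemma Re_herm_pairing:
  assumes "\<And>p q. p < n \<Longrightarrow> q < n \<Longrightarrow> a q p = cnj (a p q)"
  shows "Re (\<Sum>p<n. \<Sum>q<n. (cnj (Z p q) + Z q p) / 2 * a p q) = Re (\<Sum>p<n. \<Sum>q<n. cnj (Z p q) * a p q)"
proof -
  define A where "A = (\<Sum>p<n. \<Sum>q<n. cnj (Z p q) * a p q)"
  have "cnj A = (\<Sum>p<n. \<Sum>q<n. Z p q * cnj (a p q))" by (simp add: A_def)
  also have "\<dots> = (\<Sum>p<n. \<Sum>q<n. Z p q * a q p)"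
  proof (intro sum.cong refl)
    fix p q assume "p \<in> {..<n}" "q \<in> {..<n}"
    hence "a q p = cnj (a p q)" using assms[of p q] by blast
    thus "Z p q * cnj (a p q) = Z p q * a q p" by (rule arg_cong[OF sym])
  qed
  also have "\<dots> = (\<Sum>q<n. \<Sum>p<n. Z p q * a q p)" by (rule sum.swap)
  finally have cA: "cnj A = (\<Sum>p<n. \<Sum>q<n. Z q p * a p q)" .
  have "(\<Sum>p<n. \<Sum>q<n. (cnj (Z p q) + Z q p) / 2 * a p q) = (A + cnj A) / 2"
    unfolding cA unfolding A_def sum.distrib[symmetric] sum_divide_distrib
    by (intro sum.cong refl) (simp add: field_simps)
  also have "\<dots> = of_real (Re A)" by (simp add: complex_add_cnj)
  finally show ?thesis by (simp add: A_def)
qed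

definition affine_mat ::
  "(nat \<Rightarrow> nat \<Rightarrow> complex) \<Rightarrow> ('d::finite \<Rightarrow> nat \<Rightarrow> nat \<Rightarrow> complex) \<Rightarrow> real^'d \<Rightarrow> nat \<Rightarrow> nat \<Rightarrow> complex" where
  "affine_mat c0 c \<mu> = (\<lambda>i j. c0 i j + (\<Sum>l\<in>UNIV. of_real (vec_nth \<mu> l) * c l i j))"

text \<open>A point outside the minimal set is strictly separated from the compact hull of
  \<open>rank_ones\<close>. Evaluated on rank-one matrices the functional is a quadratic form
  depending affinely on \<open>\<mu>\<close>, so strict separation yields an affine function that is
  strictly positive on \<open>K\<close> yet negative at \<open>a\<close>, contradicting
  \<open>H\<close>.\<close>

lemma Kmin_separation:
  fixes K :: "(real^'d) set"
  assumes n: "1 \<le> n" and K: "compact K" "K \<noteq> {}" and ac: "\<And>l. a l \<in> carrier_mat n n"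
    and herm: "\<And>l p q. p < n \<Longrightarrow> q < n \<Longrightarrow> a l $$ (q, p) = cnj (a l $$ (p, q))"
    and H: "\<And>c0 c. (\<And>\<mu>. \<mu> \<in> K \<Longrightarrow> psd n (affine_mat c0 c \<mu>)) \<Longrightarrow>
      (\<And>\<mu> v. \<mu> \<in> K \<Longrightarrow> \<exists>i<n. v i \<noteq> 0 \<Longrightarrow> quad n (affine_mat c0 c \<mu>) v \<noteq> 0) \<Longrightarrow>
      0 \<le> Re ((\<Sum>i<n. c0 i i) + (\<Sum>l\<in>UNIV. \<Sum>i<n. \<Sum>j<n. c l i j * a l $$ (i, j)))"
  shows "(n, a) \<in> Kmin K"
proof (rule ccontr)
  assume nK: "(n, a) \<notin> Kmin K"
  have n0: "0 < n" using n by simp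
  let ?C = "convex hull (rank_ones K n)" and ?x = "(1 / real n) *\<^sub>R emb n a"
  have C1: "?x \<notin> ?C"
  proof
    assume "?x \<in> ?C"
    from hull_imp_Kmin[OF n this] have "(n, unemb n ?x) \<in> Kmin K" by (simp add: emb_def)
    thus False using nK unemb_emb[of a n, OF ac n0] by simp
  qed
  have C2: "?C \<noteq> {}"
  proof -
    obtain \<mu> where "\<mu> \<in> K" using K(2) by blast
    have "(\<Sum>p<n. (cmod (if p = 0 then 1 else 0))\<^sup>2) = (\<Sum>p<n. if p = 0 then 1 else (0::real))" by (intro sum.cong refl) auto
    hence "(\<Sum>p<n. (cmod (if p = 0 then 1 else 0))\<^sup>2) = 1" using n0 by simp
    from hull_inc[OF rank_one_in_rank_ones[OF this \<open>\<mu> \<in> K\<close> n0]] show ?thesis by blast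
  qed
  obtain z b where "inner z ?x < b \<and> (\<forall>y\<in>?C. b < inner z y)"
    using separate_point_compact[OF compact_hull_rank_ones[OF K(1)] convex_convex_hull C2 C1] by (elim exE)
  hence zb: "inner z ?x < b" "\<And>y. y \<in> ?C \<Longrightarrow> b < inner z y" by simp_all
  define Z0 where "Z0 = (\<lambda>p q. ell2_nth (fst z) (p * n + q))"
  define Z where "Z = (\<lambda>l p q. ell2_nth (vec_nth (snd z) l) (p * n + q))"
  \<comment> \<open>The threshold \<open>b\<close> is moved into the constant term, as a multiple of
    the identity; this turns the strict inequality into positivity.\<close>
  define c0 where "c0 = (\<lambda>p q. (cnj (Z0 p q) + Z0 q p) / 2 + of_real (- b) * ident p q)"
  define c where "c = (\<lambda>l p q. (cnj (Z l p q) + Z l q p) / 2)"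
  have inn: "inner z (matvec n f, \<chi> l. matvec n (g l)) = Re (\<Sum>p<n. \<Sum>q<n. cnj (Z0 p q) * f p q)
      + (\<Sum>l\<in>UNIV. Re (\<Sum>p<n. \<Sum>q<n. cnj (Z l p q) * g l p q))" for f g
    by (simp add: inner_prod_def inner_vec_def inner_matvec[OF n0] Z0_def Z_def)
  have ro: "inner z (rank_one n u \<mu>) = Re (\<Sum>p<n. \<Sum>q<n. cnj (Z0 p q) * (u p * cnj (u q)))
      + (\<Sum>l\<in>UNIV. vec_nth \<mu> l * Re (\<Sum>p<n. \<Sum>q<n. cnj (Z l p q) * (u p * cnj (u q))))" for u \<mu>
    unfolding rank_one_def by (simp add: inner_prod_def inner_vec_def inner_matvec[OF n0] Z0_def Z_def)
  have q: "quad n (affine_mat c0 c \<mu>) v = of_real (inner z (rank_one n (\<lambda>p. cnj (v p)) \<mu>) - b * (\<Sum>p<n. (cmod (v p))\<^sup>2))" for v \<mu>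
    unfolding affine_mat_def c0_def c_def quad_add quad_sum quad_scale quad_herm quad_ident ro by simp
  have qpos: "0 < inner z (rank_one n (\<lambda>p. cnj (v p)) \<mu>) - b * (\<Sum>p<n. (cmod (v p))\<^sup>2)"
    if \<mu>: "\<mu> \<in> K" and v: "\<exists>i<n. v i \<noteq> 0" for v \<mu>
  proof -
    \<comment> \<open>The separation concerns unit vectors; scaling by \<open>1 / sqrt t\<close>
      carries it to every nonzero \<open>v\<close>.\<close>
    define t where "t = (\<Sum>p<n. (cmod (v p))\<^sup>2)"
    obtain i where i: "i < n" "v i \<noteq> 0" using v by blast
    have "(cmod (v i))\<^sup>2 \<le> t" unfolding t_def using i by (intro member_le_sum) auto
    moreover have "0 < (cmod (v i))\<^sup>2" using i by simp
    ultimately have t: "0 < t" by linarith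
    define u where "u = (\<lambda>p. of_real (1 / sqrt t) * cnj (v p))"
    have "(\<Sum>p<n. (cmod (u p))\<^sup>2) = (\<Sum>p<n. (1 / t) * (cmod (v p))\<^sup>2)"
      using t unfolding u_def
      by (intro sum.cong refl) (simp only: norm_mult norm_of_real power_mult_distrib complex_mod_cnj, simp add: power_divide)
    also have "\<dots> = (1 / t) * t" unfolding t_def by (rule sum_distrib_left[symmetric])
    finally have "(\<Sum>p<n. (cmod (u p))\<^sup>2) = 1" using t by simp
    from zb(2)[OF hull_inc[OF rank_one_in_rank_ones[OF this \<mu> n0]]] have "b < inner z (rank_one n u \<mu>)" .
    also have "inner z (rank_one n u \<mu>) = (1 / t) * inner z (rank_one n (\<lambda>p. cnj (v p)) \<mu>)"
      unfolding u_def rank_one_scale using t by (simp add: power_divide)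
    finally show ?thesis using t by (simp add: t_def[symmetric] field_simps)
  qed
  have "0 \<le> Re ((\<Sum>i<n. c0 i i) + (\<Sum>l\<in>UNIV. \<Sum>i<n. \<Sum>j<n. c l i j * a l $$ (i, j)))"
  proof (rule H[of c0 c])
    fix \<mu> assume \<mu>: "\<mu> \<in> K"
    show "psd n (affine_mat c0 c \<mu>)" unfolding psd_def
    proof
      fix v show "quad n (affine_mat c0 c \<mu>) v \<in> \<real>\<^sub>\<ge>\<^sub>0"
      proof (cases "\<exists>i<n. v i \<noteq> 0")
        case True
        show ?thesis unfolding q nonneg_Reals_of_real_iff using qpos[OF \<mu> True] by simp
      next
        case False
        hence "quad n (affine_mat c0 c \<mu>) v = 0" unfolding quad_def by (intro sum.neutral) simp
        thus ?thesis by simp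
      qed
    qed
    fix v :: "nat \<Rightarrow> complex" assume "\<exists>i<n. v i \<noteq> 0"
    from qpos[OF \<mu> this] show "quad n (affine_mat c0 c \<mu>) v \<noteq> 0" unfolding q of_real_eq_0_iff by simp
  qed
  also have "Re ((\<Sum>i<n. c0 i i) + (\<Sum>l\<in>UNIV. \<Sum>i<n. \<Sum>j<n. c l i j * a l $$ (i, j))) =
      Re (\<Sum>i<n. c0 i i) + (\<Sum>l\<in>UNIV. Re (\<Sum>p<n. \<Sum>q<n. cnj (Z l p q) * a l $$ (p, q)))"
  proof -
    have "Re (\<Sum>i<n. \<Sum>j<n. c l i j * a l $$ (i, j)) = Re (\<Sum>p<n. \<Sum>q<n. cnj (Z l p q) * a l $$ (p, q))" for l
      unfolding c_def by (rule Re_herm_pairing) (rule herm)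
    thus ?thesis by (simp only: plus_complex.sel Re_sum[of _ UNIV])
  qed
  \<comment> \<open>The trace of the threshold term is \<open>n * b\<close>, which matches the
    factor \<open>1 / n\<close> in the separated point.\<close>
  also have "Re (\<Sum>i<n. c0 i i) = Re (\<Sum>p<n. \<Sum>q<n. cnj (Z0 p q) * ident p q) - real n * b"
  proof -
    have "(\<Sum>p<n. \<Sum>q<n. cnj (Z0 p q) * ident p q) = (\<Sum>p<n. cnj (Z0 p p))"
      by (intro sum.cong refl) (simp add: ident_def if_distrib cong: if_cong)
    moreover have "Re (\<Sum>i<n. c0 i i) = (\<Sum>i<n. Re (Z0 i i) - b)"
      unfolding Re_sum by (intro sum.cong refl) (simp add: c0_def ident_def)
    ultimately show ?thesis by (simp add: sum_subtractf)
  qed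
  finally have "real n * b \<le> inner z (emb n a)" unfolding emb_def inn by simp
  moreover have "inner z (emb n a) < real n * b" using zb(1) n0 by (simp add: field_simps)
  ultimately show False by simp
qed

section \<open>Limits along an ultrafilter\<close>

lemma compact_fun_Pi:
  fixes A :: "'i \<Rightarrow> 'b::topological_space set"
  assumes "\<And>i. compact (A i)" shows "compact {p. \<forall>i. p i \<in> A i}"
proof -
  have "compactin (product_topology (\<lambda>i. euclidean) UNIV) (PiE UNIV A)"
    unfolding compactin_PiE using assms by simp
  moreover have "PiE UNIV A = {p. \<forall>i. p i \<in> A i}" by (auto simp: PiE_def Pi_def extensional_def)
  ultimately show ?thesis by (simp add: euclidean_product_topology)
qed

text \<open>Tychonoff: the points listing the \<open>k\<close>-th terms of all bounded sequences lie
  in a compact product and have a cluster point \<open>p\<close>; pulling its neighbourhoods back to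
  the indices gives a filter along which every bounded sequence converges to its entry in
  \<open>p\<close>.\<close>

lemma exists_limit_filter:
  "\<exists>U::nat filter. U \<noteq> bot \<and> U \<le> sequentially \<and> (\<forall>f::nat \<Rightarrow> complex. bounded (range f) \<longrightarrow> (\<exists>l. (f \<longlongrightarrow> l) U))"
proof -
  define A where "A = (\<lambda>f :: nat \<Rightarrow> complex. if bounded (range f) then closure (range f) else {0})"
  define x where "x = (\<lambda>k (f :: nat \<Rightarrow> complex). if bounded (range f) then f k else 0)"
  have "compact {p. \<forall>f. p f \<in> A f}" by (rule compact_fun_Pi) (simp add: A_def compact_closure)
  moreover have "filtermap x sequentially \<noteq> bot" by (simp add: filtermap_bot_iff)
  moreover have "\<forall>\<^sub>F p in filtermap x sequentially. p \<in> {p. \<forall>f. p f \<in> A f}"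
    unfolding eventually_filtermap by (intro always_eventually allI) (auto simp: x_def A_def intro: closure_subset[THEN subsetD])
  ultimately obtain p where p: "inf (nhds p) (filtermap x sequentially) \<noteq> bot"
    unfolding compact_filter by blast
  \<comment> \<open>Intersecting with \<open>sequentially\<close> keeps ordinary limits valid along
    the filter.\<close>
  define U where "U = inf (filtercomap x (nhds p)) sequentially"
  have "U \<noteq> bot"
  proof
    assume "U = bot"
    hence "eventually (\<lambda>_. False) U" by simp
    then obtain Q R where QR: "eventually Q (filtercomap x (nhds p))" "eventually R sequentially" "\<And>k. Q k \<and> R k \<Longrightarrow> False"
      unfolding U_def eventually_inf by auto
    obtain Q' where Q': "eventually Q' (nhds p)" "\<And>k. Q' (x k) \<Longrightarrow> Q k"
      using QR(1) unfolding eventually_filtercomap by blast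
    have "eventually (\<lambda>y. \<exists>k. R k \<and> y = x k) (filtermap x sequentially)"
      unfolding eventually_filtermap by (rule eventually_mono[OF QR(2)]) blast
    hence "eventually (\<lambda>_. False) (inf (nhds p) (filtermap x sequentially))"
      unfolding eventually_inf using Q' QR(3) by blast
    thus False using p by (simp add: eventually_False)
  qed
  moreover have "U \<le> sequentially" by (simp add: U_def)
  moreover have "\<exists>l. (f \<longlongrightarrow> l) U" if f: "bounded (range f)" for f :: "nat \<Rightarrow> complex"
  proof
    have "(x \<longlongrightarrow> p) U"
      unfolding U_def by (rule filterlim_mono[OF filterlim_filtercomap order_refl inf_le1])
    moreover have "((\<lambda>q. q f) \<longlongrightarrow> p f) (nhds p)"
    proof (rule tendsto_at_iff_tendsto_nhds[THEN iffD1])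
      show "(\<lambda>q. q f) \<midarrow>p\<rightarrow> p f"
        using continuous_on_product_coordinates[of f] unfolding continuous_on_def by blast
    qed
    ultimately have "((\<lambda>k. x k f) \<longlongrightarrow> p f) U" by (rule filterlim_compose[rotated])
    thus "(f \<longlongrightarrow> p f) U" using f by (simp add: x_def)
  qed
  ultimately show ?thesis by blast
qed

definition ufil :: "nat filter" where
  "ufil = (SOME U. U \<noteq> bot \<and> U \<le> sequentially \<and> (\<forall>f::nat \<Rightarrow> complex. bounded (range f) \<longrightarrow> (\<exists>l. (f \<longlongrightarrow> l) U)))"

lemma ufil:
  fixes f :: "nat \<Rightarrow> complex"
  shows ufil_neq_bot: "ufil \<noteq> bot" and ufil_le: "ufil \<le> sequentially"
    and ufil_lim: "bounded (range f) \<Longrightarrow> (f \<longlongrightarrow> Lim ufil f) ufil"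
proof -
  have *: "ufil \<noteq> bot \<and> ufil \<le> sequentially \<and> (\<forall>f::nat \<Rightarrow> complex. bounded (range f) \<longrightarrow> (\<exists>l. (f \<longlongrightarrow> l) ufil))"
    unfolding ufil_def by (rule someI_ex[OF exists_limit_filter])
  thus "ufil \<noteq> bot" "ufil \<le> sequentially" by blast+
  show "(f \<longlongrightarrow> Lim ufil f) ufil" if "bounded (range f)"
  proof -
    from *[THEN conjunct2, THEN conjunct2, rule_format, OF that]
    obtain l where l: "(f \<longlongrightarrow> l) ufil" by (elim exE)
    moreover have "Lim ufil f = l" using tendsto_Lim[OF _ l] * by blast
    ultimately show ?thesis by simp
  qed
qed

lemma Lim_ufil: "(f \<longlongrightarrow> l) ufil \<Longrightarrow> Lim ufil f = (l::complex)"
  by (rule tendsto_Lim[OF ufil_neq_bot])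

lemma Lim_ufil_sequentially: "f \<longlonglongrightarrow> l \<Longrightarrow> Lim ufil f = (l::complex)"
  by (rule Lim_ufil[OF tendsto_mono[OF ufil_le]])

text \<open>Only the values on bounded operators matter.\<close>

definition ess_state :: "((ell2 \<Rightarrow> ell2) \<Rightarrow> complex) \<Rightarrow> bool" where
  "ess_state s \<longleftrightarrow> (\<forall>S\<in>bounded_ops. \<forall>T\<in>bounded_ops. s (\<lambda>x. S x + T x) = s S + s T) \<and>
     (\<forall>c. \<forall>T\<in>bounded_ops. s (\<lambda>x. scaleC c (T x)) = c * s T) \<and> s id = 1 \<and>
     (\<forall>n X. positive_matrix B_alg n X \<and> (\<forall>i<n. \<forall>j<n. X i j \<in> bounded_ops) \<longrightarrow> psd n (\<lambda>i j. s (X i j))) \<and>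
     (\<forall>T\<in>bounded_ops. tail_small T \<longrightarrow> s T = 0)"

lemma positive_matrix_B_D:
  assumes "positive_matrix B_alg n X" shows "(\<Sum>i<n. \<Sum>j<n. cinner (v i) (X i j (v j))) \<in> \<real>\<^sub>\<ge>\<^sub>0"
proof -
  obtain Y where Y': "(\<forall>i<n. \<forall>j<n. Y i j \<in> bounded_ops) \<and>
      (\<forall>i<n. \<forall>j<n. X i j = (\<lambda>x. \<Sum>k<n. op_adjoint (Y k i) (Y k j x)))"
    by (rule exE[OF iffD1[OF positive_matrix_B_sub[OF cstar_subalgebra_bounded_ops, unfolded B_alg_update] assms]])
  show ?thesis by (rule positive_matrix_quadratic[of n Y]) (use Y' in simp_all)
qed

lemma positive_matrix_B_mono:
  assumes D: "cstar_subalgebra B_alg D" and pm: "positive_matrix (B_alg\<lparr>carrier := D\<rparr>) n X"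
  shows "positive_matrix B_alg n X" "\<And>i j. i < n \<Longrightarrow> j < n \<Longrightarrow> X i j \<in> D"
proof -
  note d = cstar_subalgebra_B_algD[OF D]
  obtain Y where Y': "(\<forall>i<n. \<forall>j<n. Y i j \<in> D) \<and>
      (\<forall>i<n. \<forall>j<n. X i j = (\<lambda>x. \<Sum>k<n. op_adjoint (Y k i) (Y k j x)))"
    by (rule exE[OF iffD1[OF positive_matrix_B_sub[OF D] pm]])
  hence "(\<forall>i<n. \<forall>j<n. Y i j \<in> bounded_ops) \<and>
      (\<forall>i<n. \<forall>j<n. X i j = (\<lambda>x. \<Sum>k<n. op_adjoint (Y k i) (Y k j x)))" using d(1) by blast
  thus "positive_matrix B_alg n X"
    unfolding positive_matrix_B_sub[OF cstar_subalgebra_bounded_ops, of n X, unfolded B_alg_update]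
    by (intro exI[of _ Y])
  fix i j assume ij: "i < n" "j < n"
  have "(\<lambda>x. \<Sum>k<n. op_adjoint (Y k i) (Y k j x)) \<in> D"
  proof (rule cstar_subalgebra_sum[OF D])
    fix k assume "k \<in> {..<n}"
    hence "op_adjoint (Y k i) \<circ> Y k j \<in> D" using Y' ij by (intro d(5) d(7)) simp_all
    thus "(\<lambda>x. op_adjoint (Y k i) (Y k j x)) \<in> D" by (simp add: comp_def)
  qed
  thus "X i j \<in> D" using Y' ij by simp
qed

text \<open>Limits of convex combinations of vector states. The \<open>N\<close>-th ones use vectors
  in the \<open>N\<close>-th tail, which is what makes the limit vanish on compact
  operators.\<close>

lemma ess_state_limit:
  fixes F :: "nat \<Rightarrow> 'i set" and c :: "nat \<Rightarrow> 'i \<Rightarrow> real"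
  assumes F: "\<And>N. finite (F N)" and c: "\<And>N k. k \<in> F N \<Longrightarrow> 0 \<le> c N k" "\<And>N. sum (c N) (F N) = 1"
    and v: "\<And>N k. k \<in> F N \<Longrightarrow> norm (v N k) = 1" "\<And>N k. k \<in> F N \<Longrightarrow> tailp N (v N k) = v N k"
  defines "s \<equiv> \<lambda>T. Lim ufil (\<lambda>N. \<Sum>k\<in>F N. of_real (c N k) * cinner (v N k) (T (v N k)))"
  shows "ess_state s"
    and "T \<in> bounded_ops \<Longrightarrow> ((\<lambda>N. \<Sum>k\<in>F N. of_real (c N k) * cinner (v N k) (T (v N k))) \<longlongrightarrow> s T) ufil"
proof -
  let ?s = "\<lambda>T N. \<Sum>k\<in>F N. of_real (c N k) * cinner (v N k) (T (v N k))"
  have le: "cmod (?s T N) \<le> B" if "\<And>k. k \<in> F N \<Longrightarrow> cmod (cinner (v N k) (T (v N k))) \<le> B" for T N B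
  proof -
    have "cmod (?s T N) \<le> (\<Sum>k\<in>F N. c N k * B)"
      by (rule order_trans[OF norm_sum], rule sum_mono) (use c(1) that in \<open>auto simp: norm_mult mult_left_mono\<close>)
    also have "\<dots> = B" by (simp add: sum_distrib_right[symmetric] c(2))
    finally show ?thesis .
  qed
  have bd: "bounded (range (?s T))" if T: "T \<in> bounded_ops" for T
  proof (rule boundedI[where B = "onorm T"])
    fix z assume "z \<in> range (?s T)"
    then obtain N where z: "z = ?s T N" by blast
    show "norm z \<le> onorm T" unfolding z
    proof (rule le)
      fix k assume k: "k \<in> F N"
      have "cmod (cinner (v N k) (T (v N k))) \<le> norm (v N k) * norm (T (v N k))" by (rule cmod_cinner_le)
      also have "\<dots> \<le> 1 * (onorm T * 1)" using norm_op_le[OF T, of "v N k"] by (simp add: v(1)[OF k])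
      finally show "cmod (cinner (v N k) (T (v N k))) \<le> onorm T" by simp
    qed
  qed
  have lim: "(?s T \<longlongrightarrow> s T) ufil" if "T \<in> bounded_ops" for T
    unfolding s_def by (rule ufil_lim[OF bd[OF that]])
  show "T \<in> bounded_ops \<Longrightarrow> (?s T \<longlongrightarrow> s T) ufil" by (rule lim)
  show "ess_state s" unfolding ess_state_def
  proof (intro conjI ballI allI impI)
    fix S T assume S: "S \<in> bounded_ops" and T: "T \<in> bounded_ops"
    have "?s (\<lambda>x. S x + T x) = (\<lambda>N. ?s S N + ?s T N)" by (simp add: distrib_left sum.distrib)
    thus "s (\<lambda>x. S x + T x) = s S + s T"
      using Lim_ufil[OF tendsto_add[OF lim[OF S] lim[OF T]]] unfolding s_def by simp
  next
    fix a T assume T: "T \<in> bounded_ops"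
    have "?s (\<lambda>x. scaleC a (T x)) = (\<lambda>N. a * ?s T N)" by (simp add: sum_distrib_left mult_ac)
    thus "s (\<lambda>x. scaleC a (T x)) = a * s T"
      using Lim_ufil[OF tendsto_mult[OF tendsto_const lim[OF T]], of a] unfolding s_def by simp
  next
    have "?s id = (\<lambda>N. 1)"
    proof
      fix N
      have "?s id N = (\<Sum>k\<in>F N. of_real (c N k))" using v(1) by (intro sum.cong refl) (simp add: cinner_self)
      also have "\<dots> = of_real (sum (c N) (F N))" by simp
      finally show "?s id N = 1" by (simp add: c(2))
    qed
    thus "s id = 1" unfolding s_def by (simp only:) (rule Lim_ufil[OF tendsto_const])
  next
    fix T assume T: "T \<in> bounded_ops" and ts: "tail_small T"
    \<comment> \<open>Each vector state at a vector of the \<open>N\<close>-th tail is bounded by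
      the norm of \<open>T\<close> on that tail, and convex weights preserve the bound.\<close>
    have "?s T \<longlonglongrightarrow> 0"
    proof (rule LIMSEQ_I)
      fix r :: real assume r: "0 < r"
      hence "0 < r/2" by simp
      from tail_smallD[OF ts this] obtain N0 where N0: "\<And>M v. N0 \<le> M \<Longrightarrow> norm (T (tailp M v)) \<le> (r/2) * norm v" by blast
      have "norm (?s T N - 0) < r" if N: "N0 \<le> N" for N
      proof -
        have "cmod (?s T N) \<le> r/2"
        proof (rule le)
          fix k assume k: "k \<in> F N"
          have "cmod (cinner (v N k) (T (v N k))) \<le> norm (v N k) * norm (T (v N k))" by (rule cmod_cinner_le)
          also have "\<dots> \<le> r/2" using N0[OF N, of "v N k"] by (simp add: v[OF k])
          finally show "cmod (cinner (v N k) (T (v N k))) \<le> r/2" .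
        qed
        thus ?thesis using r by simp
      qed
      thus "\<exists>N0. \<forall>N\<ge>N0. norm (?s T N - 0) < r" by blast
    qed
    thus "s T = 0" unfolding s_def by (rule Lim_ufil_sequentially)
  next
    fix n X assume pm: "positive_matrix B_alg n X \<and> (\<forall>i<n. \<forall>j<n. X i j \<in> bounded_ops)"
    hence Xb: "\<And>i j. i < n \<Longrightarrow> j < n \<Longrightarrow> X i j \<in> bounded_ops" by blast
    show "psd n (\<lambda>i j. s (X i j))" unfolding psd_def
    proof
      fix \<xi>
      have "((\<lambda>N. quad n (\<lambda>i j. ?s (X i j) N) \<xi>) \<longlongrightarrow> quad n (\<lambda>i j. s (X i j)) \<xi>) ufil"
        unfolding quad_def by (intro tendsto_sum tendsto_mult tendsto_const lim Xb) auto
      moreover have "quad n (\<lambda>i j. ?s (X i j) N) \<xi> \<in> \<real>\<^sub>\<ge>\<^sub>0" for N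
      proof -
        have "quad n (\<lambda>i j. cinner (v N k) (X i j (v N k))) \<xi> \<in> \<real>\<^sub>\<ge>\<^sub>0" for k
        proof -
          have "quad n (\<lambda>i j. cinner (v N k) (X i j (v N k))) \<xi> =
              (\<Sum>i<n. \<Sum>j<n. cinner (scaleC (\<xi> i) (v N k)) (X i j (scaleC (\<xi> j) (v N k))))"
            unfolding quad_def by (intro sum.cong refl) (simp add: bounded_ops_lin(2)[OF Xb] mult_ac)
          thus ?thesis using positive_matrix_B_D[of n X "\<lambda>i. scaleC (\<xi> i) (v N k)"] pm by simp
        qed
        hence "(\<Sum>k\<in>F N. of_real (c N k) * quad n (\<lambda>i j. cinner (v N k) (X i j (v N k))) \<xi>) \<in> \<real>\<^sub>\<ge>\<^sub>0"
          by (intro nonneg_Reals_sum nonneg_Reals_mult_I) (simp_all add: c(1))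
        thus ?thesis by (simp only: quad_sum quad_scale)
      qed
      ultimately show "quad n (\<lambda>i j. s (X i j)) \<xi> \<in> \<real>\<^sub>\<ge>\<^sub>0"
        by (intro Lim_in_closed_set[OF closed_nonneg_Reals_complex _ ufil_neq_bot]) auto
    qed
  qed
qed

section \<open>Compressions to tails\<close>

text \<open>Gram-Schmidt inside a tail, allowing dependent vectors: where a vector is already in the
  span, a fresh direction is added instead, so there are always exactly \<open>n\<close> orthonormal
  vectors.\<close>

lemma gram_schmidt_tail:
  fixes u :: "nat \<Rightarrow> ell2"
  assumes "\<And>j. j < n \<Longrightarrow> tailp M (u j) = u j"
  shows "\<exists>e g. (\<forall>p<n. tailp M (e p) = e p) \<and> (\<forall>p<n. \<forall>q<n. cinner (e p) (e q) = (if p = q then 1 else 0)) \<and>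
     (\<forall>j<n. u j = (\<Sum>p<n. scaleC (g p j) (e p)))"
  using assms
proof (induction n)
  case (Suc n)
  hence "\<exists>e g. (\<forall>p<n. tailp M (e p) = e p) \<and> (\<forall>p<n. \<forall>q<n. cinner (e p) (e q) = (if p = q then 1 else 0)) \<and>
     (\<forall>j<n. u j = (\<Sum>p<n. scaleC (g p j) (e p)))" by (intro Suc.IH) simp
  then obtain e g where "(\<forall>p<n. tailp M (e p) = e p) \<and> (\<forall>p<n. \<forall>q<n. cinner (e p) (e q) = (if p = q then 1 else 0)) \<and>
     (\<forall>j<n. u j = (\<Sum>p<n. scaleC (g p j) (e p)))" by (elim exE)
  hence e: "\<And>p. p < n \<Longrightarrow> tailp M (e p) = e p"
      "\<And>p q. p < n \<Longrightarrow> q < n \<Longrightarrow> cinner (e p) (e q) = (if p = q then 1 else 0)"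
      "\<And>j. j < n \<Longrightarrow> u j = (\<Sum>p<n. scaleC (g p j) (e p))" by blast+
  define proj where "proj = (\<lambda>x. \<Sum>p<n. scaleC (cinner (e p) x) (e p))"
  have orth: "cinner (e q) (x - proj x) = 0" if "q < n" for q x
  proof -
    have "cinner (e q) (proj x) = (\<Sum>p<n. if p = q then cinner (e p) x else 0)"
      unfolding proj_def cinner_sum_right by (intro sum.cong refl) (use that e(2) in auto)
    thus ?thesis using that by simp
  qed
  have tl: "tailp M (x - proj x) = x - proj x" if x: "tailp M x = x" for x
  proof -
    have "tailp M (proj x) = proj x" unfolding proj_def bounded_ops_sum[OF tailp_bounded]
      by (intro sum.cong refl) (simp add: e(1))
    thus ?thesis using x by (simp add: bounded_ops_lin(4)[OF tailp_bounded])
  qed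
  have "\<exists>f h. tailp M f = f \<and> norm f = 1 \<and> (\<forall>q<n. cinner (e q) f = 0) \<and> u n = proj (u n) + scaleC h f"
  proof (cases "u n = proj (u n)")
    case False
    let ?r = "u n - proj (u n)"
    have r: "0 < norm ?r" using False by simp
    let ?f = "scaleC (of_real (1 / norm ?r)) ?r"
    have "tailp M ?f = ?f" using tl[OF Suc.prems[of n]] by (simp only: tailp_linear lessI)
    moreover have "norm ?f = 1" using r by (simp add: norm_divide del: of_real_divide)
    moreover have "\<forall>q<n. cinner (e q) ?f = 0" 
    proof (intro allI impI)
      fix q assume "q < n"
      from orth[OF this] show "cinner (e q) ?f = 0" by (simp only: cinner_simps(4) mult_zero_right)
    qed
    moreover have "u n = proj (u n) + scaleC (of_real (norm ?r)) ?f"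
    proof -
      have "of_real (norm ?r) * (of_real (1 / norm ?r) :: complex) = of_real (norm ?r * (1 / norm ?r))"
        by (rule of_real_mult[symmetric])
      also have "norm ?r * (1 / norm ?r) = 1" using r by simp
      finally have "of_real (norm ?r) * (of_real (1 / norm ?r) :: complex) = 1" by simp
      thus ?thesis by (simp only: scaleC_simps) simp
    qed
    ultimately have "tailp M ?f = ?f \<and> norm ?f = 1 \<and> (\<forall>q<n. cinner (e q) ?f = 0) \<and> u n = proj (u n) + scaleC (of_real (norm ?r)) ?f"
      by (intro conjI)
    thus ?thesis by (intro exI)
  next
    case True
    \<comment> \<open>The coordinates of the finitely many \<open>e p\<close> tend to zero, so some
      coordinate vector beyond \<open>M\<close> is not in their span; its part orthogonal to them
      gives the new direction.\<close>
    have "(\<lambda>k. \<Sum>p<n. (cmod (ell2_nth (e p) k))\<^sup>2) \<longlonglongrightarrow> (\<Sum>p<n. 0)"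
      by (intro tendsto_sum summable_LIMSEQ_zero summable_ell2_nth)
    from LIMSEQ_D[OF this, of 1] obtain k0 where k0: "\<And>k. k0 \<le> k \<Longrightarrow> norm (\<Sum>p<n. (cmod (ell2_nth (e p) k))\<^sup>2) < 1" by auto
    define k where "k = max k0 M"
    let ?x = "ebasis k"
    have tx: "tailp M ?x = ?x" by (rule ell2_eqI) (auto simp: k_def)
    let ?r = "?x - proj ?x"
    have "?r \<noteq> 0"
    proof
      assume "?r = 0"
      hence px: "proj ?x = ?x" by simp
      have "cinner ?x (proj ?x) = (\<Sum>p<n. of_real ((cmod (ell2_nth (e p) k))\<^sup>2))"
        unfolding proj_def cinner_sum_right
        by (intro sum.cong refl) (simp only: cinner_simps cinner_ebasis_left cinner_ebasis_right complex_norm_square mult.commute)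
      hence "complex_of_real (\<Sum>p<n. (cmod (ell2_nth (e p) k))\<^sup>2) = 1" unfolding px by simp
      hence "(\<Sum>p<n. (cmod (ell2_nth (e p) k))\<^sup>2) = 1" by (simp only: of_real_eq_1_iff)
      thus False using k0[of k] by (simp add: k_def)
    qed
    hence r: "0 < norm ?r" by simp
    let ?f = "scaleC (of_real (1 / norm ?r)) ?r"
    have "tailp M ?f = ?f" using tl[OF tx] by (simp only: tailp_linear)
    moreover have "norm ?f = 1" using r by (simp add: norm_divide del: of_real_divide)
    moreover have "\<forall>q<n. cinner (e q) ?f = 0" 
    proof (intro allI impI)
      fix q assume "q < n"
      from orth[OF this] show "cinner (e q) ?f = 0" by (simp only: cinner_simps(4) mult_zero_right)
    qed
    moreover have "u n = proj (u n) + scaleC 0 ?f" unfolding scaleC_simps(2) add_0_right by (rule True)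
    ultimately have "tailp M ?f = ?f \<and> norm ?f = 1 \<and> (\<forall>q<n. cinner (e q) ?f = 0) \<and> u n = proj (u n) + scaleC 0 ?f"
      by (intro conjI)
    thus ?thesis by (intro exI)
  qed
  then obtain f h where "tailp M f = f \<and> norm f = 1 \<and> (\<forall>q<n. cinner (e q) f = 0) \<and> u n = proj (u n) + scaleC h f"
    by (elim exE)
  hence f: "tailp M f = f" "norm f = 1" "\<And>q. q < n \<Longrightarrow> cinner (e q) f = 0" "u n = proj (u n) + scaleC h f"
    by blast+
  define e' where "e' = e(n := f)"
  define g' where "g' = (\<lambda>p j. if j < n then (if p < n then g p j else 0) else if p < n then cinner (e p) (u n) else h)"
  have f': "cinner f (e q) = 0" if "q < n" for q using f(3)[OF that] cnj_cinner[of "e q" f] by simp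
  have ff: "cinner f f = 1" using f(2) by (simp add: cinner_self)
  show ?case
  proof (intro exI[of _ e'] exI[of _ g'] conjI allI impI)
    fix p assume "p < Suc n"
    thus "tailp M (e' p) = e' p" using e(1) f(1) by (cases "p = n") (simp_all add: e'_def)
    fix q assume "q < Suc n"
    thus "cinner (e' p) (e' q) = (if p = q then 1 else 0)" using \<open>p < Suc n\<close> e(2) f(3) f' ff
      by (cases "p = n"; cases "q = n") (simp_all add: e'_def)
  next
    fix j assume j: "j < Suc n"
    show "u j = (\<Sum>p<Suc n. scaleC (g' p j) (e' p))"
    proof (cases "j = n")
      case True
      have "(\<Sum>p<Suc n. scaleC (g' p n) (e' p)) = proj (u n) + scaleC h f"
        by (simp add: e'_def g'_def proj_def)
      thus ?thesis unfolding True using f(4) by (rule trans[OF _ sym, rotated])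
    next
      case False
      thus ?thesis using j e(3)[of j] by (simp add: e'_def g'_def)
    qed
  qed
qed simp

text \<open>Limit of the compressions to orthonormal \<open>n\<close>-frames that run off to
  infinity: the source of the elements of the essential matrix range constructed here.\<close>

definition compr :: "nat \<Rightarrow> (nat \<Rightarrow> nat \<Rightarrow> ell2) \<Rightarrow> (ell2 \<Rightarrow> ell2) \<Rightarrow> complex mat" where
  "compr n e Z = mat n n (\<lambda>(p, q). Lim ufil (\<lambda>M. cinner (e M p) (Z (e M q))))"

context
  fixes n :: nat and e :: "nat \<Rightarrow> nat \<Rightarrow> ell2"
  assumes n: "0 < n" and tl: "\<And>M p. p < n \<Longrightarrow> tailp M (e M p) = e M p"
    and on: "\<And>M p q. p < n \<Longrightarrow> q < n \<Longrightarrow> cinner (e M p) (e M q) = (if p = q then 1 else 0)"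
begin

lemma compr_lim:
  assumes Z: "Z \<in> bounded_ops" and pq: "p < n" "q < n"
  shows "((\<lambda>M. cinner (e M p) (Z (e M q))) \<longlongrightarrow> compr n e Z $$ (p, q)) ufil"
proof -
  have ne: "norm (e M p) = 1" if "p < n" for M p
    using on[OF that that, of M] power2_eq_iff_nonneg[of "norm (e M p)" 1] by (simp add: cinner_self flip: of_real_power)
  have "bounded (range (\<lambda>M. cinner (e M p) (Z (e M q))))"
  proof (rule boundedI[where B = "onorm Z"])
    fix z assume "z \<in> range (\<lambda>M. cinner (e M p) (Z (e M q)))"
    then obtain M where z: "z = cinner (e M p) (Z (e M q))" by blast
    show "norm z \<le> onorm Z" unfolding z
      using cmod_cinner_le[of "e M p" "Z (e M q)"] norm_op_le[OF Z, of "e M q"] by (simp add: ne pq)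
  qed
  from ufil_lim[OF this] show ?thesis using pq by (simp add: compr_def)
qed

text \<open>Compressions are ucp and positivity is a closed condition, so it survives the limit;
  compact operators are sent to zero because the frames lie in the tails.\<close>

lemma compr_ucp:
  assumes D: "cstar_subalgebra B_alg D"
  shows "ucp (B_alg\<lparr>carrier := D\<rparr>) D (M_alg n) (compr n e)"
    and "\<And>T. T \<in> compact_ops \<Longrightarrow> compr n e T = 0\<^sub>m n n"
proof -
  note d = cstar_subalgebra_B_algD[OF D]
  have cc: "compr n e Z \<in> carrier_mat n n" for Z by (simp add: compr_def)
  have Db: "T \<in> bounded_ops" if "T \<in> D" for T using d(1) that by blast
  show "ucp (B_alg\<lparr>carrier := D\<rparr>) D (M_alg n) (compr n e)" unfolding ucp_def
  proof (intro conjI ballI allI impI)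
    fix S show "compr n e S \<in> carrier (M_alg n)" using cc by simp
  next
    fix S T assume S: "S \<in> D" and T: "T \<in> D"
    show "compr n e (S \<oplus>\<^bsub>B_alg\<lparr>carrier := D\<rparr>\<^esub> T) = compr n e S \<oplus>\<^bsub>M_alg n\<^esub> compr n e T"
    proof (rule eq_matI)
      fix p q assume "p < dim_row (compr n e S \<oplus>\<^bsub>M_alg n\<^esub> compr n e T)" "q < dim_col (compr n e S \<oplus>\<^bsub>M_alg n\<^esub> compr n e T)"
      hence pq: "p < n" "q < n" using cc[of T] by auto
      from Lim_ufil[OF tendsto_add[OF compr_lim[OF Db[OF S] pq] compr_lim[OF Db[OF T] pq]]]
      show "compr n e (S \<oplus>\<^bsub>B_alg\<lparr>carrier := D\<rparr>\<^esub> T) $$ (p, q) = (compr n e S \<oplus>\<^bsub>M_alg n\<^esub> compr n e T) $$ (p, q)"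
        using pq cc[of T] by (simp add: compr_def)
    qed (simp_all add: compr_def)
  next
    fix c T assume T: "T \<in> D"
    show "compr n e (c \<odot>\<^bsub>B_alg\<lparr>carrier := D\<rparr>\<^esub> T) = c \<odot>\<^bsub>M_alg n\<^esub> compr n e T"
    proof (rule eq_matI)
      fix p q assume "p < dim_row (c \<odot>\<^bsub>M_alg n\<^esub> compr n e T)" "q < dim_col (c \<odot>\<^bsub>M_alg n\<^esub> compr n e T)"
      hence pq: "p < n" "q < n" using cc[of T] by auto
      from Lim_ufil[OF tendsto_mult[OF tendsto_const[of c] compr_lim[OF Db[OF T] pq]]]
      show "compr n e (c \<odot>\<^bsub>B_alg\<lparr>carrier := D\<rparr>\<^esub> T) $$ (p, q) = (c \<odot>\<^bsub>M_alg n\<^esub> compr n e T) $$ (p, q)"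
        using pq cc[of T] by (simp add: compr_def)
    qed (simp_all add: compr_def)
  next
    show "compr n e \<one>\<^bsub>B_alg\<lparr>carrier := D\<rparr>\<^esub> = \<one>\<^bsub>M_alg n\<^esub>"
      by (rule eq_matI) (simp_all add: compr_def on Lim_ufil[OF tendsto_const])
  next
    fix k :: nat and X assume "(\<forall>i<k. \<forall>j<k. X i j \<in> D) \<and> positive_matrix (B_alg\<lparr>carrier := D\<rparr>) k X"
    hence XD: "\<And>i j. i < k \<Longrightarrow> j < k \<Longrightarrow> X i j \<in> D" and pm: "positive_matrix B_alg k X"
      using positive_matrix_B_mono(1)[OF D] by blast+
    have "psd (k * n) (blockmat n (\<lambda>i j. compr n e (X i j)))" unfolding psd_blockmat[OF n]
    proof
      fix \<xi> :: "nat \<Rightarrow> nat \<Rightarrow> complex"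
      let ?v = "\<lambda>M i. \<Sum>p<n. scaleC (\<xi> i p) (e M p)"
      have "((\<lambda>M. \<Sum>i<k. \<Sum>p<n. \<Sum>j<k. \<Sum>q<n. cnj (\<xi> i p) * cinner (e M p) (X i j (e M q)) * \<xi> j q)
          \<longlongrightarrow> (\<Sum>i<k. \<Sum>p<n. \<Sum>j<k. \<Sum>q<n. cnj (\<xi> i p) * compr n e (X i j) $$ (p, q) * \<xi> j q)) ufil"
        by (intro tendsto_sum tendsto_mult tendsto_const compr_lim Db XD) auto
      moreover have "(\<Sum>i<k. \<Sum>p<n. \<Sum>j<k. \<Sum>q<n. cnj (\<xi> i p) * cinner (e M p) (X i j (e M q)) * \<xi> j q) \<in> \<real>\<^sub>\<ge>\<^sub>0" for M
      proof -
        have "(\<Sum>i<k. \<Sum>p<n. \<Sum>j<k. \<Sum>q<n. cnj (\<xi> i p) * cinner (e M p) (X i j (e M q)) * \<xi> j q) =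
            (\<Sum>i<k. \<Sum>j<k. \<Sum>p<n. \<Sum>q<n. cnj (\<xi> i p) * cinner (e M p) (X i j (e M q)) * \<xi> j q)"
          by (intro sum.cong refl sum.swap)
        also have "\<dots> = (\<Sum>i<k. \<Sum>j<k. cinner (?v M i) (X i j (?v M j)))"
        proof (intro sum.cong refl)
          fix i j assume "i \<in> {..<k}" "j \<in> {..<k}"
          hence b: "X i j \<in> bounded_ops" using Db XD by simp
          have A: "cinner z (X i j (?v M j)) = (\<Sum>q<n. \<xi> j q * cinner z (X i j (e M q)))" for z
            by (simp only: bounded_ops_sum[OF b] bounded_ops_lin(2)[OF b] cinner_sum_right cinner_simps)
          have B: "cinner (?v M i) z = (\<Sum>p<n. cnj (\<xi> i p) * cinner (e M p) z)" for z
            by (simp only: cinner_sum_left cinner_simps)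
          have "cinner (?v M i) (X i j (?v M j)) = (\<Sum>p<n. cnj (\<xi> i p) * cinner (e M p) (X i j (?v M j)))" by (rule B)
          also have "\<dots> = (\<Sum>p<n. cnj (\<xi> i p) * (\<Sum>q<n. \<xi> j q * cinner (e M p) (X i j (e M q))))"
            by (simp only: A)
          finally have "cinner (?v M i) (X i j (?v M j)) = (\<Sum>p<n. cnj (\<xi> i p) * (\<Sum>q<n. \<xi> j q * cinner (e M p) (X i j (e M q))))" .
          thus "(\<Sum>p<n. \<Sum>q<n. cnj (\<xi> i p) * cinner (e M p) (X i j (e M q)) * \<xi> j q) = cinner (?v M i) (X i j (?v M j))"
            by (simp add: sum_distrib_left mult_ac)
        qed
        also have "\<dots> \<in> \<real>\<^sub>\<ge>\<^sub>0" by (rule positive_matrix_B_D[OF pm])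
        finally show ?thesis .
      qed
      ultimately show "(\<Sum>i<k. \<Sum>p<n. \<Sum>j<k. \<Sum>q<n. cnj (\<xi> i p) * compr n e (X i j) $$ (p, q) * \<xi> j q) \<in> \<real>\<^sub>\<ge>\<^sub>0"
        by (intro Lim_in_closed_set[OF closed_nonneg_Reals_complex _ ufil_neq_bot]) auto
    qed
    thus "positive_matrix (M_alg n) k (\<lambda>i j. compr n e (X i j))"
      by (intro positive_matrix_M_algI n cc)
  qed
  fix T assume "T \<in> compact_ops"
  hence Tb: "T \<in> bounded_ops" and ts: "tail_small T" by (auto simp: compact_ops_iff)
  have ne: "norm (e M p) = 1" if "p < n" for M p
    using on[OF that that, of M] power2_eq_iff_nonneg[of "norm (e M p)" 1] by (simp add: cinner_self flip: of_real_power)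
  show "compr n e T = 0\<^sub>m n n"
  proof (rule eq_matI)
    fix p q assume "p < dim_row (0\<^sub>m n n :: complex mat)" "q < dim_col (0\<^sub>m n n :: complex mat)"
    hence pq: "p < n" "q < n" by auto
    have "(\<lambda>M. cinner (e M p) (T (e M q))) \<longlonglongrightarrow> 0"
    proof (rule LIMSEQ_I)
      fix r :: real assume r: "0 < r"
      hence "0 < r/2" by simp
      from tail_smallD[OF ts this] obtain N0 where N0: "\<And>M v. N0 \<le> M \<Longrightarrow> norm (T (tailp M v)) \<le> (r/2) * norm v" by blast
      have "norm (cinner (e M p) (T (e M q)) - 0) < r" if N: "N0 \<le> M" for M
        using cmod_cinner_le[of "e M p" "T (e M q)"] N0[OF N, of "e M q"] r by (simp add: ne tl pq)
      thus "\<exists>N0. \<forall>M\<ge>N0. norm (cinner (e M p) (T (e M q)) - 0) < r" by blast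
    qed
    from Lim_ufil_sequentially[OF this] show "compr n e T $$ (p, q) = 0\<^sub>m n n $$ (p, q)" using pq by (simp add: compr_def)
  qed (simp_all add: compr_def)
qed

end

section \<open>The algebra generated by a tuple\<close>

lemma operator_system_subset:
  assumes D: "cstar_subalgebra B_alg D" and x: "\<And>l. x l \<in> D"
  shows "operator_system B_alg x \<subseteq> D"
proof
  fix T assume "T \<in> operator_system B_alg x"
  then obtain F c where F: "finite F" "F \<subseteq> insert id (range x \<union> range (\<lambda>l. op_adjoint (x l)))"
    and T: "T = (\<Oplus>\<^bsub>B_alg\<^esub>s\<in>F. c s \<odot>\<^bsub>B_alg\<^esub> s)"
    unfolding operator_system_def cspan_def by auto
  note d = cstar_subalgebra_B_algD[OF D]
  have FD: "(\<lambda>v. scaleC (c s) (s v)) \<in> D" if "s \<in> F" for s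
    by (rule d(6)) (use that F(2) x d(2,7) in auto)
  have "T = (\<lambda>v. \<Sum>s\<in>F. scaleC (c s) (s v))"
    unfolding T B_alg_sel by (rule finsum_B_alg[OF F(1)]) (use FD d(1) in blast)
  also have "\<dots> \<in> D" by (rule cstar_subalgebra_sum[OF D FD])
  finally show "T \<in> D" .
qed

lemma cstar_of_tuple:
  assumes x: "\<And>l. x l \<in> bounded_ops"
  shows "cstar_subalgebra B_alg (cstar_of_tuple B_alg x)" and "x l \<in> cstar_of_tuple B_alg x"
    and "cstar_subalgebra B_alg D \<Longrightarrow> (\<And>l. x l \<in> D) \<Longrightarrow> cstar_of_tuple B_alg x \<subseteq> D"
proof -
  let ?O = "operator_system B_alg x"
  let ?G = "cstar_of_tuple B_alg x"
  have G: "T \<in> ?G \<longleftrightarrow> (\<forall>D. cstar_subalgebra B_alg D \<and> ?O \<subseteq> D \<longrightarrow> T \<in> D)" for T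
    unfolding cstar_of_tuple_def cstar_generated_def by blast
  have Ob: "?O \<subseteq> bounded_ops" by (rule operator_system_subset[OF cstar_subalgebra_bounded_ops x])
  have Gb: "?G \<subseteq> bounded_ops" using G cstar_subalgebra_bounded_ops Ob by blast
  show "cstar_subalgebra B_alg ?G"
  proof (rule cstar_subalgebra_B_algI[OF Gb])
    show "id \<in> ?G" unfolding G using cstar_subalgebra_B_algD(2) by blast
    show "(\<lambda>x. S x + T x) \<in> ?G" if "S \<in> ?G" "T \<in> ?G" for S T
      using that unfolding G using cstar_subalgebra_B_algD(3)[of _ S T] by blast
    show "S \<circ> T \<in> ?G" if "S \<in> ?G" "T \<in> ?G" for S T
      using that unfolding G using cstar_subalgebra_B_algD(5)[of _ S T] by blast
    show "(\<lambda>x. scaleC c (T x)) \<in> ?G" if "T \<in> ?G" for c T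
      using that unfolding G using cstar_subalgebra_B_algD(6)[of _ T c] by blast
    show "op_adjoint T \<in> ?G" if "T \<in> ?G" for T
      using that unfolding G using cstar_subalgebra_B_algD(7)[of _ T] by blast
    fix \<sigma> L assume s: "\<And>n. \<sigma> n \<in> ?G" and L: "L \<in> bounded_ops" "(\<lambda>n. onorm (\<lambda>x. \<sigma> n x - L x)) \<longlonglongrightarrow> 0"
    show "L \<in> ?G" unfolding G
    proof (intro allI impI)
      fix D assume D: "cstar_subalgebra B_alg D \<and> ?O \<subseteq> D"
      have "\<And>n. \<sigma> n \<in> D" using s D unfolding G by blast
      from cstar_subalgebra_B_algD(9)[OF conjunct1[OF D] this L] show "L \<in> D" .
    qed
  qed
  have "x l \<in> ?O"
  proof -
    have "x l = (\<Oplus>\<^bsub>B_alg\<^esub>s\<in>{x l}. (\<lambda>_. 1) s \<odot>\<^bsub>B_alg\<^esub> s)"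
      using finsum_B_alg[of "{x l}" "\<lambda>s v. scaleC 1 (s v)"] x by simp
    thus ?thesis unfolding operator_system_def cspan_def mem_Collect_eq
      by (intro exI[of _ "{x l}"] exI[of _ "\<lambda>_. 1"] conjI) auto
  qed
  thus "x l \<in> ?G" unfolding G by blast
  show "?G \<subseteq> D" if "cstar_subalgebra B_alg D" "\<And>l. x l \<in> D" for D
  proof
    fix T assume "T \<in> ?G"
    thus "T \<in> D" unfolding G using that(1) operator_system_subset[of D x, OF that] by blast
  qed
qed

lemma ucp_B_D:
  assumes U: "ucp (B_alg\<lparr>carrier := D\<rparr>) D (M_alg n) \<phi>" and D: "cstar_subalgebra B_alg D"
  shows "T \<in> D \<Longrightarrow> \<phi> T \<in> carrier_mat n n"
    and "S \<in> D \<Longrightarrow> T \<in> D \<Longrightarrow> \<phi> (\<lambda>x. S x + T x) = \<phi> S + \<phi> T"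
    and "T \<in> D \<Longrightarrow> \<phi> (\<lambda>x. scaleC c (T x)) = c \<cdot>\<^sub>m \<phi> T"
    and "\<phi> id = 1\<^sub>m n"
    and "0 < n \<Longrightarrow> (\<And>i j. i < k \<Longrightarrow> j < k \<Longrightarrow> X i j \<in> D) \<Longrightarrow> positive_matrix (B_alg\<lparr>carrier := D\<rparr>) k X \<Longrightarrow>
      psd (k * n) (blockmat n (\<lambda>i j. \<phi> (X i j)))"
proof -
  have u: "(\<forall>x\<in>D. \<phi> x \<in> carrier_mat n n) \<and> (\<forall>x\<in>D. \<forall>y\<in>D. \<phi> (\<lambda>v. x v + y v) = \<phi> x + \<phi> y) \<and>
     (\<forall>c. \<forall>x\<in>D. \<phi> (\<lambda>v. scaleC c (x v)) = c \<cdot>\<^sub>m \<phi> x) \<and> \<phi> id = 1\<^sub>m n \<and>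
     (\<forall>k X. (\<forall>i<k. \<forall>j<k. X i j \<in> D) \<and> positive_matrix (B_alg\<lparr>carrier := D\<rparr>) k X \<longrightarrow>
            positive_matrix (M_alg n) k (\<lambda>i j. \<phi> (X i j)))"
    using U unfolding ucp_def by simp
  show "\<phi> T \<in> carrier_mat n n" if "T \<in> D" using u that by blast
  show "\<phi> (\<lambda>x. S x + T x) = \<phi> S + \<phi> T" if "S \<in> D" "T \<in> D" using u that by blast
  show "\<phi> (\<lambda>x. scaleC c (T x)) = c \<cdot>\<^sub>m \<phi> T" if "T \<in> D" using u that by blast
  show "\<phi> id = 1\<^sub>m n" using u by blast
  show "psd (k * n) (blockmat n (\<lambda>i j. \<phi> (X i j)))"
    if "0 < n" "\<And>i j. i < k \<Longrightarrow> j < k \<Longrightarrow> X i j \<in> D" "positive_matrix (B_alg\<lparr>carrier := D\<rparr>) k X"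
  proof -
    have "positive_matrix (M_alg n) k (\<lambda>i j. \<phi> (X i j))"
      using u[THEN conjunct2, THEN conjunct2, THEN conjunct2, THEN conjunct2, rule_format, of k X] that(2,3) by simp
    thus ?thesis by (rule positive_matrix_M_algD(2)[OF that(1)])
  qed
qed

lemma ucp_B_sum:
  assumes U: "ucp (B_alg\<lparr>carrier := D\<rparr>) D (M_alg n) \<phi>" and D: "cstar_subalgebra B_alg D"
    and f: "\<And>i. i \<in> F \<Longrightarrow> f i \<in> D" and "finite F" and pq: "p < n" "q < n"
  shows "\<phi> (\<lambda>x. \<Sum>i\<in>F. f i x) $$ (p, q) = (\<Sum>i\<in>F. \<phi> (f i) $$ (p, q))"
  using \<open>finite F\<close> f
proof (induction F rule: finite_induct)
  case empty
  have "\<phi> (\<lambda>x. scaleC 0 (id x)) = 0 \<cdot>\<^sub>m \<phi> id"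
    by (rule ucp_B_D(3)[OF U D cstar_subalgebra_B_algD(2)[OF D]])
  thus ?case using pq by (simp add: ucp_B_D(4)[OF U D])
next
  case (insert a F)
  have F: "(\<lambda>x. \<Sum>i\<in>F. f i x) \<in> D" by (rule cstar_subalgebra_sum[OF D]) (use insert.prems in simp)
  have a: "f a \<in> D" using insert.prems by simp
  have "\<phi> (\<lambda>x. \<Sum>i\<in>insert a F. f i x) = \<phi> (f a) + \<phi> (\<lambda>x. \<Sum>i\<in>F. f i x)"
    using ucp_B_D(2)[OF U D a F] insert.hyps by simp
  thus ?case using insert ucp_B_D(1)[OF U D a] ucp_B_D(1)[OF U D F] pq by simp
qed

text \<open>Follows from positivity of the matrix with entries \<open>1\<close>, \<open>T\<close>,
  \<open>T\<^sup>*\<close>, \<open>T\<^sup>* T\<close> and Hermitian symmetry of its image.\<close>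

lemma ucp_B_adjoint:
  assumes U: "ucp (B_alg\<lparr>carrier := D\<rparr>) D (M_alg n) \<phi>" and D: "cstar_subalgebra B_alg D"
    and T: "T \<in> D" and pq: "p < n" "q < n"
  shows "\<phi> (op_adjoint T) $$ (q, p) = cnj (\<phi> T $$ (p, q))"
proof -
  note d = cstar_subalgebra_B_algD[OF D]
  have Tb: "T \<in> bounded_ops" using d(1) T by blast
  \<comment> \<open>The factor of that matrix: the row \<open>(1, T)\<close> above a zero
    row.\<close>
  define Y where "Y = (\<lambda>k j :: nat. if k = (0 :: nat) then (if j = 0 then id else T) else (\<lambda>x. 0))"
  define X where "X = (\<lambda>i j x. \<Sum>k<(2::nat). op_adjoint (Y k i) (Y k j x))"
  have YD: "Y k j \<in> D" for k j using d(2,8) T by (simp add: Y_def)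
  have adj0: "op_adjoint (\<lambda>x. 0) = (\<lambda>x. 0)" by (rule op_adjointI) auto
  have pm: "positive_matrix (B_alg\<lparr>carrier := D\<rparr>) 2 X"
    unfolding positive_matrix_B_sub[OF D] by (rule exI[of _ Y]) (simp add: YD X_def)
  have XD: "X i j \<in> D" if "i < 2" "j < 2" for i j by (rule positive_matrix_B_mono(2)[OF D pm that])
  have n: "0 < n" using pq by simp
  have X01: "X 0 1 = T" and X10: "X 1 0 = op_adjoint T"
    by (auto simp: X_def Y_def adj0 numeral_2_eq_2 fun_eq_iff)
  have "psd (2 * n) (blockmat n (\<lambda>i j. \<phi> (X i j)))" by (rule ucp_B_D(5)[OF U D n XD pm])
  from psd_hermitian[OF this, of p "n + q"] pq
  have "blockmat n (\<lambda>i j. \<phi> (X i j)) (n + q) p = cnj (blockmat n (\<lambda>i j. \<phi> (X i j)) p (n + q))" by simp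
  thus ?thesis using pq X01 X10 by (simp add: blockmat_def)
qed

text \<open>The affine function evaluated at the tuple; its counterpart at a point of
  \<open>K\<close> is \<open>affine_mat\<close>.\<close>

definition aff_op ::
  "(nat \<Rightarrow> nat \<Rightarrow> complex) \<Rightarrow> ('d::finite \<Rightarrow> nat \<Rightarrow> nat \<Rightarrow> complex) \<Rightarrow> ('d \<Rightarrow> ell2 \<Rightarrow> ell2) \<Rightarrow> nat \<Rightarrow> nat \<Rightarrow> ell2 \<Rightarrow> ell2" where
  "aff_op c0 c x = (\<lambda>i j v. scaleC (c0 i j) (id v) + (\<Sum>l\<in>UNIV. scaleC (c l i j) (x l v)))"

lemma aff_op_mem:
  assumes D: "cstar_subalgebra B_alg D" and x: "\<And>l. x l \<in> D" shows "aff_op c0 c x i j \<in> D"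
  unfolding aff_op_def
  by (intro cstar_subalgebra_B_algD(3)[OF D] cstar_subalgebra_B_algD(6)[OF D] cstar_subalgebra_B_algD(2)[OF D]
      cstar_subalgebra_sum[OF D] x)

lemma ucp_aff_op:
  assumes U: "ucp (B_alg\<lparr>carrier := D\<rparr>) D (M_alg n) \<phi>" and D: "cstar_subalgebra B_alg D" and x: "\<And>l. x l \<in> D"
    and pq: "p < n" "q < n"
  shows "\<phi> (aff_op c0 c x i j) $$ (p, q) = c0 i j * ident p q + (\<Sum>l\<in>UNIV. c l i j * \<phi> (x l) $$ (p, q))"
proof -
  have 1: "(\<lambda>v. scaleC (c0 i j) (id v)) \<in> D" by (intro cstar_subalgebra_B_algD(6)[OF D] cstar_subalgebra_B_algD(2)[OF D])
  have 2: "(\<lambda>v. scaleC (c l i j) (x l v)) \<in> D" for l by (intro cstar_subalgebra_B_algD(6)[OF D] x)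
  have 3: "(\<lambda>v. \<Sum>l\<in>UNIV. scaleC (c l i j) (x l v)) \<in> D" by (rule cstar_subalgebra_sum[OF D 2])
  have "\<phi> (aff_op c0 c x i j) = \<phi> (\<lambda>v. scaleC (c0 i j) (id v)) + \<phi> (\<lambda>v. \<Sum>l\<in>UNIV. scaleC (c l i j) (x l v))"
    unfolding aff_op_def by (rule ucp_B_D(2)[OF U D 1 3])
  hence "\<phi> (aff_op c0 c x i j) $$ (p, q) = \<phi> (\<lambda>v. scaleC (c0 i j) (id v)) $$ (p, q) + \<phi> (\<lambda>v. \<Sum>l\<in>UNIV. scaleC (c l i j) (x l v)) $$ (p, q)"
    using ucp_B_D(1)[OF U D 3] pq by simp
  also have "\<phi> (\<lambda>v. scaleC (c0 i j) (id v)) $$ (p, q) = c0 i j * ident p q"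
    using pq by (simp only: ucp_B_D(3)[OF U D cstar_subalgebra_B_algD(2)[OF D]] ucp_B_D(4)[OF U D]) (simp add: ident_def)
  also have "\<phi> (\<lambda>v. \<Sum>l\<in>UNIV. scaleC (c l i j) (x l v)) $$ (p, q) = (\<Sum>l\<in>UNIV. \<phi> (\<lambda>v. scaleC (c l i j) (x l v)) $$ (p, q))"
    by (rule ucp_B_sum[OF U D 2 _ pq]) simp
  also have "\<dots> = (\<Sum>l\<in>UNIV. c l i j * \<phi> (x l) $$ (p, q))"
  proof (intro sum.cong refl)
    fix l
    have "\<phi> (\<lambda>v. scaleC (c l i j) (x l v)) = c l i j \<cdot>\<^sub>m \<phi> (x l)" by (rule ucp_B_D(3)[OF U D x])
    thus "\<phi> (\<lambda>v. scaleC (c l i j) (x l v)) $$ (p, q) = c l i j * \<phi> (x l) $$ (p, q)"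
      using ucp_B_D(1)[OF U D x[of l]] pq by simp
  qed
  finally show ?thesis .
qed

section \<open>Essential positivity from the essential matrix range\<close>

text \<open>The failure is normalized to unit vectors and stated as membership in a union of three
  closed half-planes, a condition that passes to limits.\<close>

lemma not_ess_nonneg_sequence:
  assumes T: "T \<in> bounded_ops" and ne: "\<not> ess_nonneg T"
  shows "\<exists>\<epsilon>>0. \<forall>N. \<exists>y. norm y = 1 \<and> tailp N y = y \<and>
    cinner y (T y) \<in> {z. Re z \<le> - \<epsilon>} \<union> {z. \<epsilon> \<le> Im z} \<union> {z. Im z \<le> - \<epsilon>}"
proof -
  have "\<exists>\<epsilon>>0. \<forall>N. \<exists>N'\<ge>N. \<exists>v. \<not> (- (\<epsilon> * (norm v)\<^sup>2) \<le> Re (cinner (tailp N' v) (T (tailp N' v)))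
     \<and> \<bar>Im (cinner (tailp N' v) (T (tailp N' v)))\<bar> \<le> \<epsilon> * (norm v)\<^sup>2)"
    using ne by (simp only: ess_nonneg_def not_all not_ex not_imp simp_thms)
  then obtain \<epsilon> where \<epsilon>: "0 < \<epsilon>" and bad: "\<forall>N. \<exists>N'\<ge>N. \<exists>v. \<not> (- (\<epsilon> * (norm v)\<^sup>2) \<le> Re (cinner (tailp N' v) (T (tailp N' v)))
     \<and> \<bar>Im (cinner (tailp N' v) (T (tailp N' v)))\<bar> \<le> \<epsilon> * (norm v)\<^sup>2)"
    by (elim exE conjE)
  have "\<exists>y. norm y = 1 \<and> tailp N y = y \<and>
    cinner y (T y) \<in> {z. Re z \<le> - \<epsilon>} \<union> {z. \<epsilon> \<le> Im z} \<union> {z. Im z \<le> - \<epsilon>}" for N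
  proof -
    obtain N' v where N': "N \<le> N'" and b: "\<not> (- (\<epsilon> * (norm v)\<^sup>2) \<le> Re (cinner (tailp N' v) (T (tailp N' v)))
     \<and> \<bar>Im (cinner (tailp N' v) (T (tailp N' v)))\<bar> \<le> \<epsilon> * (norm v)\<^sup>2)"
      using bad[rule_format, of N] by (elim exE conjE)
    define w where "w = tailp N' v"
    define z where "z = cinner w (T w)"
    have "(norm w)\<^sup>2 \<le> (norm v)\<^sup>2" unfolding w_def by (intro power_mono norm_tailp_le) simp
    hence "\<epsilon> * (norm w)\<^sup>2 \<le> \<epsilon> * (norm v)\<^sup>2" using \<epsilon> by (intro mult_left_mono) auto
    moreover have "\<not> (- (\<epsilon> * (norm v)\<^sup>2) \<le> Re z \<and> \<bar>Im z\<bar> \<le> \<epsilon> * (norm v)\<^sup>2)" using b by (simp only: w_def z_def not_False_eq_True)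
    ultimately have b': "Re z < - (\<epsilon> * (norm w)\<^sup>2) \<or> \<epsilon> * (norm w)\<^sup>2 < \<bar>Im z\<bar>" by linarith
    have "w \<noteq> 0"
    proof
      assume "w = 0"
      hence "z = 0" by (simp add: z_def)
      thus False using b' \<open>w = 0\<close> by simp
    qed
    hence nw: "0 < norm w" by simp
    define y where "y = (1 / norm w) *\<^sub>R w"
    have "norm y = 1" using nw by (simp add: y_def)
    moreover have "tailp N w = w" unfolding w_def by (rule tailp_tailp[OF N'])
    hence "tailp N y = y" by (simp add: y_def scaleR_scaleC)
    moreover have zy: "cinner y (T y) = of_real (1 / (norm w)\<^sup>2) * z"
      by (simp add: y_def z_def bounded_ops_lin(6)[OF T] power2_eq_square)
    have "Re (cinner y (T y)) = Re z / (norm w)\<^sup>2" "Im (cinner y (T y)) = Im z / (norm w)\<^sup>2"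
      unfolding zy by simp_all
    hence "Re (cinner y (T y)) \<le> - \<epsilon> \<or> \<epsilon> \<le> Im (cinner y (T y)) \<or> Im (cinner y (T y)) \<le> - \<epsilon>"
      using b' pos_divide_le_eq[of "(norm w)\<^sup>2" "Re z" "- \<epsilon>"] pos_le_divide_eq[of "(norm w)\<^sup>2" \<epsilon> "Im z"]
        pos_divide_le_eq[of "(norm w)\<^sup>2" "Im z" "- \<epsilon>"] nw by (cases "0 \<le> Im z") auto
    ultimately have "norm y = 1 \<and> tailp N y = y \<and> cinner y (T y) \<in> {z. Re z \<le> - \<epsilon>} \<union> {z. \<epsilon> \<le> Im z} \<union> {z. Im z \<le> - \<epsilon>}"
      by simp
    thus ?thesis by (rule exI)
  qed
  hence "\<forall>N. \<exists>y. norm y = 1 \<and> tailp N y = y \<and>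
    cinner y (T y) \<in> {z. Re z \<le> - \<epsilon>} \<union> {z. \<epsilon> \<le> Im z} \<union> {z. Im z \<le> - \<epsilon>}" by (rule allI)
  thus ?thesis by (intro exI[of _ \<epsilon>] conjI \<epsilon>)
qed

text \<open>Violating unit vectors escape to infinity, but their \<open>n\<close> components change
  with \<open>M\<close>. Each time they are written in an orthonormal \<open>n\<close>-frame of the
  tail; compressions and coefficients then both converge along \<open>ufil\<close>. The limit
  compression lies in the essential matrix range, hence comes from a measure on \<open>K\<close>,
  which makes the limit of the forms a sum of nonnegative values.\<close>

lemma ess_nonneg_aff_op:
  fixes K :: "(real^'d) set"
  assumes x: "\<And>l. x l \<in> bounded_ops" and We: "ess_matrix_range x \<subseteq> Kmin K" and n: "1 \<le> n"
    and psd: "\<And>\<mu>. \<mu> \<in> K \<Longrightarrow> psd n (affine_mat c0 c \<mu>)"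
  shows "ess_nonneg (block_op n (aff_op c0 c x))"
proof (rule ccontr)
  assume ne: "\<not> ess_nonneg (block_op n (aff_op c0 c x))"
  have n0: "0 < n" using n by simp
  let ?X = "aff_op c0 c x" and ?D = "cstar_of_tuple B_alg x"
  note D = cstar_of_tuple(1)[of x, OF x] and xD = cstar_of_tuple(2)[of x, OF x]
  have Xb: "?X i j \<in> bounded_ops" for i j by (rule aff_op_mem[OF cstar_subalgebra_bounded_ops x])
  have Tb: "block_op n ?X \<in> bounded_ops" by (rule block_op_bounded[OF Xb])
  obtain \<epsilon> where \<epsilon>: "0 < \<epsilon>" and seq: "\<forall>N. \<exists>y. norm y = 1 \<and> tailp N y = y \<and>
      cinner y (block_op n ?X y) \<in> {z. Re z \<le> - \<epsilon>} \<union> {z. \<epsilon> \<le> Im z} \<union> {z. Im z \<le> - \<epsilon>}"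
    using not_ess_nonneg_sequence[OF Tb ne] by (elim exE conjE)
  \<comment> \<open>Starting beyond \<open>M * n\<close> puts the components beyond
    \<open>M\<close>, by \<open>tailp_cuntz_adj\<close>.\<close>
  have "\<exists>y. \<forall>M. norm (y M) = 1 \<and> tailp (M * n) (y M) = y M \<and>
      cinner (y M) (block_op n ?X (y M)) \<in> {z. Re z \<le> - \<epsilon>} \<union> {z. \<epsilon> \<le> Im z} \<union> {z. Im z \<le> - \<epsilon>}"
    by (rule choice, rule allI, rule seq[rule_format])
  then obtain y where y': "\<forall>M. norm (y M) = 1 \<and> tailp (M * n) (y M) = y M \<and>
      cinner (y M) (block_op n ?X (y M)) \<in> {z. Re z \<le> - \<epsilon>} \<union> {z. \<epsilon> \<le> Im z} \<union> {z. Im z \<le> - \<epsilon>}"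
    by (elim exE)
  have y: "norm (y M) = 1" "tailp (M * n) (y M) = y M"
      "cinner (y M) (block_op n ?X (y M)) \<in> {z. Re z \<le> - \<epsilon>} \<union> {z. \<epsilon> \<le> Im z} \<union> {z. Im z \<le> - \<epsilon>}" for M
    using y'[rule_format, of M] by (simp_all only: simp_thms)
  let ?S = "{z. Re z \<le> - \<epsilon>} \<union> {z. \<epsilon> \<le> Im z} \<union> {z. Im z \<le> - \<epsilon>}"
  define u where "u = (\<lambda>M j. cuntz_adj n j (y M))"
  have ut: "tailp M (u M j) = u M j" for M j unfolding u_def using tailp_cuntz_adj[of M n j "y M"] by (simp only: y(2))
  have un: "norm (u M j) \<le> 1" for M j unfolding u_def using norm_cuntz_adj_le[of n j "y M"] by (simp only: y(1))
  have "\<forall>M. \<exists>e g. (\<forall>p<n. tailp M (e p) = e p) \<and> (\<forall>p<n. \<forall>q<n. cinner (e p) (e q) = (if p = q then 1 else 0)) \<and>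
     (\<forall>j<n. u M j = (\<Sum>p<n. scaleC (g p j) (e p)))"
    by (intro allI gram_schmidt_tail ut)
  hence "\<exists>e. \<forall>M. \<exists>g. (\<forall>p<n. tailp M (e M p) = e M p) \<and> (\<forall>p<n. \<forall>q<n. cinner (e M p) (e M q) = (if p = q then 1 else 0)) \<and>
     (\<forall>j<n. u M j = (\<Sum>p<n. scaleC (g p j) (e M p)))" by (rule choice)
  then obtain e where "\<forall>M. \<exists>g. (\<forall>p<n. tailp M (e M p) = e M p) \<and> (\<forall>p<n. \<forall>q<n. cinner (e M p) (e M q) = (if p = q then 1 else 0)) \<and>
     (\<forall>j<n. u M j = (\<Sum>p<n. scaleC (g p j) (e M p)))" by (elim exE)
  hence "\<exists>g. \<forall>M. (\<forall>p<n. tailp M (e M p) = e M p) \<and> (\<forall>p<n. \<forall>q<n. cinner (e M p) (e M q) = (if p = q then 1 else 0)) \<and>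
     (\<forall>j<n. u M j = (\<Sum>p<n. scaleC (g M p j) (e M p)))" by (rule choice)
  then obtain g where eg: "\<forall>M. (\<forall>p<n. tailp M (e M p) = e M p) \<and> (\<forall>p<n. \<forall>q<n. cinner (e M p) (e M q) = (if p = q then 1 else 0)) \<and>
     (\<forall>j<n. u M j = (\<Sum>p<n. scaleC (g M p j) (e M p)))" by (elim exE)
  have et: "tailp M (e M p) = e M p" if "p < n" for M p
    using eg[rule_format, of M, THEN conjunct1] that by (elim allE impE)
  have eo: "cinner (e M p) (e M q) = (if p = q then 1 else 0)" if "p < n" "q < n" for M p q
    by (rule eg[rule_format, of M, THEN conjunct2, THEN conjunct1, rule_format, OF that])
  have ug: "u M j = (\<Sum>p<n. scaleC (g M p j) (e M p))" if "j < n" for M j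
    by (rule eg[rule_format, of M, THEN conjunct2, THEN conjunct2, rule_format, OF that])
  have en: "norm (e M p) = 1" if "p < n" for M p
    using eo[OF that that, of M] power2_eq_iff_nonneg[of "norm (e M p)" 1] by (simp add: cinner_self flip: of_real_power)
  \<comment> \<open>The coefficients are inner products of a unit vector with vectors of norm at
    most one, hence bounded, so they have limits.\<close>
  have gb: "cmod (g M p j) \<le> 1" if "p < n" "j < n" for M p j
  proof -
    have "cinner (e M p) (u M j) = (\<Sum>q<n. if q = p then g M q j else 0)"
      unfolding ug[OF that(2)] cinner_sum_right by (intro sum.cong refl) (use that eo in auto)
    hence "g M p j = cinner (e M p) (u M j)" using that by simp
    hence "cmod (g M p j) \<le> norm (e M p) * norm (u M j)" by (metis cmod_cinner_le)
    thus ?thesis using un[of M j] en[OF that(1)] by simp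
  qed
  define \<gamma> where "\<gamma> = (\<lambda>p j. Lim ufil (\<lambda>M. g M p j))"
  have gl: "((\<lambda>M. g M p j) \<longlongrightarrow> \<gamma> p j) ufil" if "p < n" "j < n" for p j
    unfolding \<gamma>_def by (rule ufil_lim) (use gb[OF that] in \<open>auto intro!: boundedI[where B = 1]\<close>)
  note U = compr_ucp(1)[of n e, OF n0 et eo D]
  note Uc = compr_ucp(2)[of n e, OF n0 et eo D]
  define a where "a = (\<lambda>l. compr n e (x l))"
  have "(n, a) \<in> ess_matrix_range x" unfolding ess_matrix_range_def a_def using n U Uc by blast
  hence "(n, a) \<in> Kmin K" using We by blast
  then obtain m w \<Lambda> where P: "povm K n m w \<Lambda> a" unfolding Kmin_iff_povm by blast
  let ?G = "\<lambda>r. affine_mat c0 c (\<Lambda> r)"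
  have cX: "compr n e (?X i j) $$ (p, q) = (\<Sum>r<m. ?G r i j * (w r p * cnj (w r q)))" if pq: "p < n" "q < n" for i j p q
  proof -
    have "compr n e (?X i j) $$ (p, q) = c0 i j * ident p q + (\<Sum>l\<in>UNIV. c l i j * a l $$ (p, q))"
      unfolding a_def by (rule ucp_aff_op[OF U D xD pq])
    also have "ident p q = (\<Sum>r<m. w r p * cnj (w r q))" using P pq by (simp add: povm_def ident_def)
    also have "(\<Sum>l\<in>UNIV. c l i j * a l $$ (p, q)) = (\<Sum>l\<in>UNIV. \<Sum>r<m. c l i j * (of_real (vec_nth (\<Lambda> r) l) * (w r p * cnj (w r q))))"
      using P pq by (intro sum.cong refl) (simp add: povm_def sum_distrib_left)
    also have "\<dots> = (\<Sum>r<m. \<Sum>l\<in>UNIV. c l i j * (of_real (vec_nth (\<Lambda> r) l) * (w r p * cnj (w r q))))" by (rule sum.swap)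
    also have "c0 i j * (\<Sum>r<m. w r p * cnj (w r q)) + \<dots> = (\<Sum>r<m. ?G r i j * (w r p * cnj (w r q)))"
      unfolding affine_mat_def sum_distrib_left sum.distrib[symmetric]
      by (intro sum.cong refl) (simp add: distrib_left distrib_right sum_distrib_right sum_distrib_left mult_ac)
    finally show ?thesis .
  qed
  let ?L = "\<Sum>i<n. \<Sum>j<n. \<Sum>p<n. \<Sum>q<n. cnj (\<gamma> p i) * compr n e (?X i j) $$ (p, q) * \<gamma> q j"
  have yq: "cinner (y M) (block_op n ?X (y M)) = (\<Sum>i<n. \<Sum>j<n. \<Sum>p<n. \<Sum>q<n. cnj (g M p i) * cinner (e M p) (?X i j (e M q)) * g M q j)" for M
  proof -
    have "cinner (y M) (block_op n ?X (y M)) = (\<Sum>i<n. \<Sum>j<n. cinner (u M i) (?X i j (u M j)))"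
      unfolding cinner_block_op u_def ..
    also have "\<dots> = (\<Sum>i<n. \<Sum>j<n. \<Sum>p<n. \<Sum>q<n. cnj (g M p i) * cinner (e M p) (?X i j (e M q)) * g M q j)"
    proof (intro sum.cong refl)
      fix i j assume "i \<in> {..<n}" "j \<in> {..<n}"
      hence ij: "i < n" "j < n" by auto
      have A: "cinner z (?X i j (u M j)) = (\<Sum>q<n. g M q j * cinner z (?X i j (e M q)))" for z
        unfolding ug[OF ij(2)] by (simp only: bounded_ops_sum[OF Xb] bounded_ops_lin(2)[OF Xb] cinner_sum_right cinner_simps)
      have B: "cinner (u M i) z = (\<Sum>p<n. cnj (g M p i) * cinner (e M p) z)" for z
        unfolding ug[OF ij(1)] by (simp only: cinner_sum_left cinner_simps)
      have "cinner (u M i) (?X i j (u M j)) = (\<Sum>p<n. cnj (g M p i) * cinner (e M p) (?X i j (u M j)))" by (rule B)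
      also have "\<dots> = (\<Sum>p<n. cnj (g M p i) * (\<Sum>q<n. g M q j * cinner (e M p) (?X i j (e M q))))" by (simp only: A)
      also have "\<dots> = (\<Sum>p<n. \<Sum>q<n. cnj (g M p i) * cinner (e M p) (?X i j (e M q)) * g M q j)"
        by (simp add: sum_distrib_left mult_ac)
      finally show "cinner (u M i) (?X i j (u M j)) = (\<Sum>p<n. \<Sum>q<n. cnj (g M p i) * cinner (e M p) (?X i j (e M q)) * g M q j)" .
    qed
    finally show ?thesis .
  qed
  have "((\<lambda>M. cinner (y M) (block_op n ?X (y M))) \<longlongrightarrow> ?L) ufil"
    unfolding yq by (intro tendsto_sum tendsto_mult tendsto_cnj gl compr_lim[OF n0 et eo Xb]) auto
  moreover have "closed ?S"
    by (intro closed_Un closed_Collect_le continuous_intros)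
  ultimately have LS: "?L \<in> ?S"
    by (intro Lim_in_closed_set[OF _ _ ufil_neq_bot]) (use y(3) in \<open>auto intro!: always_eventually\<close>)
  \<comment> \<open>Substituting the rank-one measure for the compression regroups the limit into
    one form of \<open>affine_mat\<close> at each point \<open>\<Lambda> r\<close> of
    \<open>K\<close>.\<close>
  have "?L = (\<Sum>i<n. \<Sum>j<n. \<Sum>r<m. ?G r i j * ((\<Sum>p<n. cnj (\<gamma> p i) * w r p) * cnj (\<Sum>q<n. cnj (\<gamma> q j) * w r q)))"
    unfolding sum_rank_one_conj by (intro sum.cong refl) (simp add: cX)
  also have "\<dots> = (\<Sum>i<n. \<Sum>r<m. \<Sum>j<n. ?G r i j * ((\<Sum>p<n. cnj (\<gamma> p i) * w r p) * cnj (\<Sum>q<n. cnj (\<gamma> q j) * w r q)))"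
    by (intro sum.cong refl sum.swap)
  also have "\<dots> = (\<Sum>r<m. \<Sum>i<n. \<Sum>j<n. ?G r i j * ((\<Sum>p<n. cnj (\<gamma> p i) * w r p) * cnj (\<Sum>q<n. cnj (\<gamma> q j) * w r q)))"
    by (rule sum.swap)
  also have "\<dots> = (\<Sum>r<m. quad n (?G r) (\<lambda>j. cnj (\<Sum>q<n. cnj (\<gamma> q j) * w r q)))"
    unfolding quad_def by (intro sum.cong refl) (simp add: mult_ac)
  also have "\<dots> \<in> \<real>\<^sub>\<ge>\<^sub>0"
  proof (rule nonneg_Reals_sum)
    fix r assume "r \<in> {..<m}"
    hence "\<Lambda> r \<in> K" using P by (simp add: povm_def)
    from psd[OF this] show "quad n (?G r) (\<lambda>j. cnj (\<Sum>q<n. cnj (\<gamma> q j) * w r q)) \<in> \<real>\<^sub>\<ge>\<^sub>0" unfolding psd_def by blast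
  qed
  finally have "0 \<le> Re ?L \<and> Im ?L = 0" unfolding complex_nonneg_Reals_iff .
  thus False using LS \<epsilon> by (simp only: Un_iff mem_Collect_eq) linarith
qed

section \<open>Essential states with prescribed values\<close>

text \<open>\<open>T\<close> equals a positive \<open>R\<close> up to a compact operator, and both
  lie in \<open>D\<close>; there \<open>\<phi>\<close> is nonnegative on
  \<open>R = Q\<^sup>* Q\<close> and zero on the difference.\<close>

lemma ucp_ess_pos:
  assumes U: "ucp (B_alg\<lparr>carrier := D\<rparr>) D (M_alg 1) \<phi>" and D: "cstar_subalgebra B_alg D"
    and van: "\<And>T. T \<in> D \<Longrightarrow> T \<in> compact_ops \<Longrightarrow> \<phi> T = 0\<^sub>m 1 1"
    and T: "T \<in> D" "op_adjoint T = T" "ess_pos T"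
  shows "0 \<le> Re (\<phi> T $$ (0, 0))"
proof -
  note d = cstar_subalgebra_B_algD[OF D]
  have Tb: "T \<in> bounded_ops" using d(1) T(1) by blast
  obtain R where R: "pos_op R" "tail_small (\<lambda>x. R x - T x)" and RD: "R \<in> D"
    by (rule ess_pos_decomp[OF Tb T(2,3)]) (use D T(1) in blast)
  obtain Q where Q': "pos_op Q \<and> (\<forall>x. Q (Q x) = R x) \<and> (\<forall>D. cstar_subalgebra B_alg D \<longrightarrow> R \<in> D \<longrightarrow> Q \<in> D)"
    by (rule exE[OF pos_op_sqrt_ex[OF R(1)]])
  hence Q: "pos_op Q" "\<And>x. Q (Q x) = R x" "Q \<in> D" using D RD by simp_all
  have "op_adjoint Q = Q" using Q(1) unfolding pos_op_def by simp
  hence pm: "positive_matrix (B_alg\<lparr>carrier := D\<rparr>) 1 (\<lambda>i j. R)"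
    unfolding positive_matrix_B_sub[OF D] by (intro exI[of _ "\<lambda>i j. Q"]) (simp add: Q)
  have "psd (1 * 1) (blockmat 1 (\<lambda>i j. \<phi> R))" by (rule ucp_B_D(5)[OF U D _ _ pm]) (use RD in auto)
  from psd_diag[OF this, of 0] have p: "0 \<le> Re (\<phi> R $$ (0, 0))" by (simp add: blockmat_def complex_nonneg_Reals_iff)
  define S where "S = (\<lambda>x. R x - T x)"
  have SD: "S \<in> D" unfolding S_def by (rule d(4)[OF RD T(1)])
  have "S \<in> compact_ops" unfolding compact_ops_iff S_def using R(2) SD d(1) by (auto simp: S_def)
  hence S0: "\<phi> S = 0\<^sub>m 1 1" by (rule van[OF SD])
  have "R = (\<lambda>x. S x + T x)" by (simp add: S_def)
  hence "\<phi> R = \<phi> S + \<phi> T" using ucp_B_D(2)[OF U D SD T(1)] by simp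
  hence "\<phi> R $$ (0, 0) = \<phi> T $$ (0, 0)" using ucp_B_D(1)[OF U D T(1)] S0 by simp
  thus ?thesis using p by simp
qed

lemma inner_complex_vec: "inner (a :: complex^'d) z = Re (\<Sum>l\<in>UNIV. cnj (vec_nth a l) * vec_nth z l)"
  by (simp add: inner_vec_def inner_complex_def)

lemma ess_pos_if_unit_tail:
  assumes T: "T \<in> bounded_ops" and H: "\<And>v. norm v = 1 \<Longrightarrow> tailp N v = v \<Longrightarrow> 0 \<le> Re (cinner v (T v))"
  shows "ess_pos T"
  unfolding ess_pos_def
proof (intro allI impI exI[of _ N])
  fix \<epsilon> :: real and N' v assume e: "0 < \<epsilon>" and N: "N \<le> N'"
  define w where "w = tailp N' v"
  have tw: "tailp N w = w" unfolding w_def by (rule tailp_tailp[OF N])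
  have "0 \<le> Re (cinner w (T w))"
  proof (cases "w = 0")
    case False
    define y where "y = (1 / norm w) *\<^sub>R w"
    have "norm y = 1" using False by (simp add: y_def)
    moreover have "tailp N y = y" using tw by (simp add: y_def scaleR_scaleC)
    ultimately have "0 \<le> Re (cinner y (T y))" by (rule H)
    also have "cinner y (T y) = of_real (1 / (norm w)\<^sup>2) * cinner w (T w)"
      by (simp add: y_def bounded_ops_lin(6)[OF T] power2_eq_square)
    finally show ?thesis using False by (simp add: zero_le_divide_iff)
  qed simp
  moreover have "0 \<le> \<epsilon> * (norm v)\<^sup>2" using e by simp
  ultimately show "- (\<epsilon> * (norm v)\<^sup>2) \<le> Re (cinner (tailp N' v) (T (tailp N' v)))" unfolding w_def by linarith
qed

lemma Kmin_scalar:
  assumes "\<mu> \<in> K" shows "(1, \<lambda>l. mat 1 1 (\<lambda>_. of_real (vec_nth \<mu> l))) \<in> Kmin K"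
  by (rule povm_imp_Kmin[where m = 1 and w = "\<lambda>_ _. 1" and \<Lambda> = "\<lambda>_. \<mu>"]) (use assms in \<open>auto simp: povm_def\<close>)

text \<open>A functional separating \<open>\<mu>\<close> from the numerical range over the
  \<open>N\<close>-th tail gives an operator whose form has nonnegative real part on that tail. A
  ucp map vanishing on compact operators then has nonnegative real part there, while the one that
  represents \<open>\<mu>\<close> does not.\<close>

lemma joint_numerical_range_closure:
  fixes K :: "(real^'d) set"
  assumes x: "\<And>l. x l \<in> bounded_ops" and We: "Kmin K \<subseteq> ess_matrix_range x" and \<mu>: "\<mu> \<in> K"
  shows "(\<chi> l. complex_of_real (vec_nth \<mu> l)) \<in>
    closure (convex hull {(\<chi> l. cinner v (x l v)) | v. norm v = 1 \<and> tailp N v = v})" (is "?m \<in> closure (convex hull ?S)")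
proof (rule ccontr)
  assume nin: "?m \<notin> closure (convex hull ?S)"
  have "\<exists>a b. inner a ?m < b \<and> (\<forall>x\<in>closure (convex hull ?S). inner a x > b)"
    by (rule separating_hyperplane_closed_point[OF convex_closure[OF convex_convex_hull] closed_closure nin])
  then obtain a b where ab: "inner a ?m < b" "\<forall>x\<in>closure (convex hull ?S). b < inner a x" by (elim exE conjE)
  \<comment> \<open>Coefficients of the separating functional with the threshold as constant term:
    at a unit vector, the real part of the form of \<open>T\<close> is the functional minus
    \<open>b\<close>.\<close>
  define c0 where "c0 = (\<lambda>(i::nat) (j::nat). - complex_of_real b)"
  define c where "c = (\<lambda>l. \<lambda>(i::nat) (j::nat). cnj (vec_nth a l))"
  let ?D = "cstar_of_tuple B_alg x"
  note D = cstar_of_tuple(1)[of x, OF x] and xD = cstar_of_tuple(2)[of x, OF x]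
  note d = cstar_subalgebra_B_algD[OF D]
  define T where "T = aff_op c0 c x 0 0"
  have TD: "T \<in> ?D" unfolding T_def by (rule aff_op_mem[OF D xD])
  have Tb: "T \<in> bounded_ops" using d(1) TD by blast
  \<comment> \<open>The \<open>x l\<close> need not be self-adjoint, so the argument runs with twice
    the real part of \<open>T\<close>.\<close>
  define H where "H = (\<lambda>v. T v + op_adjoint T v)"
  have HD: "H \<in> ?D" unfolding H_def by (rule d(3)[OF TD d(7)[OF TD]])
  have Hb: "H \<in> bounded_ops" using d(1) HD by blast
  have Ha: "op_adjoint H = H" unfolding H_def by (simp add: op_adjoint_add[OF Tb op_adjoint_bounded[OF Tb]] Tb add.commute)
  have Hp: "0 \<le> Re (cinner v (H v))" if v: "norm v = 1" "tailp N v = v" for v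
  proof -
    have "(\<chi> l. cinner v (x l v)) \<in> ?S" using v by blast
    hence "(\<chi> l. cinner v (x l v)) \<in> closure (convex hull ?S)" by (rule subsetD[OF closure_subset hull_inc])
    hence "b < inner a (\<chi> l. cinner v (x l v))" using ab(2) by blast
    hence "b < Re (\<Sum>l\<in>UNIV. cnj (vec_nth a l) * cinner v (x l v))" by (simp add: inner_complex_vec)
    moreover have "cinner v (T v) = - of_real b + (\<Sum>l\<in>UNIV. cnj (vec_nth a l) * cinner v (x l v))"
      using v(1) by (simp add: T_def aff_op_def c0_def c_def cinner_sum_right cinner_self)
    ultimately have "0 \<le> Re (cinner v (T v))" by simp
    moreover have "cinner v (op_adjoint T v) = cnj (cinner v (T v))"
      by (simp add: cinner_op_adjoint'[OF Tb] cnj_cinner)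
    ultimately show ?thesis by (simp add: H_def)
  qed
  have He: "ess_pos H" by (rule ess_pos_if_unit_tail[OF Hb Hp])
  have "(1, \<lambda>l. mat 1 1 (\<lambda>_. complex_of_real (vec_nth \<mu> l))) \<in> ess_matrix_range x" using Kmin_scalar[OF \<mu>] We by blast
  hence "\<exists>\<phi>. (\<lambda>l. mat 1 1 (\<lambda>_. complex_of_real (vec_nth \<mu> l))) = (\<lambda>l. \<phi> (x l)) \<and>
      ucp (B_alg\<lparr>carrier := ?D\<rparr>) ?D (M_alg 1) \<phi> \<and> (\<forall>T\<in>?D \<inter> compact_ops. \<phi> T = 0\<^sub>m 1 1)"
    unfolding ess_matrix_range_def by simp
  then obtain \<phi> where \<phi>: "(\<lambda>l. mat 1 1 (\<lambda>_. complex_of_real (vec_nth \<mu> l))) = (\<lambda>l. \<phi> (x l))"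
      and U: "ucp (B_alg\<lparr>carrier := ?D\<rparr>) ?D (M_alg 1) \<phi>"
      and van: "\<forall>T\<in>?D \<inter> compact_ops. \<phi> T = 0\<^sub>m 1 1" by (elim exE conjE)
  have \<phi>x: "\<phi> (x l) $$ (0, 0) = of_real (vec_nth \<mu> l)" for l
    using fun_cong[OF \<phi>, of l, symmetric] by simp
  have "0 \<le> Re (\<phi> H $$ (0, 0))" by (rule ucp_ess_pos[OF U D _ HD Ha He]) (use van in blast)
  also have "\<phi> H = \<phi> T + \<phi> (op_adjoint T)" unfolding H_def by (rule ucp_B_D(2)[OF U D TD d(7)[OF TD]])
  also have "\<dots> $$ (0, 0) = \<phi> T $$ (0, 0) + cnj (\<phi> T $$ (0, 0))"
    using ucp_B_D(1)[OF U D d(7)[OF TD]] ucp_B_adjoint[OF U D TD, of 0 0] by simp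
  finally have "0 \<le> Re (\<phi> T $$ (0, 0))" by simp
  also have "\<phi> T $$ (0, 0) = c0 0 0 * ident 0 0 + (\<Sum>l\<in>UNIV. c l 0 0 * \<phi> (x l) $$ (0, 0))"
    unfolding T_def by (rule ucp_aff_op[OF U D xD]) auto
  finally have "b \<le> Re (\<Sum>l\<in>UNIV. cnj (vec_nth a l) * of_real (vec_nth \<mu> l))"
    by (simp add: c0_def c_def \<phi>x ident_def)
  thus False using ab(1) by (simp add: inner_complex_vec)
qed

text \<open>Convex combinations of vector states over the \<open>N\<close>-th tail approximate the
  point within \<open>1 / (N + 1)\<close>; their limit along \<open>ufil\<close> takes the exact
  values.\<close>

lemma ess_state_exists:
  fixes K :: "(real^'d) set"
  assumes x: "\<And>l. x l \<in> bounded_ops" and We: "Kmin K \<subseteq> ess_matrix_range x" and \<mu>: "\<mu> \<in> K"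
  shows "\<exists>s. ess_state s \<and> (\<forall>l. s (x l) = of_real (vec_nth \<mu> l))"
proof -
  let ?m = "\<chi> l. complex_of_real (vec_nth \<mu> l)"
  define S where "S = (\<lambda>N. {(\<chi> l. cinner v (x l v)) | v. norm v = 1 \<and> tailp N v = v})"
  have "\<exists>F c. finite F \<and> F \<subseteq> S N \<and> (\<forall>y\<in>F. 0 \<le> c y) \<and> sum c F = (1::real) \<and> dist (\<Sum>y\<in>F. c y *\<^sub>R y) ?m < inverse (real (Suc N))" for N
  proof -
    have "?m \<in> closure (convex hull (S N))" unfolding S_def by (rule joint_numerical_range_closure[OF x We \<mu>])
    hence "\<exists>z\<in>convex hull (S N). dist ?m z < inverse (real (Suc N))" by (rule closure_approachableD) simp
    then obtain z where z: "z \<in> convex hull (S N)" "dist ?m z < inverse (real (Suc N))" by (elim bexE)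
    from z(1) obtain F c where "finite F" "F \<subseteq> S N" "\<forall>y\<in>F. 0 \<le> c y" "sum c F = (1::real)" "(\<Sum>y\<in>F. c y *\<^sub>R y) = z"
      unfolding convex_hull_explicit mem_Collect_eq by (elim exE conjE)
    thus ?thesis using z(2) by (intro exI[of _ F] exI[of _ c]) (simp add: dist_commute)
  qed
  hence "\<forall>N. \<exists>F c. finite F \<and> F \<subseteq> S N \<and> (\<forall>y\<in>F. 0 \<le> c y) \<and> sum c F = (1::real) \<and> dist (\<Sum>y\<in>F. c y *\<^sub>R y) ?m < inverse (real (Suc N))"
    by (rule allI)
  hence "\<exists>F. \<forall>N. \<exists>c. finite (F N) \<and> F N \<subseteq> S N \<and> (\<forall>y\<in>F N. 0 \<le> c y) \<and> sum c (F N) = (1::real) \<and> dist (\<Sum>y\<in>F N. c y *\<^sub>R y) ?m < inverse (real (Suc N))"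
    by (rule choice)
  then obtain F where "\<forall>N. \<exists>c. finite (F N) \<and> F N \<subseteq> S N \<and> (\<forall>y\<in>F N. 0 \<le> c y) \<and> sum c (F N) = (1::real) \<and> dist (\<Sum>y\<in>F N. c y *\<^sub>R y) ?m < inverse (real (Suc N))"
    by (elim exE)
  hence "\<exists>c. \<forall>N. finite (F N) \<and> F N \<subseteq> S N \<and> (\<forall>y\<in>F N. 0 \<le> c N y) \<and> sum (c N) (F N) = (1::real) \<and> dist (\<Sum>y\<in>F N. c N y *\<^sub>R y) ?m < inverse (real (Suc N))"
    by (rule choice)
  then obtain c where Fc: "\<forall>N. finite (F N) \<and> F N \<subseteq> S N \<and> (\<forall>y\<in>F N. 0 \<le> c N y) \<and> sum (c N) (F N) = (1::real) \<and> dist (\<Sum>y\<in>F N. c N y *\<^sub>R y) ?m < inverse (real (Suc N))"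
    by (elim exE)
  have F: "finite (F N)" "F N \<subseteq> S N" "sum (c N) (F N) = 1" "dist (\<Sum>y\<in>F N. c N y *\<^sub>R y) ?m < inverse (real (Suc N))" for N
    using Fc[rule_format, of N] by simp_all
  have c: "0 \<le> c N y" if "y \<in> F N" for N y using Fc[rule_format, of N] that by simp
  define v where "v = (\<lambda>N y. SOME v. norm v = 1 \<and> tailp N v = v \<and> y = (\<chi> l. cinner v (x l v)))"
  have v: "norm (v N y) = 1 \<and> tailp N (v N y) = v N y \<and> y = (\<chi> l. cinner (v N y) (x l (v N y)))" if "y \<in> F N" for N y
  proof -
    have "y \<in> S N" using that F(2)[of N] by blast
    hence "\<exists>v. norm v = 1 \<and> tailp N v = v \<and> y = (\<chi> l. cinner v (x l v))" unfolding S_def by blast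
    thus ?thesis unfolding v_def by (rule someI_ex)
  qed
  define s where "s = (\<lambda>T. Lim ufil (\<lambda>N. \<Sum>y\<in>F N. of_real (c N y) * cinner (v N y) (T (v N y))))"
  have es: "ess_state s" unfolding s_def
    by (rule ess_state_limit(1)) (use F(1,3) c v in simp_all)
  moreover have "s (x l) = of_real (vec_nth \<mu> l)" for l
  proof -
    have eq: "(\<Sum>y\<in>F N. of_real (c N y) * cinner (v N y) (x l (v N y))) = vec_nth (\<Sum>y\<in>F N. c N y *\<^sub>R y) l" for N
      unfolding sum_component
    proof (intro sum.cong refl)
      fix y assume y: "y \<in> F N"
      have "vec_nth y l = cinner (v N y) (x l (v N y))"
        using arg_cong[OF v[OF y, THEN conjunct2, THEN conjunct2], of "\<lambda>z. vec_nth z l"] by (simp only: vec_lambda_beta)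
      thus "of_real (c N y) * cinner (v N y) (x l (v N y)) = vec_nth (c N y *\<^sub>R y) l"
        by (simp only: vector_scaleR_component) (simp add: scaleR_conv_of_real)
    qed
    have "(\<lambda>N. vec_nth (\<Sum>y\<in>F N. c N y *\<^sub>R y) l) \<longlonglongrightarrow> vec_nth ?m l"
    proof (rule tendsto_vec_nth)
      show "(\<lambda>N. \<Sum>y\<in>F N. c N y *\<^sub>R y) \<longlonglongrightarrow> ?m"
        by (rule metric_tendsto_imp_tendsto[OF LIMSEQ_inverse_real_of_nat])
          (use F(4) in \<open>auto intro!: always_eventually less_imp_le\<close>)
    qed
    thus ?thesis unfolding s_def eq by (simp add: Lim_ufil_sequentially)
  qed
  ultimately show ?thesis by blast
qed

section \<open>Transport of structure\<close>

context cstar_algebra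
begin

text \<open>The unqualified names of the ring laws refer to the scalar ring.\<close>

lemma ring_A: "ring A"
  by (rule cstar_algebra.axioms(1)[OF cstar_algebra_axioms])

lemmas abelian_group_A = ring.is_abelian_group[OF ring_A]
lemmas a_comm_A = abelian_monoid.a_comm[OF abelian_group.axioms(1)[OF abelian_group_A]]
lemmas a_lcomm_A = abelian_monoid.a_lcomm[OF abelian_group.axioms(1)[OF abelian_group_A]]
lemmas l_neg_A = abelian_group.l_neg[OF abelian_group_A]
lemmas m_assoc_A = monoid.m_assoc[OF ring.axioms(2)[OF ring_A]]

end

definition transport :: "('a \<Rightarrow> 'b) \<Rightarrow> ('a, 'm) cstar_alg_scheme \<Rightarrow> 'b cstar_alg" where
  "transport g A = (let h = inv_into (carrier A) g in
    \<lparr>carrier = g ` carrier A, mult = (\<lambda>x y. g (h x \<otimes>\<^bsub>A\<^esub> h y)), one = g \<one>\<^bsub>A\<^esub>, zero = g \<zero>\<^bsub>A\<^esub>,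
     add = (\<lambda>x y. g (h x \<oplus>\<^bsub>A\<^esub> h y)), smult = (\<lambda>c x. g (c \<odot>\<^bsub>A\<^esub> h x)),
     star = (\<lambda>x. g (star A (h x))), cnorm = (\<lambda>x. cnorm A (h x))\<rparr>)"

locale cstar_transport = cstar_algebra A for A :: "('a, 'm) cstar_alg_scheme" (structure) +
  fixes g :: "'a \<Rightarrow> 'b"
  assumes inj: "inj_on g (carrier A)" and metric: "Metric_space (carrier A) (cdist A)"
begin

lemma inv_g [simp]: "x \<in> carrier A \<Longrightarrow> inv_into (carrier A) g (g x) = x"
  by (rule inv_into_f_f[OF inj])

lemma g_eq_iff [simp]: "x \<in> carrier A \<Longrightarrow> y \<in> carrier A \<Longrightarrow> g x = g y \<longleftrightarrow> x = y"
  by (rule inj_on_eq_iff[OF inj])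

lemma transport_carrier [simp]: "carrier (transport g A) = g ` carrier A"
  by (simp add: transport_def Let_def)

lemma transport_sel [simp]:
  "\<one>\<^bsub>transport g A\<^esub> = g \<one>" "\<zero>\<^bsub>transport g A\<^esub> = g \<zero>"
  "x \<in> carrier A \<Longrightarrow> y \<in> carrier A \<Longrightarrow> g x \<otimes>\<^bsub>transport g A\<^esub> g y = g (x \<otimes> y)"
  "x \<in> carrier A \<Longrightarrow> y \<in> carrier A \<Longrightarrow> g x \<oplus>\<^bsub>transport g A\<^esub> g y = g (x \<oplus> y)"
  "x \<in> carrier A \<Longrightarrow> c \<odot>\<^bsub>transport g A\<^esub> g x = g (c \<odot> x)"
  "x \<in> carrier A \<Longrightarrow> star (transport g A) (g x) = g (star A x)"
  "x \<in> carrier A \<Longrightarrow> cnorm (transport g A) (g x) = cnorm A x"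
  by (simp_all add: transport_def Let_def)

lemma smult_cl [simp]: "x \<in> carrier A \<Longrightarrow> c \<odot> x \<in> carrier A"
  using smult_closed[of c x] by simp

lemma ring_transport: "ring (transport g A)"
proof (rule ringI)
  show "abelian_group (transport g A)"
  proof (rule abelian_groupI)
    fix x assume "x \<in> carrier (transport g A)"
    then obtain a where a: "x = g a" "a \<in> carrier A" by auto
    show "\<exists>y\<in>carrier (transport g A). y \<oplus>\<^bsub>transport g A\<^esub> x = \<zero>\<^bsub>transport g A\<^esub>"
      using a by (intro bexI[of _ "g (\<ominus> a)"]) (auto simp: l_neg_A)
  qed (auto simp: a_comm_A a_lcomm_A)
  show "monoid (transport g A)" by (rule monoidI) (auto simp: m_assoc_A)
qed (auto simp: ring.ring_simprules[OF ring_A])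

lemma transport_minus [simp]:
  assumes "x \<in> carrier A" "y \<in> carrier A" shows "g x \<ominus>\<^bsub>transport g A\<^esub> g y = g (x \<ominus> y)"
proof -
  interpret T: ring "transport g A" by (rule ring_transport)
  have "\<ominus>\<^bsub>transport g A\<^esub> g y = g (\<ominus> y)" by (rule T.minus_equality) (use assms in \<open>auto simp: l_neg_A\<close>)
  thus ?thesis using assms by (simp add: a_minus_def)
qed

lemma cdist_transport [simp]:
  assumes "x \<in> carrier A" "y \<in> carrier A" shows "cdist (transport g A) (g x) (g y) = cdist A x y"
  using assms by (simp add: cdist_def)

lemma Metric_space_transport: "Metric_space (g ` carrier A) (cdist (transport g A))"
proof -
  interpret M: Metric_space "carrier A" "cdist A" by (rule metric)
  show ?thesis
  proof
    fix x y
    have "0 \<le> cdist (transport g A) x y \<and> cdist (transport g A) x y = cdist (transport g A) y x"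
    proof (cases "x \<in> g ` carrier A \<and> y \<in> g ` carrier A")
      case True
      then obtain a b where "x = g a" "a \<in> carrier A" "y = g b" "b \<in> carrier A" by blast
      thus ?thesis using M.commute[of a b] by simp
    next
      case False thus ?thesis by (auto simp: cdist_def)
    qed
    thus "0 \<le> cdist (transport g A) x y" "cdist (transport g A) x y = cdist (transport g A) y x" by blast+
  next
    fix x y assume "x \<in> g ` carrier A" "y \<in> g ` carrier A"
    then obtain a b where ab: "x = g a" "a \<in> carrier A" "y = g b" "b \<in> carrier A" by blast
    thus "cdist (transport g A) x y = 0 \<longleftrightarrow> x = y" using M.zero[of a b] by simp
    fix z assume "z \<in> g ` carrier A"
    then obtain c where c: "z = g c" "c \<in> carrier A" by blast
    show "cdist (transport g A) x z \<le> cdist (transport g A) x y + cdist (transport g A) y z"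
      using ab c M.triangle[of a b c] by simp
  qed
qed

lemma limitin_transport:
  assumes "\<And>n. \<sigma> n \<in> carrier A" "x \<in> carrier A"
  shows "limitin (Metric_space.mtopology (g ` carrier A) (cdist (transport g A))) (\<lambda>n. g (\<sigma> n)) (g x) sequentially \<longleftrightarrow>
    limitin (cstar_topology A) \<sigma> x sequentially"
proof -
  interpret M: Metric_space "carrier A" "cdist A" by (rule metric)
  interpret N: Metric_space "g ` carrier A" "cdist (transport g A)" by (rule Metric_space_transport)
  show ?thesis unfolding M.limitin_metric_dist_null N.limitin_metric_dist_null using assms by simp
qed

lemma mcomplete_transport: "Metric_space.mcomplete (g ` carrier A) (cdist (transport g A))"
proof -
  interpret M: Metric_space "carrier A" "cdist A" by (rule metric)
  interpret N: Metric_space "g ` carrier A" "cdist (transport g A)" by (rule Metric_space_transport)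
  show ?thesis unfolding N.mcomplete_def
  proof (intro allI impI)
    fix \<sigma> assume C: "N.MCauchy \<sigma>"
    define \<tau> where "\<tau> = (\<lambda>n. inv_into (carrier A) g (\<sigma> n))"
    have \<sigma>: "\<sigma> n \<in> g ` carrier A" for n using C unfolding N.MCauchy_def by blast
    have \<tau>: "\<tau> n \<in> carrier A" "g (\<tau> n) = \<sigma> n" for n
      using inv_into_into[OF \<sigma>] f_inv_into_f[OF \<sigma>] unfolding \<tau>_def by auto
    have "cdist (transport g A) (\<sigma> n) (\<sigma> m) = cdist A (\<tau> n) (\<tau> m)" for n m
      using cdist_transport[OF \<tau>(1) \<tau>(1), of n m] by (simp only: \<tau>(2))
    hence "M.MCauchy \<tau>" using C \<tau>(1) unfolding N.MCauchy_def M.MCauchy_def by auto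
    then obtain x where x: "limitin M.mtopology \<tau> x sequentially"
      using complete unfolding M.mcomplete_def by blast
    hence "x \<in> carrier A" using M.limitin_mspace by blast
    with limitin_transport[of \<tau> x] \<tau>(1) x
    have "limitin N.mtopology (\<lambda>n. g (\<tau> n)) (g x) sequentially" by blast
    thus "\<exists>x. limitin N.mtopology \<sigma> x sequentially" unfolding \<tau>(2) by blast
  qed
qed

lemma cstar_algebra_transport: "cstar_algebra (transport g A)"
proof -
  interpret T: ring "transport g A" by (rule ring_transport)
  have m: "module (class_ring :: complex ring) (transport g A)"
    by (rule moduleI[OF cring_complex T.abelian_group_axioms])
      (use smult_l_distr smult_r_distr smult_assoc1 smult_one in auto)
  show ?thesis
  proof (intro cstar_algebra.intro ring_transport m cstar_algebra_axioms.intro)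
    show "Metric_space.mcomplete (carrier (transport g A)) (cdist (transport g A))" using mcomplete_transport by simp
  qed (auto simp: star_closed star_star star_add star_smult star_mult cnorm_nonneg cnorm_eq_0_iff cnorm_triangle
      cnorm_smult cnorm_mult cstar_identity smult_mult_left smult_mult_right)
qed

lemma ideal_transport:
  assumes "ideal J A" shows "ideal (g ` J) (transport g A)"
proof -
  interpret J: ideal J A by (rule assms)
  interpret T: ring "transport g A" by (rule ring_transport)
  note Jc = J.Icarr
  have inv: "a_inv (transport g A) (g x) = g (\<ominus> x)" if "x \<in> J" for x
    by (rule T.minus_equality) (use that Jc in \<open>auto simp: l_neg_A\<close>)
  show ?thesis
  proof (rule idealI[OF ring_transport])
    show "subgroup (g ` J) (add_monoid (transport g A))"
    proof (rule T.add.subgroupI)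
      show "g ` J \<subseteq> carrier (transport g A)" using Jc by auto
      show "g ` J \<noteq> {}" using J.zero_closed by blast
      fix x assume "x \<in> g ` J"
      then obtain a where a: "x = g a" "a \<in> J" by blast
      show "a_inv (transport g A) x \<in> g ` J" using a inv J.a_inv_closed by simp
      fix y assume "y \<in> g ` J"
      then obtain b where b: "y = g b" "b \<in> J" by blast
      have "a \<oplus> b \<in> J" using a b by simp
      thus "x \<oplus>\<^bsub>transport g A\<^esub> y \<in> g ` J" using a b Jc by simp
    qed
  next
    fix x y assume "x \<in> g ` J" "y \<in> carrier (transport g A)"
    then obtain a b where ab: "x = g a" "a \<in> J" "y = g b" "b \<in> carrier A" by auto
    show "y \<otimes>\<^bsub>transport g A\<^esub> x \<in> g ` J" using ab Jc J.I_l_closed[of a b] by simp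
    show "x \<otimes>\<^bsub>transport g A\<^esub> y \<in> g ` J" using ab Jc J.I_r_closed[of a b] by simp
  qed
qed

text \<open>Convergent sequences in the image of the ideal are pulled back along \<open>g\<close>,
  which is isometric.\<close>

lemma closed_ideal_transport:
  assumes "closed_ideal A J" shows "closed_ideal (transport g A) (g ` J)"
proof -
  interpret M: Metric_space "carrier A" "cdist A" by (rule metric)
  interpret N: Metric_space "g ` carrier A" "cdist (transport g A)" by (rule Metric_space_transport)
  have J: "ideal J A" and cl: "closedin (cstar_topology A) J" using assms unfolding closed_ideal_def by auto
  have JA: "J \<subseteq> carrier A" using ideal.Icarr[OF J] by blast
  have "closedin N.mtopology (g ` J)"
    unfolding N.metric_closedin_iff_sequentially_closed
  proof (intro conjI allI impI)
    show "g ` J \<subseteq> g ` carrier A" using JA by blast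
    fix \<sigma> l assume \<sigma>: "range \<sigma> \<subseteq> g ` J \<and> limitin N.mtopology \<sigma> l sequentially"
    hence "l \<in> g ` carrier A" using N.limitin_mspace by blast
    then obtain x where x: "l = g x" "x \<in> carrier A" by blast
    define \<tau> where "\<tau> = (\<lambda>n. inv_into J g (\<sigma> n))"
    have \<tau>: "\<tau> n \<in> J" "g (\<tau> n) = \<sigma> n" for n
      using \<sigma> inv_into_into[of "\<sigma> n" g J] f_inv_into_f[of "\<sigma> n" g J] unfolding \<tau>_def by blast+
    have "limitin N.mtopology (\<lambda>n. g (\<tau> n)) (g x) sequentially" unfolding \<tau>(2) using \<sigma> x by simp
    hence "limitin M.mtopology \<tau> x sequentially" using limitin_transport[of \<tau> x] \<tau>(1) JA x(2) by blast
    hence "x \<in> J" using cl \<tau>(1) unfolding M.metric_closedin_iff_sequentially_closed by blast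
    thus "l \<in> g ` J" using x by blast
  qed
  thus ?thesis unfolding closed_ideal_def using ideal_transport[OF J] by simp
qed

end

section \<open>Positive matrices over a quotient\<close>

lemma quotient_alg_sel [simp]:
  "carrier (quotient_alg A J) = carrier (A Quot J)" "mult (quotient_alg A J) = mult (A Quot J)"
  "one (quotient_alg A J) = one (A Quot J)" "zero (quotient_alg A J) = zero (A Quot J)"
  "add (quotient_alg A J) = add (A Quot J)"
  by (simp_all add: quotient_alg_def)

text \<open>Self-adjointness of the ideal makes the involution on cosets independent of
  representatives; for the compact operators it is \<open>tail_small_adjoint\<close>.\<close>

locale star_ideal = cstar_algebra A + J: ideal J A for A :: "('a, 'm) cstar_alg_scheme" (structure) and J +
  assumes star_J: "x \<in> J \<Longrightarrow> star A x \<in> J"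
begin

abbreviation Q where "Q \<equiv> quotient_alg A J"

lemma coset_eq_iff: "x \<in> carrier A \<Longrightarrow> y \<in> carrier A \<Longrightarrow> J +> x = J +> y \<longleftrightarrow> x \<ominus> y \<in> J"
  using ring.quotient_eq_iff_same_a_r_cos[OF ring_A J.ideal_axioms] by blast

lemma coset_closed: "x \<in> carrier A \<Longrightarrow> J +> x \<in> carrier Q"
  by (auto simp: FactRing_def A_RCOSETS_def')

lemma coset_ops:
  shows coset_add: "x \<in> carrier A \<Longrightarrow> y \<in> carrier A \<Longrightarrow> (J +> x) \<oplus>\<^bsub>Q\<^esub> (J +> y) = J +> (x \<oplus> y)"
    and coset_mult: "x \<in> carrier A \<Longrightarrow> y \<in> carrier A \<Longrightarrow> (J +> x) \<otimes>\<^bsub>Q\<^esub> (J +> y) = J +> (x \<otimes> y)"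
    and coset_one: "\<one>\<^bsub>Q\<^esub> = J +> \<one>"
    and coset_zero: "\<zero>\<^bsub>Q\<^esub> = J +> \<zero>"
  using J.a_rcos_sum J.rcoset_mult_add ring.a_rcos_zero[OF ring_A J.ideal_axioms J.zero_closed]
  by (simp_all add: FactRing_def)

lemma smult_cl: "x \<in> carrier A \<Longrightarrow> c \<odot> x \<in> carrier A"
  using smult_closed[of c x] by simp

lemma smult_J: "x \<in> J \<Longrightarrow> c \<odot> x \<in> J"
  using J.I_l_closed[of x "c \<odot> \<one>"] smult_cl[of \<one> c] smult_mult_left[of \<one> x c] J.Icarr[of x] by simp

lemma mem_coset: "x \<in> carrier A \<Longrightarrow> y \<in> J +> x \<longleftrightarrow> (\<exists>j\<in>J. y = j \<oplus> x)"
  unfolding a_r_coset_def' by blast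

lemma self_mem_coset: "x \<in> carrier A \<Longrightarrow> x \<in> J +> x"
  unfolding mem_coset using J.zero_closed by (intro bexI[of _ \<zero>]) auto

lemma coset_addJ: "x \<in> carrier A \<Longrightarrow> j \<in> J \<Longrightarrow> J +> (j \<oplus> x) = J +> x"
  using coset_add[of j x] J.Icarr ring.a_rcos_zero[OF ring_A J.ideal_axioms] coset_zero coset_add[of \<zero> x]
    ring.a_rcos_zero[OF ring_A J.ideal_axioms J.zero_closed] by simp

text \<open>The quotient operation is a union over representatives; they all yield the same coset,
  so the union collapses.\<close>

lemma coset_smult:
  assumes x: "x \<in> carrier A" shows "c \<odot>\<^bsub>Q\<^esub> (J +> x) = J +> (c \<odot> x)"
proof -
  have "J +> (c \<odot> y) = J +> (c \<odot> x)" if "y \<in> J +> x" for y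
  proof -
    obtain j where j: "j \<in> J" "y = j \<oplus> x" using \<open>y \<in> J +> x\<close> mem_coset[OF x] by blast
    have "c \<odot> y = c \<odot> j \<oplus> c \<odot> x" using smult_r_distr[of c j x] j J.Icarr x by simp
    thus ?thesis using coset_addJ[OF smult_cl[OF x] smult_J[OF j(1)]] by simp
  qed
  moreover have "c \<odot>\<^bsub>Q\<^esub> (J +> x) = (\<Union>y\<in>J +> x. J +> (c \<odot> y))" by (simp add: quotient_alg_def)
  ultimately show ?thesis by (simp only:) (rule UN_constant_eq[OF self_mem_coset[OF x]], blast)
qed

lemma coset_star:
  assumes x: "x \<in> carrier A" shows "star Q (J +> x) = J +> star A x"
proof -
  have "J +> star A y = J +> star A x" if "y \<in> J +> x" for y
  proof -
    obtain j where j: "j \<in> J" "y = j \<oplus> x" using \<open>y \<in> J +> x\<close> mem_coset[OF x] by blast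
    have "star A y = star A j \<oplus> star A x" using star_add j J.Icarr x by simp
    thus ?thesis using coset_addJ[OF star_closed[OF x] star_J[OF j(1)]] by simp
  qed
  moreover have "star Q (J +> x) = (\<Union>y\<in>J +> x. J +> star A y)" by (simp add: quotient_alg_def)
  ultimately show ?thesis by (simp only:) (rule UN_constant_eq[OF self_mem_coset[OF x]], blast)
qed

lemma abelian_monoid_Q: "abelian_monoid Q"
proof -
  interpret F: ring "A Quot J" by (rule J.quotient_is_ring)
  show ?thesis by (rule abelian_monoidI) (auto simp only: quotient_alg_sel F.add.m_closed F.zero_closed F.l_zero F.a_assoc F.a_comm F.a_lcomm F.r_zero)
qed

lemma coset_finsum:
  assumes "finite F" "\<And>i. i \<in> F \<Longrightarrow> f i \<in> carrier A"
  shows "(\<Oplus>\<^bsub>Q\<^esub>i\<in>F. J +> f i) = J +> (\<Oplus>i\<in>F. f i)"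
  using assms
proof (induction F rule: finite_induct)
  case empty
  interpret Q: abelian_monoid Q by (rule abelian_monoid_Q)
  show ?case using coset_zero by simp
next
  case (insert a F)
  interpret Q: abelian_monoid Q by (rule abelian_monoid_Q)
  have f: "f a \<in> carrier A" "f \<in> F \<rightarrow> carrier A" using insert.prems by auto
  have "(\<Oplus>\<^bsub>Q\<^esub>i\<in>insert a F. J +> f i) = (J +> f a) \<oplus>\<^bsub>Q\<^esub> (\<Oplus>\<^bsub>Q\<^esub>i\<in>F. J +> f i)"
    by (rule Q.finsum_insert) (use insert.hyps f coset_closed in \<open>auto simp del: quotient_alg_sel\<close>)
  also have "(\<Oplus>\<^bsub>Q\<^esub>i\<in>F. J +> f i) = J +> (\<Oplus>i\<in>F. f i)" using insert by blast
  also have "(J +> f a) \<oplus>\<^bsub>Q\<^esub> \<dots> = J +> (f a \<oplus> (\<Oplus>i\<in>F. f i))" by (rule coset_add) (use f in auto)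
  finally show ?case using insert.hyps f by simp
qed

text \<open>The quotient map carries factors to factors.\<close>

lemma positive_matrix_coset:
  assumes "positive_matrix A n Z" and X: "\<And>i j. i < n \<Longrightarrow> j < n \<Longrightarrow> X i j = J +> Z i j"
  shows "positive_matrix Q n X"
proof -
  obtain Y where Y': "(\<forall>i<n. \<forall>j<n. Y i j \<in> carrier A) \<and>
      (\<forall>i<n. \<forall>j<n. Z i j = (\<Oplus>k\<in>{..<n}. star A (Y k i) \<otimes> Y k j))"
    using assms(1) unfolding positive_matrix_def by (elim exE)
  have Y: "Y i j \<in> carrier A" if "i < n" "j < n" for i j using Y' that by blast
  have Z: "Z i j = (\<Oplus>k\<in>{..<n}. star A (Y k i) \<otimes> Y k j)" if "i < n" "j < n" for i j using Y' that by blast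
  have "X i j = (\<Oplus>\<^bsub>Q\<^esub>k\<in>{..<n}. star Q (J +> Y k i) \<otimes>\<^bsub>Q\<^esub> (J +> Y k j))" if ij: "i < n" "j < n" for i j
  proof -
    have "X i j = (\<Oplus>\<^bsub>Q\<^esub>k\<in>{..<n}. J +> (star A (Y k i) \<otimes> Y k j))"
      unfolding X[OF ij] Z[OF ij] by (rule coset_finsum[symmetric]) (use Y ij star_closed in auto)
    also have "\<dots> = (\<Oplus>\<^bsub>Q\<^esub>k\<in>{..<n}. star Q (J +> Y k i) \<otimes>\<^bsub>Q\<^esub> (J +> Y k j))"
    proof (rule abelian_monoid.finsum_cong'[OF abelian_monoid_Q refl])
      show "J +> (star A (Y k i) \<otimes> Y k j) = star Q (J +> Y k i) \<otimes>\<^bsub>Q\<^esub> (J +> Y k j)" if "k \<in> {..<n}" for k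
        using that ij Y star_closed by (simp only: coset_star coset_mult lessThan_iff)
      show "(\<lambda>k. star Q (J +> Y k i) \<otimes>\<^bsub>Q\<^esub> (J +> Y k j)) \<in> {..<n} \<rightarrow> carrier Q"
      proof
        fix k assume "k \<in> {..<n}"
        hence k: "Y k i \<in> carrier A" "Y k j \<in> carrier A" using Y ij by auto
        show "star Q (J +> Y k i) \<otimes>\<^bsub>Q\<^esub> (J +> Y k j) \<in> carrier Q"
          unfolding coset_star[OF k(1)] coset_mult[OF star_closed[OF k(1)] k(2)]
          by (rule coset_closed) (use k star_closed in auto)
      qed
    qed
    finally show ?thesis .
  qed
  thus ?thesis unfolding positive_matrix_def using Y coset_closed
    by (intro exI[of _ "\<lambda>i j. J +> Y i j"]) blast
qed

end

lemma compact_ops_closed_ideal: "closed_ideal B_alg compact_ops"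
proof -
  interpret R: ring B_alg by (rule ring_B_alg)
  have "subgroup compact_ops (add_monoid B_alg)"
  proof (rule R.add.subgroupI)
    have "(\<lambda>x. 0) \<in> compact_ops" by (simp add: compact_ops_iff)
    thus "compact_ops \<noteq> {}" by blast
  qed (auto simp: compact_ops_iff a_inv_B_alg tail_small_uminus tail_small_add)
  hence "ideal compact_ops B_alg"
    by (rule idealI[OF ring_B_alg]) (auto simp: compact_ops_iff comp_def tail_small_comp_left tail_small_comp_right bounded_ops_comp[unfolded comp_def])
  moreover have "closedin (cstar_topology B_alg) compact_ops"
    unfolding closedin_B_alg compact_ops_iff using tail_small_limit by (auto simp: compact_ops_iff)
  ultimately show ?thesis unfolding closed_ideal_def ..
qed

text \<open>An operator is determined by its matrix entries, and these by the rationals below their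
  real and imaginary parts; encoded, this is a set of naturals. The bound is what fits the algebra
  into the universe.\<close>

lemma bounded_ops_lepoll_reals: "bounded_ops \<lesssim> (UNIV :: real set)"
proof -
  define code where "code = (\<lambda>T :: ell2 \<Rightarrow> ell2. {to_nat (n :: nat, m :: nat, b :: bool, q :: rat) | n m b q.
    real_of_rat q < (if b then Re (ell2_nth (T (ebasis n)) m) else Im (ell2_nth (T (ebasis n)) m))})"
  have mem: "to_nat (n :: nat, m :: nat, b :: bool, q :: rat) \<in> code T \<longleftrightarrow>
      real_of_rat q < (if b then Re (ell2_nth (T (ebasis n)) m) else Im (ell2_nth (T (ebasis n)) m))" for n m b q T
    unfolding code_def by auto
  have eqI: "r = s" if "\<And>q. real_of_rat q < r \<longleftrightarrow> real_of_rat q < s" for r s :: real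
  proof (rule ccontr)
    assume "r \<noteq> s"
    then consider "r < s" | "s < r" by linarith
    thus False
    proof cases
      case 1 from of_rat_dense[OF 1] obtain q where "r < real_of_rat q" "real_of_rat q < s" by blast
      thus False using that[of q] by simp
    next
      case 2 from of_rat_dense[OF 2] obtain q where "s < real_of_rat q" "real_of_rat q < r" by blast
      thus False using that[of q] by simp
    qed
  qed
  have "inj_on code bounded_ops"
  proof (rule inj_onI)
    fix S T assume ST: "S \<in> bounded_ops" "T \<in> bounded_ops" "code S = code T"
    show "S = T"
    proof (rule bounded_ops_eqI[OF ST(1,2)])
      fix n show "S (ebasis n) = T (ebasis n)"
      proof (rule ell2_eqI, rule complex_eqI)
        fix m
        show "Re (ell2_nth (S (ebasis n)) m) = Re (ell2_nth (T (ebasis n)) m)"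
          by (rule eqI) (use mem[of n m True _ S] mem[of n m True _ T] ST(3) in simp)
        show "Im (ell2_nth (S (ebasis n)) m) = Im (ell2_nth (T (ebasis n)) m)"
          by (rule eqI) (use mem[of n m False _ S] mem[of n m False _ T] ST(3) in simp)
      qed
    qed
  qed
  hence "bounded_ops \<lesssim> (UNIV :: nat set set)" unfolding lepoll_def by blast
  thus ?thesis using nat_sets_eqpoll_reals lepoll_trans2 by blast
qed

section \<open>Affine functions and affine combinations of operators\<close>

definition lin_op :: "('d::finite \<Rightarrow> ell2 \<Rightarrow> ell2) \<Rightarrow> complex \<Rightarrow> ('d \<Rightarrow> complex) \<Rightarrow> ell2 \<Rightarrow> ell2" where
  "lin_op x c0 c = (\<lambda>v. scaleC c0 (id v) + (\<Sum>l\<in>UNIV. scaleC (c l) (x l v)))"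

lemma aff_op_lin_op: "aff_op c0 c x i j = lin_op x (c0 i j) (\<lambda>l. c l i j)"
  by (simp add: aff_op_def lin_op_def)

lemma lin_op_bounded: "(\<And>l. x l \<in> bounded_ops) \<Longrightarrow> lin_op x c0 c \<in> bounded_ops"
  using aff_op_mem[OF cstar_subalgebra_bounded_ops, of x "\<lambda>_ _. c0" "\<lambda>l _ _. c l" 0 0]
  by (simp add: aff_op_lin_op)

lemma lin_op_add: "lin_op x (c0 + d0) (\<lambda>l. c l + d l) = (\<lambda>v. lin_op x c0 c v + lin_op x d0 d v)"
  by (simp add: lin_op_def fun_eq_iff scaleC_distribs sum.distrib algebra_simps)

lemma lin_op_scale: "lin_op x (a * c0) (\<lambda>l. a * c l) = (\<lambda>v. scaleC a (lin_op x c0 c v))"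
  by (simp add: lin_op_def fun_eq_iff scaleC_distribs scaleC_sum)

lemma scaleC_minus_one: "scaleC (- 1) v = - v"
  by (rule ell2_eqI) simp

lemma lin_op_one: "lin_op x 1 (\<lambda>_. 0) = id"
  by (simp add: lin_op_def fun_eq_iff)

lemma lin_op_coord: "lin_op x 0 (\<lambda>l. if l = k then 1 else 0) = x k"
proof
  fix v
  have "(\<Sum>l\<in>UNIV. scaleC (if l = k then 1 else 0) (x l v)) = (\<Sum>l\<in>UNIV. if l = k then x l v else 0)"
    by (intro sum.cong refl) simp
  thus "lin_op x 0 (\<lambda>l. if l = k then 1 else 0) v = x k v" by (simp add: lin_op_def)
qed

definition affine_fun :: "(real^'d) set \<Rightarrow> complex \<Rightarrow> ('d::finite \<Rightarrow> complex) \<Rightarrow> real^'d \<Rightarrow> complex" where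
  "affine_fun K c0 c = (\<lambda>\<zeta>. if \<zeta> \<in> K then c0 + (\<Sum>l\<in>UNIV. of_real (vec_nth \<zeta> l) * c l) else 0)"

lemma affine_fun_add: "(\<lambda>\<zeta>. affine_fun K c0 c \<zeta> + affine_fun K d0 d \<zeta>) = affine_fun K (c0 + d0) (\<lambda>l. c l + d l)"
  by (simp add: affine_fun_def fun_eq_iff distrib_left sum.distrib)

lemma affine_fun_scale: "(\<lambda>\<zeta>. a * affine_fun K c0 c \<zeta>) = affine_fun K (a * c0) (\<lambda>l. a * c l)"
  by (simp add: affine_fun_def fun_eq_iff distrib_left sum_distrib_left mult_ac)

lemma affine_fun_one: "(\<lambda>\<zeta>. if \<zeta> \<in> K then 1 else 0) = affine_fun K 1 (\<lambda>_. 0)"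
  by (simp add: affine_fun_def fun_eq_iff)

lemma affine_fun_coord: "coord_fun K k = affine_fun K 0 (\<lambda>l. if l = k then 1 else 0)"
proof -
  have "(\<Sum>l\<in>UNIV. complex_of_real (vec_nth \<zeta> l) * (if l = k then 1 else 0)) = of_real (vec_nth \<zeta> k)" for \<zeta> :: "real^'a"
  proof -
    have "(\<Sum>l\<in>UNIV. complex_of_real (vec_nth \<zeta> l) * (if l = k then 1 else 0)) = (\<Sum>l\<in>UNIV. if l = k then complex_of_real (vec_nth \<zeta> l) else 0)"
      by (intro sum.cong refl) simp
    thus ?thesis by simp
  qed
  thus ?thesis by (simp add: affine_fun_def coord_fun_def fun_eq_iff)
qed

lemma affine_fun_carrier: "affine_fun K c0 c \<in> carrier (C_alg K)"
proof -
  have "continuous_on K (\<lambda>\<zeta>. c0 + (\<Sum>l\<in>UNIV. of_real (vec_nth \<zeta> l) * c l))" by (intro continuous_intros)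
  hence "continuous_on K (affine_fun K c0 c)" by (rule continuous_on_eq) (simp add: affine_fun_def)
  thus ?thesis by (simp add: affine_fun_def)
qed

lemma affine_fun_generator:
  assumes "s \<in> insert \<one>\<^bsub>C_alg K\<^esub> (range (coord_fun K))" shows "\<exists>c0 c. s = affine_fun K c0 c"
proof -
  from assms consider "s = \<one>\<^bsub>C_alg K\<^esub>" | l where "s = coord_fun K l" by blast
  thus ?thesis
  proof cases
    case 1 thus ?thesis unfolding C_alg_sel affine_fun_one by blast
  next
    case 2 thus ?thesis unfolding affine_fun_coord by blast
  qed
qed

lemma affine_fun_sum:
  assumes "finite F" "F \<subseteq> insert \<one>\<^bsub>C_alg K\<^esub> (range (coord_fun K))"
  shows "\<exists>c0 d. (\<lambda>\<zeta>. \<Sum>s\<in>F. c s * s \<zeta>) = affine_fun K c0 d"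
  using assms
proof (induction F rule: finite_induct)
  case empty
  show ?case by (intro exI[of _ 0] exI[of _ "\<lambda>_. 0"]) (simp add: affine_fun_def fun_eq_iff)
next
  case (insert a F)
  then obtain c0 d where 1: "(\<lambda>\<zeta>. \<Sum>s\<in>F. c s * s \<zeta>) = affine_fun K c0 d" by blast
  have "\<exists>e0 e. a = affine_fun K e0 e" by (rule affine_fun_generator) (use insert.prems in blast)
  then obtain e0 e where 2: "a = affine_fun K e0 e" by blast
  have "(\<lambda>\<zeta>. \<Sum>s\<in>insert a F. c s * s \<zeta>) = (\<lambda>\<zeta>. c a * a \<zeta> + affine_fun K c0 d \<zeta>)"
    using insert.hyps fun_cong[OF 1] by simp
  also have "\<dots> = affine_fun K (c a * e0 + c0) (\<lambda>l. c a * e l + d l)"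
    unfolding 2 by (simp add: affine_fun_def fun_eq_iff distrib_left distrib_right sum.distrib sum_distrib_left sum_distrib_right mult_ac)
  finally show ?case by blast
qed

lemma spectral_system_iff: "f \<in> spectral_system K \<longleftrightarrow> (\<exists>c0 c. f = affine_fun K c0 c)"
proof
  let ?G = "insert \<one>\<^bsub>C_alg K\<^esub> (range (coord_fun K))"
  have G: "s \<in> carrier (C_alg K)" if "s \<in> ?G" for s
    using affine_fun_generator[OF that] affine_fun_carrier[of K] by blast
  have smG: "(\<lambda>\<zeta>. a * s \<zeta>) \<in> carrier (C_alg K)" if "s \<in> ?G" for s a
    using G[OF that] by (auto intro: continuous_intros)
  have fs: "(\<Oplus>\<^bsub>C_alg K\<^esub>s\<in>F. c s \<odot>\<^bsub>C_alg K\<^esub> s) = (\<lambda>\<zeta>. \<Sum>s\<in>F. c s * s \<zeta>)" if "finite F" "F \<subseteq> ?G" for F c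
    unfolding C_alg_sel(6) by (rule finsum_C_alg[OF that(1)]) (use that(2) smG in blast)
  {
    assume "f \<in> spectral_system K"
    then obtain F c where F: "finite F" "F \<subseteq> ?G" "f = (\<Oplus>\<^bsub>C_alg K\<^esub>s\<in>F. c s \<odot>\<^bsub>C_alg K\<^esub> s)"
      unfolding spectral_system_def cspan_def mem_Collect_eq by (elim exE conjE)
    show "\<exists>c0 c. f = affine_fun K c0 c" unfolding F(3) fs[OF F(1,2)] by (rule affine_fun_sum[OF F(1,2)])
  next
    assume "\<exists>c0 c. f = affine_fun K c0 c"
    then obtain c0 c where f: "f = affine_fun K c0 c" by blast
    \<comment> \<open>Different coordinates, or a coordinate and the unit, can coincide as functions
      on \<open>K\<close>; the coefficient of a generator therefore collects all contributions with
      the same function.\<close>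
    define a where "a = (\<lambda>s. (if s = \<one>\<^bsub>C_alg K\<^esub> then c0 else 0) + (\<Sum>l\<in>{l \<in> UNIV. coord_fun K l = s}. c l))"
    have fin: "finite ?G" by simp
    have "(\<Sum>s\<in>?G. a s * s \<zeta>) = f \<zeta>" for \<zeta>
    proof -
      have "(\<Sum>s\<in>?G. a s * s \<zeta>) = (\<Sum>s\<in>?G. (if s = \<one>\<^bsub>C_alg K\<^esub> then c0 * s \<zeta> else 0)) +
          (\<Sum>s\<in>?G. \<Sum>l\<in>{l \<in> UNIV. coord_fun K l = s}. c l * coord_fun K l \<zeta>)"
        unfolding sum.distrib[symmetric]
        by (intro sum.cong refl) (auto simp: a_def distrib_right sum_distrib_right intro!: sum.cong)
      also have "(\<Sum>s\<in>?G. \<Sum>l\<in>{l \<in> UNIV. coord_fun K l = s}. c l * coord_fun K l \<zeta>) = (\<Sum>l\<in>UNIV. c l * coord_fun K l \<zeta>)"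
        by (rule sum.group) auto
      also have "(\<Sum>s\<in>?G. (if s = \<one>\<^bsub>C_alg K\<^esub> then c0 * s \<zeta> else 0)) = c0 * \<one>\<^bsub>C_alg K\<^esub> \<zeta>"
        using sum.delta[OF fin, of "\<one>\<^bsub>C_alg K\<^esub>" "\<lambda>s. c0 * s \<zeta>"] by simp
      also have "c0 * \<one>\<^bsub>C_alg K\<^esub> \<zeta> + (\<Sum>l\<in>UNIV. c l * coord_fun K l \<zeta>) = f \<zeta>"
        by (simp add: f affine_fun_def coord_fun_def mult_ac)
      finally show ?thesis .
    qed
    hence "f = (\<Oplus>\<^bsub>C_alg K\<^esub>s\<in>?G. a s \<odot>\<^bsub>C_alg K\<^esub> s)" unfolding fs[OF fin order_refl] by (simp add: fun_eq_iff)
    thus "f \<in> spectral_system K" unfolding spectral_system_def cspan_def mem_Collect_eq using fin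
      by (intro exI[of _ ?G] exI[of _ a]) auto
  }
qed

lemma block_op_1: "block_op 1 X = X 0 0"
proof
  fix v
  have c: "cuntz_adj 1 0 = id" by (rule ext, rule ell2_eqI) (simp add: ell2_nth_cuntz_adj)
  have "cuntz 1 0 = id" unfolding cuntz_def c by (rule op_adjoint_id(1))
  thus "block_op 1 X v = X 0 0 v" using c by (simp add: block_op_def)
qed

text \<open>Up to a compact operator \<open>T\<close> is a positive \<open>R\<close>, and the
  hypothesis on the negative of \<open>T\<close> makes the form of \<open>R\<close> small on tails,
  so \<open>R\<close> is compact.\<close>

lemma tail_small_if_ess_nonneg_both:
  assumes T: "T \<in> bounded_ops" "ess_nonneg T" "ess_nonneg (\<lambda>x. - T x)"
  shows "tail_small T"
proof -
  obtain R where R: "pos_op R" "tail_small (\<lambda>x. T x - R x)" by (rule ess_nonneg_decomp[OF T(1,2)])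
  have "ess_pos R" unfolding ess_pos_def
  proof (intro allI impI exI[of _ 0])
    fix e :: real and M :: nat and v :: ell2 assume "0 < e"
    hence "- (e * (norm v)\<^sup>2) \<le> 0" by simp
    also have "\<dots> \<le> Re (cinner (tailp M v) (R (tailp M v)))" by (rule pos_opD(3)[OF R(1)])
    finally show "- (e * (norm v)\<^sup>2) \<le> Re (cinner (tailp M v) (R (tailp M v)))" .
  qed
  moreover have "ess_pos (\<lambda>x. - R x)" unfolding ess_pos_def
  proof (intro allI impI)
    fix e :: real assume e: "0 < e"
    hence e2: "0 < e/2" by simp
    from T(3)[unfolded ess_nonneg_def, rule_format, OF e2]
    obtain N1 where N1: "\<forall>M\<ge>N1. \<forall>v. - (e/2 * (norm v)\<^sup>2) \<le> Re (cinner (tailp M v) (- T (tailp M v)))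
      \<and> \<bar>Im (cinner (tailp M v) (- T (tailp M v)))\<bar> \<le> e/2 * (norm v)\<^sup>2" by (elim exE)
    from tail_smallD[OF R(2) e2]
    obtain N2 where N2: "\<And>M v. N2 \<le> M \<Longrightarrow> norm (T (tailp M v) - R (tailp M v)) \<le> (e/2) * norm v" by blast
    show "\<exists>N. \<forall>M\<ge>N. \<forall>v. - (e * (norm v)\<^sup>2) \<le> Re (cinner (tailp M v) (- R (tailp M v)))"
    proof (intro exI allI impI)
      fix M v assume M: "max N1 N2 \<le> M"
      let ?w = "tailp M v"
      have 1: "- (e/2 * (norm v)\<^sup>2) \<le> Re (cinner ?w (- T ?w))" using N1 M by simp
      have "cmod (cinner ?w (T ?w - R ?w)) \<le> norm ?w * norm (T ?w - R ?w)" by (rule cmod_cinner_le)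
      also have "\<dots> \<le> norm v * ((e/2) * norm v)" by (intro mult_mono norm_tailp_le N2) (use M in auto)
      finally have "cmod (cinner ?w (T ?w - R ?w)) \<le> e/2 * (norm v)\<^sup>2" by (simp add: power2_eq_square mult_ac)
      hence 2: "- (e/2 * (norm v)\<^sup>2) \<le> Re (cinner ?w (T ?w - R ?w))" using abs_Re_le_cmod[of "cinner ?w (T ?w - R ?w)"] by linarith
      have "cinner ?w (- R ?w) = cinner ?w (T ?w - R ?w) + cinner ?w (- T ?w)" by simp
      thus "- (e * (norm v)\<^sup>2) \<le> Re (cinner ?w (- R ?w))" using 1 2 by simp
    qed
  qed
  ultimately have "tail_small R" by (intro tail_small_if_quadratic_small pos_opD[OF R(1)])
  from tail_small_add[OF R(2) this] show ?thesis by simp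
qed

text \<open>An affine function vanishing on \<open>K\<close> is semidefinite together with its
  negative, so \<open>ess_nonneg_aff_op\<close> applies to both signs.\<close>

lemma lin_op_vanish:
  fixes K :: "(real^'d) set"
  assumes x: "\<And>l. x l \<in> bounded_ops" and We: "ess_matrix_range x \<subseteq> Kmin K"
    and z: "affine_fun K c0 c = (\<lambda>_. 0)"
  shows "tail_small (lin_op x c0 c)"
proof -
  have nn: "ess_nonneg (lin_op x (a * c0) (\<lambda>l. a * c l))" for a
  proof -
    have "psd 1 (affine_mat (\<lambda>_ _. a * c0) (\<lambda>l _ _. a * c l) \<mu>)" if "\<mu> \<in> K" for \<mu>
    proof -
      have "affine_fun K (a * c0) (\<lambda>l. a * c l) \<mu> = 0" unfolding affine_fun_scale[symmetric] z by simp
      hence "affine_mat (\<lambda>_ _. a * c0) (\<lambda>l _ _. a * c l) \<mu> 0 0 = 0" using that by (simp add: affine_fun_def affine_mat_def)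
      thus ?thesis by (simp add: psd_def quad_def)
    qed
    from ess_nonneg_aff_op[OF x We _ this] show ?thesis unfolding block_op_1 aff_op_lin_op by simp
  qed
  have "ess_nonneg (lin_op x c0 c)" using nn[of 1] by simp
  moreover have "ess_nonneg (\<lambda>v. - lin_op x c0 c v)" using nn[of "-1"] unfolding lin_op_scale scaleC_minus_one .
  ultimately show ?thesis by (intro tail_small_if_ess_nonneg_both lin_op_bounded x)
qed

section \<open>The matrix range of a lift\<close>

lemma ess_stateD:
  assumes "ess_state s"
  shows "S \<in> bounded_ops \<Longrightarrow> T \<in> bounded_ops \<Longrightarrow> s (\<lambda>x. S x + T x) = s S + s T"
    and "T \<in> bounded_ops \<Longrightarrow> s (\<lambda>x. scaleC c (T x)) = c * s T" and "s id = 1"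
    and "positive_matrix B_alg n X \<Longrightarrow> (\<And>i j. i < n \<Longrightarrow> j < n \<Longrightarrow> X i j \<in> bounded_ops) \<Longrightarrow> psd n (\<lambda>i j. s (X i j))"
    and "T \<in> bounded_ops \<Longrightarrow> tail_small T \<Longrightarrow> s T = 0"
  using assms unfolding ess_state_def by blast+

text \<open>With one state per point of the measure of \<open>a\<close>, the map \<open>T \<mapsto>
  \<Sum>\<^sub>j s\<^sub>j(T) w\<^sub>j w\<^sub>j\<^sup>*\<close> is ucp and takes \<open>y\<close>
  to \<open>a\<close>.\<close>

lemma Kmin_subset_matrix_range:
  fixes K :: "(real^'d) set"
  assumes y: "\<And>l. y l \<in> bounded_ops"
    and st: "\<And>\<mu>. \<mu> \<in> K \<Longrightarrow> \<exists>s. ess_state s \<and> (\<forall>l. s (y l) = of_real (vec_nth \<mu> l))"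
  shows "Kmin K \<subseteq> matrix_range B_alg y"
proof
  fix na assume "na \<in> Kmin K"
  then obtain n a where na: "na = (n, a)" "(n, a) \<in> Kmin K" by (cases na) simp
  then obtain m w \<Lambda> where P: "povm K n m w \<Lambda> a" and n: "1 \<le> n" unfolding Kmin_iff_povm by blast
  hence n0: "0 < n" by simp
  define s where "s = (\<lambda>j. SOME s. ess_state s \<and> (\<forall>l. s (y l) = complex_of_real (vec_nth (\<Lambda> j) l)))"
  have s: "ess_state (s j) \<and> (\<forall>l. s j (y l) = complex_of_real (vec_nth (\<Lambda> j) l))" if "j < m" for j
  proof -
    have "\<Lambda> j \<in> K" using P that by (simp add: povm_def)
    from someI_ex[OF st[OF this]] show ?thesis unfolding s_def .
  qed
  have es: "ess_state (s j)" if "j < m" for j using s[OF that] by blast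
  let ?D = "cstar_of_tuple B_alg y"
  note D = cstar_of_tuple(1)[of y, OF y]
  note d = cstar_subalgebra_B_algD[OF D]
  have Db: "T \<in> bounded_ops" if "T \<in> ?D" for T using d(1) that by blast
  define \<Phi> where "\<Phi> = (\<lambda>T. mat n n (\<lambda>(p, q). \<Sum>j<m. s j T * (w j p * cnj (w j q))))"
  have cc: "\<Phi> T \<in> carrier_mat n n" for T by (simp add: \<Phi>_def)
  have "ucp (B_alg\<lparr>carrier := ?D\<rparr>) ?D (M_alg n) \<Phi>" unfolding ucp_def
  proof (intro conjI ballI allI impI)
    fix S show "\<Phi> S \<in> carrier (M_alg n)" using cc by simp
  next
    fix S T assume S: "S \<in> ?D" and T: "T \<in> ?D"
    show "\<Phi> (S \<oplus>\<^bsub>B_alg\<lparr>carrier := ?D\<rparr>\<^esub> T) = \<Phi> S \<oplus>\<^bsub>M_alg n\<^esub> \<Phi> T"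
    proof (rule eq_matI)
      fix p q assume "p < dim_row (\<Phi> S \<oplus>\<^bsub>M_alg n\<^esub> \<Phi> T)" "q < dim_col (\<Phi> S \<oplus>\<^bsub>M_alg n\<^esub> \<Phi> T)"
      hence pq: "p < n" "q < n" using cc[of T] by auto
      show "\<Phi> (S \<oplus>\<^bsub>B_alg\<lparr>carrier := ?D\<rparr>\<^esub> T) $$ (p, q) = (\<Phi> S \<oplus>\<^bsub>M_alg n\<^esub> \<Phi> T) $$ (p, q)"
        using pq cc[of T] by (simp add: \<Phi>_def ess_stateD(1)[OF es Db[OF S] Db[OF T]] distrib_right sum.distrib)
    qed (simp_all add: \<Phi>_def)
  next
    fix c T assume T: "T \<in> ?D"
    show "\<Phi> (c \<odot>\<^bsub>B_alg\<lparr>carrier := ?D\<rparr>\<^esub> T) = c \<odot>\<^bsub>M_alg n\<^esub> \<Phi> T"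
    proof (rule eq_matI)
      fix p q assume "p < dim_row (c \<odot>\<^bsub>M_alg n\<^esub> \<Phi> T)" "q < dim_col (c \<odot>\<^bsub>M_alg n\<^esub> \<Phi> T)"
      hence pq: "p < n" "q < n" using cc[of T] by auto
      show "\<Phi> (c \<odot>\<^bsub>B_alg\<lparr>carrier := ?D\<rparr>\<^esub> T) $$ (p, q) = (c \<odot>\<^bsub>M_alg n\<^esub> \<Phi> T) $$ (p, q)"
        using pq cc[of T] by (simp add: \<Phi>_def ess_stateD(2)[OF es Db[OF T]] sum_distrib_left mult_ac)
    qed (simp_all add: \<Phi>_def)
  next
    show "\<Phi> \<one>\<^bsub>B_alg\<lparr>carrier := ?D\<rparr>\<^esub> = \<one>\<^bsub>M_alg n\<^esub>"
      by (rule eq_matI) (use P in \<open>auto simp: \<Phi>_def ess_stateD(3)[OF es] povm_def\<close>)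
  next
    fix k :: nat and X assume X: "(\<forall>i<k. \<forall>j<k. X i j \<in> ?D) \<and> positive_matrix (B_alg\<lparr>carrier := ?D\<rparr>) k X"
    hence XD: "\<And>i j. i < k \<Longrightarrow> j < k \<Longrightarrow> X i j \<in> ?D" and pm: "positive_matrix B_alg k X"
      using positive_matrix_B_mono(1)[OF D] by blast+
    have "psd (k * n) (blockmat n (\<lambda>i j. \<Phi> (X i j)))" unfolding psd_blockmat[OF n0]
    proof
      fix \<xi> :: "nat \<Rightarrow> nat \<Rightarrow> complex"
      have "(\<Sum>i<k. \<Sum>p<n. \<Sum>j<k. \<Sum>q<n. cnj (\<xi> i p) * \<Phi> (X i j) $$ (p, q) * \<xi> j q) =
          (\<Sum>i<k. \<Sum>j<k. \<Sum>p<n. \<Sum>q<n. cnj (\<xi> i p) * \<Phi> (X i j) $$ (p, q) * \<xi> j q)"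
        by (intro sum.cong refl sum.swap)
      also have "\<dots> = (\<Sum>i<k. \<Sum>j<k. \<Sum>p<n. \<Sum>q<n. cnj (\<xi> i p) * (\<Sum>r<m. s r (X i j) * (w r p * cnj (w r q))) * \<xi> j q)"
        by (intro sum.cong refl) (simp add: \<Phi>_def)
      also have "\<dots> = (\<Sum>i<k. \<Sum>j<k. \<Sum>r<m. s r (X i j) * ((\<Sum>p<n. cnj (\<xi> i p) * w r p) * cnj (\<Sum>q<n. cnj (\<xi> j q) * w r q)))"
        unfolding sum_rank_one_conj ..
      also have "\<dots> = (\<Sum>i<k. \<Sum>r<m. \<Sum>j<k. s r (X i j) * ((\<Sum>p<n. cnj (\<xi> i p) * w r p) * cnj (\<Sum>q<n. cnj (\<xi> j q) * w r q)))"
        by (intro sum.cong refl sum.swap)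
      also have "\<dots> = (\<Sum>r<m. \<Sum>i<k. \<Sum>j<k. s r (X i j) * ((\<Sum>p<n. cnj (\<xi> i p) * w r p) * cnj (\<Sum>q<n. cnj (\<xi> j q) * w r q)))"
        by (rule sum.swap)
      also have "\<dots> = (\<Sum>r<m. quad k (\<lambda>i j. s r (X i j)) (\<lambda>j. cnj (\<Sum>q<n. cnj (\<xi> j q) * w r q)))"
        unfolding quad_def by (intro sum.cong refl) (simp add: mult_ac)
      also have "\<dots> \<in> \<real>\<^sub>\<ge>\<^sub>0"
      proof (rule nonneg_Reals_sum)
        fix r assume "r \<in> {..<m}"
        hence "r < m" by simp
        from ess_stateD(4)[OF es[OF this] pm Db[OF XD]]
        show "quad k (\<lambda>i j. s r (X i j)) (\<lambda>j. cnj (\<Sum>q<n. cnj (\<xi> j q) * w r q)) \<in> \<real>\<^sub>\<ge>\<^sub>0" unfolding psd_def by blast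
      qed
      finally show "(\<Sum>i<k. \<Sum>p<n. \<Sum>j<k. \<Sum>q<n. cnj (\<xi> i p) * \<Phi> (X i j) $$ (p, q) * \<xi> j q) \<in> \<real>\<^sub>\<ge>\<^sub>0" .
    qed
    thus "positive_matrix (M_alg n) k (\<lambda>i j. \<Phi> (X i j))" by (intro positive_matrix_M_algI n0 cc)
  qed
  moreover have "a = (\<lambda>l. \<Phi> (y l))"
  proof
    fix l show "a l = \<Phi> (y l)"
    proof (rule eq_matI)
      fix p q assume "p < dim_row (\<Phi> (y l))" "q < dim_col (\<Phi> (y l))"
      hence pq: "p < n" "q < n" by (simp_all add: \<Phi>_def)
      have "(\<Sum>j<m. s j (y l) * (w j p * cnj (w j q))) = (\<Sum>j<m. of_real (vec_nth (\<Lambda> j) l) * (w j p * cnj (w j q)))"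
        by (intro sum.cong refl) (use s in simp)
      thus "a l $$ (p, q) = \<Phi> (y l) $$ (p, q)" using P pq by (simp add: povm_def \<Phi>_def)
    qed (use P in \<open>auto simp: povm_def \<Phi>_def\<close>)
  qed
  ultimately show "na \<in> matrix_range B_alg y" unfolding na(1) matrix_range_def using n by blast
qed

text \<open>Positivity at \<open>y\<close> of affine functions, fed into a ucp map, gives the
  inequalities required by \<open>Kmin_separation\<close>. The trace pairing there is the quadratic
  form at the vector \<open>\<Sum>\<^sub>i e\<^sub>i \<otimes> e\<^sub>i\<close>, which appears
  below as \<open>ident\<close>.\<close>

lemma matrix_range_subset_Kmin:
  fixes K :: "(real^'d) set"
  assumes K: "compact K" "K \<noteq> {}" and y: "\<And>l. y l \<in> bounded_ops"
    and pos: "\<And>n c0 c. (\<And>\<mu>. \<mu> \<in> K \<Longrightarrow> psd n (affine_mat c0 c \<mu>)) \<Longrightarrow>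
      (\<And>\<mu> v. \<mu> \<in> K \<Longrightarrow> \<exists>i<n. v i \<noteq> 0 \<Longrightarrow> quad n (affine_mat c0 c \<mu>) v \<noteq> 0) \<Longrightarrow>
      positive_matrix B_alg n (aff_op c0 c y)"
  shows "matrix_range B_alg y \<subseteq> Kmin K"
proof
  fix na assume "na \<in> matrix_range B_alg y"
  then obtain n a where na: "na = (n, a)" "(n, a) \<in> matrix_range B_alg y" by (cases na) simp
  let ?D = "cstar_of_tuple B_alg y"
  note D = cstar_of_tuple(1)[of y, OF y] and yD = cstar_of_tuple(2)[of y, OF y]
  have n: "1 \<le> n" using na(2) unfolding matrix_range_def by simp
  hence n0: "0 < n" by simp
  have "\<exists>\<Phi>. a = (\<lambda>l. \<Phi> (y l)) \<and> ucp (B_alg\<lparr>carrier := ?D\<rparr>) ?D (M_alg n) \<Phi>"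
    using na(2) unfolding matrix_range_def by simp
  then obtain \<Phi> where a: "a = (\<lambda>l. \<Phi> (y l))" and U: "ucp (B_alg\<lparr>carrier := ?D\<rparr>) ?D (M_alg n) \<Phi>" by (elim exE conjE)
  \<comment> \<open>Adding a constant beyond the bound of \<open>K\<close> makes the coordinate
    function strictly positive, so its value at \<open>y\<close> is of the form
    \<open>Y\<^sup>* Y\<close> and hence self-adjoint.\<close>
  have ysa: "op_adjoint (y l) = y l" for l
  proof -
    obtain B where B: "\<forall>\<mu>\<in>K. norm \<mu> \<le> B" using compact_imp_bounded[OF K(1)] unfolding bounded_iff by blast
    define c0 where "c0 = (\<lambda>(i::nat) (j::nat). complex_of_real (\<bar>B\<bar> + 1))"
    define c where "c = (\<lambda>k. \<lambda>(i::nat) (j::nat). if k = l then 1 else (0::complex))"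
    have am: "affine_mat c0 c \<mu> i j = of_real (\<bar>B\<bar> + 1 + vec_nth \<mu> l)" for \<mu> :: "real^'d" and i j
    proof -
      have "(\<Sum>k\<in>UNIV. complex_of_real (vec_nth \<mu> k) * c k i j) = (\<Sum>k\<in>UNIV. if k = l then complex_of_real (vec_nth \<mu> k) else 0)"
        by (intro sum.cong refl) (simp add: c_def)
      thus ?thesis by (simp add: affine_mat_def c0_def)
    qed
    have p: "0 < \<bar>B\<bar> + 1 + vec_nth \<mu> l" if "\<mu> \<in> K" for \<mu>
    proof -
      have "\<bar>vec_nth \<mu> l\<bar> \<le> norm \<mu>" by (rule component_le_norm_cart)
      moreover have "norm \<mu> \<le> B" using B that by blast
      ultimately show ?thesis by linarith
    qed
    have q: "quad 1 (affine_mat c0 c \<mu>) v = of_real ((\<bar>B\<bar> + 1 + vec_nth \<mu> l) * (cmod (v 0))\<^sup>2)" for \<mu> :: "real^'d" and v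
      by (simp add: quad_def am complex_norm_square[symmetric] mult_ac del: of_real_add)
    have pm: "positive_matrix B_alg 1 (aff_op c0 c y)"
    proof (rule pos)
      fix \<mu> :: "real^'d" assume \<mu>: "\<mu> \<in> K"
      show "psd 1 (affine_mat c0 c \<mu>)" unfolding psd_def q nonneg_Reals_of_real_iff
        using p[OF \<mu>] by (intro allI mult_nonneg_nonneg) auto
      fix v :: "nat \<Rightarrow> complex" assume "\<exists>i<1. v i \<noteq> 0"
      thus "quad 1 (affine_mat c0 c \<mu>) v \<noteq> 0" unfolding q of_real_eq_0_iff using p[OF \<mu>] by simp
    qed
    obtain Y where Y': "(\<forall>i<(1::nat). \<forall>j<(1::nat). Y i j \<in> bounded_ops) \<and>
        (\<forall>i<(1::nat). \<forall>j<(1::nat). aff_op c0 c y i j = (\<lambda>x. \<Sum>k<(1::nat). op_adjoint (Y k i) (Y k j x)))"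
      by (rule exE[OF iffD1[OF positive_matrix_B_sub[OF cstar_subalgebra_bounded_ops, unfolded B_alg_update] pm]])
    hence Yb: "Y 0 0 \<in> bounded_ops" and Y: "aff_op c0 c y 0 0 = op_adjoint (Y 0 0) \<circ> Y 0 0" by (auto simp: comp_def)
    have sa: "op_adjoint (aff_op c0 c y 0 0) = aff_op c0 c y 0 0"
      unfolding Y using op_adjoint_comp[OF op_adjoint_bounded[OF Yb] Yb] Yb by simp
    have e: "aff_op c0 c y 0 0 = (\<lambda>v. scaleC (of_real (\<bar>B\<bar> + 1)) (id v) + y l v)"
    proof
      fix v
      have "(\<Sum>k\<in>UNIV. scaleC (c k 0 0) (y k v)) = (\<Sum>k\<in>UNIV. if k = l then y k v else 0)"
        by (intro sum.cong refl) (simp add: c_def)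
      thus "aff_op c0 c y 0 0 v = scaleC (of_real (\<bar>B\<bar> + 1)) (id v) + y l v" by (simp add: aff_op_def c0_def)
    qed
    have "op_adjoint (aff_op c0 c y 0 0) = (\<lambda>v. scaleC (of_real (\<bar>B\<bar> + 1)) (id v) + op_adjoint (y l) v)"
      unfolding e by (subst op_adjoint_add) (auto simp: op_adjoint_scaleC y intro!: bounded_ops_scaleC simp del: of_real_add)
    hence "scaleC (of_real (\<bar>B\<bar> + 1)) v + op_adjoint (y l) v = scaleC (of_real (\<bar>B\<bar> + 1)) v + y l v" for v
      using sa unfolding e by (simp only: fun_eq_iff id_apply)
    thus ?thesis by (intro ext) (simp only: add_left_cancel)
  qed
  have "(n, a) \<in> Kmin K"
  proof (rule Kmin_separation[OF n K])
    show "a l \<in> carrier_mat n n" for l unfolding a by (rule ucp_B_D(1)[OF U D yD])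
    show "a l $$ (q, p) = cnj (a l $$ (p, q))" if "p < n" "q < n" for l p q
      using ucp_B_adjoint[OF U D yD[of l] that] unfolding a ysa .
    fix c0 c
    assume H: "\<And>\<mu>. \<mu> \<in> K \<Longrightarrow> psd n (affine_mat c0 c \<mu>)"
      "\<And>\<mu> v. \<mu> \<in> K \<Longrightarrow> \<exists>i<n. v i \<noteq> 0 \<Longrightarrow> quad n (affine_mat c0 c \<mu>) v \<noteq> 0"
    have XD: "aff_op c0 c y i j \<in> ?D" for i j by (rule aff_op_mem[OF D yD])
    have "positive_matrix (B_alg\<lparr>carrier := ?D\<rparr>) n (aff_op c0 c y)"
      by (rule positive_matrix_shrink[OF pos[OF H] D XD])
    from ucp_B_D(5)[OF U D n0 XD this]
    have P: "(\<Sum>i<n. \<Sum>p<n. \<Sum>j<n. \<Sum>q<n. cnj (\<xi> i p) * \<Phi> (aff_op c0 c y i j) $$ (p, q) * \<xi> j q) \<in> \<real>\<^sub>\<ge>\<^sub>0" for \<xi>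
      unfolding psd_blockmat[OF n0] by blast
    have "(\<Sum>i<n. \<Sum>p<n. \<Sum>j<n. \<Sum>q<n. cnj (ident i p) * \<Phi> (aff_op c0 c y i j) $$ (p, q) * ident j q) =
        (\<Sum>i<n. \<Sum>j<n. \<Phi> (aff_op c0 c y i j) $$ (i, j))"
    proof (rule sum.cong[OF refl])
      fix i assume i: "i \<in> {..<n}"
      have "(\<Sum>p<n. \<Sum>j<n. \<Sum>q<n. cnj (ident i p) * \<Phi> (aff_op c0 c y i j) $$ (p, q) * ident j q) =
          (\<Sum>p<n. if p = i then \<Sum>j<n. \<Sum>q<n. \<Phi> (aff_op c0 c y i j) $$ (p, q) * ident j q else 0)"
        by (intro sum.cong refl) (simp add: ident_def)
      also have "\<dots> = (\<Sum>j<n. \<Sum>q<n. \<Phi> (aff_op c0 c y i j) $$ (i, q) * ident j q)" using i by simp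
      also have "\<dots> = (\<Sum>j<n. \<Phi> (aff_op c0 c y i j) $$ (i, j))"
      proof (rule sum.cong[OF refl])
        fix j assume j: "j \<in> {..<n}"
        have "(\<Sum>q<n. \<Phi> (aff_op c0 c y i j) $$ (i, q) * ident j q) = (\<Sum>q<n. if q = j then \<Phi> (aff_op c0 c y i j) $$ (i, q) else 0)"
          by (intro sum.cong refl) (simp add: ident_def)
        thus "(\<Sum>q<n. \<Phi> (aff_op c0 c y i j) $$ (i, q) * ident j q) = \<Phi> (aff_op c0 c y i j) $$ (i, j)" using j by simp
      qed
      finally show "(\<Sum>p<n. \<Sum>j<n. \<Sum>q<n. cnj (ident i p) * \<Phi> (aff_op c0 c y i j) $$ (p, q) * ident j q) =
          (\<Sum>j<n. \<Phi> (aff_op c0 c y i j) $$ (i, j))" .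
    qed
    also have "\<dots> = (\<Sum>i<n. \<Sum>j<n. c0 i j * ident i j + (\<Sum>l\<in>UNIV. c l i j * a l $$ (i, j)))"
      unfolding a by (intro sum.cong refl ucp_aff_op[OF U D yD]) auto
    also have "\<dots> = (\<Sum>i<n. \<Sum>j<n. c0 i j * ident i j) + (\<Sum>i<n. \<Sum>j<n. \<Sum>l\<in>UNIV. c l i j * a l $$ (i, j))"
      by (simp add: sum.distrib)
    also have "(\<Sum>i<n. \<Sum>j<n. c0 i j * ident i j) = (\<Sum>i<n. c0 i i)"
    proof (rule sum.cong[OF refl])
      fix i assume i: "i \<in> {..<n}"
      have "(\<Sum>j<n. c0 i j * ident i j) = (\<Sum>j<n. if j = i then c0 i j else 0)"
        by (intro sum.cong refl) (simp add: ident_def)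
      thus "(\<Sum>j<n. c0 i j * ident i j) = c0 i i" using i by simp
    qed
    also have "(\<Sum>i<n. \<Sum>j<n. \<Sum>l\<in>UNIV. c l i j * a l $$ (i, j)) = (\<Sum>i<n. \<Sum>l\<in>UNIV. \<Sum>j<n. c l i j * a l $$ (i, j))"
      by (intro sum.cong refl sum.swap)
    also have "\<dots> = (\<Sum>l\<in>UNIV. \<Sum>i<n. \<Sum>j<n. c l i j * a l $$ (i, j))" by (rule sum.swap)
    finally show "0 \<le> Re ((\<Sum>i<n. c0 i i) + (\<Sum>l\<in>UNIV. \<Sum>i<n. \<Sum>j<n. c l i j * a l $$ (i, j)))"
      using P[of ident] by (simp only: complex_nonneg_Reals_iff)
  qed
  thus "na \<in> Kmin K" by (simp only: na(1))
qed

lemma ucp_positive: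
  assumes "ucp C R B \<phi>" "\<And>i j. i < n \<Longrightarrow> j < n \<Longrightarrow> X i j \<in> R" "positive_matrix C n X"
  shows "positive_matrix B n (\<lambda>i j. \<phi> (X i j))"
  using assms(1)[unfolded ucp_def, THEN conjunct2, THEN conjunct2, THEN conjunct2, THEN conjunct2, rule_format, of n X]
    assms(2,3) by simp

section \<open>Positivity and ucp maps under the copy\<close>

context cstar_transport
begin

lemma finsum_transport:
  assumes "finite F" "\<And>i. i \<in> F \<Longrightarrow> f i \<in> carrier A"
  shows "(\<Oplus>\<^bsub>transport g A\<^esub>i\<in>F. g (f i)) = g (\<Oplus>i\<in>F. f i)"
  using assms
proof (induction F rule: finite_induct)
  case empty
  interpret T: ring "transport g A" by (rule ring_transport)
  show ?case by simp
next
  case (insert a F)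
  interpret T: ring "transport g A" by (rule ring_transport)
  note am = abelian_group.axioms(1)[OF abelian_group_A]
  have f: "f a \<in> carrier A" "f \<in> F \<rightarrow> carrier A" using insert.prems by auto
  have c: "finsum A f F \<in> carrier A" by (rule abelian_monoid.finsum_closed[OF am f(2)])
  have "(\<Oplus>\<^bsub>transport g A\<^esub>i\<in>insert a F. g (f i)) = g (f a) \<oplus>\<^bsub>transport g A\<^esub> (\<Oplus>\<^bsub>transport g A\<^esub>i\<in>F. g (f i))"
    by (rule T.finsum_insert) (use insert.hyps f in auto)
  also have "(\<Oplus>\<^bsub>transport g A\<^esub>i\<in>F. g (f i)) = g (\<Oplus>i\<in>F. f i)" using insert by blast
  also have "g (f a) \<oplus>\<^bsub>transport g A\<^esub> \<dots> = g (f a \<oplus> (\<Oplus>i\<in>F. f i))" using f(1) c by simp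
  also have "f a \<oplus> (\<Oplus>i\<in>F. f i) = (\<Oplus>i\<in>insert a F. f i)"
    by (rule abelian_monoid.finsum_insert[OF am insert.hyps(1,2) f(2,1), symmetric])
  finally show ?case .
qed

lemma gram_transport:
  fixes n i j :: nat
  assumes "\<And>i j. i < n \<Longrightarrow> j < n \<Longrightarrow> Y i j \<in> carrier A" and ij: "i < n" "j < n"
  shows "(\<Oplus>\<^bsub>transport g A\<^esub>k\<in>{..<n}. star (transport g A) (g (Y k i)) \<otimes>\<^bsub>transport g A\<^esub> g (Y k j)) =
    g (\<Oplus>k\<in>{..<n}. star A (Y k i) \<otimes> Y k j)"
proof -
  interpret T: ring "transport g A" by (rule ring_transport)
  note mc = monoid.m_closed[OF ring.axioms(2)[OF ring_A]]
  have m: "star A (Y k i) \<otimes> Y k j \<in> carrier A" if "k < n" for k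
    by (intro mc star_closed assms ij that)
  have "(\<Oplus>\<^bsub>transport g A\<^esub>k\<in>{..<n}. star (transport g A) (g (Y k i)) \<otimes>\<^bsub>transport g A\<^esub> g (Y k j)) =
      (\<Oplus>\<^bsub>transport g A\<^esub>k\<in>{..<n}. g (star A (Y k i) \<otimes> Y k j))"
    by (rule T.finsum_cong') (use m assms star_closed in auto)
  also have "\<dots> = g (\<Oplus>k\<in>{..<n}. star A (Y k i) \<otimes> Y k j)" by (rule finsum_transport) (use m in auto)
  finally show ?thesis .
qed

lemma positive_matrix_transport:
  assumes "positive_matrix A n X" shows "positive_matrix (transport g A) n (\<lambda>i j. g (X i j))"
proof -
  obtain Y where Y': "(\<forall>i<n. \<forall>j<n. Y i j \<in> carrier A) \<and>
      (\<forall>i<n. \<forall>j<n. X i j = (\<Oplus>k\<in>{..<n}. star A (Y k i) \<otimes> Y k j))"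
    using assms unfolding positive_matrix_def by (elim exE)
  have Y: "Y i j \<in> carrier A" if "i < n" "j < n" for i j using Y' that by blast
  have X: "X i j = (\<Oplus>k\<in>{..<n}. star A (Y k i) \<otimes> Y k j)" if "i < n" "j < n" for i j using Y' that by blast
  show ?thesis unfolding positive_matrix_def
    by (intro exI[of _ "\<lambda>i j. g (Y i j)"] conjI allI impI) (use Y X gram_transport[of n Y] in auto)
qed

lemma positive_matrix_transportD:
  assumes "positive_matrix (transport g A) n X"
  shows "positive_matrix A n (\<lambda>i j. inv_into (carrier A) g (X i j))"
proof -
  obtain Y where Y': "(\<forall>i<n. \<forall>j<n. Y i j \<in> carrier (transport g A)) \<and>
      (\<forall>i<n. \<forall>j<n. X i j = (\<Oplus>\<^bsub>transport g A\<^esub>k\<in>{..<n}. star (transport g A) (Y k i) \<otimes>\<^bsub>transport g A\<^esub> Y k j))"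
    using assms unfolding positive_matrix_def by (elim exE)
  define Z where "Z = (\<lambda>i j. inv_into (carrier A) g (Y i j))"
  have Z: "Z i j \<in> carrier A" "Y i j = g (Z i j)" if "i < n" "j < n" for i j
  proof -
    have "Y i j \<in> g ` carrier A" using Y' that by simp
    thus "Z i j \<in> carrier A" "Y i j = g (Z i j)" unfolding Z_def by (auto simp: inv_into_into f_inv_into_f)
  qed
  have fc: "(\<Oplus>k\<in>{..<n}. star A (Z k i) \<otimes> Z k j) \<in> carrier A" if "i < n" "j < n" for i j
    by (rule abelian_monoid.finsum_closed[OF abelian_group.axioms(1)[OF abelian_group_A]])
      (use that Z star_closed monoid.m_closed[OF ring.axioms(2)[OF ring_A]] in auto)
  have "X i j = g (\<Oplus>k\<in>{..<n}. star A (Z k i) \<otimes> Z k j)" if ij: "i < n" "j < n" for i j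
  proof -
    interpret T: ring "transport g A" by (rule ring_transport)
    note mc = monoid.m_closed[OF ring.axioms(2)[OF ring_A]]
    have "X i j = (\<Oplus>\<^bsub>transport g A\<^esub>k\<in>{..<n}. star (transport g A) (Y k i) \<otimes>\<^bsub>transport g A\<^esub> Y k j)"
      using Y' ij by blast
    also have "\<dots> = (\<Oplus>\<^bsub>transport g A\<^esub>k\<in>{..<n}. star (transport g A) (g (Z k i)) \<otimes>\<^bsub>transport g A\<^esub> g (Z k j))"
      by (rule T.finsum_cong') (use Z ij mc star_closed in auto)
    also have "\<dots> = g (\<Oplus>k\<in>{..<n}. star A (Z k i) \<otimes> Z k j)" by (rule gram_transport[OF Z(1) ij])
    finally show ?thesis .
  qed
  thus ?thesis unfolding positive_matrix_def
    by (intro exI[of _ Z] conjI allI impI) (use Z fc in auto)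
qed

lemma ucp_transportD:
  assumes "ucp C R (transport g A) \<psi>"
  shows "ucp C R A (\<lambda>f. inv_into (carrier A) g (\<psi> f))" and "f \<in> R \<Longrightarrow> \<psi> f \<in> g ` carrier A"
proof -
  let ?h = "inv_into (carrier A) g"
  have cl: "\<psi> f \<in> g ` carrier A" if "f \<in> R" for f using assms that unfolding ucp_def by simp
  show "f \<in> R \<Longrightarrow> \<psi> f \<in> g ` carrier A" by (rule cl)
  have h: "?h (\<psi> f) \<in> carrier A" "g (?h (\<psi> f)) = \<psi> f" if "f \<in> R" for f
    using inv_into_into[OF cl[OF that]] f_inv_into_f[OF cl[OF that]] by auto
  have add: "\<psi> (x \<oplus>\<^bsub>C\<^esub> y) = \<psi> x \<oplus>\<^bsub>transport g A\<^esub> \<psi> y" if "x \<in> R" "y \<in> R" for x y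
    using assms that unfolding ucp_def by blast
  have sm: "\<psi> (c \<odot>\<^bsub>C\<^esub> x) = c \<odot>\<^bsub>transport g A\<^esub> \<psi> x" if "x \<in> R" for x c
    using assms that unfolding ucp_def by blast
  have one: "\<psi> \<one>\<^bsub>C\<^esub> = \<one>\<^bsub>transport g A\<^esub>" using assms unfolding ucp_def by blast
  note ac = abelian_monoid.a_closed[OF abelian_group.axioms(1)[OF abelian_group_A]]
    and oc = monoid.one_closed[OF ring.axioms(2)[OF ring_A]]
  show "ucp C R A (\<lambda>f. ?h (\<psi> f))" unfolding ucp_def
  proof (intro conjI ballI allI impI)
    show "?h (\<psi> x) \<in> carrier A" if "x \<in> R" for x by (rule h(1)[OF that])
    show "?h (\<psi> (x \<oplus>\<^bsub>C\<^esub> y)) = ?h (\<psi> x) \<oplus> ?h (\<psi> y)" if "x \<in> R" "y \<in> R" for x y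
    proof -
      have "\<psi> (x \<oplus>\<^bsub>C\<^esub> y) = g (?h (\<psi> x) \<oplus> ?h (\<psi> y))"
        using add[OF that] transport_sel(4)[OF h(1)[OF that(1)] h(1)[OF that(2)]] by (simp only: h(2) that)
      thus ?thesis using ac[OF h(1)[OF that(1)] h(1)[OF that(2)]] by simp
    qed
    show "?h (\<psi> (c \<odot>\<^bsub>C\<^esub> x)) = c \<odot> ?h (\<psi> x)" if "x \<in> R" for x c
    proof -
      have "\<psi> (c \<odot>\<^bsub>C\<^esub> x) = g (c \<odot> ?h (\<psi> x))"
        using sm[OF that] transport_sel(5)[OF h(1)[OF that]] by (simp only: h(2) that)
      thus ?thesis using smult_cl[OF h(1)[OF that]] by simp
    qed
    show "?h (\<psi> \<one>\<^bsub>C\<^esub>) = \<one>" unfolding one transport_sel(1) by (rule inv_g[OF oc])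
    fix n X assume "(\<forall>i<n. \<forall>j<n. X i j \<in> R) \<and> positive_matrix C n X"
    hence "positive_matrix (transport g A) n (\<lambda>i j. \<psi> (X i j))" by (intro ucp_positive[OF assms]) blast+
    from positive_matrix_transportD[OF this] show "positive_matrix A n (\<lambda>i j. ?h (\<psi> (X i j)))" .
  qed
qed

end

section \<open>The lifting argument\<close>

text \<open>Compressing to the single vectors \<open>ebasis M\<close> gives an element; together
  with \<open>Kmin_empty\<close> this excludes an empty \<open>K\<close>.\<close>

lemma ess_matrix_range_nonempty:
  assumes x: "\<And>l. x l \<in> bounded_ops" shows "ess_matrix_range x \<noteq> {}"
proof -
  have 1: "tailp M (ebasis M) = ebasis M" for M by (rule ell2_eqI) auto
  note U = compr_ucp[of 1 "\<lambda>M p. ebasis M"]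
  have "ucp (B_alg\<lparr>carrier := cstar_of_tuple B_alg x\<rparr>) (cstar_of_tuple B_alg x) (M_alg 1) (compr 1 (\<lambda>M p. ebasis M))"
    by (rule U(1)) (use 1 cstar_of_tuple(1)[of x, OF x] in auto)
  moreover have "\<forall>T\<in>cstar_of_tuple B_alg x \<inter> compact_ops. compr 1 (\<lambda>M p. ebasis M) T = 0\<^sub>m 1 1"
    using U(2)[OF _ _ _ cstar_of_tuple(1)[of x, OF x]] 1 by simp
  ultimately have "(1, \<lambda>l. compr 1 (\<lambda>M p. ebasis M) (x l)) \<in> ess_matrix_range x"
    unfolding ess_matrix_range_def by auto
  thus ?thesis by blast
qed

text \<open>An empty \<open>K\<close> leaves only empty sums, which cannot be the identity at a
  level \<open>n \<ge> 1\<close>.\<close>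

lemma Kmin_empty: "Kmin {} = {}"
proof -
  have "(n, a) \<notin> Kmin {}" for n and a :: "'a \<Rightarrow> complex mat"
  proof
    assume "(n, a) \<in> Kmin {}"
    then obtain m w \<Lambda> where n: "1 \<le> n" and P: "povm {} n m w \<Lambda> a" unfolding Kmin_iff_povm by blast
    have "m = 0" using P by (auto simp: povm_def)
    have "\<forall>p<n. \<forall>q<n. (\<Sum>j<m. w j p * cnj (w j q)) = (if p = q then 1 else 0)" using P unfolding povm_def by blast
    from this[rule_format, of 0 0] have "(0::complex) = 1" using n \<open>m = 0\<close> by simp
    thus False by simp
  qed
  thus ?thesis by auto
qed

lemma ucp_affine_fun:
  fixes K :: "(real^'d) set"
  assumes U: "ucp (C_alg K) (spectral_system K) B_alg \<Psi>"
  shows "\<Psi> (affine_fun K c0 c) = lin_op (\<lambda>l. \<Psi> (coord_fun K l)) c0 c"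
proof -
  have S: "affine_fun K c0 c \<in> spectral_system K" for c0 c unfolding spectral_system_iff by blast
  have add: "\<Psi> (\<lambda>\<zeta>. f \<zeta> + h \<zeta>) = (\<lambda>v. \<Psi> f v + \<Psi> h v)" if "f \<in> spectral_system K" "h \<in> spectral_system K" for f h
    using U that unfolding ucp_def by simp
  have sm: "\<Psi> (\<lambda>\<zeta>. a * f \<zeta>) = (\<lambda>v. scaleC a (\<Psi> f v))" if "f \<in> spectral_system K" for a f
    using U that unfolding ucp_def by simp
  have one: "\<Psi> (affine_fun K 1 (\<lambda>_. 0)) = id" using U unfolding ucp_def affine_fun_one[symmetric] by simp
  have const: "\<Psi> (affine_fun K a (\<lambda>_. 0)) = (\<lambda>v. scaleC a (id v))" for a
    using sm[OF S[of 1 "\<lambda>_. 0"], of a] unfolding affine_fun_scale one by simp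
  \<comment> \<open>Induction on the support of the coefficients reduces linearity over all
    coordinates to additivity for two summands.\<close>
  have *: "\<Psi> (affine_fun K c0 (\<lambda>l. if l \<in> F then c l else 0)) =
      (\<lambda>v. scaleC c0 (id v) + (\<Sum>l\<in>F. scaleC (c l) (\<Psi> (coord_fun K l) v)))" if "finite F" for F
    using that
  proof (induction F rule: finite_induct)
    case empty
    show ?case using const[of c0] by simp
  next
    case (insert k F)
    have "affine_fun K c0 (\<lambda>l. if l \<in> insert k F then c l else 0) =
        affine_fun K (c0 + c k * 0) (\<lambda>l. (if l \<in> F then c l else 0) + c k * (if l = k then 1 else 0))"
      using insert.hyps by (intro arg_cong2[where f = "affine_fun K"] ext) auto
    also have "\<dots> = (\<lambda>\<zeta>. affine_fun K c0 (\<lambda>l. if l \<in> F then c l else 0) \<zeta> + affine_fun K (c k * 0) (\<lambda>l. c k * (if l = k then 1 else 0)) \<zeta>)"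
      by (rule affine_fun_add[symmetric])
    finally have "\<Psi> (affine_fun K c0 (\<lambda>l. if l \<in> insert k F then c l else 0)) =
        (\<lambda>v. \<Psi> (affine_fun K c0 (\<lambda>l. if l \<in> F then c l else 0)) v + \<Psi> (affine_fun K (c k * 0) (\<lambda>l. c k * (if l = k then 1 else 0))) v)"
      by (simp only: add[OF S S])
    also have "\<Psi> (affine_fun K (c k * 0) (\<lambda>l. c k * (if l = k then 1 else 0))) = (\<lambda>v. scaleC (c k) (\<Psi> (coord_fun K k) v))"
      using sm[OF S, of "c k" 0 "\<lambda>l. if l = k then 1 else 0"]
      unfolding affine_fun_scale affine_fun_coord .
    finally show ?case unfolding insert.IH using insert.hyps by (simp add: add_ac)
  qed
  from *[OF finite_class.finite_UNIV] show ?thesis by (simp add: lin_op_def)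
qed

text \<open>Strictness lets the affine matrix function factor continuously, so it is positive over
  \<open>C_alg K\<close> and its image under \<open>\<Psi>\<close> is positive.\<close>

lemma ucp_positive_affine:
  fixes K :: "(real^'d) set"
  assumes U: "ucp (C_alg K) (spectral_system K) B_alg \<Psi>"
    and psd: "\<And>\<mu>. \<mu> \<in> K \<Longrightarrow> psd n (affine_mat c0 c \<mu>)"
    and strict: "\<And>\<mu> v. \<mu> \<in> K \<Longrightarrow> \<exists>i<n. v i \<noteq> 0 \<Longrightarrow> quad n (affine_mat c0 c \<mu>) v \<noteq> 0"
  shows "positive_matrix B_alg n (aff_op c0 c (\<lambda>l. \<Psi> (coord_fun K l)))"
proof -
  have S: "affine_fun K c0 c \<in> spectral_system K" for c0 c unfolding spectral_system_iff by blast
  have "positive_matrix (C_alg K) n (\<lambda>i j \<zeta>. if \<zeta> \<in> K then affine_mat c0 c \<zeta> i j else 0)"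
    by (rule positive_matrix_C_algI[OF _ psd strict]) (auto simp: affine_mat_def intro!: continuous_intros)
  hence "positive_matrix (C_alg K) n (\<lambda>i j. affine_fun K (c0 i j) (\<lambda>l. c l i j))"
    unfolding affine_fun_def affine_mat_def .
  hence "positive_matrix B_alg n (\<lambda>i j. \<Psi> (affine_fun K (c0 i j) (\<lambda>l. c l i j)))"
    by (intro ucp_positive[OF U] S)
  thus ?thesis unfolding ucp_affine_fun[OF U] aff_op_lin_op[symmetric] .
qed

text \<open>Affine functions vanishing on \<open>K\<close> correspond to compact operators, so \<open>\<epsilon>\<^sub>l \<mapsto> x\<^sub>l\<close> is well defined
  modulo the compact operators; complete positivity is \<open>ess_nonneg_aff_op\<close>.\<close>

lemma ucp_lift:
  fixes K :: "(real^'d) set"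
  assumes universe: "(UNIV :: real set) \<lesssim> (UNIV :: 'u set)"
    and lift: "lifting_property TYPE('u) (C_alg K) (spectral_system K)"
    and x: "\<And>l. x l \<in> bounded_ops" and We: "ess_matrix_range x \<subseteq> Kmin K"
  shows "\<exists>\<Psi>. ucp (C_alg K) (spectral_system K) B_alg \<Psi> \<and> (\<forall>l. (\<lambda>v. \<Psi> (coord_fun K l) v - x l v) \<in> compact_ops)"
proof -
  \<comment> \<open>The universe has at least the cardinality of the reals, enough for a copy of the
    operator algebra with carrier in \<open>'u\<close>.\<close>
  have "bounded_ops \<lesssim> (UNIV :: 'u set)" using bounded_ops_lepoll_reals universe lepoll_trans by blast
  then obtain g :: "(ell2 \<Rightarrow> ell2) \<Rightarrow> 'u" where g: "inj_on g bounded_ops" unfolding lepoll_def by blast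
  let ?A = "transport g B_alg"
  let ?J = "g ` compact_ops"
  have "cstar_transport_axioms B_alg g" by (rule cstar_transport_axioms.intro) (use g Metric_space_B_alg in simp_all)
  hence tr: "cstar_transport B_alg g" by (rule cstar_transport.intro[OF cstar_algebra_B_alg])
  have sel: "S \<in> bounded_ops \<Longrightarrow> T \<in> bounded_ops \<Longrightarrow> g S \<oplus>\<^bsub>?A\<^esub> g T = g (\<lambda>v. S v + T v)"
    "T \<in> bounded_ops \<Longrightarrow> c \<odot>\<^bsub>?A\<^esub> g T = g (\<lambda>v. scaleC c (T v))"
    "T \<in> bounded_ops \<Longrightarrow> star ?A (g T) = g (op_adjoint T)" "\<one>\<^bsub>?A\<^esub> = g id" "carrier ?A = g ` bounded_ops"
    "S \<in> bounded_ops \<Longrightarrow> T \<in> bounded_ops \<Longrightarrow> g S \<ominus>\<^bsub>?A\<^esub> g T = g (\<lambda>v. S v - T v)" for S T c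
    using cstar_transport.transport_sel[OF tr] cstar_transport.transport_minus[OF tr, of S T] cstar_transport.transport_carrier[OF tr]
    by (simp_all add: a_minus_B_alg)
  have A: "cstar_algebra ?A" by (rule cstar_transport.cstar_algebra_transport[OF tr])
  have J: "closed_ideal ?A ?J" by (rule cstar_transport.closed_ideal_transport[OF tr compact_ops_closed_ideal])
  have si: "star_ideal ?A ?J"
  proof (intro star_ideal.intro A star_ideal_axioms.intro)
    show "ideal ?J ?A" using J unfolding closed_ideal_def by blast
    show "star ?A z \<in> ?J" if "z \<in> ?J" for z
      using that by (auto simp: compact_ops_iff sel tail_small_adjoint)
  qed
  note coset_ops = star_ideal.coset_ops[OF si] and coset_eq = star_ideal.coset_eq_iff[OF si]
  define \<pi> where "\<pi> = (\<lambda>T. ?J +>\<^bsub>?A\<^esub> g T)"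
  let ?Q = "quotient_alg ?A ?J"
  have gA: "g T \<in> carrier ?A" if "T \<in> bounded_ops" for T using that sel(5) by blast
  have g_J: "g T \<in> ?J \<longleftrightarrow> tail_small T" if "T \<in> bounded_ops" for T
  proof -
    have "compact_ops \<subseteq> bounded_ops" by (auto simp: compact_ops_iff)
    from inj_on_image_mem_iff[OF g that this] show ?thesis using that by (simp add: compact_ops_iff)
  qed
  have \<pi>_eq: "\<pi> S = \<pi> T \<longleftrightarrow> tail_small (\<lambda>v. S v - T v)" if "S \<in> bounded_ops" "T \<in> bounded_ops" for S T
    unfolding \<pi>_def coset_eq[OF gA[OF that(1)] gA[OF that(2)]] sel(6)[OF that] by (rule g_J[OF bounded_ops_diff[OF that]])
  have \<pi>_add: "\<pi> S \<oplus>\<^bsub>?Q\<^esub> \<pi> T = \<pi> (\<lambda>v. S v + T v)" if "S \<in> bounded_ops" "T \<in> bounded_ops" for S T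
    unfolding \<pi>_def coset_ops(1)[OF gA[OF that(1)] gA[OF that(2)]] sel(1)[OF that] ..
  have \<pi>_smult: "c \<odot>\<^bsub>?Q\<^esub> \<pi> T = \<pi> (\<lambda>v. scaleC c (T v))" if "T \<in> bounded_ops" for c T
    unfolding \<pi>_def star_ideal.coset_smult[OF si gA[OF that]] sel(2)[OF that] ..
  have \<pi>_one: "\<one>\<^bsub>?Q\<^esub> = \<pi> id" unfolding \<pi>_def coset_ops(3) sel(4) ..
  have \<pi>_cl: "\<pi> T \<in> carrier ?Q" if "T \<in> bounded_ops" for T
    unfolding \<pi>_def by (rule star_ideal.coset_closed[OF si gA[OF that]])
  have lb: "lin_op x c0 c \<in> bounded_ops" for c0 c by (rule lin_op_bounded[OF x])
  \<comment> \<open>The same function on \<open>K\<close> can have different coefficients; their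
    difference gives a function vanishing on \<open>K\<close>, so the two operators agree modulo
    compact ones.\<close>
  have wd: "\<pi> (lin_op x c0 c) = \<pi> (lin_op x d0 d)" if e: "affine_fun K c0 c = affine_fun K d0 d" for c0 c d0 d
  proof -
    have "affine_fun K (c0 + (-1) * d0) (\<lambda>l. c l + (-1) * d l) = (\<lambda>_. 0)"
      unfolding affine_fun_add[symmetric] affine_fun_scale[symmetric] e by simp
    from lin_op_vanish[OF x We this] have "tail_small (\<lambda>v. lin_op x c0 c v - lin_op x d0 d v)"
      unfolding lin_op_add lin_op_scale scaleC_minus_one by simp
    thus ?thesis by (simp only: \<pi>_eq[OF lb lb])
  qed
  define rep where "rep = (\<lambda>f. SOME p. f = affine_fun K (fst p) (snd p))"
  have rep: "affine_fun K (fst (rep f)) (snd (rep f)) = f" if "f \<in> spectral_system K" for f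
  proof -
    have "\<exists>p. f = affine_fun K (fst p) (snd p)" using that unfolding spectral_system_iff by auto
    from someI_ex[OF this] show ?thesis unfolding rep_def by (rule sym)
  qed
  define \<phi> where "\<phi> = (\<lambda>f. \<pi> (lin_op x (fst (rep f)) (snd (rep f))))"
  have \<phi>: "\<phi> (affine_fun K c0 c) = \<pi> (lin_op x c0 c)" for c0 c
    unfolding \<phi>_def by (rule wd, rule rep) (unfold spectral_system_iff, blast)
  have "ucp (C_alg K) (spectral_system K) ?Q \<phi>" unfolding ucp_def
  proof (intro conjI ballI allI impI)
    show "\<phi> f \<in> carrier ?Q" for f unfolding \<phi>_def by (rule \<pi>_cl[OF lb])
    show "\<phi> (f \<oplus>\<^bsub>C_alg K\<^esub> h) = \<phi> f \<oplus>\<^bsub>?Q\<^esub> \<phi> h" if fh: "f \<in> spectral_system K" "h \<in> spectral_system K" for f h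
    proof -
      obtain c0 c d0 d where f: "f = affine_fun K c0 c" and h: "h = affine_fun K d0 d"
        using fh unfolding spectral_system_iff by (elim exE)
      show ?thesis unfolding f h C_alg_sel affine_fun_add \<phi> \<pi>_add[OF lb lb] lin_op_add ..
    qed
    show "\<phi> (a \<odot>\<^bsub>C_alg K\<^esub> f) = a \<odot>\<^bsub>?Q\<^esub> \<phi> f" if fS: "f \<in> spectral_system K" for a f
    proof -
      obtain c0 c where f: "f = affine_fun K c0 c" using fS unfolding spectral_system_iff by (elim exE)
      show ?thesis unfolding f C_alg_sel affine_fun_scale \<phi> \<pi>_smult[OF lb] lin_op_scale ..
    qed
    show "\<phi> \<one>\<^bsub>C_alg K\<^esub> = \<one>\<^bsub>?Q\<^esub>" unfolding C_alg_sel affine_fun_one \<phi> lin_op_one \<pi>_one ..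
    fix n X assume X: "(\<forall>i<n. \<forall>j<n. X i j \<in> spectral_system K) \<and> positive_matrix (C_alg K) n X"
    show "positive_matrix ?Q n (\<lambda>i j. \<phi> (X i j))"
    \<comment> \<open>\<open>ess_nonneg_aff_op\<close> needs \<open>1 \<le> n\<close>; at
      \<open>n = 0\<close> positivity is vacuous.\<close>
    proof (cases "n = 0")
      case True thus ?thesis by (simp add: positive_matrix_def)
    next
      case False
      define c0 where "c0 = (\<lambda>i j. fst (rep (X i j)))"
      define c where "c = (\<lambda>l i j. snd (rep (X i j)) l)"
      have XS: "X i j = affine_fun K (c0 i j) (\<lambda>l. c l i j)" if "i < n" "j < n" for i j
        using rep[of "X i j"] X that unfolding c0_def c_def by simp
      have "psd n (affine_mat c0 c \<mu>)" if \<mu>: "\<mu> \<in> K" for \<mu>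
      proof -
        have "psd n (\<lambda>i j. X i j \<mu>)" by (rule positive_matrix_C_algD[OF conjunct2[OF X]])
        also have "psd n (\<lambda>i j. X i j \<mu>) = psd n (affine_mat c0 c \<mu>)"
          by (rule psd_cong) (simp add: XS affine_fun_def affine_mat_def \<mu>)
        finally show ?thesis .
      qed
      hence en: "ess_nonneg (block_op n (aff_op c0 c x))"
        by (intro ess_nonneg_aff_op[OF x We]) (use False in auto)
      have ab: "aff_op c0 c x i j \<in> bounded_ops" for i j unfolding aff_op_lin_op by (rule lb)
      have "\<exists>Y. (\<forall>i j. Y i j \<in> bounded_ops) \<and>
          (\<forall>i<n. \<forall>j<n. tail_small (\<lambda>v. aff_op c0 c x i j v - (\<Sum>k<n. op_adjoint (Y k i) (Y k j v))))"
      proof (rule ess_nonneg_corners[OF ab en])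
        fix Y assume 1: "\<And>i j. Y i j \<in> bounded_ops"
          and 2: "\<And>i j. i < n \<Longrightarrow> j < n \<Longrightarrow> tail_small (\<lambda>v. aff_op c0 c x i j v - (\<Sum>k<n. op_adjoint (Y k i) (Y k j v)))"
        show "\<exists>Y. (\<forall>i j. Y i j \<in> bounded_ops) \<and>
          (\<forall>i<n. \<forall>j<n. tail_small (\<lambda>v. aff_op c0 c x i j v - (\<Sum>k<n. op_adjoint (Y k i) (Y k j v))))"
          by (rule exI[of _ Y], rule conjI, (intro allI, rule 1), (intro allI impI, rule 2))
      qed
      then obtain Y where Y': "(\<forall>i j. Y i j \<in> bounded_ops) \<and>
          (\<forall>i<n. \<forall>j<n. tail_small (\<lambda>v. aff_op c0 c x i j v - (\<Sum>k<n. op_adjoint (Y k i) (Y k j v))))"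
        by (elim exE)
      have Y: "Y i j \<in> bounded_ops" for i j by (rule Y'[THEN conjunct1, rule_format])
      have Yt: "tail_small (\<lambda>v. aff_op c0 c x i j v - (\<Sum>k<n. op_adjoint (Y k i) (Y k j v)))"
        if "i < n" "j < n" for i j by (rule Y'[THEN conjunct2, rule_format, OF that])
      \<comment> \<open>The Gram matrix of \<open>Y\<close> is a positive representative of the
        matrix of cosets.\<close>
      define Z where "Z = (\<lambda>i j v. \<Sum>k<n. op_adjoint (Y k i) (Y k j v))"
      have Zb: "Z i j \<in> bounded_ops" for i j unfolding Z_def
        by (rule bounded_ops_sum_fun) (rule bounded_ops_comp'[OF op_adjoint_bounded[OF Y] Y])
      have "positive_matrix B_alg n Z"
        unfolding Z_def by (rule iffD2[OF positive_matrix_B_sub[OF cstar_subalgebra_bounded_ops, unfolded B_alg_update]]) (intro exI[of _ Y] conjI allI impI Y refl)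
      hence pA: "positive_matrix ?A n (\<lambda>i j. g (Z i j))" by (rule cstar_transport.positive_matrix_transport[OF tr])
      show ?thesis
      proof (rule star_ideal.positive_matrix_coset[OF si pA])
        fix i j assume ij: "i < n" "j < n"
        have "\<phi> (X i j) = \<pi> (aff_op c0 c x i j)" unfolding XS[OF ij] \<phi> aff_op_lin_op ..
        also have "\<dots> = \<pi> (Z i j)" unfolding \<pi>_eq[OF ab Zb] unfolding Z_def by (rule Yt[OF ij])
        finally show "\<phi> (X i j) = ?J +>\<^bsub>?A\<^esub> g (Z i j)" unfolding \<pi>_def .
      qed
    qed
  qed
  hence "\<exists>\<psi>. ucp (C_alg K) (spectral_system K) ?A \<psi> \<and> (\<forall>r\<in>spectral_system K. \<phi> r = ?J +>\<^bsub>?A\<^esub> \<psi> r)"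
    using lift A J unfolding lifting_property_def by blast
  then obtain \<psi> where \<psi>: "ucp (C_alg K) (spectral_system K) ?A \<psi>"
    and lft: "\<forall>r\<in>spectral_system K. \<phi> r = ?J +>\<^bsub>?A\<^esub> \<psi> r" by (elim exE conjE)
  \<comment> \<open>The lift takes values in the copy; reading them back gives operators.\<close>
  define \<Psi> where "\<Psi> = (\<lambda>f. inv_into bounded_ops g (\<psi> f))"
  have U: "ucp (C_alg K) (spectral_system K) B_alg \<Psi>"
    using cstar_transport.ucp_transportD(1)[OF tr \<psi>] unfolding \<Psi>_def by simp
  have "(\<lambda>v. \<Psi> (coord_fun K l) v - x l v) \<in> compact_ops" for l
  proof -
    have cS: "coord_fun K l \<in> spectral_system K" unfolding spectral_system_iff affine_fun_coord by blast
    have in_im: "\<psi> (coord_fun K l) \<in> g ` bounded_ops"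
      using cstar_transport.ucp_transportD(2)[OF tr \<psi> cS] by simp
    have \<Psi>b: "\<Psi> (coord_fun K l) \<in> bounded_ops" "g (\<Psi> (coord_fun K l)) = \<psi> (coord_fun K l)"
      unfolding \<Psi>_def using inv_into_into[OF in_im] f_inv_into_f[OF in_im] by simp_all
    have "\<pi> (\<Psi> (coord_fun K l)) = \<phi> (coord_fun K l)" using lft cS unfolding \<pi>_def \<Psi>b(2) by simp
    also have "\<dots> = \<pi> (x l)" unfolding affine_fun_coord \<phi> lin_op_coord ..
    finally have "tail_small (\<lambda>v. \<Psi> (coord_fun K l) v - x l v)" unfolding \<pi>_eq[OF \<Psi>b(1) x] .
    thus ?thesis unfolding compact_ops_iff using bounded_ops_diff[OF \<Psi>b(1) x] by blast
  qed
  thus ?thesis using U by blast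
qed

theorem theorem4p4:
  fixes K :: "(real^'d) set"
  assumes "compact K" and "convex K"
    and universe: "(UNIV :: real set) \<lesssim> (UNIV :: 'u set)"
    and "lifting_property TYPE('u) (C_alg K) (spectral_system K)"
  shows "smith_ward_geometry (Kmin K)"
  unfolding smith_ward_geometry_def
proof (intro conjI allI impI)
  show "compact_matrix_convex (Kmin K)" by (rule compact_matrix_convex_Kmin[OF assms(1)])
  fix x :: "'d \<Rightarrow> ell2 \<Rightarrow> ell2" assume H: "(\<forall>l. x l \<in> bounded_ops) \<and> ess_matrix_range x = Kmin K"
  hence x: "x l \<in> bounded_ops" and We: "ess_matrix_range x = Kmin K" for l by blast+
  \<comment> \<open>The separation in \<open>matrix_range_subset_Kmin\<close> starts from a point of
    \<open>K\<close>.\<close>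
  have K: "K \<noteq> {}" using ess_matrix_range_nonempty[of x, OF x] We Kmin_empty by metis
  from ucp_lift[OF universe assms(4) x equalityD1[OF We]]
  obtain \<Psi> where U: "ucp (C_alg K) (spectral_system K) B_alg \<Psi>"
    and kc: "\<forall>l. (\<lambda>v. \<Psi> (coord_fun K l) v - x l v) \<in> compact_ops" by (elim exE conjE)
  define y where "y = (\<lambda>l. \<Psi> (coord_fun K l))"
  define k where "k = (\<lambda>l v. y l v - x l v)"
  have k: "k l \<in> compact_ops" for l using kc unfolding k_def y_def by blast
  have kb: "k l \<in> bounded_ops" and kt: "tail_small (k l)" for l using k[of l] unfolding compact_ops_iff by blast+
  have yk: "y l = (\<lambda>v. x l v + k l v)" for l by (simp add: k_def)
  have yb: "y l \<in> bounded_ops" for l unfolding yk by (rule bounded_ops_add[OF x kb])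
  have "\<exists>s. ess_state s \<and> (\<forall>l. s (y l) = of_real (vec_nth \<mu> l))" if \<mu>: "\<mu> \<in> K" for \<mu>
  proof -
    from ess_state_exists[OF x equalityD2[OF We] \<mu>]
    obtain s where s: "ess_state s" "\<forall>l. s (x l) = of_real (vec_nth \<mu> l)" by (elim exE conjE)
    \<comment> \<open>The state vanishes on the compact \<open>k l\<close>, so it has the same
      values at \<open>y\<close> and at \<open>x\<close>.\<close>
    have "s (y l) = of_real (vec_nth \<mu> l)" for l
      unfolding yk ess_stateD(1)[OF s(1) x kb] ess_stateD(5)[OF s(1) kb kt] using s(2) by simp
    thus ?thesis using s(1) by blast
  qed
  hence "Kmin K \<subseteq> matrix_range B_alg y" by (rule Kmin_subset_matrix_range[OF yb])
  moreover have "matrix_range B_alg y \<subseteq> Kmin K"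
    by (rule matrix_range_subset_Kmin[OF assms(1) K yb])
      (unfold y_def, rule ucp_positive_affine[OF U], blast+)
  moreover have "(\<lambda>l. x l \<oplus>\<^bsub>B_alg\<^esub> k l) = y" by (simp add: yk fun_eq_iff)
  ultimately show "smith_ward_property x" unfolding smith_ward_property_def
    using k We by (intro exI[of _ k]) auto
qed

end
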